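(* Let $r,s>0$ with $1\le rs$. Suppose $A$ is an IndBanach $k\llbracket\hslash\rrbracket$-algebra equipped with a $k\llbracket\hslash\rrbracket$-linear isomorphism $A\cong U(\mathfrak g)^{\mathrm{an}}_{r,s}\llbracket\hslash\rrbracket$ that preserves the unit, and that the induced isomorphism $A/\hslash A\cong U(\mathfrak g)^{\mathrm{an}}_{r,s}$ is an isomorphism of algebras. Suppose that $H_b^2(\mathfrak g_{r,s},U(\mathfrak g)^{\mathrm{an}}_{r,s})=0$. Then there is an isomorphism of $k\llbracket\hslash\rrbracket$-algebras $A\cong U(\mathfrak g)^{\mathrm{an}}_{r,s}\llbracket\hslash\rrbracket$ inducing the given algebra isomorphism modulo $\hslash$.
   Context: $k$ is a field of characteristic $0$ complete for a non-Archimedean absolute value; Banach spaces have ultrametric norms; $\hat\otimes$ is the completed projective tensor product, extended to the Ind-completion $\mathrm{IndBan}_k$ of the category of Banach spaces and bounded maps; $\coprod_i^{\le1}V_i=\{(v_i):\lim\|v_i\|=0\}$ with sup norm. Root datum: a free $\mathbb Z$-module $\Phi$, a submodule $\Psi\subset\Phi$ with basis $\{\alpha_i\}_{i\in I}$, a symmetric bilinear form $(\cdot,\cdot):\Phi\times\Phi\to\mathbb Q$ with $(\alpha_i,\alpha_i)\in2\mathbb N$ (nonzero), $(\alpha_i,\alpha_j)\le0$ for $i\ne j$, and $\lambda_i\in\mathrm{Hom}(\Phi,\mathbb Z)$ with $\lambda_i(\alpha)=2(\alpha_i,\alpha)/(\alpha_i,\alpha_i)$. $\mathscr H_0=\coprod^{\le1}_{\underline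 n}k\,H^{\underline n}$, $\underline n$ finitely supported in $\mathbb N^I$ (Tate algebra in commuting primitive variables $H_i$ of norm 1). $V_0=\coprod_{i\in I}^{\le1}k\,v_i$, $T_r(V_0)=\coprod_{n\ge0}^{\le1}(V_0^{\hat\otimes n})_{r^n}$ (norm on degree $n$ scaled by $r^n$). $U^-(\mathfrak g)_r^{\mathrm{an}}=U^+(\mathfrak g)_r^{\mathrm{an}}$ is the quotient of $T_r(V_0)$ by the closed two-sided ideal generated by $\sum_{m=0}^{1-\lambda_i(\alpha_j)}(-1)^m\binom{1-\lambda_i(\alpha_j)}{m}v_i^{1-\lambda_i(\alpha_j)-m}v_jv_i^m$, $i\ne j$. For $1\le rs$, $U(\mathfrak g)^{\mathrm{an}}_{r,s}=U^-(\mathfrak g)_r^{\mathrm{an}}\hat\otimes\mathscr H_0\hat\otimes U^+(\mathfrak g)_s^{\mathrm{an}}$ is the Banach algebra in which the three factors are subalgebras, $y\otimes h\otimes x=yhx$, and with $F_i=v_i\otimes1\otimes1$, $E_i=1\otimes1\otimes v_i$: $[H_i,E_j]=\lambda_i(\alpha_j)E_j$, $[H_i,F_j]=-\lambda_i(\alpha_j)F_j$, $[E_i,F_j]=\delta_{ij}H_i$. $\mathfrak g_{r,s}$ is the closed Lie subalgebra of $U(\mathfrak g)^{\mathrm{an}}_{r,s}$ generated by all $F_i,H_i,E_i$; it acts on $U(\mathfrak g)^{\mathrm{an}}_{r,s}$ by commutators, $x\cdot u=xu-ux$. $k\llbracket\hslash\rrbracket=\prod_{n\ge0}k\,\hslash^n=\lim_nk[\hslash]/(\hslash^n)$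 and $X\llbracket\hslash\rrbracket=\prod_{n\ge0}X\,\hslash^n$, products taken in $\mathrm{IndBan}_k$; $X\llbracket\hslash\rrbracket$ is an IndBanach algebra when $X$ is. For a Banach $\mathfrak g_{r,s}$-module $M$, $C_b^n(\mathfrak g_{r,s},M)$ is the space of bounded alternating $n$-linear maps $\mathfrak g_{r,s}^n\to M$ ($C_b^0=M$), $\delta_n(f)(x_1,\dots,x_{n+1})=\sum_{i<j}(-1)^{i+j}f([x_i,x_j],x_1,..,\hat x_i,..,\hat x_j,..,x_{n+1})+\sum_i(-1)^{i+1}x_if(x_1,..,\hat x_i,..,x_{n+1})$, and $H_b^n(\mathfrak g_{r,s},M)=\mathrm{Ker}(\delta_n)/\mathrm{Im}(\delta_{n-1})$. *)

theory Defs
  imports Complex_Main "HOL-Library.Poly_Mapping" "HOL-Library.FuncSet" "HOL-Algebra.QuotRing" "HOL-Algebra.Module"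
begin

section \<open>Banach spaces over a complete non-Archimedean field\<close>

text \<open>
  The ground field is a type \<open>'k\<close> of class \<^class>\<open>field_char_0\<close> together with an absolute value
  \<open>av\<close>. A normed space is a module record of \<open>HOL-Algebra\<close> with a norm; since that
  record extends \<open>ring\<close>, the same record serves for normed algebras. For spaces that carry
  no product the fields \<open>mult\<close> and \<open>one\<close> are irrelevant.
\<close>

definition kring :: "'k::field_char_0 ring" where
  "kring = \<lparr>carrier = UNIV, mult = (*), one = 1, zero = 0, add = (+)\<rparr>"

record ('k, 'v) nspace = "('k, 'v) module" +
  nrm :: "'v \<Rightarrow> real"

definition kspace :: "('k::field_char_0 \<Rightarrow> real) \<Rightarrow> ('k, 'k) nspace" where
  "kspace av = \<lparr>carrier = UNIV, mult = (*), one = 1, zero = 0, add = (+), smult = (*), nrm = av\<rparr>"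

definition normed_complete :: "('k, 'v) nspace \<Rightarrow> bool" where
  "normed_complete V \<longleftrightarrow>
     (\<forall>X. (\<forall>n::nat. X n \<in> carrier V) \<and>
          (\<forall>e>0. \<exists>N. \<forall>m\<ge>N. \<forall>n\<ge>N. nrm V (X m \<ominus>\<^bsub>V\<^esub> X n) < e) \<longrightarrow>
        (\<exists>l\<in>carrier V. (\<lambda>n. nrm V (X n \<ominus>\<^bsub>V\<^esub> l)) \<longlonglongrightarrow> 0))"

definition banach_space :: "('k::field_char_0 \<Rightarrow> real) \<Rightarrow> ('k, 'v) nspace \<Rightarrow> bool" where
  "banach_space av V \<longleftrightarrow>
     module kring V \<and>
     (\<forall>x\<in>carrier V. 0 \<le> nrm V x \<and> (nrm V x = 0 \<longleftrightarrow> x = \<zero>\<^bsub>V\<^esub>)) \<and>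
     (\<forall>a. \<forall>x\<in>carrier V. nrm V (a \<odot>\<^bsub>V\<^esub> x) = av a * nrm V x) \<and>
     (\<forall>x\<in>carrier V. \<forall>y\<in>carrier V. nrm V (x \<oplus>\<^bsub>V\<^esub> y) \<le> max (nrm V x) (nrm V y)) \<and>
     normed_complete V"

definition na_field :: "('k::field_char_0 \<Rightarrow> real) \<Rightarrow> bool" where
  "na_field av \<longleftrightarrow>
     (\<forall>x. 0 \<le> av x \<and> (av x = 0 \<longleftrightarrow> x = 0)) \<and>
     (\<forall>x y. av (x * y) = av x * av y) \<and>
     (\<forall>x y. av (x + y) \<le> max (av x) (av y)) \<and>
     normed_complete (kspace av)"

definition bounded_linear_map :: "('k, 'v) nspace \<Rightarrow> ('k, 'w) nspace \<Rightarrow> ('v \<Rightarrow> 'w) \<Rightarrow> bool" where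
  "bounded_linear_map V W f \<longleftrightarrow>
     f \<in> carrier V \<rightarrow> carrier W \<and>
     (\<forall>x\<in>carrier V. \<forall>y\<in>carrier V. f (x \<oplus>\<^bsub>V\<^esub> y) = f x \<oplus>\<^bsub>W\<^esub> f y) \<and>
     (\<forall>a. \<forall>x\<in>carrier V. f (a \<odot>\<^bsub>V\<^esub> x) = a \<odot>\<^bsub>W\<^esub> f x) \<and>
     (\<exists>C. \<forall>x\<in>carrier V. nrm W (f x) \<le> C * nrm V x)"

text \<open>Banach algebras are the (unital) monoids in Banach spaces and bounded maps, so the product
  is only required to be bounded.\<close>

definition banach_algebra :: "('k::field_char_0 \<Rightarrow> real) \<Rightarrow> ('k, 'v) nspace \<Rightarrow> bool" where
  "banach_algebra av A \<longleftrightarrow>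
     banach_space av A \<and> ring A \<and>
     (\<forall>a. \<forall>x\<in>carrier A. \<forall>y\<in>carrier A.
        (a \<odot>\<^bsub>A\<^esub> x) \<otimes>\<^bsub>A\<^esub> y = a \<odot>\<^bsub>A\<^esub> (x \<otimes>\<^bsub>A\<^esub> y) \<and> x \<otimes>\<^bsub>A\<^esub> (a \<odot>\<^bsub>A\<^esub> y) = a \<odot>\<^bsub>A\<^esub> (x \<otimes>\<^bsub>A\<^esub> y)) \<and>
     (\<exists>C. \<forall>x\<in>carrier A. \<forall>y\<in>carrier A. nrm A (x \<otimes>\<^bsub>A\<^esub> y) \<le> C * (nrm A x * nrm A y))"

definition nclosed :: "('k, 'v) nspace \<Rightarrow> 'v set \<Rightarrow> bool" where
  "nclosed V S \<longleftrightarrow> (\<forall>x\<in>carrier V. (\<forall>e>0. \<exists>s\<in>S. nrm V (x \<ominus>\<^bsub>V\<^esub> s) < e) \<longrightarrow> x \<in> S)"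

definition rescale :: "real \<Rightarrow> ('k, 'v) nspace \<Rightarrow> ('k, 'v) nspace" where
  "rescale r V = V\<lparr>nrm := (\<lambda>x. r * nrm V x)\<rparr>"

text \<open>The contracting coproduct of the family \<open>X\<close> over \<open>J\<close>: families whose norms tend to zero along
  the cofinite filter of \<open>J\<close>, with the supremum norm.\<close>

definition c0_coprod :: "'j set \<Rightarrow> ('j \<Rightarrow> ('k, 'v) nspace) \<Rightarrow> ('k, 'j \<Rightarrow> 'v) nspace" where
  "c0_coprod J X = \<lparr>
     carrier = {x \<in> \<Pi>\<^sub>E j\<in>J. carrier (X j). \<forall>e>0. finite {j\<in>J. e \<le> nrm (X j) (x j)}},
     mult = undefined, one = undefined,
     zero = (\<lambda>j\<in>J. \<zero>\<^bsub>X j\<^esub>),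
     add = (\<lambda>x y. \<lambda>j\<in>J. x j \<oplus>\<^bsub>X j\<^esub> y j),
     smult = (\<lambda>a x. \<lambda>j\<in>J. a \<odot>\<^bsub>X j\<^esub> x j),
     nrm = (\<lambda>x. Sup (insert 0 ((\<lambda>j. nrm (X j) (x j)) ` J)))\<rparr>"

definition nquot :: "('k, 'v) nspace \<Rightarrow> 'v set \<Rightarrow> ('k, 'v set) nspace" where
  "nquot V N = \<lparr>
     carrier = carrier (V Quot N), mult = mult (V Quot N), one = one (V Quot N),
     zero = zero (V Quot N), add = add (V Quot N),
     smult = (\<lambda>a P. \<Union>x\<in>P. N +>\<^bsub>V\<^esub> (a \<odot>\<^bsub>V\<^esub> x)),
     nrm = (\<lambda>P. Inf (nrm V ` P))\<rparr>"


section \<open>Completed projective tensor products\<close>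

text \<open>
  An algebraic tensor product is the free module on tuples of vectors modulo multilinearity, and
  its projective seminorm is the quotient of the weighted supremum seminorm on the free module. The
  completed tensor product is the separated completion, that is, Cauchy sequences modulo null
  sequences. The construction is carried out for a general set \<open>G\<close> of generators with
  weights \<open>w\<close> and relations \<open>R\<close>, and then used for binary tensor products and for
  tensor powers.
\<close>

definition pscale :: "'k::field_char_0 \<Rightarrow> ('g \<Rightarrow>\<^sub>0 'k) \<Rightarrow> ('g \<Rightarrow>\<^sub>0 'k)" where
  "pscale c a = Poly_Mapping.map ((*) c) a"

definition kspan :: "('g \<Rightarrow>\<^sub>0 'k::field_char_0) set \<Rightarrow> ('g \<Rightarrow>\<^sub>0 'k) set" where
  "kspan R = {(\<Sum>t\<in>T. pscale (c t) t) | c T. finite T \<and> T \<subseteq> R}"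

definition wmax :: "('k::field_char_0 \<Rightarrow> real) \<Rightarrow> ('g \<Rightarrow> real) \<Rightarrow> ('g \<Rightarrow>\<^sub>0 'k) \<Rightarrow> real" where
  "wmax av w b = Max (insert 0 ((\<lambda>g. av (Poly_Mapping.lookup b g) * w g) ` Poly_Mapping.keys b))"

definition pres_seminorm ::
  "('k::field_char_0 \<Rightarrow> real) \<Rightarrow> 'g set \<Rightarrow> ('g \<Rightarrow> real) \<Rightarrow> ('g \<Rightarrow>\<^sub>0 'k) set \<Rightarrow> ('g \<Rightarrow>\<^sub>0 'k) \<Rightarrow> real" where
  "pres_seminorm av G w R a = Inf {wmax av w b | b. Poly_Mapping.keys b \<subseteq> G \<and> a - b \<in> kspan R}"

definition pres_cauchy ::
  "('k::field_char_0 \<Rightarrow> real) \<Rightarrow> 'g set \<Rightarrow> ('g \<Rightarrow> real) \<Rightarrow> ('g \<Rightarrow>\<^sub>0 'k) set \<Rightarrow> (nat \<Rightarrow> 'g \<Rightarrow>\<^sub>0 'k) set" where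
  "pres_cauchy av G w R =
     {X. (\<forall>n. Poly_Mapping.keys (X n) \<subseteq> G) \<and>
         (\<forall>e>0. \<exists>N. \<forall>m\<ge>N. \<forall>n\<ge>N. pres_seminorm av G w R (X m - X n) < e)}"

definition pres_class ::
  "('k::field_char_0 \<Rightarrow> real) \<Rightarrow> 'g set \<Rightarrow> ('g \<Rightarrow> real) \<Rightarrow> ('g \<Rightarrow>\<^sub>0 'k) set \<Rightarrow>
   (nat \<Rightarrow> 'g \<Rightarrow>\<^sub>0 'k) \<Rightarrow> (nat \<Rightarrow> 'g \<Rightarrow>\<^sub>0 'k) set" where
  "pres_class av G w R X =
     {Y \<in> pres_cauchy av G w R. (\<lambda>n. pres_seminorm av G w R (Y n - X n)) \<longlonglongrightarrow> 0}"

definition presented ::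
  "('k::field_char_0 \<Rightarrow> real) \<Rightarrow> 'g set \<Rightarrow> ('g \<Rightarrow> real) \<Rightarrow> ('g \<Rightarrow>\<^sub>0 'k) set \<Rightarrow>
   ('k, (nat \<Rightarrow> 'g \<Rightarrow>\<^sub>0 'k) set) nspace" where
  "presented av G w R = \<lparr>
     carrier = pres_class av G w R ` pres_cauchy av G w R,
     mult = undefined, one = undefined,
     zero = pres_class av G w R (\<lambda>n. 0),
     add = (\<lambda>P Q. \<Union>X\<in>P. \<Union>Y\<in>Q. pres_class av G w R (\<lambda>n. X n + Y n)),
     smult = (\<lambda>a P. \<Union>X\<in>P. pres_class av G w R (\<lambda>n. pscale a (X n))),
     nrm = (\<lambda>P. lim (\<lambda>n. pres_seminorm av G w R ((SOME X. X \<in> P) n)))\<rparr>"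

definition pres_gen ::
  "('k::field_char_0 \<Rightarrow> real) \<Rightarrow> 'g set \<Rightarrow> ('g \<Rightarrow> real) \<Rightarrow> ('g \<Rightarrow>\<^sub>0 'k) set \<Rightarrow> 'g \<Rightarrow> (nat \<Rightarrow> 'g \<Rightarrow>\<^sub>0 'k) set" where
  "pres_gen av G w R g = pres_class av G w R (\<lambda>n. Poly_Mapping.single g 1)"

type_synonym ('k, 'v, 'w) tens = "(nat \<Rightarrow> ('v \<times> 'w) \<Rightarrow>\<^sub>0 'k) set"

definition tens_weight :: "('k, 'v) nspace \<Rightarrow> ('k, 'w) nspace \<Rightarrow> 'v \<times> 'w \<Rightarrow> real" where
  "tens_weight V W = (\<lambda>(v, w). nrm V v * nrm W w)"

definition tens_rels ::
  "('k::field_char_0, 'v) nspace \<Rightarrow> ('k, 'w) nspace \<Rightarrow> (('v \<times> 'w) \<Rightarrow>\<^sub>0 'k) set" where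
  "tens_rels V W =
     {Poly_Mapping.single (v \<oplus>\<^bsub>V\<^esub> v', w) 1 - Poly_Mapping.single (v, w) 1 - Poly_Mapping.single (v', w) 1
        | v v' w. v \<in> carrier V \<and> v' \<in> carrier V \<and> w \<in> carrier W} \<union>
     {Poly_Mapping.single (v, w \<oplus>\<^bsub>W\<^esub> w') 1 - Poly_Mapping.single (v, w) 1 - Poly_Mapping.single (v, w') 1
        | v w w'. v \<in> carrier V \<and> w \<in> carrier W \<and> w' \<in> carrier W} \<union>
     {Poly_Mapping.single (a \<odot>\<^bsub>V\<^esub> v, w) 1 - Poly_Mapping.single (v, w) a
        | a v w. v \<in> carrier V \<and> w \<in> carrier W} \<union>
     {Poly_Mapping.single (v, a \<odot>\<^bsub>W\<^esub> w) 1 - Poly_Mapping.single (v, w) a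
        | a v w. v \<in> carrier V \<and> w \<in> carrier W}"

definition ctens ::
  "('k::field_char_0 \<Rightarrow> real) \<Rightarrow> ('k, 'v) nspace \<Rightarrow> ('k, 'w) nspace \<Rightarrow> ('k, ('k, 'v, 'w) tens) nspace" where
  "ctens av V W = presented av (carrier V \<times> carrier W) (tens_weight V W) (tens_rels V W)"

definition pure_tens ::
  "('k::field_char_0 \<Rightarrow> real) \<Rightarrow> ('k, 'v) nspace \<Rightarrow> ('k, 'w) nspace \<Rightarrow> 'v \<Rightarrow> 'w \<Rightarrow> ('k, 'v, 'w) tens" where
  "pure_tens av V W v w =
     pres_gen av (carrier V \<times> carrier W) (tens_weight V W) (tens_rels V W) (v, w)"

text \<open>The bounded linear map on the completed tensor product that is induced by a bounded bilinear
  map; it is unique on the carrier because elementary tensors span a dense subspace.\<close>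

definition tens_lift ::
  "('k::field_char_0 \<Rightarrow> real) \<Rightarrow> ('k, 'v) nspace \<Rightarrow> ('k, 'w) nspace \<Rightarrow> ('k, 'z) nspace \<Rightarrow>
   ('v \<Rightarrow> 'w \<Rightarrow> 'z) \<Rightarrow> ('k, 'v, 'w) tens \<Rightarrow> 'z" where
  "tens_lift av V W Z b =
     (SOME f. bounded_linear_map (ctens av V W) Z f \<and>
        (\<forall>v\<in>carrier V. \<forall>w\<in>carrier W. f (pure_tens av V W v w) = b v w))"

definition tens_map ::
  "('k::field_char_0 \<Rightarrow> real) \<Rightarrow> ('k, 'v) nspace \<Rightarrow> ('k, 'w) nspace \<Rightarrow>
   ('k, 'v2) nspace \<Rightarrow> ('k, 'w2) nspace \<Rightarrow> ('v \<Rightarrow> 'v2) \<Rightarrow> ('w \<Rightarrow> 'w2) \<Rightarrow>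
   ('k, 'v, 'w) tens \<Rightarrow> ('k, 'v2, 'w2) tens" where
  "tens_map av V W V' W' f g =
     tens_lift av V W (ctens av V' W') (\<lambda>v w. pure_tens av V' W' (f v) (g w))"

type_synonym ('k, 'v) tpow = "(nat \<Rightarrow> 'v list \<Rightarrow>\<^sub>0 'k) set"

definition tpow_gens :: "('k, 'v) nspace \<Rightarrow> nat \<Rightarrow> 'v list set" where
  "tpow_gens V n = {vs. set vs \<subseteq> carrier V \<and> length vs = n}"

definition tpow_weight :: "('k, 'v) nspace \<Rightarrow> 'v list \<Rightarrow> real" where
  "tpow_weight V vs = prod_list (map (nrm V) vs)"

definition tpow_rels :: "('k::field_char_0, 'v) nspace \<Rightarrow> nat \<Rightarrow> ('v list \<Rightarrow>\<^sub>0 'k) set" where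
  "tpow_rels V n =
     {Poly_Mapping.single (us @ [v \<oplus>\<^bsub>V\<^esub> v'] @ ws) 1 - Poly_Mapping.single (us @ [v] @ ws) 1
        - Poly_Mapping.single (us @ [v'] @ ws) 1
        | us ws v v'. us @ [v] @ ws \<in> tpow_gens V n \<and> v' \<in> carrier V} \<union>
     {Poly_Mapping.single (us @ [a \<odot>\<^bsub>V\<^esub> v] @ ws) 1 - Poly_Mapping.single (us @ [v] @ ws) a
        | us ws a v. us @ [v] @ ws \<in> tpow_gens V n}"

definition tpow_class ::
  "('k::field_char_0 \<Rightarrow> real) \<Rightarrow> ('k, 'v) nspace \<Rightarrow> nat \<Rightarrow> (nat \<Rightarrow> 'v list \<Rightarrow>\<^sub>0 'k) \<Rightarrow> ('k, 'v) tpow" where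
  "tpow_class av V n = pres_class av (tpow_gens V n) (tpow_weight V) (tpow_rels V n)"

definition tpow :: "('k::field_char_0 \<Rightarrow> real) \<Rightarrow> ('k, 'v) nspace \<Rightarrow> nat \<Rightarrow> ('k, ('k, 'v) tpow) nspace" where
  "tpow av V n = presented av (tpow_gens V n) (tpow_weight V) (tpow_rels V n)"

definition pure_tpow ::
  "('k::field_char_0 \<Rightarrow> real) \<Rightarrow> ('k, 'v) nspace \<Rightarrow> nat \<Rightarrow> 'v list \<Rightarrow> ('k, 'v) tpow" where
  "pure_tpow av V n vs = tpow_class av V n (\<lambda>j. Poly_Mapping.single vs 1)"

definition list_conv :: "('v list \<Rightarrow>\<^sub>0 'k::field_char_0) \<Rightarrow> ('v list \<Rightarrow>\<^sub>0 'k) \<Rightarrow> ('v list \<Rightarrow>\<^sub>0 'k)" where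
  "list_conv a b = (\<Sum>u\<in>Poly_Mapping.keys a. \<Sum>v\<in>Poly_Mapping.keys b.
      Poly_Mapping.single (u @ v) (Poly_Mapping.lookup a u * Poly_Mapping.lookup b v))"

definition tpow_mult ::
  "('k::field_char_0 \<Rightarrow> real) \<Rightarrow> ('k, 'v) nspace \<Rightarrow> nat \<Rightarrow> nat \<Rightarrow>
   ('k, 'v) tpow \<Rightarrow> ('k, 'v) tpow \<Rightarrow> ('k, 'v) tpow" where
  "tpow_mult av V l m P Q = (\<Union>X\<in>P. \<Union>Y\<in>Q. tpow_class av V (l + m) (\<lambda>j. list_conv (X j) (Y j)))"

definition tens_alg ::
  "('k::field_char_0 \<Rightarrow> real) \<Rightarrow> real \<Rightarrow> ('k, 'v) nspace \<Rightarrow> ('k, nat \<Rightarrow> ('k, 'v) tpow) nspace" where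
  "tens_alg av r V = (c0_coprod UNIV (\<lambda>n. rescale (r ^ n) (tpow av V n)))
     \<lparr>mult := (\<lambda>x y n. \<Oplus>\<^bsub>tpow av V n\<^esub>l\<in>{..n}. tpow_mult av V l (n - l) (x l) (y (n - l))),
      one := (\<lambda>n. if n = 0 then pure_tpow av V 0 [] else \<zero>\<^bsub>tpow av V n\<^esub>)\<rparr>"

definition tens_alg_incl ::
  "('k::field_char_0 \<Rightarrow> real) \<Rightarrow> ('k, 'v) nspace \<Rightarrow> 'v \<Rightarrow> nat \<Rightarrow> ('k, 'v) tpow" where
  "tens_alg_incl av V v = (\<lambda>n. if n = 1 then pure_tpow av V 1 [v] else \<zero>\<^bsub>tpow av V n\<^esub>)"


section \<open>Root data\<close>

text \<open>The lattice \<open>\<Phi>\<close> is an additive group type \<open>'p\<close>.\<close>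

definition zmul :: "int \<Rightarrow> 'p::ab_group_add \<Rightarrow> 'p" where
  "zmul n x = (if 0 \<le> n then (((+) x) ^^ nat n) 0 else - ((((+) x) ^^ nat (- n)) 0))"

definition zcomb :: "('b \<Rightarrow> 'p::ab_group_add) \<Rightarrow> ('b \<Rightarrow>\<^sub>0 int) \<Rightarrow> 'p" where
  "zcomb e c = (\<Sum>b\<in>Poly_Mapping.keys c. zmul (Poly_Mapping.lookup c b) (e b))"

definition zbasis :: "'p::ab_group_add set \<Rightarrow> 'b set \<Rightarrow> ('b \<Rightarrow> 'p) \<Rightarrow> bool" where
  "zbasis L B e \<longleftrightarrow> bij_betw (zcomb e) {c. Poly_Mapping.keys c \<subseteq> B} L"

definition root_datum ::
  "'i set \<Rightarrow> 'p::ab_group_add set \<Rightarrow> ('i \<Rightarrow> 'p) \<Rightarrow> ('p \<Rightarrow> 'p \<Rightarrow> rat) \<Rightarrow> ('i \<Rightarrow> 'p \<Rightarrow> int) \<Rightarrow> bool" where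
  "root_datum I \<Psi> \<alpha> form lam \<longleftrightarrow>
     (\<exists>B. zbasis (UNIV :: 'p set) B id) \<and>
     zbasis \<Psi> I \<alpha> \<and>
     (\<forall>x y. form x y = form y x) \<and>
     (\<forall>x y z. form (x + y) z = form x z + form y z) \<and>
     (\<forall>i\<in>I. \<exists>n::nat. 0 < n \<and> form (\<alpha> i) (\<alpha> i) = of_nat (2 * n)) \<and>
     (\<forall>i\<in>I. \<forall>j\<in>I. i \<noteq> j \<longrightarrow> form (\<alpha> i) (\<alpha> j) \<le> 0) \<and>
     (\<forall>i\<in>I. \<forall>x y. lam i (x + y) = lam i x + lam i y) \<and>
     (\<forall>i\<in>I. \<forall>x. of_int (lam i x) = 2 * form (\<alpha> i) x / form (\<alpha> i) (\<alpha> i))"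


section \<open>The analytic enveloping algebra\<close>

definition V0 :: "('k::field_char_0 \<Rightarrow> real) \<Rightarrow> 'i set \<Rightarrow> ('k, 'i \<Rightarrow> 'k) nspace" where
  "V0 av I = c0_coprod I (\<lambda>_. kspace av)"

definition V0_gen :: "'i set \<Rightarrow> 'i \<Rightarrow> 'i \<Rightarrow> 'k::field_char_0" where
  "V0_gen I i = (\<lambda>j\<in>I. if j = i then 1 else 0)"

type_synonym ('k, 'i) talg = "nat \<Rightarrow> ('k, 'i \<Rightarrow> 'k) tpow"

definition T_gen :: "('k::field_char_0 \<Rightarrow> real) \<Rightarrow> 'i set \<Rightarrow> 'i \<Rightarrow> ('k, 'i) talg" where
  "T_gen av I i = tens_alg_incl av (V0 av I) (V0_gen I i)"

text \<open>\<open>a i j\<close> stands for the Cartan integer \<open>\<lambda>\<^sub>i(\<alpha>\<^sub>j)\<close>.\<close>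

definition serre ::
  "('k::field_char_0 \<Rightarrow> real) \<Rightarrow> 'i set \<Rightarrow> ('i \<Rightarrow> 'i \<Rightarrow> int) \<Rightarrow> real \<Rightarrow> 'i \<Rightarrow> 'i \<Rightarrow> ('k, 'i) talg" where
  "serre av I a r i j =
     (let T = tens_alg av r (V0 av I); N = nat (1 - a i j) in
      \<Oplus>\<^bsub>T\<^esub>m\<in>{0..N}. ((- 1) ^ m * of_nat (N choose m)) \<odot>\<^bsub>T\<^esub>
        (T_gen av I i [^]\<^bsub>T\<^esub> (N - m) \<otimes>\<^bsub>T\<^esub> T_gen av I j \<otimes>\<^bsub>T\<^esub> T_gen av I i [^]\<^bsub>T\<^esub> m))"

definition serre_ideal ::
  "('k::field_char_0 \<Rightarrow> real) \<Rightarrow> 'i set \<Rightarrow> ('i \<Rightarrow> 'i \<Rightarrow> int) \<Rightarrow> real \<Rightarrow> ('k, 'i) talg set" where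
  "serre_ideal av I a r =
     (let T = tens_alg av r (V0 av I) in
      \<Inter>{J. ideal J T \<and> nclosed T J \<and> (\<forall>i\<in>I. \<forall>j\<in>I. i \<noteq> j \<longrightarrow> serre av I a r i j \<in> J)})"

definition U_half ::
  "('k::field_char_0 \<Rightarrow> real) \<Rightarrow> 'i set \<Rightarrow> ('i \<Rightarrow> 'i \<Rightarrow> int) \<Rightarrow> real \<Rightarrow> ('k, ('k, 'i) talg set) nspace" where
  "U_half av I a r = nquot (tens_alg av r (V0 av I)) (serre_ideal av I a r)"

definition U_half_gen ::
  "('k::field_char_0 \<Rightarrow> real) \<Rightarrow> 'i set \<Rightarrow> ('i \<Rightarrow> 'i \<Rightarrow> int) \<Rightarrow> real \<Rightarrow> 'i \<Rightarrow> ('k, 'i) talg set" where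
  "U_half_gen av I a r i = serre_ideal av I a r +>\<^bsub>tens_alg av r (V0 av I)\<^esub> T_gen av I i"

definition multi_indices :: "'i set \<Rightarrow> ('i \<Rightarrow>\<^sub>0 nat) set" where
  "multi_indices I = {n. Poly_Mapping.keys n \<subseteq> I}"

definition H0 :: "('k::field_char_0 \<Rightarrow> real) \<Rightarrow> 'i set \<Rightarrow> ('k, ('i \<Rightarrow>\<^sub>0 nat) \<Rightarrow> 'k) nspace" where
  "H0 av I = (c0_coprod (multi_indices I) (\<lambda>_. kspace av))
     \<lparr>mult := (\<lambda>x y. \<lambda>n\<in>multi_indices I. \<Sum>(l, m)\<in>{(l, m). l + m = n}. x l * y m),
      one := (\<lambda>n\<in>multi_indices I. if n = 0 then 1 else 0)\<rparr>"

definition H0_gen :: "'i set \<Rightarrow> 'i \<Rightarrow> ('i \<Rightarrow>\<^sub>0 nat) \<Rightarrow> 'k::field_char_0" where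
  "H0_gen I i = (\<lambda>n\<in>multi_indices I. if n = Poly_Mapping.single i 1 then 1 else 0)"

type_synonym ('k, 'i) uel =
  "('k, ('k, ('k, 'i) talg set, ('i \<Rightarrow>\<^sub>0 nat) \<Rightarrow> 'k) tens, ('k, 'i) talg set) tens"

definition U_space ::
  "('k::field_char_0 \<Rightarrow> real) \<Rightarrow> 'i set \<Rightarrow> ('i \<Rightarrow> 'i \<Rightarrow> int) \<Rightarrow> real \<Rightarrow> real \<Rightarrow> ('k, ('k, 'i) uel) nspace" where
  "U_space av I a r s = ctens av (ctens av (U_half av I a r) (H0 av I)) (U_half av I a s)"

definition U_tens ::
  "('k::field_char_0 \<Rightarrow> real) \<Rightarrow> 'i set \<Rightarrow> ('i \<Rightarrow> 'i \<Rightarrow> int) \<Rightarrow> real \<Rightarrow> real \<Rightarrow>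
   ('k, 'i) talg set \<Rightarrow> (('i \<Rightarrow>\<^sub>0 nat) \<Rightarrow> 'k) \<Rightarrow> ('k, 'i) talg set \<Rightarrow> ('k, 'i) uel" where
  "U_tens av I a r s y h x =
     pure_tens av (ctens av (U_half av I a r) (H0 av I)) (U_half av I a s)
       (pure_tens av (U_half av I a r) (H0 av I) y h) x"

definition U_minus_emb where
  "U_minus_emb av I a r s y = U_tens av I a r s y \<one>\<^bsub>H0 av I\<^esub> \<one>\<^bsub>U_half av I a s\<^esub>"

definition U_zero_emb where
  "U_zero_emb av I a r s h = U_tens av I a r s \<one>\<^bsub>U_half av I a r\<^esub> h \<one>\<^bsub>U_half av I a s\<^esub>"

definition U_plus_emb where
  "U_plus_emb av I a r s x = U_tens av I a r s \<one>\<^bsub>U_half av I a r\<^esub> \<one>\<^bsub>H0 av I\<^esub> x"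

definition U_F where "U_F av I a r s i = U_minus_emb av I a r s (U_half_gen av I a r i)"
definition U_H where "U_H av I a r s i = U_zero_emb av I a r s (H0_gen I i)"
definition U_E where "U_E av I a r s i = U_plus_emb av I a r s (U_half_gen av I a s i)"

definition commutator :: "('k, 'v) nspace \<Rightarrow> 'v \<Rightarrow> 'v \<Rightarrow> 'v" where
  "commutator A x y = x \<otimes>\<^bsub>A\<^esub> y \<ominus>\<^bsub>A\<^esub> y \<otimes>\<^bsub>A\<^esub> x"

text \<open>\<open>U\<close> is the Banach algebra on the triple tensor product whose product is determined by the
  triangular decomposition and the commutation relations.\<close>

definition is_U_an ::
  "('k::field_char_0 \<Rightarrow> real) \<Rightarrow> 'i set \<Rightarrow> ('i \<Rightarrow> 'i \<Rightarrow> int) \<Rightarrow> real \<Rightarrow> real \<Rightarrow> ('k, ('k, 'i) uel) nspace \<Rightarrow> bool" where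
  "is_U_an av I a r s U \<longleftrightarrow>
     (\<exists>m e. U = (U_space av I a r s)\<lparr>mult := m, one := e\<rparr>) \<and>
     banach_algebra av U \<and>
     U_minus_emb av I a r s \<in> ring_hom (U_half av I a r) U \<and>
     U_zero_emb av I a r s \<in> ring_hom (H0 av I) U \<and>
     U_plus_emb av I a r s \<in> ring_hom (U_half av I a s) U \<and>
     (\<forall>y\<in>carrier (U_half av I a r). \<forall>h\<in>carrier (H0 av I). \<forall>x\<in>carrier (U_half av I a s).
        U_tens av I a r s y h x =
          U_minus_emb av I a r s y \<otimes>\<^bsub>U\<^esub> U_zero_emb av I a r s h \<otimes>\<^bsub>U\<^esub> U_plus_emb av I a r s x) \<and>
     (\<forall>i\<in>I. \<forall>j\<in>I.
        commutator U (U_H av I a r s i) (U_E av I a r s j) = of_int (a i j) \<odot>\<^bsub>U\<^esub> U_E av I a r s j \<and>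
        commutator U (U_H av I a r s i) (U_F av I a r s j) = of_int (- a i j) \<odot>\<^bsub>U\<^esub> U_F av I a r s j \<and>
        commutator U (U_E av I a r s i) (U_F av I a r s j) =
          (if i = j then U_H av I a r s i else \<zero>\<^bsub>U\<^esub>))"

definition closed_lie_hull :: "('k, 'v) nspace \<Rightarrow> 'v set \<Rightarrow> 'v set" where
  "closed_lie_hull A S =
     \<Inter>{L. L \<subseteq> carrier A \<and> S \<subseteq> L \<and> \<zero>\<^bsub>A\<^esub> \<in> L \<and>
         (\<forall>x\<in>L. \<forall>y\<in>L. x \<oplus>\<^bsub>A\<^esub> y \<in> L \<and> commutator A x y \<in> L) \<and>
         (\<forall>c. \<forall>x\<in>L. c \<odot>\<^bsub>A\<^esub> x \<in> L) \<and> nclosed A L}"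

text \<open>The space underlying the Lie algebra \<open>\<gg>\<^sub>r\<^sub>,\<^sub>s\<close>; its bracket is
  \<open>commutator U\<close>, its norm that of \<open>U\<close>.\<close>

definition g_an ::
  "('k::field_char_0 \<Rightarrow> real) \<Rightarrow> 'i set \<Rightarrow> ('i \<Rightarrow> 'i \<Rightarrow> int) \<Rightarrow> real \<Rightarrow> real \<Rightarrow> ('k, ('k, 'i) uel) nspace \<Rightarrow>
   ('k, ('k, 'i) uel) nspace" where
  "g_an av I a r s U =
     U\<lparr>carrier := closed_lie_hull U (U_F av I a r s ` I \<union> U_H av I a r s ` I \<union> U_E av I a r s ` I)\<rparr>"


section \<open>Bounded Lie algebra cohomology\<close>

text \<open>An \<open>n\<close>-linear map is a function on lists of length \<open>n\<close>, undefined elsewhere. Positions are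
  counted from \<open>0\<close>, so that the sign \<open>(-1)\<^sup>i\<^sup>+\<^sup>1\<close> of the usual formula becomes \<open>(-1)\<^sup>i\<close>.\<close>

definition tuples :: "('k, 'v) nspace \<Rightarrow> nat \<Rightarrow> 'v list set" where
  "tuples L n = {xs. set xs \<subseteq> carrier L \<and> length xs = n}"

definition omit :: "nat \<Rightarrow> 'v list \<Rightarrow> 'v list" where
  "omit i xs = take i xs @ drop (Suc i) xs"

definition Cb :: "('k, 'v) nspace \<Rightarrow> ('k, 'm) nspace \<Rightarrow> nat \<Rightarrow> ('v list \<Rightarrow> 'm) set" where
  "Cb L M n = {f \<in> tuples L n \<rightarrow>\<^sub>E carrier M.
     (\<forall>xs\<in>tuples L n. \<forall>i<n. \<forall>y\<in>carrier L. \<forall>z\<in>carrier L.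
        f (xs[i := y \<oplus>\<^bsub>L\<^esub> z]) = f (xs[i := y]) \<oplus>\<^bsub>M\<^esub> f (xs[i := z])) \<and>
     (\<forall>xs\<in>tuples L n. \<forall>i<n. \<forall>c. \<forall>y\<in>carrier L.
        f (xs[i := c \<odot>\<^bsub>L\<^esub> y]) = c \<odot>\<^bsub>M\<^esub> f (xs[i := y])) \<and>
     (\<forall>xs\<in>tuples L n. \<forall>i<n. \<forall>j<n. i \<noteq> j \<and> xs ! i = xs ! j \<longrightarrow> f xs = \<zero>\<^bsub>M\<^esub>) \<and>
     (\<exists>C. \<forall>xs\<in>tuples L n. nrm M (f xs) \<le> C * prod_list (map (nrm L) xs))}"

definition ce_diff ::
  "('k::field_char_0, 'v) nspace \<Rightarrow> ('v \<Rightarrow> 'v \<Rightarrow> 'v) \<Rightarrow> ('k, 'm) nspace \<Rightarrow> ('v \<Rightarrow> 'm \<Rightarrow> 'm) \<Rightarrow>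
   nat \<Rightarrow> ('v list \<Rightarrow> 'm) \<Rightarrow> 'v list \<Rightarrow> 'm" where
  "ce_diff L br M act n f = (\<lambda>xs\<in>tuples L (Suc n).
     (\<Oplus>\<^bsub>M\<^esub>j\<in>{..<Suc n}. \<Oplus>\<^bsub>M\<^esub>i\<in>{..<j}.
        ((- 1) ^ (i + j)) \<odot>\<^bsub>M\<^esub> f (br (xs ! i) (xs ! j) # omit i (omit j xs))) \<oplus>\<^bsub>M\<^esub>
     (\<Oplus>\<^bsub>M\<^esub>i\<in>{..<Suc n}. ((- 1) ^ i) \<odot>\<^bsub>M\<^esub> act (xs ! i) (f (omit i xs))))"

definition Zb where
  "Zb L br M act n = {f \<in> Cb L M n. ce_diff L br M act n f = (\<lambda>xs\<in>tuples L (Suc n). \<zero>\<^bsub>M\<^esub>)}"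

definition Bb where
  "Bb L br M act n = (case n of 0 \<Rightarrow> {\<lambda>xs\<in>tuples L 0. \<zero>\<^bsub>M\<^esub>}
     | Suc m \<Rightarrow> ce_diff L br M act m ` Cb L M m)"

definition cocycle_group ::
  "('k::field_char_0, 'v) nspace \<Rightarrow> ('v \<Rightarrow> 'v \<Rightarrow> 'v) \<Rightarrow> ('k, 'm) nspace \<Rightarrow> ('v \<Rightarrow> 'm \<Rightarrow> 'm) \<Rightarrow>
   nat \<Rightarrow> ('v list \<Rightarrow> 'm) monoid" where
  "cocycle_group L br M act n =
     \<lparr>carrier = Zb L br M act n, mult = (\<lambda>f g. \<lambda>xs\<in>tuples L n. f xs \<oplus>\<^bsub>M\<^esub> g xs),
      one = (\<lambda>xs\<in>tuples L n. \<zero>\<^bsub>M\<^esub>)\<rparr>"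

definition Hb ::
  "('k::field_char_0, 'v) nspace \<Rightarrow> ('v \<Rightarrow> 'v \<Rightarrow> 'v) \<Rightarrow> ('k, 'm) nspace \<Rightarrow> ('v \<Rightarrow> 'm \<Rightarrow> 'm) \<Rightarrow>
   nat \<Rightarrow> ('v list \<Rightarrow> 'm) set monoid" where
  "Hb L br M act n = cocycle_group L br M act n Mod Bb L br M act n"


section \<open>IndBanach spaces\<close>

record ('o, 'm) cat =
  Obj :: "'o set"
  Arr :: "'m set"
  Dom :: "'m \<Rightarrow> 'o"
  Cod :: "'m \<Rightarrow> 'o"
  Idn :: "'o \<Rightarrow> 'm"
  Cmp :: "'m \<Rightarrow> 'm \<Rightarrow> 'm"

definition hom_set :: "('o, 'm) cat \<Rightarrow> 'o \<Rightarrow> 'o \<Rightarrow> 'm set" where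
  "hom_set J i j = {u \<in> Arr J. Dom J u = i \<and> Cod J u = j}"

definition is_category :: "('o, 'm) cat \<Rightarrow> bool" where
  "is_category J \<longleftrightarrow>
     (\<forall>u\<in>Arr J. Dom J u \<in> Obj J \<and> Cod J u \<in> Obj J) \<and>
     (\<forall>i\<in>Obj J. Idn J i \<in> hom_set J i i) \<and>
     (\<forall>i j l. \<forall>u\<in>hom_set J i j. \<forall>v\<in>hom_set J j l. Cmp J v u \<in> hom_set J i l) \<and>
     (\<forall>i j. \<forall>u\<in>hom_set J i j. Cmp J u (Idn J i) = u \<and> Cmp J (Idn J j) u = u) \<and>
     (\<forall>i j l p. \<forall>u\<in>hom_set J i j. \<forall>v\<in>hom_set J j l. \<forall>w\<in>hom_set J l p.
        Cmp J w (Cmp J v u) = Cmp J (Cmp J w v) u)"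

definition filtered :: "('o, 'm) cat \<Rightarrow> bool" where
  "filtered J \<longleftrightarrow> is_category J \<and> Obj J \<noteq> {} \<and>
     (\<forall>i\<in>Obj J. \<forall>j\<in>Obj J. \<exists>l. hom_set J i l \<noteq> {} \<and> hom_set J j l \<noteq> {}) \<and>
     (\<forall>i j. \<forall>u\<in>hom_set J i j. \<forall>v\<in>hom_set J i j. \<exists>l. \<exists>w\<in>hom_set J j l. Cmp J w u = Cmp J w v)"

record ('o, 'm, 'k, 'v) ind =
  Idx :: "('o, 'm) cat"
  Sp :: "'o \<Rightarrow> ('k, 'v) nspace"
  Tr :: "'m \<Rightarrow> 'v \<Rightarrow> 'v"

definition ind_banach :: "('k::field_char_0 \<Rightarrow> real) \<Rightarrow> ('o, 'm, 'k, 'v, 'z) ind_scheme \<Rightarrow> bool" where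
  "ind_banach av D \<longleftrightarrow>
     filtered (Idx D) \<and>
     (\<forall>i\<in>Obj (Idx D). banach_space av (Sp D i)) \<and>
     (\<forall>u\<in>Arr (Idx D). bounded_linear_map (Sp D (Dom (Idx D) u)) (Sp D (Cod (Idx D) u)) (Tr D u)) \<and>
     (\<forall>i\<in>Obj (Idx D). \<forall>x\<in>carrier (Sp D i). Tr D (Idn (Idx D) i) x = x) \<and>
     (\<forall>i j l. \<forall>u\<in>hom_set (Idx D) i j. \<forall>v\<in>hom_set (Idx D) j l. \<forall>x\<in>carrier (Sp D i).
        Tr D (Cmp (Idx D) v u) x = Tr D v (Tr D u x))"

text \<open>
  Morphisms \<open>D \<rightarrow> E\<close> in the Ind-completion are the elements of
  \<open>lim\<^sub>i colim\<^sub>j Hom(D\<^sub>i, E\<^sub>j)\<close>. Such an element is presented by choosing for every \<open>i\<close> a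
  representative \<open>(j, g)\<close> with \<open>g: D\<^sub>i \<rightarrow> E\<^sub>j\<close> of its \<open>i\<close>-th component; two
  presentations give the same morphism when they are related by \<open>ind_eq\<close>. Equations between
  morphisms are therefore always stated with \<open>ind_eq\<close>.
\<close>

type_synonym ('o, 'v, 'p, 'w) imor = "'o \<Rightarrow> 'p \<times> ('v \<Rightarrow> 'w)"

definition colim_eq ::
  "('p, 'n, 'k, 'w, 'z) ind_scheme \<Rightarrow> 'v set \<Rightarrow> 'p \<times> ('v \<Rightarrow> 'w) \<Rightarrow> 'p \<times> ('v \<Rightarrow> 'w) \<Rightarrow> bool" where
  "colim_eq E S f g \<longleftrightarrow>
     (\<exists>l. \<exists>u\<in>hom_set (Idx E) (fst f) l. \<exists>v\<in>hom_set (Idx E) (fst g) l.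
        \<forall>x\<in>S. Tr E u (snd f x) = Tr E v (snd g x))"

definition ind_hom ::
  "('o, 'm, 'k, 'v, 'y) ind_scheme \<Rightarrow> ('p, 'n, 'k, 'w, 'z) ind_scheme \<Rightarrow> ('o, 'v, 'p, 'w) imor \<Rightarrow> bool" where
  "ind_hom D E f \<longleftrightarrow>
     (\<forall>i\<in>Obj (Idx D). fst (f i) \<in> Obj (Idx E) \<and>
        bounded_linear_map (Sp D i) (Sp E (fst (f i))) (snd (f i))) \<and>
     (\<forall>i i'. \<forall>u\<in>hom_set (Idx D) i i'.
        colim_eq E (carrier (Sp D i)) (f i) (fst (f i'), snd (f i') \<circ> Tr D u))"

definition ind_eq ::
  "('o, 'm, 'k, 'v, 'y) ind_scheme \<Rightarrow> ('p, 'n, 'k, 'w, 'z) ind_scheme \<Rightarrow>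
   ('o, 'v, 'p, 'w) imor \<Rightarrow> ('o, 'v, 'p, 'w) imor \<Rightarrow> bool" where
  "ind_eq D E f g \<longleftrightarrow> (\<forall>i\<in>Obj (Idx D). colim_eq E (carrier (Sp D i)) (f i) (g i))"

definition ind_id :: "('o, 'v, 'o, 'v) imor" where
  "ind_id = (\<lambda>i. (i, id))"

definition ind_comp ::
  "('p, 'w, 'q, 'x) imor \<Rightarrow> ('o, 'v, 'p, 'w) imor \<Rightarrow> ('o, 'v, 'q, 'x) imor" (infixr \<open>\<circ>\<^sub>I\<close> 55) where
  "g \<circ>\<^sub>I f = (\<lambda>i. (fst (g (fst (f i))), snd (g (fst (f i))) \<circ> snd (f i)))"

definition ind_iso ::
  "('o, 'm, 'k, 'v, 'y) ind_scheme \<Rightarrow> ('p, 'n, 'k, 'w, 'z) ind_scheme \<Rightarrow> ('o, 'v, 'p, 'w) imor \<Rightarrow> bool" where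
  "ind_iso D E f \<longleftrightarrow> ind_hom D E f \<and>
     (\<exists>g. ind_hom E D g \<and> ind_eq D D (g \<circ>\<^sub>I f) ind_id \<and> ind_eq E E (f \<circ>\<^sub>I g) ind_id)"

definition ind_is_zero ::
  "('o, 'm, 'k, 'v, 'y) ind_scheme \<Rightarrow> ('p, 'n, 'k, 'w, 'z) ind_scheme \<Rightarrow> ('o, 'v, 'p, 'w) imor \<Rightarrow> bool" where
  "ind_is_zero D E f \<longleftrightarrow> ind_eq D E f (\<lambda>i. (fst (f i), \<lambda>x. \<zero>\<^bsub>Sp E (fst (f i))\<^esub>))"

text \<open>\<open>p: E \<rightarrow> Q\<close> is a cokernel of \<open>f: D \<rightarrow> E\<close>. HOL cannot quantify over types inside a
  definition, so the test objects \<open>T\<close> live over the same types as \<open>Q\<close>; where the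
  predicate is used as a hypothesis this only admits more objects \<open>Q\<close>.\<close>

definition ind_cokernel ::
  "('k::field_char_0 \<Rightarrow> real) \<Rightarrow> ('o, 'm, 'k, 'v, 'x) ind_scheme \<Rightarrow> ('p, 'n, 'k, 'w, 'y) ind_scheme \<Rightarrow>
   ('o, 'v, 'p, 'w) imor \<Rightarrow> ('q, 'l, 'k, 'u, 'z) ind_scheme \<Rightarrow> ('p, 'w, 'q, 'u) imor \<Rightarrow> bool" where
  "ind_cokernel av D E f Q p \<longleftrightarrow>
     ind_banach av Q \<and> ind_hom E Q p \<and> ind_is_zero D Q (p \<circ>\<^sub>I f) \<and>
     (\<forall>(T :: ('q, 'l, 'k, 'u) ind) t.
        ind_banach av T \<and> ind_hom E T t \<and> ind_is_zero D T (t \<circ>\<^sub>I f) \<longrightarrow>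
        (\<exists>h. ind_hom Q T h \<and> ind_eq E T (h \<circ>\<^sub>I p) t \<and>
             (\<forall>h'. ind_hom Q T h' \<and> ind_eq E T (h' \<circ>\<^sub>I p) t \<longrightarrow> ind_eq Q T h' h)))"

definition ind_const :: "('k, 'v) nspace \<Rightarrow> (unit, unit, 'k, 'v) ind" where
  "ind_const V = \<lparr>Idx = \<lparr>Obj = {()}, Arr = {()}, Dom = (\<lambda>_. ()), Cod = (\<lambda>_. ()),
       Idn = (\<lambda>_. ()), Cmp = (\<lambda>_ _. ())\<rparr>, Sp = (\<lambda>_. V), Tr = (\<lambda>_. id)\<rparr>"

definition cat_prod :: "('o, 'm) cat \<Rightarrow> ('p, 'n) cat \<Rightarrow> ('o \<times> 'p, 'm \<times> 'n) cat" where
  "cat_prod J L = \<lparr>Obj = Obj J \<times> Obj L, Arr = Arr J \<times> Arr L,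
     Dom = map_prod (Dom J) (Dom L), Cod = map_prod (Cod J) (Cod L),
     Idn = map_prod (Idn J) (Idn L), Cmp = (\<lambda>(v, v') (u, u'). (Cmp J v u, Cmp L v' u'))\<rparr>"

definition ind_tens ::
  "('k::field_char_0 \<Rightarrow> real) \<Rightarrow> ('o, 'm, 'k, 'v, 'y) ind_scheme \<Rightarrow> ('p, 'n, 'k, 'w, 'z) ind_scheme \<Rightarrow>
   ('o \<times> 'p, 'm \<times> 'n, 'k, ('k, 'v, 'w) tens) ind" where
  "ind_tens av D E = \<lparr>
     Idx = cat_prod (Idx D) (Idx E),
     Sp = (\<lambda>(i, j). ctens av (Sp D i) (Sp E j)),
     Tr = (\<lambda>(u, v). tens_map av (Sp D (Dom (Idx D) u)) (Sp E (Dom (Idx E) v))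
                       (Sp D (Cod (Idx D) u)) (Sp E (Cod (Idx E) v)) (Tr D u) (Tr E v))\<rparr>"

definition ind_tens_map ::
  "('k::field_char_0 \<Rightarrow> real) \<Rightarrow> ('o, 'm, 'k, 'v, 'y) ind_scheme \<Rightarrow> ('p, 'n, 'k, 'w, 'z) ind_scheme \<Rightarrow>
   ('o2, 'm2, 'k, 'v2, 'y2) ind_scheme \<Rightarrow> ('p2, 'n2, 'k, 'w2, 'z2) ind_scheme \<Rightarrow>
   ('o, 'v, 'o2, 'v2) imor \<Rightarrow> ('p, 'w, 'p2, 'w2) imor \<Rightarrow>
   ('o \<times> 'p, ('k, 'v, 'w) tens, 'o2 \<times> 'p2, ('k, 'v2, 'w2) tens) imor" where
  "ind_tens_map av D E D' E' f g = (\<lambda>(i, j). ((fst (f i), fst (g j)),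
     tens_map av (Sp D i) (Sp E j) (Sp D' (fst (f i))) (Sp E' (fst (g j))) (snd (f i)) (snd (g j))))"

definition ind_assoc ::
  "('k::field_char_0 \<Rightarrow> real) \<Rightarrow> ('o, 'm, 'k, 'u, 'x) ind_scheme \<Rightarrow> ('p, 'n, 'k, 'v, 'y) ind_scheme \<Rightarrow>
   ('q, 'l, 'k, 'w, 'z) ind_scheme \<Rightarrow>
   (('o \<times> 'p) \<times> 'q, ('k, ('k, 'u, 'v) tens, 'w) tens,
    'o \<times> ('p \<times> 'q), ('k, 'u, ('k, 'v, 'w) tens) tens) imor" where
  "ind_assoc av A B C = (\<lambda>((i, j), l). ((i, (j, l)),
     (let X = Sp A i; Y = Sp B j; Z = Sp C l; W = ctens av X (ctens av Y Z) in
      tens_lift av (ctens av X Y) Z W (\<lambda>t z.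
        tens_lift av X Y W (\<lambda>x y. pure_tens av X (ctens av Y Z) x (pure_tens av Y Z y z)) t))))"

definition ind_swap ::
  "('k::field_char_0 \<Rightarrow> real) \<Rightarrow> ('o, 'm, 'k, 'v, 'y) ind_scheme \<Rightarrow> ('p, 'n, 'k, 'w, 'z) ind_scheme \<Rightarrow>
   ('o \<times> 'p, ('k, 'v, 'w) tens, 'p \<times> 'o, ('k, 'w, 'v) tens) imor" where
  "ind_swap av D E = (\<lambda>(i, j). ((j, i),
     tens_lift av (Sp D i) (Sp E j) (ctens av (Sp E j) (Sp D i))
       (\<lambda>x y. pure_tens av (Sp E j) (Sp D i) y x)))"

definition ind_lunit ::
  "('k::field_char_0 \<Rightarrow> real) \<Rightarrow> ('o, 'm, 'k, 'v, 'y) ind_scheme \<Rightarrow> (unit \<times> 'o, ('k, 'k, 'v) tens, 'o, 'v) imor" where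
  "ind_lunit av D = (\<lambda>(_, i). (i, tens_lift av (kspace av) (Sp D i) (Sp D i) (\<lambda>c x. c \<odot>\<^bsub>Sp D i\<^esub> x)))"

definition ind_runit ::
  "('k::field_char_0 \<Rightarrow> real) \<Rightarrow> ('o, 'm, 'k, 'v, 'y) ind_scheme \<Rightarrow> ('o \<times> unit, ('k, 'v, 'k) tens, 'o, 'v) imor" where
  "ind_runit av D = (\<lambda>(i, _). (i, tens_lift av (Sp D i) (kspace av) (Sp D i) (\<lambda>x c. c \<odot>\<^bsub>Sp D i\<^esub> x)))"


section \<open>IndBanach algebras\<close>

record (overloaded) ('o, 'm, 'k, 'v) indalg = "('o, 'm, 'k::field_char_0, 'v) ind" +
  imul :: "('o \<times> 'o, ('k, 'v, 'v) tens, 'o, 'v) imor"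
  iunit :: "(unit, 'k, 'o, 'v) imor"

abbreviation "ind_k av \<equiv> ind_const (kspace av)"

definition ind_algebra ::
  "('k::field_char_0 \<Rightarrow> real) \<Rightarrow> ('o, 'm, 'k, 'v, 'z) indalg_scheme \<Rightarrow> bool" where
  "ind_algebra av A \<longleftrightarrow>
     ind_banach av A \<and>
     ind_hom (ind_tens av A A) A (imul A) \<and>
     ind_hom (ind_k av) A (iunit A) \<and>
     ind_eq (ind_tens av (ind_tens av A A) A) A
       (imul A \<circ>\<^sub>I ind_tens_map av (ind_tens av A A) A A A (imul A) ind_id)
       (imul A \<circ>\<^sub>I ind_tens_map av A (ind_tens av A A) A A ind_id (imul A) \<circ>\<^sub>I ind_assoc av A A A) \<and>
     ind_eq (ind_tens av (ind_k av) A) A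
       (imul A \<circ>\<^sub>I ind_tens_map av (ind_k av) A A A (iunit A) ind_id) (ind_lunit av A) \<and>
     ind_eq (ind_tens av A (ind_k av)) A
       (imul A \<circ>\<^sub>I ind_tens_map av A (ind_k av) A A ind_id (iunit A)) (ind_runit av A)"

definition ind_alg_hom ::
  "('k::field_char_0 \<Rightarrow> real) \<Rightarrow> ('o, 'm, 'k, 'v, 'y) indalg_scheme \<Rightarrow> ('p, 'n, 'k, 'w, 'z) indalg_scheme \<Rightarrow>
   ('o, 'v, 'p, 'w) imor \<Rightarrow> bool" where
  "ind_alg_hom av A B f \<longleftrightarrow>
     ind_hom A B f \<and>
     ind_eq (ind_tens av A A) B (f \<circ>\<^sub>I imul A) (imul B \<circ>\<^sub>I ind_tens_map av A A B B f f) \<and>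
     ind_eq (ind_k av) B (f \<circ>\<^sub>I iunit A) (iunit B)"

definition const_alg :: "('k::field_char_0 \<Rightarrow> real) \<Rightarrow> ('k, 'v) nspace \<Rightarrow> (unit, unit, 'k, 'v) indalg" where
  "const_alg av X = ind.extend (ind_const X) (indalg.fields
     (\<lambda>_. ((), tens_lift av X X X (\<lambda>x y. x \<otimes>\<^bsub>X\<^esub> y)))
     (\<lambda>_. ((), \<lambda>c. c \<odot>\<^bsub>X\<^esub> \<one>\<^bsub>X\<^esub>)))"


section \<open>Formal power series\<close>

text \<open>
  The product of countably many copies of a Banach space \<open>X\<close> in the Ind-completion. A family of
  bounded maps \<open>V \<rightarrow> X\<close> with operator norms at most \<open>c n\<close> takes values in the Banach space of
  sequences with \<open>\<parallel>x n\<parallel> = O(c n)\<close>, so the product is the formal filtered colimit of these spaces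
  over all \<open>c > 0\<close>, ordered pointwise. The element \<open>x\<close> stands for \<open>\<Sum>n. x n \<hbar>\<^sup>n\<close>.
\<close>

definition weighted_seqs :: "(nat \<Rightarrow> real) \<Rightarrow> ('k, 'v) nspace \<Rightarrow> ('k, nat \<Rightarrow> 'v) nspace" where
  "weighted_seqs c X = \<lparr>
     carrier = {x. (\<forall>n. x n \<in> carrier X) \<and> bdd_above (range (\<lambda>n. nrm X (x n) / c n))},
     mult = undefined, one = undefined,
     zero = (\<lambda>n. \<zero>\<^bsub>X\<^esub>), add = (\<lambda>x y n. x n \<oplus>\<^bsub>X\<^esub> y n), smult = (\<lambda>a x n. a \<odot>\<^bsub>X\<^esub> x n),
     nrm = (\<lambda>x. SUP n. nrm X (x n) / c n)\<rparr>"

type_synonym weight = "nat \<Rightarrow> real"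

definition powser :: "('k, 'v) nspace \<Rightarrow> (weight, weight \<times> weight, 'k, nat \<Rightarrow> 'v) ind" where
  "powser X = \<lparr>
     Idx = \<lparr>Obj = {c. \<forall>n. 0 < c n}, Arr = {(c, d). (\<forall>n. 0 < c n) \<and> c \<le> d},
            Dom = fst, Cod = snd, Idn = (\<lambda>c. (c, c)), Cmp = (\<lambda>v u. (fst u, snd v))\<rparr>,
     Sp = (\<lambda>c. weighted_seqs c X), Tr = (\<lambda>_. id)\<rparr>"

definition coeff_map :: "nat \<Rightarrow> (weight, nat \<Rightarrow> 'v, unit, 'v) imor" where
  "coeff_map n = (\<lambda>c. ((), \<lambda>x. x n))"

lemma powser_coeff:
  assumes "banach_space av X"
  shows "ind_hom (powser X) (ind_const X) (coeff_map n)"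
proof -
  have "nrm X (x n) \<le> c n * (SUP n. nrm X (x n) / c n)"
    if "0 < c n" "bdd_above (range (\<lambda>n. nrm X (x n) / c n))" for x c
    using cSUP_upper[OF UNIV_I that(2), of n] that(1) by (simp add: field_simps)
  then have bound: "\<exists>C. \<forall>x. (\<forall>n. x n \<in> carrier X) \<and> bdd_above (range (\<lambda>n. nrm X (x n) / c n)) \<longrightarrow>
      nrm X (x n) \<le> C * (SUP n. nrm X (x n) / c n)" if "\<forall>n. 0 < c n" for c
    using that by blast
  show ?thesis
    by (auto simp: ind_hom_def powser_def ind_const_def coeff_map_def bounded_linear_map_def
        weighted_seqs_def colim_eq_def hom_set_def intro: bound)
qed

text \<open>The universal property of the product in the Ind-completion.\<close>

lemma powser_product:
  fixes X :: "('k::field_char_0, 'v) nspace" and T :: "('o, 'm, 'k, 'w, 'z) ind_scheme"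
  assumes X: "banach_space av X" and T: "ind_banach av T"
    and f: "\<And>n. ind_hom T (ind_const X) (f n)"
  shows "\<exists>F. ind_hom T (powser X) F \<and>
             (\<forall>n. ind_eq T (ind_const X) (coeff_map n \<circ>\<^sub>I F) (f n)) \<and>
             (\<forall>F'. ind_hom T (powser X) F' \<and>
                   (\<forall>n. ind_eq T (ind_const X) (coeff_map n \<circ>\<^sub>I F') (f n)) \<longrightarrow>
                   ind_eq T (powser X) F' F)"
proof -
  have blin: "bounded_linear_map (Sp T i) X (snd (f n i))" if "i \<in> Obj (Idx T)" for i n
    using f[of n] that by (auto simp: ind_hom_def ind_const_def)
  have "\<exists>C. 0 < C \<and> (\<forall>x\<in>carrier (Sp T i). nrm X (snd (f n i) x) \<le> C * nrm (Sp T i) x)"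
    if i: "i \<in> Obj (Idx T)" for i n
  proof -
    obtain C where C: "\<forall>x\<in>carrier (Sp T i). nrm X (snd (f n i) x) \<le> C * nrm (Sp T i) x"
      using blin[OF i] unfolding bounded_linear_map_def by blast
    have "nrm X (snd (f n i) x) \<le> max 1 C * nrm (Sp T i) x" if x: "x \<in> carrier (Sp T i)" for x
    proof -
      have "0 \<le> nrm (Sp T i) x"
        using T i x by (auto simp: ind_banach_def banach_space_def)
      then have "C * nrm (Sp T i) x \<le> max 1 C * nrm (Sp T i) x"
        by (intro mult_right_mono) auto
      then show ?thesis using C x by force
    qed
    then show ?thesis by (intro exI[of _ "max 1 C"]) auto
  qed
  then obtain c where c: "\<And>i n. i \<in> Obj (Idx T) \<Longrightarrow>
      0 < c i n \<and> (\<forall>x\<in>carrier (Sp T i). nrm X (snd (f n i) x) \<le> c i n * nrm (Sp T i) x)"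
    by metis
  define F where "F = (\<lambda>i. (c i, \<lambda>x n. snd (f n i) x))"
  have quo: "nrm X (snd (f n i) x) / c i n \<le> nrm (Sp T i) x"
    if "i \<in> Obj (Idx T)" "x \<in> carrier (Sp T i)" for i n x
    using c[OF that(1), of n] that by (simp add: field_simps)
  have blinF: "bounded_linear_map (Sp T i) (weighted_seqs (c i) X) (\<lambda>x n. snd (f n i) x)"
    if i: "i \<in> Obj (Idx T)" for i
  proof -
    have "bdd_above (range (\<lambda>n. nrm X (snd (f n i) x) / c i n))" if "x \<in> carrier (Sp T i)" for x
      using quo[OF i that] by (intro bdd_aboveI[of _ "nrm (Sp T i) x"]) auto
    moreover have "(SUP n. nrm X (snd (f n i) x) / c i n) \<le> 1 * nrm (Sp T i) x"
      if "x \<in> carrier (Sp T i)" for x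
      using quo[OF i that] by (auto intro!: cSUP_least)
    ultimately show ?thesis
      using blin[OF i] unfolding bounded_linear_map_def weighted_seqs_def
      by (auto intro!: exI[of _ 1] simp: Pi_iff)
  qed
  have upper: "colim_eq (powser X) S (d, g) (e, h)"
    if "\<forall>n. 0 < d n" "\<forall>n. 0 < e n" "\<forall>x\<in>S. g x = h x" for S :: "'w set" and d e g h
    unfolding colim_eq_def
    by (rule exI[of _ "\<lambda>n. max (d n) (e n)"],
        rule bexI[of _ "(d, \<lambda>n. max (d n) (e n))"], rule bexI[of _ "(e, \<lambda>n. max (d n) (e n))"])
      (use that in \<open>auto simp: powser_def hom_set_def le_fun_def less_max_iff_disj\<close>)
  have obj: "i \<in> Obj (Idx T) \<and> i' \<in> Obj (Idx T)" if "u \<in> hom_set (Idx T) i i'" for i i' u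
    using T that by (auto simp: ind_banach_def filtered_def is_category_def hom_set_def)
  have nat: "snd (f n i) x = snd (f n i') (Tr T u x)"
    if "u \<in> hom_set (Idx T) i i'" "x \<in> carrier (Sp T i)" for n i i' u x
    using f[of n] that by (fastforce simp: ind_hom_def ind_const_def colim_eq_def hom_set_def)
  have "ind_hom T (powser X) F"
    unfolding ind_hom_def
  proof (intro conjI ballI allI)
    fix i assume "i \<in> Obj (Idx T)"
    then show "fst (F i) \<in> Obj (Idx (powser X))"
      and "bounded_linear_map (Sp T i) (Sp (powser X) (fst (F i))) (snd (F i))"
      using blinF c by (auto simp: F_def powser_def)
  next
    fix i i' u assume u: "u \<in> hom_set (Idx T) i i'"
    show "colim_eq (powser X) (carrier (Sp T i)) (F i) (fst (F i'), snd (F i') \<circ> Tr T u)"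
      unfolding F_def fst_conv snd_conv
      by (rule upper) (use c obj[OF u] nat[OF u] in auto)
  qed
  moreover have "ind_eq T (ind_const X) (coeff_map n \<circ>\<^sub>I F) (f n)" for n
    by (auto simp: ind_eq_def ind_const_def colim_eq_def hom_set_def coeff_map_def ind_comp_def F_def)
  moreover have "ind_eq T (powser X) F' F"
    if F': "ind_hom T (powser X) F'" "\<forall>n. ind_eq T (ind_const X) (coeff_map n \<circ>\<^sub>I F') (f n)" for F'
    unfolding ind_eq_def
  proof
    fix i assume i: "i \<in> Obj (Idx T)"
    have "snd (F' i) x = (\<lambda>n. snd (f n i) x)" if "x \<in> carrier (Sp T i)" for x
      using F'(2) i that
      by (auto simp: ind_eq_def ind_const_def colim_eq_def hom_set_def coeff_map_def ind_comp_def)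
    moreover have "\<forall>n. 0 < fst (F' i) n"
      using F'(1) i by (auto simp: ind_hom_def powser_def)
    ultimately show "colim_eq (powser X) (carrier (Sp T i)) (F' i) (F i)"
      using upper[of "fst (F' i)" "c i" "carrier (Sp T i)" "snd (F' i)" "\<lambda>x n. snd (f n i) x"] c i
      by (simp add: F_def)
  qed
  ultimately show ?thesis by blast
qed

definition conv_weight :: "weight \<Rightarrow> weight \<Rightarrow> weight" where
  "conv_weight c d = (\<lambda>n. Max ((\<lambda>l. c l * d (n - l)) ` {..n}))"

definition powser_alg ::
  "('k::field_char_0 \<Rightarrow> real) \<Rightarrow> ('k, 'v) nspace \<Rightarrow> (weight, weight \<times> weight, 'k, nat \<Rightarrow> 'v) indalg" where
  "powser_alg av X = ind.extend (powser X) (indalg.fields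
     (\<lambda>(c, d). (conv_weight c d,
        tens_lift av (weighted_seqs c X) (weighted_seqs d X) (weighted_seqs (conv_weight c d) X)
          (\<lambda>x y n. \<Oplus>\<^bsub>X\<^esub>l\<in>{..n}. x l \<otimes>\<^bsub>X\<^esub> y (n - l))))
     (\<lambda>_. (\<lambda>n. 1, \<lambda>a n. if n = 0 then a \<odot>\<^bsub>X\<^esub> \<one>\<^bsub>X\<^esub> else \<zero>\<^bsub>X\<^esub>)))"

abbreviation "kpow av \<equiv> powser_alg av (kspace av)"

type_synonym ('o, 'k, 'v) hact = "(weight \<times> 'o, ('k, nat \<Rightarrow> 'k, 'v) tens, 'o, 'v) imor"

definition powser_act :: "('k::field_char_0 \<Rightarrow> real) \<Rightarrow> ('k, 'v) nspace \<Rightarrow> (weight, 'k, nat \<Rightarrow> 'v) hact" where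
  "powser_act av X = (\<lambda>(c, d). (conv_weight c d,
     tens_lift av (weighted_seqs c (kspace av)) (weighted_seqs d X) (weighted_seqs (conv_weight c d) X)
       (\<lambda>a x n. \<Oplus>\<^bsub>X\<^esub>l\<in>{..n}. a l \<odot>\<^bsub>X\<^esub> x (n - l))))"

text \<open>A \<open>k\<lbrakk>\<hbar>\<rbrakk>\<close>-algebra is an algebra with a \<open>k\<lbrakk>\<hbar>\<rbrakk>\<close>-module structure for which the product is
  \<open>k\<lbrakk>\<hbar>\<rbrakk>\<close>-bilinear.\<close>

record (overloaded) ('o, 'm, 'k, 'v) hindalg = "('o, 'm, 'k::field_char_0, 'v) indalg" +
  iact :: "('o, 'k, 'v) hact"

definition powser_halg ::
  "('k::field_char_0 \<Rightarrow> real) \<Rightarrow> ('k, 'v) nspace \<Rightarrow> (weight, weight \<times> weight, 'k, nat \<Rightarrow> 'v) hindalg" where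
  "powser_halg av X = indalg.extend (powser_alg av X) (hindalg.fields (powser_act av X))"

definition h_algebra ::
  "('k::field_char_0 \<Rightarrow> real) \<Rightarrow> ('o, 'm, 'k, 'v) hindalg \<Rightarrow> bool" where
  "h_algebra av A \<longleftrightarrow>
     ind_algebra av A \<and>
     ind_hom (ind_tens av (kpow av) A) A (iact A) \<and>
     ind_eq (ind_tens av (ind_tens av (kpow av) (kpow av)) A) A
       (iact A \<circ>\<^sub>I ind_tens_map av (ind_tens av (kpow av) (kpow av)) A (kpow av) A (imul (kpow av)) ind_id)
       (iact A \<circ>\<^sub>I ind_tens_map av (kpow av) (ind_tens av (kpow av) A) (kpow av) A ind_id (iact A)
          \<circ>\<^sub>I ind_assoc av (kpow av) (kpow av) A) \<and>
     ind_eq (ind_tens av (ind_k av) A) A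
       (iact A \<circ>\<^sub>I ind_tens_map av (ind_k av) A (kpow av) A (iunit (kpow av)) ind_id) (ind_lunit av A) \<and>
     ind_eq (ind_tens av (ind_tens av (kpow av) A) A) A
       (imul A \<circ>\<^sub>I ind_tens_map av (ind_tens av (kpow av) A) A A A (iact A) ind_id)
       (iact A \<circ>\<^sub>I ind_tens_map av (kpow av) (ind_tens av A A) (kpow av) A ind_id (imul A)
          \<circ>\<^sub>I ind_assoc av (kpow av) A A) \<and>
     ind_eq (ind_tens av (ind_tens av A (kpow av)) A) A
       (imul A \<circ>\<^sub>I ind_tens_map av A (ind_tens av (kpow av) A) A A ind_id (iact A)
          \<circ>\<^sub>I ind_assoc av A (kpow av) A)
       (imul A \<circ>\<^sub>I ind_tens_map av (ind_tens av A (kpow av)) A A A (iact A \<circ>\<^sub>I ind_swap av A (kpow av)) ind_id)"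

definition h_linear ::
  "('k::field_char_0 \<Rightarrow> real) \<Rightarrow> ('o, 'm, 'k, 'v) hindalg \<Rightarrow> ('p, 'n, 'k, 'w) hindalg \<Rightarrow>
   ('o, 'v, 'p, 'w) imor \<Rightarrow> bool" where
  "h_linear av A B f \<longleftrightarrow>
     ind_hom A B f \<and>
     ind_eq (ind_tens av (kpow av) A) B
       (f \<circ>\<^sub>I iact A) (iact B \<circ>\<^sub>I ind_tens_map av (kpow av) A (kpow av) B ind_id f)"

definition hbar_mult ::
  "('k::field_char_0 \<Rightarrow> real) \<Rightarrow> ('o, 'm, 'k, 'v) hindalg \<Rightarrow> ('o, 'v, 'o, 'v) imor" where
  "hbar_mult av A = (\<lambda>i. (fst (iact A (\<lambda>n. 1, i)), \<lambda>x. snd (iact A (\<lambda>n. 1, i))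
     (pure_tens av (weighted_seqs (\<lambda>n. 1) (kspace av)) (Sp A i) (\<lambda>n. if n = 1 then 1 else 0) x)))"

end

theory Submission imports Defs
begin

abbreviation elem  (infix "|:" 50) where "x |: V \<equiv> x \<in> carrier V"

alias bl = bounded_linear_map
alias wseq = weighted_seqs
alias single = Poly_Mapping.single
alias lookup = Poly_Mapping.lookup
alias keys = Poly_Mapping.keys

syntax "_index" :: "logic => index"  ("\<^sub>_" [1000] 1000)

text \<open>
 Transport the product of \<open>A\<close> along \<open>\<theta>\<close> to a product \<open>\<star>\<close> on the coefficient sequences of power
 series. Bounded maps \<open>T\<^sub>n\<close> of \<open>U\<close> with \<open>T a \<star> T b = T (a b)\<close> for \<open>T = \<Sum> T\<^sub>n \<hbar>\<^sup>n\<close> are found order by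
 order, the obstruction at each order being a bounded normalised Hochschild 2-cocycle \<open>m\<close> of \<open>U\<close>;
 the \<open>\<hbar>\<close>-linear extension of \<open>T\<close> is invertible and its inverse corrects \<open>\<theta>\<close>.

 To trivialise \<open>m\<close>, let \<open>E\<close> be the square-zero extension of \<open>U\<close> by itself that it defines. The
 antisymmetrisation of \<open>m\<close> is a Lie cocycle on \<open>\<gg>\<^sub>r\<^sub>,\<^sub>s\<close>, hence the coboundary of a bounded \<open>t\<close>, and
 \<open>x \<mapsto> (x, t x)\<close> is a homomorphism of Lie algebras to \<open>E\<close>. It respects the Serre relations, which
 are iterated commutators, and the norms of words stay bounded because only one letter of a word
 can be altered at a time in \<open>E\<close>. By the triangular decomposition it therefore extends to an algebra
 section \<open>U \<rightarrow> E\<close>, whose second component trivialises \<open>m\<close>.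
\<close>

section \<open>Seminormed spaces and bounded maps\<close>

text \<open>Two things keep the argument from being formal. \<open>U\<close> is known only through
  its triangular decomposition and the commutators of its generators, so a homomorphism out of it is
  not given by a universal property: it is built as a bounded linear map on the triple tensor
  product and shown multiplicative by moving generators past one another. And products are bounded
  only up to a constant, so a bounded map on letters need not extend to the tensor algebra: a word
  of length n could cost an n-th power of that constant. No estimate has to be uniform in the order
  of \<hbar>. The power series object is a colimit over all positive weights, and whatever growth
  the coefficients of \<open>T\<close> and of its inverse have is absorbed by a change of weight.
  The transition maps of that colimit are inclusions, so equality of morphisms into it is equality
  of coefficient sequences; this is why the structure maps of \<open>A\<close> can be studied on
  elements, and why only the corrected isomorphism has to be turned back into a morphism. That
  \<open>A\<close> reduces to \<open>U\<close> as an algebra enters through the constant coefficient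
  of \<star>.\<close>

locale nonarch =
 fixes av :: "'k::field_char_0 => real"
 assumes na: "na_field av"
begin

lemma av_nonneg [simp]: "0 \<le> av x" and av_eq_0 [simp]: "av x = 0 \<longleftrightarrow> x = 0"
 and av_mult: "av (x * y) = av x * av y"
 and av_add: "av (x + y) \<le> max (av x) (av y)"
 and av_complete: "normed_complete (kspace av)" using na unfolding na_field_def by auto

lemma av_0 [simp]: "av 0 = 0" by simp

lemma av_1 [simp]: "av 1 = 1"
proof -
 have "av 1 * av 1 = av 1" using av_mult[of 1 1] by simp
 moreover have "av 1 \<noteq> 0" by (subst av_eq_0) simp
 ultimately show ?thesis by simp
qed

lemma av_minus [simp]: "av (- x) = av x"
proof -
 have "av (-1) * av (-1) = 1" using av_mult[of "-1" "-1"] by simp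
 then have "av (-1) = 1 \<or> av (-1) = -1" by (simp add: square_eq_1_iff)
 then have "av (-1) = 1" using av_nonneg[of "-1"] by linarith
 then show ?thesis using av_mult[of "-1" x] by simp
qed

end

section \<open>The ground field and seminormed vector spaces over it\<close>

lemma cring_kring: "cring (kring :: 'k::field_char_0 ring)"
proof (intro cringI abelian_groupI comm_monoidI)
 fix x :: 'k
 show "\<exists>y\<in>carrier kring. y \<oplus>\<^bsub>kring\<^esub> x = \<zero>\<^bsub>kring\<^esub>" by (rule bexI[of _ "- x"]) (simp_all add: kring_def)
qed (simp_all add: kring_def algebra_simps)

lemma kring_simps [simp]:
 "carrier kring = UNIV" "mult kring = (*)" "one kring = 1" "zero kring = 0" "add kring = (+)"
 by (simp_all add: kring_def)

lemma kring_a_inv [simp]: "a_inv kring x = - x"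
proof -
 interpret cring kring by (rule cring_kring)
 show ?thesis by (rule minus_equality) simp_all
qed

locale seminormed = nonarch av + module kring V
 for av :: "'k::field_char_0 => real" and V :: "('k, 'v) nspace" (structure) +
 assumes norm_nonneg [simp]: "x |: V ==> 0 \<le> nrm V x"
  and norm_smult: "x |: V ==> nrm V (a \<odot> x) = av a * nrm V x"
  and norm_add: "x |: V ==> y |: V ==> nrm V (x \<oplus> y) \<le> max (nrm V x) (nrm V y)"
begin

lemma add_cl [simp, intro]: "x |: V ==> y |: V ==> x \<oplus> y |: V" and zero_cl [simp, intro]: "\<zero> |: V"
 and neg_cl [simp, intro]: "x |: V ==> \<ominus> x |: V"
 and sub_cl [simp, intro]: "x |: V ==> y |: V ==> x \<ominus> y |: V"
 and sm_cl [simp, intro]: "x |: V ==> a \<odot> x |: V" using smult_closed[of a x] by auto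

lemma sm_add_l: "x |: V ==> (a + b) \<odot> x = a \<odot> x \<oplus> b \<odot> x"
 and sm_add_r: "x |: V ==> y |: V ==> a \<odot> (x \<oplus> y) = a \<odot> x \<oplus> a \<odot> y"
 and sm_sm: "x |: V ==> a \<odot> (b \<odot> x) = (a * b) \<odot> x"
 and sm_1 [simp]: "x |: V ==> 1 \<odot> x = x"
 and sm_0l [simp]: "x |: V ==> 0 \<odot> x = \<zero>"
 and sm_0r [simp]: "a \<odot> \<zero> = \<zero>"
 and sm_neg: "x |: V ==> (- a) \<odot> x = \<ominus> (a \<odot> x)"
 using smult_l_distr[of a b x] smult_r_distr[of a x y] smult_assoc1[of a b x] smult_one[of x]
  smult_l_null[of x] smult_r_null[of a] smult_l_minus[of a x] by simp_all

lemma sm_neg_r: "x |: V ==> a \<odot> (\<ominus> x) = \<ominus> (a \<odot> x)" using smult_r_minus[of a x] by simp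

lemma sm_m1: "x |: V ==> (- 1) \<odot> x = \<ominus> x" by (simp add: sm_neg)

lemmas ag = M.a_assoc M.a_comm M.a_lcomm M.minus_eq M.minus_add M.minus_minus M.r_neg M.l_neg
 M.r_neg1 M.r_neg2

lemma sub_self [simp]: "x |: V ==> x \<ominus> x = \<zero>" by (simp add: ag)

lemma sub_eq_0: "x |: V ==> y |: V ==> x \<ominus> y = \<zero> \<longleftrightarrow> x = y"
 by (metis M.add.inv_solve_right M.l_zero M.minus_eq zero_cl)

lemma sub_0 [simp]: "x |: V ==> x \<ominus> \<zero> = x" by (simp add: M.minus_eq)

lemma neg_sub: "x |: V ==> y |: V ==> \<ominus> (x \<ominus> y) = y \<ominus> x" by (simp add: ag)

lemma sub_split: "x |: V ==> y |: V ==> z |: V ==> x \<ominus> z = (x \<ominus> y) \<oplus> (y \<ominus> z)" by (simp add: ag)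

lemma sub_sub: "x |: V ==> y |: V ==> z |: V ==> x \<ominus> y \<ominus> z = x \<ominus> (y \<oplus> z)" by (simp add: ag)

lemma sub_add_cancel [simp]: "x |: V ==> y |: V ==> (x \<ominus> y) \<oplus> y = x" by (simp add: ag)

lemma add_sub_cancel [simp]: "x |: V ==> y |: V ==> (x \<oplus> y) \<ominus> y = x" by (simp add: ag)

lemma add_sub_add: "x |: V ==> y |: V ==> x' |: V ==> y' |: V ==>
  (x \<oplus> y) \<ominus> (x' \<oplus> y') = (x \<ominus> x') \<oplus> (y \<ominus> y')" by (simp add: ag)

lemma sub_eq_iff: "x |: V ==> y |: V ==> z |: V ==> x \<ominus> y = z \<longleftrightarrow> x = z \<oplus> y"
 by (metis add_sub_cancel sub_add_cancel sub_cl)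

lemma sm_sub: "x |: V ==> y |: V ==> a \<odot> (x \<ominus> y) = a \<odot> x \<ominus> a \<odot> y" by (simp add: M.minus_eq sm_add_r sm_neg_r)

lemma norm_0 [simp]: "nrm V \<zero> = 0" using norm_smult[of "\<zero>" 0] by simp

lemma norm_neg [simp]: "x |: V ==> nrm V (\<ominus> x) = nrm V x" using norm_smult[of x "-1"] by (simp add: sm_m1)

lemma norm_sub: "x |: V ==> y |: V ==> nrm V (x \<ominus> y) \<le> max (nrm V x) (nrm V y)"
 using norm_add[of x "\<ominus> y"] by (simp add: M.minus_eq)

lemma norm_sub_comm: "x |: V ==> y |: V ==> nrm V (x \<ominus> y) = nrm V (y \<ominus> x)"
 using norm_neg[of "x \<ominus> y"] by (simp add: neg_sub)

lemma norm_tri: "x |: V ==> y |: V ==> z |: V ==> nrm V (x \<ominus> z) \<le> max (nrm V (x \<ominus> y)) (nrm V (y \<ominus> z))"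
 using norm_add[of "x \<ominus> y" "y \<ominus> z"] by (simp add: sub_split[of x y z])

lemma norm_add_le: "x |: V ==> y |: V ==> nrm V x \<le> B ==> nrm V y \<le> B ==> nrm V (x \<oplus> y) \<le> B"
 using norm_add[of x y] by simp

lemma norm_sub_le: "x |: V ==> y |: V ==> nrm V x \<le> B ==> nrm V y \<le> B ==> nrm V (x \<ominus> y) \<le> B"
 using norm_sub[of x y] by simp

text \<open>By the ultrametric inequality the bound does not grow with the number of terms. An empty
  or infinite index set gives the sum zero, whence \<open>0 \<le> B\<close>.\<close>

lemma norm_finsum_le:
 assumes "f \<in> A \<rightarrow> carrier V" "!!i. i \<in> A ==> nrm V (f i) \<le> B" "0 \<le> B"
 shows "nrm V (finsum V f A) \<le> B"
proof (cases "finite A")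
 case True
 then show ?thesis using assms(1,2)
 proof (induction A rule: finite_induct)
  case (insert x F)
  then have "nrm V (f x \<oplus> finsum V f F) \<le> B" by (intro norm_add_le) (auto intro!: M.finsum_closed)
  then show ?case using insert by (subst M.finsum_insert) (auto simp: Pi_iff)
 qed (use assms in simp)
next
 case False
 then show ?thesis using assms by (simp add: M.finsum_infinite)
qed

lemma finsum_sm:
 assumes "f \<in> A \<rightarrow> carrier V"
 shows "a \<odot> finsum V f A = (\<Oplus>i\<in>A. a \<odot> f i)"
proof (cases "finite A")
 case True
 then show ?thesis using assms
 proof (induction A rule: finite_induct)
  case (insert x F)
  then show ?case by (subst M.finsum_insert; (subst M.finsum_insert)?)
     (auto simp: Pi_iff sm_add_r intro!: M.finsum_closed)
 qed simp
next
 case False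
 then show ?thesis by (simp add: M.finsum_infinite)
qed

end

lemma banach_seminormed: "na_field av ==> banach_space av V ==> seminormed av V"
 unfolding banach_space_def seminormed_def seminormed_axioms_def nonarch_def by auto

lemma banach_sep: "banach_space av V ==> x |: V ==> nrm V x = 0 ==> x = \<zero>\<^sub>V"
 unfolding banach_space_def by auto

lemma banach_spaceI:
 assumes "seminormed av V" "!!x. x |: V ==> nrm V x = 0 ==> x = \<zero>\<^sub>V" "normed_complete V"
 shows "banach_space av V"
proof -
 interpret seminormed av V by fact
 show ?thesis unfolding banach_space_def using assms norm_smult norm_add module_axioms by auto
qed

lemma banach_complete:
 assumes "banach_space av V" "!!n::nat. X n |: V" and "!!e. 0 < e ==> \<exists>N. \<forall>m\<ge>N. \<forall>n\<ge>N. nrm V (X m \<ominus>\<^sub>V X n) < e"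
 shows "\<exists>l\<in>carrier V. (%n. nrm V (X n \<ominus>\<^sub>V l)) \<longlonglongrightarrow> 0"
proof -
 have "normed_complete V" using assms(1) unfolding banach_space_def by blast
 then have "(\<forall>n. X n |: V) \<and> (\<forall>e>0. \<exists>N. \<forall>m\<ge>N. \<forall>n\<ge>N. nrm V (X m \<ominus>\<^sub>V X n) < e) \<longrightarrow>
   (\<exists>l\<in>carrier V. (%n. nrm V (X n \<ominus>\<^sub>V l)) \<longlonglongrightarrow> 0)" unfolding normed_complete_def by (rule spec)
 then show ?thesis using assms(2,3) by simp
qed

text \<open>Kept apart from completeness: completeness is asked only of the targets of extended
  maps, while uniqueness rests on vectors of norm zero being zero. Sources such as the halves of
  \<open>U\<close> are treated as seminormed spaces.\<close>

definition separated :: "('k, 'v) nspace => bool" where "separated V \<longleftrightarrow> (\<forall>x\<in>carrier V. nrm V x = 0 \<longrightarrow> x = \<zero>\<^sub>V)"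

lemma banach_separated: "banach_space av V ==> separated V" by (simp add: separated_def banach_sep)

lemma separated_eqI:
 assumes "seminormed av V" "separated V" "x |: V" "y |: V" and "!!e. 0 < e ==> nrm V (x \<ominus>\<^sub>V y) \<le> e"
 shows "x = y"
proof -
 interpret seminormed av V by fact
 have "nrm V (x \<ominus>\<^sub>V y) \<le> 0" by (rule field_le_epsilon) (use assms in auto)
 then have "nrm V (x \<ominus>\<^sub>V y) = 0" using assms(3,4) by (simp add: order_antisym)
 then show ?thesis using assms sub_eq_0[of x y] by (auto simp: separated_def)
qed

subsection \<open>Bounded linear and bilinear maps\<close>

lemma bl_closed: "bl V W f ==> x |: V ==> f x |: W"
 and bl_add: "bl V W f ==> x |: V ==> y |: V ==> f (x \<oplus>\<^sub>V y) = f x \<oplus>\<^sub>W f y"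
 and bl_sm: "bl V W f ==> x |: V ==> f (a \<odot>\<^sub>V x) = a \<odot>\<^sub>W f x" unfolding bounded_linear_map_def by auto

lemma bl_bound:
 assumes "seminormed av V" "bl V W f"
 obtains C where "0 < C" "!!x. x |: V ==> nrm W (f x) \<le> C * nrm V x"
proof -
 interpret seminormed av V by fact
 obtain C where C: "\<forall>x\<in>carrier V. nrm W (f x) \<le> C * nrm V x"
  using assms unfolding bounded_linear_map_def by auto
 show ?thesis
 proof
  show "0 < max C 1" by simp
  show "nrm W (f x) \<le> max C 1 * nrm V x" if "x |: V" for x
   using C that mult_right_mono[of C "max C 1" "nrm V x"] norm_nonneg[OF that] by force
 qed
qed

lemma blI:
 assumes "!!x. x |: V ==> f x |: W" and "!!x y. x |: V ==> y |: V ==> f (x \<oplus>\<^sub>V y) = f x \<oplus>\<^sub>W f y"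
  and "!!a x. x |: V ==> f (a \<odot>\<^sub>V x) = a \<odot>\<^sub>W f x"
  and "!!x. x |: V ==> nrm W (f x) \<le> C * nrm V x"
 shows "bl V W f" unfolding bounded_linear_map_def using assms(1-3) by (auto intro!: exI[of _ C] assms(4))

lemma bl_zero:
 assumes "seminormed av V" "seminormed av W" "bl V W f"
 shows "f \<zero>\<^sub>V = \<zero>\<^sub>W"
proof -
 interpret V: seminormed av V by fact
 interpret W: seminormed av W by fact
 show ?thesis using bl_sm[OF assms(3), of "\<zero>\<^sub>V" 0] bl_closed[OF assms(3), of "\<zero>\<^sub>V"] by simp
qed

lemma bl_neg:
 assumes "seminormed av V" "seminormed av W" "bl V W f" "x |: V"
 shows "f (\<ominus>\<^sub>V x) = \<ominus>\<^sub>W (f x)"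
proof -
 interpret V: seminormed av V by fact
 interpret W: seminormed av W by fact
 show ?thesis using bl_sm[OF assms(3,4), of "-1"] bl_closed[OF assms(3,4)] assms(4)
  by (simp add: V.sm_m1 W.sm_m1)
qed

lemma bl_sub:
 assumes "seminormed av V" "seminormed av W" "bl V W f" "x |: V" "y |: V"
 shows "f (x \<ominus>\<^sub>V y) = f x \<ominus>\<^sub>W f y"
proof -
 interpret V: seminormed av V by fact
 interpret W: seminormed av W by fact
 show ?thesis using bl_add[OF assms(3,4), of "\<ominus>\<^sub>V y"] bl_neg[OF assms(1-3,5)] assms(5)
  by (simp add: V.M.minus_eq W.M.minus_eq)
qed

lemma bl_finsum:
 assumes "seminormed av V" "seminormed av W" "bl V W f" "g \<in> A \<rightarrow> carrier V"
 shows "f (finsum V g A) = (\<Oplus>\<^sub>W i\<in>A. f (g i))"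
proof -
 interpret V: seminormed av V by fact
 interpret W: seminormed av W by fact
 show ?thesis
 proof (cases "finite A")
  case True
  then show ?thesis using assms(4)
  proof (induction A rule: finite_induct)
   case empty
   then show ?case using bl_zero[OF assms(1-3)] by simp
  next
   case (insert x F)
   then show ?case using bl_closed[OF assms(3)] by (subst V.M.finsum_insert; (subst W.M.finsum_insert)?)
      (auto simp: Pi_iff bl_add[OF assms(3)] V.M.finsum_closed)
  qed
 next
  case False
  then show ?thesis using bl_zero[OF assms(1-3)] by (simp add: V.M.finsum_infinite W.M.finsum_infinite)
 qed
qed

lemma bl_id: "bl V V (%x. x)" by (rule blI[where C = 1]) auto

lemma bl_comp:
 assumes "seminormed av V" "seminormed av W" "bl V W f" "bl W Z g"
 shows "bl V Z (%x. g (f x))"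
proof -
 obtain C where C: "0 < C" "!!x. x |: V ==> nrm W (f x) \<le> C * nrm V x" using bl_bound[OF assms(1,3)] by blast
 obtain D where D: "0 < D" "!!x. x |: W ==> nrm Z (g x) \<le> D * nrm W x" using bl_bound[OF assms(2,4)] by blast
 have "nrm Z (g (f x)) \<le> (D * C) * nrm V x" if "x |: V" for x
  using D(2)[OF bl_closed[OF assms(3) that]] mult_left_mono[OF C(2)[OF that], of D] D(1)
  by (simp add: mult.assoc order.trans)
 then show ?thesis
  by (intro blI) (auto simp: bl_closed[OF assms(3)] bl_closed[OF assms(4)] bl_add[OF assms(3)]
    bl_add[OF assms(4)] bl_sm[OF assms(3)] bl_sm[OF assms(4)])
qed

lemma bl_plus:
 assumes "seminormed av V" "seminormed av W" "bl V W f" "bl V W g"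
 shows "bl V W (%x. f x \<oplus>\<^sub>W g x)"
proof -
 interpret V: seminormed av V by fact
 interpret W: seminormed av W by fact
 obtain C where C: "0 < C" "!!x. x |: V ==> nrm W (f x) \<le> C * nrm V x" using bl_bound[OF assms(1,3)] by blast
 obtain D where D: "0 < D" "!!x. x |: V ==> nrm W (g x) \<le> D * nrm V x" using bl_bound[OF assms(1,4)] by blast
 note cl = bl_closed[OF assms(3)] bl_closed[OF assms(4)]
 have "nrm W (f x \<oplus>\<^sub>W g x) \<le> max C D * nrm V x" if x: "x |: V" for x
 proof (rule W.norm_add_le)
  show "nrm W (f x) \<le> max C D * nrm V x" using C(2)[OF x] mult_right_mono[of C "max C D" "nrm V x"] x by simp
  show "nrm W (g x) \<le> max C D * nrm V x" using D(2)[OF x] mult_right_mono[of D "max C D" "nrm V x"] x by simp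
 qed (use x cl in auto)
 then show ?thesis by (intro blI)
   (auto simp: cl bl_add[OF assms(3)] bl_add[OF assms(4)] bl_sm[OF assms(3)] bl_sm[OF assms(4)]
    W.sm_add_r W.M.a_ac)
qed

lemma bl_scale:
 assumes "seminormed av V" "seminormed av W" "bl V W f"
 shows "bl V W (%x. c \<odot>\<^sub>W f x)"
proof -
 interpret V: seminormed av V by fact
 interpret W: seminormed av W by fact
 obtain C where C: "0 < C" "!!x. x |: V ==> nrm W (f x) \<le> C * nrm V x" using bl_bound[OF assms(1,3)] by blast
 show ?thesis
 proof (rule blI[where C = "av c * C"])
  show "nrm W (c \<odot>\<^sub>W f x) \<le> av c * C * nrm V x" if "x |: V" for x
   using mult_left_mono[OF C(2)[OF that], of "av c"] bl_closed[OF assms(3) that]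
   by (simp add: W.norm_smult mult.assoc)
 qed (auto simp: bl_closed[OF assms(3)] bl_add[OF assms(3)] bl_sm[OF assms(3)]
    W.sm_add_r W.sm_sm mult.commute)
qed

lemma bl_cong:
 assumes "seminormed av V" "bl V W f" "!!x. x |: V ==> f x = g x"
 shows "bl V W g"
proof -
 interpret V: seminormed av V by fact
 show ?thesis using assms(2,3) unfolding bounded_linear_map_def by (auto simp: Pi_iff)
qed

lemma bl_minus:
 assumes "seminormed av V" "seminormed av W" "bl V W f" "bl V W g"
 shows "bl V W (%x. f x \<ominus>\<^sub>W g x)"
proof -
 interpret V: seminormed av V by fact
 interpret W: seminormed av W by fact
 show ?thesis by (rule bl_cong[OF assms(1) bl_plus[OF assms(1-3) bl_scale[OF assms(1,2,4), of "-1"]]])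
    (simp add: bl_closed[OF assms(4)] W.sm_m1 W.M.minus_eq)
qed

text \<open>The joint bound is what the projective seminorm turns into a bound for the induced
  linear map. Boundedness in each variable is recorded beside it so that the rules for
  \<open>bl\<close> apply to one slot at a time.\<close>

definition bilin_map :: "('k, 'v) nspace => ('k, 'w) nspace => ('k, 'z) nspace => ('v => 'w => 'z) => bool" where
 "bilin_map V W Z b \<longleftrightarrow>
   (\<forall>w\<in>carrier W. bl V Z (%v. b v w)) \<and>
   (\<forall>v\<in>carrier V. bl W Z (b v)) \<and>
   (\<exists>C>0. \<forall>v\<in>carrier V. \<forall>w\<in>carrier W. nrm Z (b v w) \<le> C * (nrm V v * nrm W w))"

lemma bilin_left: "bilin_map V W Z b ==> w |: W ==> bl V Z (%v. b v w)"
 and bilin_right: "bilin_map V W Z b ==> v |: V ==> bl W Z (b v)" by (simp_all add: bilin_map_def)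

lemma bilin_bound:
 assumes "bilin_map V W Z b"
 obtains C where "0 < C" "!!v w. v |: V ==> w |: W ==> nrm Z (b v w) \<le> C * (nrm V v * nrm W w)"
 using assms unfolding bilin_map_def by blast

lemma bilinI:
 assumes V: "seminormed av V" and W: "seminormed av W" and cl: "!!v w. v |: V ==> w |: W ==> b v w |: Z"
  and "!!v v' w. v |: V ==> v' |: V ==> w |: W ==> b (v \<oplus>\<^sub>V v') w = b v w \<oplus>\<^sub>Z b v' w"
  and "!!v w w'. v |: V ==> w |: W ==> w' |: W ==> b v (w \<oplus>\<^sub>W w') = b v w \<oplus>\<^sub>Z b v w'"
  and "!!a v w. v |: V ==> w |: W ==> b (a \<odot>\<^sub>V v) w = a \<odot>\<^sub>Z b v w"
  and "!!a v w. v |: V ==> w |: W ==> b v (a \<odot>\<^sub>W w) = a \<odot>\<^sub>Z b v w"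
  and bd: "!!v w. v |: V ==> w |: W ==> nrm Z (b v w) \<le> C * (nrm V v * nrm W w)"
 shows "bilin_map V W Z b"
proof -
 interpret V: seminormed av V by fact
 interpret W: seminormed av W by fact
 have bd': "nrm Z (b v w) \<le> max C 1 * (nrm V v * nrm W w)" if "v |: V" "w |: W" for v w
  using bd[OF that] mult_right_mono[of C "max C 1" "nrm V v * nrm W w"] that by force
 have "bl V Z (%v. b v w)" if w: "w |: W" for w by (rule blI[where C = "max C 1 * nrm W w"])
    (use assms(3-7) bd' w in \<open>auto simp: mult_ac\<close>)
 moreover have "bl W Z (b v)" if v: "v |: V" for v by (rule blI[where C = "max C 1 * nrm V v"])
    (use assms(3-7) bd' v in \<open>auto simp: mult_ac\<close>)
 ultimately show ?thesis unfolding bilin_map_def using bd' by (auto intro!: exI[of _ "max C 1"])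
qed

lemma bilin_closed: "bilin_map V W Z b ==> v |: V ==> w |: W ==> b v w |: Z"
 using bilin_left[of V W Z b w] by (rule bl_closed)

lemma bilin_comp:
 assumes sn: "seminormed av V" "seminormed av W" "seminormed av V'" "seminormed av W'"
  and f: "bl V V' f" and g: "bl W W' g" and b: "bilin_map V' W' Z b"
 shows "bilin_map V W Z (%v w. b (f v) (g w))"
proof -
 interpret V: seminormed av V by fact
 interpret W: seminormed av W by fact
 interpret V': seminormed av V' by fact
 interpret W': seminormed av W' by fact
 obtain C where C: "0 < C" "!!x. x |: V ==> nrm V' (f x) \<le> C * nrm V x" using bl_bound[OF sn(1) f] by blast
 obtain D where D: "0 < D" "!!x. x |: W ==> nrm W' (g x) \<le> D * nrm W x" using bl_bound[OF sn(2) g] by blast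
 obtain B where B: "0 < B" "!!v w. v |: V' ==> w |: W' ==> nrm Z (b v w) \<le> B * (nrm V' v * nrm W' w)"
  using bilin_bound[OF b] by blast
 have "nrm Z (b (f v) (g w)) \<le> (B * C * D) * (nrm V v * nrm W w)" if v: "v |: V" and w: "w |: W" for v w
 proof -
  have "nrm Z (b (f v) (g w)) \<le> B * (nrm V' (f v) * nrm W' (g w))"
   using B(2) bl_closed[OF f v] bl_closed[OF g w] by blast
  also have "\<dots> \<le> B * ((C * nrm V v) * (D * nrm W w))"
   using C D B(1) v w bl_closed[OF g w] by (intro mult_left_mono mult_mono) auto
  finally show ?thesis by (simp add: mult_ac)
 qed
 then show ?thesis unfolding bilin_map_def using bl_comp[OF sn(1,3) f bilin_left[OF b bl_closed[OF g]]]
   bl_comp[OF sn(2,4) g bilin_right[OF b bl_closed[OF f]]] B(1) C(1) D(1)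
  by (auto intro!: exI[of _ "B * C * D"])
qed

lemma bl_bilin:
 assumes "seminormed av V" "seminormed av W" "seminormed av Z" "bilin_map V W Z b" "bl Z Y h"
 shows "bilin_map V W Y (%v w. h (b v w))"
proof -
 obtain B where B: "0 < B" "!!v w. v |: V ==> w |: W ==> nrm Z (b v w) \<le> B * (nrm V v * nrm W w)"
  using bilin_bound[OF assms(4)] by blast
 obtain C where C: "0 < C" "!!x. x |: Z ==> nrm Y (h x) \<le> C * nrm Z x" using bl_bound[OF assms(3,5)] by blast
 have "nrm Y (h (b v w)) \<le> (C * B) * (nrm V v * nrm W w)" if "v |: V" "w |: W" for v w
  using C(2)[OF bilin_closed[OF assms(4) that]] mult_left_mono[OF B(2)[OF that], of C] C(1)
  by (simp add: mult.assoc order.trans)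
 then show ?thesis unfolding bilin_map_def using bl_comp[OF assms(1,3) bilin_left[OF assms(4)] assms(5)]
   bl_comp[OF assms(2,3) bilin_right[OF assms(4)] assms(5)] B(1) C(1) by (auto intro!: exI[of _ "C * B"])
qed

lemma bilin_plus:
 assumes "seminormed av V" "seminormed av W" "seminormed av Z" "bilin_map V W Z b" "bilin_map V W Z c"
 shows "bilin_map V W Z (%v w. b v w \<oplus>\<^sub>Z c v w)"
proof -
 interpret V: seminormed av V by fact
 interpret W: seminormed av W by fact
 interpret Z: seminormed av Z by fact
 obtain B where B: "0 < B" "!!v w. v |: V ==> w |: W ==> nrm Z (b v w) \<le> B * (nrm V v * nrm W w)"
  using bilin_bound[OF assms(4)] by blast
 obtain C where C: "0 < C" "!!v w. v |: V ==> w |: W ==> nrm Z (c v w) \<le> C * (nrm V v * nrm W w)"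
  using bilin_bound[OF assms(5)] by blast
 have "nrm Z (b v w \<oplus>\<^sub>Z c v w) \<le> max B C * (nrm V v * nrm W w)" if vw: "v |: V" "w |: W" for v w
 proof (rule Z.norm_add_le)
  show "nrm Z (b v w) \<le> max B C * (nrm V v * nrm W w)"
   using B(2)[OF vw] mult_right_mono[of B "max B C" "nrm V v * nrm W w"] vw by simp
  show "nrm Z (c v w) \<le> max B C * (nrm V v * nrm W w)"
   using C(2)[OF vw] mult_right_mono[of C "max B C" "nrm V v * nrm W w"] vw by simp
 qed (use vw bilin_closed[OF assms(4)] bilin_closed[OF assms(5)] in auto)
 then show ?thesis unfolding bilin_map_def using B(1)
  by (auto intro!: exI[of _ "max B C"] bl_plus[OF assms(1,3)] bl_plus[OF assms(2,3)]
    bilin_left[OF assms(4)] bilin_left[OF assms(5)] bilin_right[OF assms(4)] bilin_right[OF assms(5)])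
qed

lemma bilin_scale:
 assumes "seminormed av V" "seminormed av W" "seminormed av Z" "bilin_map V W Z b"
 shows "bilin_map V W Z (%v w. k \<odot>\<^sub>Z b v w)" using bl_bilin[OF assms bl_scale[OF assms(3,3) bl_id]] .

lemma bilin_swap:
 assumes "bilin_map V W Z b"
 shows "bilin_map W V Z (%w v. b v w)" using assms unfolding bilin_map_def by (metis mult.commute)

subsection \<open>Closed subspaces and dense extension\<close>

text \<open>The vehicle of every density argument: the vectors with a given property form a closed
  subspace, it contains a set of topological generators, hence it is everything.\<close>

definition closed_subspace :: "('k, 'v) nspace => 'v set => bool" where
 "closed_subspace V S \<longleftrightarrow> S \<subseteq> carrier V \<and> \<zero>\<^sub>V \<in> S \<and> (\<forall>x\<in>S. \<forall>y\<in>S. x \<oplus>\<^sub>V y \<in> S) \<and>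
   (\<forall>a. \<forall>x\<in>S. a \<odot>\<^sub>V x \<in> S) \<and> nclosed V S"

text \<open>The difference of the two maps is bounded, so at a limit of points of agreement it is
  arbitrarily small, and \<open>W\<close> separates it from nothing but zero.\<close>

lemma closed_subspace_eq:
 assumes V: "seminormed av V" and W: "seminormed av W" "separated W" and f: "bl V W f" and g: "bl V W g"
 shows "closed_subspace V {x \<in> carrier V. f x = g x}"
proof -
 interpret V: seminormed av V by fact
 interpret W: seminormed av W by fact
 obtain C where C: "0 < C" "!!x. x |: V ==> nrm W (f x \<ominus>\<^sub>W g x) \<le> C * nrm V x"
  using bl_bound[OF V bl_minus[OF V W(1) f g]] by blast
 have "f x = g x" if x: "x |: V" and ap: "\<forall>e>0. \<exists>s\<in>{x \<in> carrier V. f x = g x}. nrm V (x \<ominus>\<^sub>V s) < e" for x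
 proof (rule separated_eqI[OF W])
  fix e :: real assume "0 < e"
  then have "0 < e / C" using C(1) by simp
  then obtain s where s: "s |: V" "f s = g s" "nrm V (x \<ominus>\<^sub>V s) < e / C" using ap by blast
  have "f x \<ominus>\<^sub>W g x = f (x \<ominus>\<^sub>V s) \<ominus>\<^sub>W g (x \<ominus>\<^sub>V s)" using s x bl_closed[OF f] bl_closed[OF g]
   by (simp add: bl_sub[OF V W(1) f] bl_sub[OF V W(1) g] W.ag)
  then have "nrm W (f x \<ominus>\<^sub>W g x) \<le> C * nrm V (x \<ominus>\<^sub>V s)" using C(2) x s by simp
  also have "\<dots> \<le> e" using s C(1) by (simp add: field_simps)
  finally show "nrm W (f x \<ominus>\<^sub>W g x) \<le> e" .
 qed (use x bl_closed[OF f] bl_closed[OF g] in auto)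
 then show ?thesis unfolding closed_subspace_def nclosed_def
  by (auto simp: bl_add[OF f] bl_add[OF g] bl_sm[OF f] bl_sm[OF g] bl_zero[OF V W(1) f] bl_zero[OF V W(1) g])
qed

lemma closed_subspace_vimage:
 assumes V: "seminormed av V" and W: "seminormed av W" and f: "bl V W f" and S: "closed_subspace W S"
 shows "closed_subspace V {x \<in> carrier V. f x \<in> S}"
proof -
 interpret V: seminormed av V by fact
 obtain C where C: "0 < C" "!!x. x |: V ==> nrm W (f x) \<le> C * nrm V x" using bl_bound[OF V f] by blast
 have "f x \<in> S" if x: "x |: V" and ap: "\<forall>e>0. \<exists>s\<in>{x \<in> carrier V. f x \<in> S}. nrm V (x \<ominus>\<^sub>V s) < e" for x
 proof -
  have "\<exists>s\<in>S. nrm W (f x \<ominus>\<^sub>W s) < e" if "0 < e" for e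
  proof -
   have "0 < e / C" using C(1) that by simp
   then obtain s where s: "s |: V" "f s \<in> S" "nrm V (x \<ominus>\<^sub>V s) < e / C" using ap by blast
   have "nrm W (f x \<ominus>\<^sub>W f s) \<le> C * nrm V (x \<ominus>\<^sub>V s)"
    using C(2)[of "x \<ominus>\<^sub>V s"] x s by (simp add: bl_sub[OF V W f])
   also have "\<dots> < e" using s C(1) by (simp add: field_simps)
   finally show ?thesis using s by blast
  qed
  then show ?thesis using S bl_closed[OF f x] unfolding closed_subspace_def nclosed_def by blast
 qed
 then show ?thesis using S unfolding closed_subspace_def nclosed_def
  by (auto simp: bl_add[OF f] bl_sm[OF f] bl_zero[OF V W f])
qed

text \<open>The extension is pinned down by one estimate: the distance from \<open>\<Phi> x\<close>
  to \<open>h d\<close> is at most \<open>C\<close> times the distance from \<open>x\<close> to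
  \<open>d\<close>, for every \<open>d\<close> in \<open>D\<close>. Additivity, homogeneity and the
  bound are read off from it without returning to approximating sequences. The constant
  \<open>C\<close> survives unchanged, which later gives explicit norms of induced maps.\<close>

lemma dense_extension:
 assumes V: "seminormed av V" and Z: "banach_space av Z"
  and D: "D \<subseteq> carrier V" "!!x y. x \<in> D ==> y \<in> D ==> x \<oplus>\<^sub>V y \<in> D" "!!a x. x \<in> D ==> a \<odot>\<^sub>V x \<in> D"
  and dense: "!!x e. x |: V ==> 0 < e ==> \<exists>d\<in>D. nrm V (x \<ominus>\<^sub>V d) < e"
  and h: "!!x. x \<in> D ==> h x |: Z" "!!x y. x \<in> D ==> y \<in> D ==> h (x \<oplus>\<^sub>V y) = h x \<oplus>\<^sub>Z h y"
   "!!a x. x \<in> D ==> h (a \<odot>\<^sub>V x) = a \<odot>\<^sub>Z h x"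
  and C: "0 \<le> C" "!!x. x \<in> D ==> nrm Z (h x) \<le> C * nrm V x"
 shows "\<exists>\<Phi>. bl V Z \<Phi> \<and> (\<forall>x\<in>D. \<Phi> x = h x) \<and> (\<forall>x\<in>carrier V. nrm Z (\<Phi> x) \<le> C * nrm V x)"
proof -
 interpret V: seminormed av V by fact
 interpret Z: seminormed av Z using Z V.na by (rule banach_seminormed[rotated])
 have sep: "separated Z" using Z by (rule banach_separated)
 have Zs: "seminormed av Z" by (rule Z.seminormed_axioms)
 have hsub: "h (x \<ominus>\<^sub>V y) = h x \<ominus>\<^sub>Z h y \<and> x \<ominus>\<^sub>V y \<in> D" if "x \<in> D" "y \<in> D" for x y
  using h(2)[OF that(1) D(3)[OF that(2), of "-1"]] h(3)[OF that(2), of "-1"] h(1)[OF that(2)]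
   D(1) D(2)[OF that(1) D(3)[OF that(2), of "-1"]] that
  by (auto simp: V.sm_m1 Z.sm_m1 V.M.minus_eq Z.M.minus_eq subset_eq)
 have ex: "\<exists>z\<in>carrier Z. \<forall>d\<in>D. nrm Z (z \<ominus>\<^sub>Z h d) \<le> C * nrm V (x \<ominus>\<^sub>V d)" if x: "x |: V" for x
 proof -
  have "\<forall>n. \<exists>d. d \<in> D \<and> nrm V (x \<ominus>\<^sub>V d) < 1 / real (Suc n)"
   using dense[OF x, of "1 / real (Suc _)"] by (auto simp: Bex_def)
  then obtain d where d: "!!n. d n \<in> D" "!!n. nrm V (x \<ominus>\<^sub>V d n) < 1 / real (Suc n)" by metis
  have dc: "d n |: V" for n using d D by blast
  have cmp: "nrm Z (h (d n) \<ominus>\<^sub>Z h e) \<le> C * nrm V (d n \<ominus>\<^sub>V e)" if "e \<in> D" for n e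
   using C(2)[of "d n \<ominus>\<^sub>V e"] hsub[OF d(1) that] by simp
  have "\<exists>N. \<forall>m\<ge>N. \<forall>n\<ge>N. nrm Z (h (d m) \<ominus>\<^sub>Z h (d n)) < e" if e: "0 < e" for e
  proof -
   obtain N where "(C + 1) / e < real N" using reals_Archimedean2 by blast
   then have "C + 1 < e * real N" using e by (simp add: field_simps)
   also have "\<dots> \<le> e * real (Suc N)" using e by simp
   finally have N: "(C + 1) / real (Suc N) < e" by (simp add: field_simps)
   have "nrm Z (h (d m) \<ominus>\<^sub>Z h (d n)) < e" if mn: "m \<ge> N" "n \<ge> N" for m n
   proof -
    have "nrm V (d m \<ominus>\<^sub>V d n) \<le> max (nrm V (x \<ominus>\<^sub>V d m)) (nrm V (x \<ominus>\<^sub>V d n))"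
     using V.norm_tri[of "d m" x "d n"] V.norm_sub_comm[of x "d m"] x dc by simp
    also have "\<dots> \<le> 1 / real (Suc N)"
    proof -
     have "1 / real (Suc k) \<le> 1 / real (Suc N)" if "k \<ge> N" for k using that by (intro divide_left_mono) auto
     from this[OF mn(1)] this[OF mn(2)] show ?thesis using d(2)[of m] d(2)[of n] by simp
    qed
    finally have "C * nrm V (d m \<ominus>\<^sub>V d n) \<le> C * (1 / real (Suc N))" using C(1) by (rule mult_left_mono)
    also have "\<dots> \<le> (C + 1) / real (Suc N)" by (simp add: divide_simps)
    finally show ?thesis using cmp[OF d(1), of m n] N by simp
   qed
   then show ?thesis by blast
  qed
  then have "\<exists>z\<in>carrier Z. (%n. nrm Z (h (d n) \<ominus>\<^sub>Z z)) \<longlonglongrightarrow> 0"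
   by (intro banach_complete[OF Z]) (simp_all add: h(1)[OF d(1)])
  then obtain z where z: "z |: Z" "(%n. nrm Z (h (d n) \<ominus>\<^sub>Z z)) \<longlonglongrightarrow> 0" by blast
  have "nrm Z (z \<ominus>\<^sub>Z h e) \<le> C * nrm V (x \<ominus>\<^sub>V e)" if e: "e \<in> D" for e
  proof (rule LIMSEQ_le_const)
   have ec: "e |: V" using D e by blast
   have "(%n. 1 / real (Suc n)) \<longlonglongrightarrow> 0" using LIMSEQ_inverse_real_of_nat by (simp add: inverse_eq_divide)
   then have "(%n. max (nrm Z (h (d n) \<ominus>\<^sub>Z z)) (C * max (nrm V (x \<ominus>\<^sub>V e)) (1 / real (Suc n))))
     \<longlonglongrightarrow> max 0 (C * max (nrm V (x \<ominus>\<^sub>V e)) 0)" by (intro tendsto_intros z)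
   then show "(%n. max (nrm Z (h (d n) \<ominus>\<^sub>Z z)) (C * max (nrm V (x \<ominus>\<^sub>V e)) (1 / real (Suc n))))
     \<longlonglongrightarrow> C * nrm V (x \<ominus>\<^sub>V e)" using ec x C(1) by (simp add: max_absorb1 max_absorb2)
   have "nrm Z (z \<ominus>\<^sub>Z h e) \<le> max (nrm Z (h (d n) \<ominus>\<^sub>Z z)) (C * max (nrm V (x \<ominus>\<^sub>V e)) (1 / real (Suc n)))" for n
   proof -
    have "nrm V (d n \<ominus>\<^sub>V e) \<le> max (nrm V (x \<ominus>\<^sub>V d n)) (nrm V (x \<ominus>\<^sub>V e))"
     using V.norm_tri[OF dc x ec, of n] V.norm_sub_comm[OF x dc, of n] by simp
    then have "nrm V (d n \<ominus>\<^sub>V e) \<le> max (nrm V (x \<ominus>\<^sub>V e)) (1 / real (Suc n))" using d(2)[of n] by linarith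
    then have "C * nrm V (d n \<ominus>\<^sub>V e) \<le> C * max (nrm V (x \<ominus>\<^sub>V e)) (1 / real (Suc n))"
     using C(1) by (rule mult_left_mono)
    then have *: "nrm Z (h (d n) \<ominus>\<^sub>Z h e) \<le> C * max (nrm V (x \<ominus>\<^sub>V e)) (1 / real (Suc n))"
     using cmp[OF e, of n] by linarith
    have "nrm Z (z \<ominus>\<^sub>Z h e) \<le> max (nrm Z (h (d n) \<ominus>\<^sub>Z z)) (nrm Z (h (d n) \<ominus>\<^sub>Z h e))"
     using Z.norm_tri[of z "h (d n)" "h e"] Z.norm_sub_comm[of z "h (d n)"] z(1) h(1)[OF d(1)] h(1)[OF e]
     by simp
    then show ?thesis using * by (rule order.trans[OF _ max.mono[OF order_refl]])
   qed
   then show "\<exists>N. \<forall>n\<ge>N. nrm Z (z \<ominus>\<^sub>Z h e) \<le> max (nrm Z (h (d n) \<ominus>\<^sub>Z z)) (C * max (nrm V (x \<ominus>\<^sub>V e)) (1 / real (Suc n)))"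
    by blast
  qed
  then show ?thesis using z by blast
 qed
 then obtain \<Phi> where \<Phi>: "!!x. x |: V ==> \<Phi> x |: Z"
  "!!x d. x |: V ==> d \<in> D ==> nrm Z (\<Phi> x \<ominus>\<^sub>Z h d) \<le> C * nrm V (x \<ominus>\<^sub>V d)" by metis
 \<comment> \<open>A vector \<open>z\<close> is the value at \<open>x\<close> as soon as the pair of
   them is approximated by pairs of \<open>d\<close> and \<open>h d\<close> with errors
   \<open>e\<close> and \<open>C * e\<close>. Dividing by \<open>C + 1\<close> below allows for
   \<open>C\<close> being zero.\<close>
 have uniq: "z = \<Phi> x" if x: "x |: V" and z: "z |: Z"
  and ap: "!!e. 0 < e ==> \<exists>d\<in>D. nrm V (x \<ominus>\<^sub>V d) \<le> e \<and> nrm Z (z \<ominus>\<^sub>Z h d) \<le> C * e" for x z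
 proof (rule separated_eqI[OF Zs sep z \<Phi>(1)[OF x]])
  fix e :: real assume e: "0 < e"
  have "0 < e / (C + 1)" using e C(1) by simp
  then obtain d where d: "d \<in> D" "nrm V (x \<ominus>\<^sub>V d) \<le> e / (C + 1)" "nrm Z (z \<ominus>\<^sub>Z h d) \<le> C * (e / (C + 1))"
   using ap by blast
  have "nrm Z (z \<ominus>\<^sub>Z \<Phi> x) \<le> max (nrm Z (z \<ominus>\<^sub>Z h d)) (nrm Z (\<Phi> x \<ominus>\<^sub>Z h d))"
   using Z.norm_tri[of z "h d" "\<Phi> x"] Z.norm_sub_comm[of "h d" "\<Phi> x"] z \<Phi>(1) x h(1) d(1) by simp
  also have "\<dots> \<le> C * (e / (C + 1))" using d \<Phi>(2)[OF x d(1)] mult_left_mono[OF d(2) C(1)] by simp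
  also have "\<dots> \<le> e" using C(1) e by (simp add: field_simps)
  finally show "nrm Z (z \<ominus>\<^sub>Z \<Phi> x) \<le> e" .
 qed
 have ap: "\<exists>d\<in>D. nrm V (x \<ominus>\<^sub>V d) \<le> e \<and> nrm Z (\<Phi> x \<ominus>\<^sub>Z h d) \<le> C * e" if x: "x |: V" "0 < e" for x e
 proof -
  obtain d where d: "d \<in> D" "nrm V (x \<ominus>\<^sub>V d) < e" using dense[OF x] by blast
  then show ?thesis using \<Phi>(2)[OF x(1) d(1)] mult_left_mono[OF _ C(1), of "nrm V (x \<ominus>\<^sub>V d)" e] by force
 qed
 have ext: "\<Phi> x = h x" if x: "x \<in> D" for x
 proof -
  have "h x = \<Phi> x"
  proof (rule uniq)
   show xc: "x |: V" using x D(1) by blast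
   show "\<exists>d\<in>D. nrm V (x \<ominus>\<^sub>V d) \<le> e \<and> nrm Z (h x \<ominus>\<^sub>Z h d) \<le> C * e" if "0 < e" for e
    using x xc h(1)[OF x] C(1) that by (intro bexI[of _ x]) simp_all
  qed (rule h(1)[OF x])
  then show ?thesis by simp
 qed
 have add: "\<Phi> (x \<oplus>\<^sub>V y) = \<Phi> x \<oplus>\<^sub>Z \<Phi> y" if xy: "x |: V" "y |: V" for x y
 proof -
  have "\<Phi> x \<oplus>\<^sub>Z \<Phi> y = \<Phi> (x \<oplus>\<^sub>V y)"
  proof (rule uniq)
   fix e :: real assume e: "0 < e"
   obtain d d' where d: "d \<in> D" "nrm V (x \<ominus>\<^sub>V d) \<le> e" "nrm Z (\<Phi> x \<ominus>\<^sub>Z h d) \<le> C * e"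
    "d' \<in> D" "nrm V (y \<ominus>\<^sub>V d') \<le> e" "nrm Z (\<Phi> y \<ominus>\<^sub>Z h d') \<le> C * e"
    using ap[OF xy(1) e] ap[OF xy(2) e] by blast
   have dc: "d |: V" "d' |: V" using d D by auto
   show "\<exists>d\<in>D. nrm V (x \<oplus>\<^sub>V y \<ominus>\<^sub>V d) \<le> e \<and> nrm Z (\<Phi> x \<oplus>\<^sub>Z \<Phi> y \<ominus>\<^sub>Z h d) \<le> C * e"
   proof (rule bexI[of _ "d \<oplus>\<^sub>V d'"], intro conjI)
    show "nrm V (x \<oplus>\<^sub>V y \<ominus>\<^sub>V (d \<oplus>\<^sub>V d')) \<le> e"
     unfolding V.add_sub_add[OF xy dc] using d xy dc by (intro V.norm_add_le) auto
    show "nrm Z (\<Phi> x \<oplus>\<^sub>Z \<Phi> y \<ominus>\<^sub>Z h (d \<oplus>\<^sub>V d')) \<le> C * e"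
     unfolding h(2)[OF d(1,4)] Z.add_sub_add[OF \<Phi>(1)[OF xy(1)] \<Phi>(1)[OF xy(2)] h(1)[OF d(1)] h(1)[OF d(4)]]
     using d xy \<Phi>(1) h(1) by (intro Z.norm_add_le) auto
   qed (rule D(2)[OF d(1,4)])
  qed (use xy \<Phi>(1) in auto)
  then show ?thesis by simp
 qed
 have sm: "\<Phi> (a \<odot>\<^sub>V x) = a \<odot>\<^sub>Z \<Phi> x" if x: "x |: V" for a x
 proof -
  have "a \<odot>\<^sub>Z \<Phi> x = \<Phi> (a \<odot>\<^sub>V x)"
  proof (rule uniq)
   fix e :: real assume e: "0 < e"
   have "0 < e / (av a + 1)" using e V.av_nonneg[of a] by (simp add: add_nonneg_pos)
   then obtain d where d: "d \<in> D" "nrm V (x \<ominus>\<^sub>V d) \<le> e / (av a + 1)" "nrm Z (\<Phi> x \<ominus>\<^sub>Z h d) \<le> C * (e / (av a + 1))"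
    using ap[OF x] by blast
   have "0 < av a + 1" using V.av_nonneg[of a] by linarith
   then have q: "av a * (e / (av a + 1)) \<le> e" using e by (simp add: field_simps)
   have dc: "d |: V" using d D by auto
   have "nrm V (a \<odot>\<^sub>V x \<ominus>\<^sub>V a \<odot>\<^sub>V d) \<le> e"
    using mult_left_mono[OF d(2), of "av a"] q x dc by (simp add: V.sm_sub[symmetric] V.norm_smult)
   moreover have "nrm Z (a \<odot>\<^sub>Z \<Phi> x \<ominus>\<^sub>Z h (a \<odot>\<^sub>V d)) \<le> C * e"
    using mult_left_mono[OF d(3), of "av a"] mult_left_mono[OF q C(1)] x \<Phi>(1) h(1) d(1)
    by (simp add: Z.sm_sub[symmetric] Z.norm_smult h(3) mult_ac)
   ultimately show "\<exists>d\<in>D. nrm V (a \<odot>\<^sub>V x \<ominus>\<^sub>V d) \<le> e \<and> nrm Z (a \<odot>\<^sub>Z \<Phi> x \<ominus>\<^sub>Z h d) \<le> C * e"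
    using D(3)[OF d(1), of a] by (intro bexI[of _ "a \<odot>\<^sub>V d"]) auto
  qed (use x \<Phi>(1) in auto)
  then show ?thesis by simp
 qed
 \<comment> \<open>The defining estimate at zero, which lies in \<open>D\<close> as the zero
   multiple of any of its elements.\<close>
 have bd: "nrm Z (\<Phi> x) \<le> C * nrm V x" if x: "x |: V" for x
 proof -
  obtain d0 where d0: "d0 \<in> D" using dense[OF x zero_less_one] by blast
  then have "d0 |: V" using D(1) by blast
  then have 0: "\<zero>\<^sub>V \<in> D" using D(3)[OF d0, of 0] by simp
  have "h \<zero>\<^sub>V = \<zero>\<^sub>Z" using h(3)[OF 0, of 0] h(1)[OF 0] by simp
  then show ?thesis using \<Phi>(2)[OF x 0] \<Phi>(1)[OF x] x by simp
 qed
 have "bl V Z \<Phi>" by (rule blI[OF \<Phi>(1) add sm bd])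
 then show ?thesis using ext bd by (intro exI[of _ \<Phi>]) auto
qed

section \<open>Presented Banach spaces and tensor products\<close>

lemma lookup_pscale [simp]: "lookup (pscale c a) g = c * lookup a g"
 by (simp add: pscale_def Poly_Mapping.map.rep_eq when_def)

lemma keys_subset_iff: "keys a \<subseteq> G \<longleftrightarrow> (\<forall>g. g \<notin> G \<longrightarrow> lookup a g = 0)" by (auto simp: in_keys_iff)

lemma pscale_simps [simp]:
 "pscale c 0 = 0" "pscale 0 a = 0" "pscale 1 a = a" "pscale c (pscale d a) = pscale (c * d) a"
 "pscale (-1) a = - a" "pscale c (single g d) = single g (c * d)"
 by (rule poly_mapping_eqI; simp add: lookup_single when_def)+

lemma pscale_add: "pscale c (a + b) = pscale c a + pscale c b"
 and pscale_diff: "pscale c (a - b) = pscale c a - pscale c b"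
 and pscale_add_left: "pscale (c + d) a = pscale c a + pscale d a"
 by (rule poly_mapping_eqI; simp add: lookup_add lookup_minus algebra_simps)+

lemma pscale_sum: "pscale c (sum f A) = (\<Sum>x\<in>A. pscale c (f x))"
 by (induction A rule: infinite_finite_induct) (simp_all add: pscale_add)

lemma kspan_base: "t \<in> R ==> t \<in> kspan R"
 unfolding kspan_def by (auto intro!: exI[of _ "%_. 1"] exI[of _ "{t}"])

lemma kspan_0: "0 \<in> kspan R" unfolding kspan_def by (auto intro!: exI[of _ "{}"])

lemma kspan_pscale: "t \<in> kspan R ==> pscale c t \<in> kspan R"
proof -
 assume "t \<in> kspan R"
 then obtain d T where "t = (\<Sum>t\<in>T. pscale (d t) t)" "finite T" "T \<subseteq> R" unfolding kspan_def by auto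
 then show ?thesis unfolding kspan_def by (auto intro!: exI[of _ "%t. c * d t"] exI[of _ T] simp: pscale_sum)
qed

lemma kspan_add:
 assumes "s \<in> kspan R" "t \<in> kspan R"
 shows "s + t \<in> kspan R"
proof -
 obtain c S where S: "s = (\<Sum>t\<in>S. pscale (c t) t)" "finite S" "S \<subseteq> R"
  using assms(1) unfolding kspan_def by auto
 obtain d T where T: "t = (\<Sum>t\<in>T. pscale (d t) t)" "finite T" "T \<subseteq> R"
  using assms(2) unfolding kspan_def by auto
 let ?e = "%t. (if t \<in> S then c t else 0) + (if t \<in> T then d t else 0)"
 have "s = (\<Sum>t\<in>S \<union> T. pscale (if t \<in> S then c t else 0) t)"
  unfolding S(1) using S T by (intro sum.mono_neutral_cong_left) auto
 moreover have "t = (\<Sum>t\<in>S \<union> T. pscale (if t \<in> T then d t else 0) t)"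
  unfolding T(1) using S T by (intro sum.mono_neutral_cong_left) auto
 ultimately have "s + t = (\<Sum>t\<in>S \<union> T. pscale (?e t) t)" by (simp add: pscale_add_left sum.distrib)
 then show ?thesis unfolding kspan_def using S T by (auto intro!: exI[of _ ?e] exI[of _ "S \<union> T"])
qed

lemma kspan_induct [consumes 1, case_names zero step]:
 assumes "t \<in> kspan R" "P 0" "!!a c t. P a ==> t \<in> R ==> P (pscale c t + a)"
 shows "P t"
proof -
 obtain c T where T: "t = (\<Sum>t\<in>T. pscale (c t) t)" "finite T" "T \<subseteq> R"
  using assms(1) unfolding kspan_def by auto
 have "P (\<Sum>t\<in>T. pscale (c t) t)" using T(2,3) by (induction T rule: finite_induct) (auto intro: assms(2,3))
 then show ?thesis using T by simp
qed

locale pres = nonarch av for av :: "'k::field_char_0 => real" +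
 fixes G :: "'g set" and w :: "'g => real" and R :: "('g \<Rightarrow>\<^sub>0 'k) set"
 assumes w_nonneg: "g \<in> G ==> 0 \<le> w g" and R_keys: "t \<in> R ==> keys t \<subseteq> G"
begin

definition FG :: "('g \<Rightarrow>\<^sub>0 'k) set" where "FG = {a. keys a \<subseteq> G}"
abbreviation "sn \<equiv> pres_seminorm av G w R"
abbreviation "cl \<equiv> pres_class av G w R"
abbreviation "Cau \<equiv> pres_cauchy av G w R"
abbreviation "P \<equiv> presented av G w R"

lemma FG_simps [simp, intro]: "0 \<in> FG" "a \<in> FG ==> b \<in> FG ==> a + b \<in> FG" "a \<in> FG ==> b \<in> FG ==> a - b \<in> FG"
 "a \<in> FG ==> - a \<in> FG" "a \<in> FG ==> pscale c a \<in> FG" "g \<in> G ==> single g c \<in> FG"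
 by (auto simp: FG_def keys_subset_iff lookup_add lookup_minus lookup_single when_def)

lemma kspan_FG: "t \<in> kspan R ==> t \<in> FG"
proof (induction rule: kspan_induct)
 case (step a c t)
 then have "t \<in> FG" using R_keys by (simp add: FG_def)
 then show ?case using step by simp
qed simp

lemma wmax_nonneg [simp]: "0 \<le> wmax av w a" unfolding wmax_def by (rule Max_ge) auto

lemma wmax_ge: "av (lookup a g) * w g \<le> wmax av w a"
proof (cases "g \<in> keys a")
 case True
 then show ?thesis unfolding wmax_def by (intro Max_ge) auto
next
 case False
 then show ?thesis by (simp add: in_keys_iff)
qed

lemma wmax_le: "0 \<le> B ==> (!!g. g \<in> keys a ==> av (lookup a g) * w g \<le> B) ==> wmax av w a \<le> B"
 unfolding wmax_def by (rule Max.boundedI) auto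

lemma wmax_add:
 assumes "a \<in> FG" "b \<in> FG"
 shows "wmax av w (a + b) \<le> max (wmax av w a) (wmax av w b)"
proof (rule wmax_le)
 fix g assume "g \<in> keys (a + b)"
 then have g: "0 \<le> w g" using assms FG_simps(2)[of a b] w_nonneg by (auto simp: FG_def)
 have "av (lookup (a + b) g) * w g \<le> max (av (lookup a g)) (av (lookup b g)) * w g"
  using g by (intro mult_right_mono) (auto simp: lookup_add av_add)
 also have "\<dots> \<le> max (wmax av w a) (wmax av w b)" using wmax_ge[of a g] wmax_ge[of b g] by (auto simp: max_def)
 finally show "av (lookup (a + b) g) * w g \<le> max (wmax av w a) (wmax av w b)" .
qed (simp add: le_max_iff_disj)

lemma wmax_pscale: "wmax av w (pscale c a) \<le> av c * wmax av w a"
 by (rule wmax_le) (auto simp: av_mult mult.assoc intro!: mult_left_mono wmax_ge)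

lemma sn_le: "b \<in> FG ==> a - b \<in> kspan R ==> sn a \<le> wmax av w b" unfolding pres_seminorm_def
 by (rule cInf_lower) (auto simp: FG_def intro!: bdd_belowI[of _ 0])

lemma sn_le_wmax: "a \<in> FG ==> sn a \<le> wmax av w a" by (rule sn_le) (auto simp: kspan_0)

lemma sn_ge:
 assumes "a \<in> FG" "!!b. b \<in> FG ==> a - b \<in> kspan R ==> B \<le> wmax av w b"
 shows "B \<le> sn a" unfolding pres_seminorm_def
proof (rule cInf_greatest)
 show "{wmax av w b |b. keys b \<subseteq> G \<and> a - b \<in> kspan R} \<noteq> {}"
  using assms(1) kspan_0[of R] by (auto simp: FG_def intro!: exI[of _ a])
qed (use assms(2) in \<open>auto simp: FG_def\<close>)

lemma sn_nonneg [simp]: "a \<in> FG ==> 0 \<le> sn a" by (rule sn_ge) auto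

lemma sn_lessE:
 assumes "a \<in> FG" "sn a < e"
 obtains b where "b \<in> FG" "a - b \<in> kspan R" "wmax av w b < e"
proof -
 have "\<not> (\<forall>b. b \<in> FG \<longrightarrow> a - b \<in> kspan R \<longrightarrow> e \<le> wmax av w b)" using sn_ge[OF assms(1), of e] assms(2) by auto
 then show ?thesis using that by auto
qed

lemma sn_kspan: "t \<in> kspan R ==> sn t = 0"
proof -
 assume t: "t \<in> kspan R"
 have "sn t \<le> wmax av w 0" by (rule sn_le) (use t in auto)
 also have "\<dots> = 0" by (simp add: wmax_def)
 finally show ?thesis using sn_nonneg[OF kspan_FG[OF t]] by simp
qed

lemma sn_add:
 assumes "a \<in> FG" "b \<in> FG"
 shows "sn (a + b) \<le> max (sn a) (sn b)"
proof (rule field_le_epsilon)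
 fix e :: real assume e: "0 < e"
 have "sn a < max (sn a) (sn b) + e" "sn b < max (sn a) (sn b) + e" using e by (simp_all add: max_def)
 then obtain a' b' where a': "a' \<in> FG" "a - a' \<in> kspan R" "wmax av w a' < max (sn a) (sn b) + e"
  and b': "b' \<in> FG" "b - b' \<in> kspan R" "wmax av w b' < max (sn a) (sn b) + e"
  using sn_lessE[OF assms(1)] sn_lessE[OF assms(2)] by metis
 have "sn (a + b) \<le> wmax av w (a' + b')"
  using a' b' kspan_add[OF a'(2) b'(2)] by (intro sn_le) (auto simp: algebra_simps)
 also have "\<dots> \<le> max (sn a) (sn b) + e" using wmax_add[OF a'(1) b'(1)] a' b' by simp
 finally show "sn (a + b) \<le> max (sn a) (sn b) + e" .
qed

lemma sn_pscale_le:
 assumes "a \<in> FG"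
 shows "sn (pscale c a) \<le> av c * sn a"
proof (cases "c = 0")
 case True
 then show ?thesis using sn_kspan[OF kspan_0] by simp
next
 case False
 then have c: "0 < av c" using av_nonneg[of c] av_eq_0[of c] by linarith
 have "sn (pscale c a) / av c \<le> sn a"
 proof (rule sn_ge[OF assms])
  fix b assume b: "b \<in> FG" "a - b \<in> kspan R"
  have "sn (pscale c a) \<le> wmax av w (pscale c b)"
   using b kspan_pscale[OF b(2), of c] by (intro sn_le) (auto simp: pscale_diff)
  also have "\<dots> \<le> av c * wmax av w b" by (rule wmax_pscale)
  finally show "sn (pscale c a) / av c \<le> wmax av w b" using c by (simp add: field_simps)
 qed
 then show ?thesis using c by (simp add: field_simps)
qed

text \<open>The missing inequality is \<open>sn_pscale_le\<close> for the inverse scalar. The norms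
  of coproducts, quotients and weighted sequence spaces are handled in the same way.\<close>

lemma sn_pscale:
 assumes a: "a \<in> FG"
 shows "sn (pscale c a) = av c * sn a"
proof (rule antisym[OF sn_pscale_le[OF a]])
 show "av c * sn a \<le> sn (pscale c a)"
 proof (cases "c = 0")
  case False
  have "av c * sn a = av c * sn (pscale (1 / c) (pscale c a))" using False by simp
  also have "\<dots> \<le> av c * (av (1 / c) * sn (pscale c a))" using a by (intro mult_left_mono sn_pscale_le) auto
  also have "\<dots> = av (c * (1 / c)) * sn (pscale c a)" by (simp only: av_mult mult.assoc)
  finally show ?thesis using False by simp
 qed (use a in simp)
qed

lemma sn_minus: "a \<in> FG ==> sn (- a) = sn a" using sn_pscale[of a "-1"] by simp

lemma sn_diff_comm: "a \<in> FG ==> b \<in> FG ==> sn (a - b) = sn (b - a)" using sn_minus[of "a - b"] by simp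

lemma sn_tri: "a \<in> FG ==> b \<in> FG ==> c \<in> FG ==> sn (a - c) \<le> max (sn (a - b)) (sn (b - c))"
 using sn_add[of "a - b" "b - c"] by simp

lemma sn_single: "g \<in> G ==> sn (single g 1) \<le> w g"
proof -
 assume g: "g \<in> G"
 have "wmax av w (single g 1) \<le> w g"
  using w_nonneg[OF g] by (intro wmax_le) (auto simp: lookup_single when_def split: if_splits)
 then show ?thesis using sn_le_wmax[OF FG_simps(6)[OF g, of 1]] by simp
qed

lemma CauD: "X \<in> Cau ==> X n \<in> FG" "X \<in> Cau ==> 0 < e ==> \<exists>N. \<forall>m\<ge>N. \<forall>n\<ge>N. sn (X m - X n) < e"
 by (auto simp: pres_cauchy_def FG_def)

lemma CauI: "(!!n. X n \<in> FG) ==> (!!e. 0 < e ==> \<exists>N. \<forall>m\<ge>N. \<forall>n\<ge>N. sn (X m - X n) < e) ==> X \<in> Cau"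
 by (auto simp: pres_cauchy_def FG_def)

lemma Cau_const: "a \<in> FG ==> (%_. a) \<in> Cau" by (rule CauI) (auto simp: sn_kspan[OF kspan_0])

lemma Cau_add:
 assumes "X \<in> Cau" "Y \<in> Cau"
 shows "(%n. X n + Y n) \<in> Cau"
proof (rule CauI)
 fix e :: real assume e: "0 < e"
 obtain N where N: "\<forall>m\<ge>N. \<forall>n\<ge>N. sn (X m - X n) < e" using CauD(2)[OF assms(1) e] ..
 obtain M where M: "\<forall>m\<ge>M. \<forall>n\<ge>M. sn (Y m - Y n) < e" using CauD(2)[OF assms(2) e] ..
 have "sn (X m + Y m - (X n + Y n)) < e" if "m \<ge> max M N" "n \<ge> max M N" for m n
 proof -
  have "sn ((X m - X n) + (Y m - Y n)) \<le> max (sn (X m - X n)) (sn (Y m - Y n))"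
   by (intro sn_add) (auto simp: CauD(1)[OF assms(1)] CauD(1)[OF assms(2)])
  also have "\<dots> < e" using that N M by simp
  finally show ?thesis by (simp add: algebra_simps)
 qed
 then show "\<exists>N. \<forall>m\<ge>N. \<forall>n\<ge>N. sn (X m + Y m - (X n + Y n)) < e" by (intro exI[of _ "max M N"]) simp
qed (auto simp: CauD(1)[OF assms(1)] CauD(1)[OF assms(2)])

lemma Cau_pscale:
 assumes "X \<in> Cau"
 shows "(%n. pscale c (X n)) \<in> Cau"
proof (rule CauI)
 fix e :: real assume e: "0 < e"
 have c: "0 < av c + 1" using av_nonneg[of c] by linarith
 then have "0 < e / (av c + 1)" using e by simp
 then obtain N where N: "\<forall>m\<ge>N. \<forall>n\<ge>N. sn (X m - X n) < e / (av c + 1)" using CauD(2)[OF assms] by blast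
 have "sn (pscale c (X m) - pscale c (X n)) < e" if mn: "m \<ge> N" "n \<ge> N" for m n
 proof -
  have d: "X m - X n \<in> FG" by (auto simp: CauD(1)[OF assms])
  have "sn (pscale c (X m) - pscale c (X n)) = av c * sn (X m - X n)"
   using sn_pscale[OF d, of c] by (simp add: pscale_diff)
  also have "\<dots> \<le> (av c + 1) * sn (X m - X n)" using sn_nonneg[OF d] by (intro mult_right_mono) auto
  also have "\<dots> < (av c + 1) * (e / (av c + 1))" using N mn c by (intro mult_strict_left_mono) auto
  also have "\<dots> = e" using c by simp
  finally show ?thesis .
 qed
 then show "\<exists>N. \<forall>m\<ge>N. \<forall>n\<ge>N. sn (pscale c (X m) - pscale c (X n)) < e" by (intro exI[of _ N]) simp
qed (auto simp: CauD(1)[OF assms])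

lemma Cau_diff: "X \<in> Cau ==> Y \<in> Cau ==> (%n. X n - Y n) \<in> Cau"
 using Cau_add[OF _ Cau_pscale[of Y "-1"], of X] by simp

lemma sn_abs_diff:
 assumes "a \<in> FG" "b \<in> FG"
 shows "\<bar>sn a - sn b\<bar> \<le> sn (a - b)"
proof -
 have "sn a \<le> max (sn (a - b)) (sn b)" using sn_add[of "a - b" b] assms by simp
 moreover have "sn b \<le> max (sn (a - b)) (sn a)" using sn_add[of "b - a" a] sn_diff_comm[OF assms] assms by simp
 moreover have "0 \<le> sn a" "0 \<le> sn b" "0 \<le> sn (a - b)" using assms by simp_all
 ultimately show ?thesis by linarith
qed

lemma sn_convergent:
 assumes "X \<in> Cau"
 shows "(%n. sn (X n)) \<longlonglongrightarrow> lim (%n. sn (X n))"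
proof -
 have "Cauchy (%n. sn (X n))"
 proof (rule metric_CauchyI)
  fix e :: real assume "0 < e"
  then obtain N where N: "\<forall>m\<ge>N. \<forall>n\<ge>N. sn (X m - X n) < e" using CauD(2)[OF assms] by blast
  have "dist (sn (X m)) (sn (X n)) < e" if "m \<ge> N" "n \<ge> N" for m n
  proof -
   have "dist (sn (X m)) (sn (X n)) \<le> sn (X m - X n)"
    unfolding dist_real_def by (rule sn_abs_diff[OF CauD(1)[OF assms] CauD(1)[OF assms]])
   also have "\<dots> < e" using N that by simp
   finally show ?thesis .
  qed
  then show "\<exists>M. \<forall>m\<ge>M. \<forall>n\<ge>M. dist (sn (X m)) (sn (X n)) < e" by (intro exI[of _ N]) simp
 qed
 then show ?thesis using Cauchy_convergent convergent_LIMSEQ_iff by blast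
qed

lemma null_trans:
 assumes "!!n. X n \<in> FG" "!!n. Y n \<in> FG" "!!n. Z n \<in> FG" "(%n. sn (X n - Y n)) \<longlonglongrightarrow> 0" "(%n. sn (Y n - Z n)) \<longlonglongrightarrow> 0"
 shows "(%n. sn (X n - Z n)) \<longlonglongrightarrow> 0"
proof (rule tendsto_sandwich[of "%_. 0" _ _ "%n. max (sn (X n - Y n)) (sn (Y n - Z n))"])
 show "(%n. max (sn (X n - Y n)) (sn (Y n - Z n))) \<longlonglongrightarrow> 0" using tendsto_max[OF assms(4,5)] by simp
qed (auto intro!: always_eventually simp: assms(1-3) sn_tri)

lemma cl_eq:
 assumes "X \<in> Cau" "Y \<in> Cau"
 shows "cl X = cl Y \<longleftrightarrow> (%n. sn (X n - Y n)) \<longlonglongrightarrow> 0"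
proof -
 note F = CauD(1)[OF assms(1)] CauD(1)[OF assms(2)]
 have self: "X \<in> cl X" using assms sn_kspan[OF kspan_0] by (simp add: pres_class_def)
 have sym: "(%n. sn (A n - B n)) = (%n. sn (B n - A n))" if "!!n. A n \<in> FG" "!!n. B n \<in> FG" for A B
  using that by (simp add: sn_diff_comm)
 have sub: "cl A \<subseteq> cl B" if A: "A \<in> Cau" "B \<in> Cau" "(%n. sn (A n - B n)) \<longlonglongrightarrow> 0" for A B
 proof
  fix C assume "C \<in> cl A"
  then have C: "C \<in> Cau" "(%n. sn (C n - A n)) \<longlonglongrightarrow> 0" by (auto simp: pres_class_def)
  show "C \<in> cl B"
   using null_trans[of C A B, OF CauD(1)[OF C(1)] CauD(1)[OF A(1)] CauD(1)[OF A(2)] C(2) A(3)] C(1)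
   by (simp add: pres_class_def)
 qed
 show ?thesis
 proof
  assume "cl X = cl Y"
  then have "X \<in> cl Y" using self by simp
  then show "(%n. sn (X n - Y n)) \<longlonglongrightarrow> 0" by (simp add: pres_class_def)
 next
  assume *: "(%n. sn (X n - Y n)) \<longlonglongrightarrow> 0"
  then have "(%n. sn (Y n - X n)) \<longlonglongrightarrow> 0" using sym[of X Y] F by simp
  then show "cl X = cl Y" using sub assms * by blast
 qed
qed

lemma cl_self: "X \<in> Cau ==> X \<in> cl X" using sn_kspan[OF kspan_0] by (simp add: pres_class_def)

lemma P_carrier: "carrier P = cl ` Cau" and P_zero: "\<zero>\<^sub>P = cl (%_. 0)" by (simp_all add: presented_def)

lemma P_cl [simp, intro]: "X \<in> Cau ==> cl X |: P" by (simp add: P_carrier)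

text \<open>The sum of two classes is a union over all representatives. Every pair contributes the
  same class, since the sum of two null sequences is null, and so the union collapses to that
  class.\<close>

lemma P_add:
 assumes "X \<in> Cau" "Y \<in> Cau"
 shows "cl X \<oplus>\<^sub>P cl Y = cl (%n. X n + Y n)"
proof -
 have eq: "cl (%n. X' n + Y' n) = cl (%n. X n + Y n)" if "X' \<in> cl X" "Y' \<in> cl Y" for X' Y'
 proof -
  have X': "X' \<in> Cau" "(%n. sn (X' n - X n)) \<longlonglongrightarrow> 0" using that by (auto simp: pres_class_def)
  have Y': "Y' \<in> Cau" "(%n. sn (Y' n - Y n)) \<longlonglongrightarrow> 0" using that by (auto simp: pres_class_def)
  have "(%n. sn ((X' n + Y' n) - (X n + Y n))) \<longlonglongrightarrow> 0"
  proof (rule tendsto_sandwich[of "%_. 0" _ _ "%n. max (sn (X' n - X n)) (sn (Y' n - Y n))"])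
   show "(%n. max (sn (X' n - X n)) (sn (Y' n - Y n))) \<longlonglongrightarrow> 0" using tendsto_max[OF X'(2) Y'(2)] by simp
   have "sn ((X' n + Y' n) - (X n + Y n)) \<le> max (sn (X' n - X n)) (sn (Y' n - Y n))" for n
    using sn_add[of "X' n - X n" "Y' n - Y n"] CauD(1)[OF assms(1)] CauD(1)[OF assms(2)] CauD(1)[OF X'(1)] CauD(1)[OF Y'(1)]
    by (simp add: algebra_simps)
   then show "\<forall>\<^sub>F n in sequentially. sn ((X' n + Y' n) - (X n + Y n)) \<le> max (sn (X' n - X n)) (sn (Y' n - Y n))"
    by simp
  qed (auto intro!: always_eventually simp: CauD(1)[OF assms(1)] CauD(1)[OF assms(2)] CauD(1)[OF X'(1)] CauD(1)[OF Y'(1)])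
  then show ?thesis using cl_eq[OF Cau_add[OF X'(1) Y'(1)] Cau_add[OF assms]] by simp
 qed
 have "cl X \<oplus>\<^sub>P cl Y = (\<Union>X'\<in>cl X. \<Union>Y'\<in>cl Y. cl (%n. X' n + Y' n))" by (simp add: presented_def)
 also have "\<dots> = (\<Union>X'\<in>cl X. \<Union>Y'\<in>cl Y. cl (%n. X n + Y n))" using eq by (intro SUP_cong refl) auto
 also have "\<dots> = cl (%n. X n + Y n)" using cl_self[OF assms(1)] cl_self[OF assms(2)] by auto
 finally show ?thesis .
qed

lemma P_sm:
 assumes "X \<in> Cau"
 shows "c \<odot>\<^sub>P cl X = cl (%n. pscale c (X n))"
proof -
 have eq: "cl (%n. pscale c (X' n)) = cl (%n. pscale c (X n))" if "X' \<in> cl X" for X'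
 proof -
  have X': "X' \<in> Cau" "(%n. sn (X' n - X n)) \<longlonglongrightarrow> 0" using that by (auto simp: pres_class_def)
  have "sn (pscale c (X' n) - pscale c (X n)) = av c * sn (X' n - X n)" for n
   using sn_pscale[of "X' n - X n" c] CauD(1)[OF assms] CauD(1)[OF X'(1)] by (simp add: pscale_diff)
  then have "(%n. sn (pscale c (X' n) - pscale c (X n))) \<longlonglongrightarrow> 0"
   using tendsto_mult_left[OF X'(2), of "av c"] by simp
  then show ?thesis using cl_eq[OF Cau_pscale[OF X'(1)] Cau_pscale[OF assms]] by simp
 qed
 have "c \<odot>\<^sub>P cl X = (\<Union>X'\<in>cl X. cl (%n. pscale c (X' n)))" by (simp add: presented_def)
 also have "\<dots> = (\<Union>X'\<in>cl X. cl (%n. pscale c (X n)))" using eq by (intro SUP_cong refl) auto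
 also have "\<dots> = cl (%n. pscale c (X n))" using cl_self[OF assms] by auto
 finally show ?thesis .
qed

text \<open>The norm is read off a chosen representative. Representatives differ by a null sequence
  and therefore have the same limit of seminorms, so any of them may be used.\<close>

lemma P_norm:
 assumes "X \<in> Cau"
 shows "(%n. sn (X n)) \<longlonglongrightarrow> nrm P (cl X)"
proof -
 define X' where "X' = (SOME X'. X' \<in> cl X)"
 have "X' \<in> cl X" unfolding X'_def by (rule someI[where P = "%X'. X' \<in> cl X"]) (rule cl_self[OF assms])
 then have X': "X' \<in> Cau" "(%n. sn (X' n - X n)) \<longlonglongrightarrow> 0" by (auto simp: pres_class_def)
 have "(%n. \<bar>sn (X' n) - sn (X n)\<bar>) \<longlonglongrightarrow> 0" by (rule tendsto_sandwich[OF _ _ tendsto_const X'(2)])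
    (simp_all add: sn_abs_diff CauD(1)[OF assms] CauD(1)[OF X'(1)])
 then have "(%n. sn (X' n) - sn (X n)) \<longlonglongrightarrow> 0" by (rule tendsto_rabs_zero_cancel)
 then have "(%n. sn (X' n) - (sn (X' n) - sn (X n))) \<longlonglongrightarrow> lim (%n. sn (X' n)) - 0"
  by (intro tendsto_diff sn_convergent[OF X'(1)])
 then show ?thesis by (simp add: presented_def X'_def)
qed

lemma P_abelian: "abelian_group P"
proof (rule abelian_groupI)
 fix x assume "x |: P"
 then obtain X where X: "X \<in> Cau" "x = cl X" by (auto simp: P_carrier)
 show "\<exists>y\<in>carrier P. y \<oplus>\<^sub>P x = \<zero>\<^sub>P" using X Cau_pscale[OF X(1), of "-1"]
  by (intro bexI[of _ "cl (%n. pscale (-1) (X n))"]) (simp_all add: P_add P_zero)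
qed (auto simp: P_carrier P_zero P_add Cau_const Cau_add add.assoc add.commute add.left_commute)

lemma P_module: "module kring P" by (rule moduleI[OF cring_kring P_abelian])
   (auto simp: P_carrier P_add P_sm Cau_pscale Cau_add pscale_add pscale_add_left intro!: imageI)

lemma P_seminormed: "seminormed av P"
proof (rule seminormed.intro[OF nonarch_axioms P_module], unfold_locales)
 fix x assume "x |: P"
 then obtain X where X: "X \<in> Cau" "x = cl X" by (auto simp: P_carrier)
 show "0 \<le> nrm P x" unfolding X(2) using CauD(1)[OF X(1)]
  by (intro tendsto_lowerbound[OF P_norm[OF X(1)]]) (auto intro!: always_eventually)
 fix a
 have "(%n. sn (pscale a (X n))) \<longlonglongrightarrow> av a * nrm P x"
  using tendsto_mult_left[OF P_norm[OF X(1)], of "av a"] X CauD(1)[OF X(1)] by (simp add: sn_pscale)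
 then show "nrm P (a \<odot>\<^sub>P x) = av a * nrm P x"
  using P_norm[OF Cau_pscale[OF X(1)], of a] X by (simp add: P_sm LIMSEQ_unique)
 fix y assume "y |: P"
 then obtain Y where Y: "Y \<in> Cau" "y = cl Y" by (auto simp: P_carrier)
 show "nrm P (x \<oplus>\<^sub>P y) \<le> max (nrm P x) (nrm P y)"
 proof (rule LIMSEQ_le)
  show "(%n. sn (X n + Y n)) \<longlonglongrightarrow> nrm P (x \<oplus>\<^sub>P y)"
   using P_norm[OF Cau_add[OF X(1) Y(1)]] X Y by (simp add: P_add)
  show "(%n. max (sn (X n)) (sn (Y n))) \<longlonglongrightarrow> max (nrm P x) (nrm P y)"
   using tendsto_max[OF P_norm[OF X(1)] P_norm[OF Y(1)]] X Y by simp
  show "\<exists>N. \<forall>n\<ge>N. sn (X n + Y n) \<le> max (sn (X n)) (sn (Y n))"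
   using CauD(1)[OF X(1)] CauD(1)[OF Y(1)] by (auto intro: sn_add)
 qed
qed

sublocale P: seminormed av P by (rule P_seminormed)

lemma P_sub:
 assumes "X \<in> Cau" "Y \<in> Cau"
 shows "cl X \<ominus>\<^sub>P cl Y = cl (%n. X n - Y n)"
proof -
 have "(cl (%n. X n - Y n)) \<oplus>\<^sub>P cl Y = cl X" using assms by (simp add: P_add Cau_diff)
 then show ?thesis using assms P.sub_eq_iff[of "cl X" "cl Y" "cl (%n. X n - Y n)"] by (simp add: Cau_diff)
qed

lemma P_separated: "separated P" unfolding separated_def
proof (intro ballI impI)
 fix x assume "x |: P" and 0: "nrm P x = 0"
 then obtain X where X: "X \<in> Cau" "x = cl X" by (auto simp: P_carrier)
 then show "x = \<zero>\<^sub>P" using P_norm[OF X(1)] 0 by (simp add: P_zero cl_eq Cau_const)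
qed

definition emb where "emb a = cl (%_::nat. a)"

lemma emb_simps:
 assumes "a \<in> FG"
 shows "emb a |: P" "nrm P (emb a) = sn a" "emb (pscale c a) = c \<odot>\<^sub>P emb a"
  "b \<in> FG ==> emb (a + b) = emb a \<oplus>\<^sub>P emb b" "b \<in> FG ==> emb (a - b) = emb a \<ominus>\<^sub>P emb b"
 using assms P_norm[OF Cau_const[OF assms]]
 by (simp_all add: emb_def Cau_const P_sm P_add P_sub LIMSEQ_const_iff)

lemma emb_approx:
 assumes "X \<in> Cau" "\<forall>m\<ge>N. sn (X m - a) \<le> e" "a \<in> FG"
 shows "nrm P (cl X \<ominus>\<^sub>P emb a) \<le> e"
proof (rule LIMSEQ_le_const2)
 show "(%n. sn (X n - a)) \<longlonglongrightarrow> nrm P (cl X \<ominus>\<^sub>P emb a)"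
  using P_norm[OF Cau_diff[OF assms(1) Cau_const[OF assms(3)]]] assms by (simp add: emb_def P_sub Cau_const)
qed (use assms in blast)

lemma emb_dense:
 assumes "x |: P" "0 < e"
 shows "\<exists>d\<in>emb ` FG. nrm P (x \<ominus>\<^sub>P d) < e"
proof -
 obtain X where X: "X \<in> Cau" "x = cl X" using assms by (auto simp: P_carrier)
 obtain N where N: "\<forall>m\<ge>N. \<forall>n\<ge>N. sn (X m - X n) < e / 2" using CauD(2)[OF X(1), of "e / 2"] assms by auto
 have "nrm P (cl X \<ominus>\<^sub>P emb (X N)) \<le> e / 2"
  using N by (intro emb_approx[of _ N] X CauD(1)[OF X(1)]) (auto intro: less_imp_le)
 then show ?thesis using X CauD(1)[OF X(1)] assms by (intro bexI[of _ "emb (X N)"]) auto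
qed

text \<open>Diagonal argument: the n-th term of a Cauchy sequence of classes is approximated within
  \<open>1 / real (Suc n)\<close> by a constant sequence. The approximating free vectors form a
  Cauchy sequence themselves, and its class is the limit.\<close>

lemma P_banach: "banach_space av P"
proof (rule banach_spaceI[OF P_seminormed])
 show "x = \<zero>\<^sub>P" if "x |: P" "nrm P x = 0" for x using P_separated that by (simp add: separated_def)
 show "normed_complete P" unfolding normed_complete_def
 proof (intro allI impI, elim conjE)
  fix x :: "nat => (nat => 'g \<Rightarrow>\<^sub>0 'k) set"
  assume xc: "\<forall>n. x n |: P" and cau: "\<forall>e>0. \<exists>N. \<forall>m\<ge>N. \<forall>n\<ge>N. nrm P (x m \<ominus>\<^sub>P x n) < e"
  have "\<forall>n. \<exists>a. a \<in> FG \<and> nrm P (x n \<ominus>\<^sub>P emb a) < 1 / real (Suc n)"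
  proof
   fix n
   show "\<exists>a. a \<in> FG \<and> nrm P (x n \<ominus>\<^sub>P emb a) < 1 / real (Suc n)"
    using emb_dense[of "x n" "1 / real (Suc n)"] xc by auto
  qed
  then obtain a where a: "!!n. a n \<in> FG" "!!n. nrm P (x n \<ominus>\<^sub>P emb (a n)) < 1 / real (Suc n)" by metis
  have ec: "emb (a n) |: P" for n using emb_simps(1)[OF a(1)] .
  have small: "1 / real (Suc k) < e" if "N \<le> k" "1 / real (Suc N) < e" for N k e
   using that by (meson frac_le le_less_trans of_nat_0_less_iff of_nat_mono Suc_le_mono zero_less_Suc zero_less_one_class.zero_le_one order_refl)
  have aCau: "a \<in> Cau"
  proof (rule CauI[OF a(1)])
   fix e :: real assume e: "0 < e"
   obtain N where N: "\<forall>m\<ge>N. \<forall>n\<ge>N. nrm P (x m \<ominus>\<^sub>P x n) < e" using cau e by blast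
   obtain M where M: "1 / real (Suc M) < e" using nat_approx_posE[OF e] by auto
   have "sn (a m - a n) < e" if mn: "m \<ge> max M N" "n \<ge> max M N" for m n
   proof -
    have "sn (a m - a n) = nrm P (emb (a m) \<ominus>\<^sub>P emb (a n))"
     using emb_simps(2)[of "a m - a n"] a(1) by (simp add: emb_simps)
    also have "\<dots> \<le> max (nrm P (emb (a m) \<ominus>\<^sub>P x m)) (max (nrm P (x m \<ominus>\<^sub>P x n)) (nrm P (x n \<ominus>\<^sub>P emb (a n))))"
     using P.norm_tri[OF ec[of m] xc[rule_format, of m] ec[of n]]
      P.norm_tri[OF xc[rule_format, of m] xc[rule_format, of n] ec[of n]] by linarith
    also have "\<dots> < e"
    proof -
     have "nrm P (emb (a m) \<ominus>\<^sub>P x m) < e"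
      using a(2)[of m] small[OF _ M, of m] mn P.norm_sub_comm[OF ec[of m] xc[rule_format, of m]] by simp
     moreover have "nrm P (x m \<ominus>\<^sub>P x n) < e" using N mn by simp
     moreover have "nrm P (x n \<ominus>\<^sub>P emb (a n)) < e" using a(2)[of n] small[OF _ M, of n] mn by simp
     ultimately show ?thesis by simp
    qed
    finally show ?thesis .
   qed
   then show "\<exists>N. \<forall>m\<ge>N. \<forall>n\<ge>N. sn (a m - a n) < e" by (intro exI[of _ "max M N"]) simp
  qed
  have "(%n. nrm P (x n \<ominus>\<^sub>P cl a)) \<longlonglongrightarrow> 0"
  proof (rule LIMSEQ_I)
   fix e :: real assume e: "0 < e"
   obtain N where N: "\<forall>m\<ge>N. \<forall>n\<ge>N. sn (a m - a n) < e / 2" using CauD(2)[OF aCau, of "e / 2"] e by auto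
   obtain M where M: "1 / real (Suc M) < e" using nat_approx_posE[OF e] by auto
   have "nrm P (x n \<ominus>\<^sub>P cl a) < e" if n: "n \<ge> max M N" for n
   proof -
    have "nrm P (cl a \<ominus>\<^sub>P emb (a n)) \<le> e / 2"
     using N n by (intro emb_approx[OF aCau, of N] a(1)) (auto intro: less_imp_le)
    moreover have "nrm P (x n \<ominus>\<^sub>P emb (a n)) < e" using a(2)[of n] small[OF _ M, of n] n by simp
    ultimately show ?thesis
     using P.norm_tri[of "x n" "emb (a n)" "cl a"] P.norm_sub_comm[of "cl a" "emb (a n)"] xc ec aCau e by simp
   qed
   then show "\<exists>no. \<forall>n\<ge>no. norm (nrm P (x n \<ominus>\<^sub>P cl a) - 0) < e"
    using xc aCau by (intro exI[of _ "max M N"]) simp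
  qed
  then show "\<exists>l\<in>carrier P. (%n. nrm P (x n \<ominus>\<^sub>P l)) \<longlonglongrightarrow> 0" using aCau by blast
 qed
qed

lemma pres_gen_emb: "pres_gen av G w R g = emb (single g 1)" by (simp add: pres_gen_def emb_def)

lemma emb_in_closed:
 assumes "closed_subspace P S" "!!g. g \<in> G ==> pres_gen av G w R g \<in> S" "a \<in> FG"
 shows "emb a \<in> S"
proof -
 have "(\<Sum>g\<in>F. single g (c g)) \<in> FG \<and> emb (\<Sum>g\<in>F. single g (c g)) \<in> S"
  if "finite F" "F \<subseteq> G" for F and c :: "'g => 'k" using that
 proof (induction F rule: finite_induct)
  case empty
  then show ?case using assms(1) by (simp add: closed_subspace_def P_zero emb_def)
 next
  case (insert k F)
  then have k: "k \<in> G" by simp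
  then have "emb (single k (c k)) = c k \<odot>\<^sub>P pres_gen av G w R k"
   using emb_simps(3)[OF FG_simps(6)[OF k, of 1], of "c k"] by (simp add: pres_gen_emb)
  then have "emb (single k (c k)) \<in> S" using assms(1,2) k by (simp add: closed_subspace_def)
  then show ?case using assms(1) insert k by (simp add: emb_simps closed_subspace_def)
 qed
 from this[of "keys a" "lookup a"] assms(3)
 have "emb (\<Sum>g\<in>keys a. single g (lookup a g)) \<in> S" by (simp add: FG_def)
 moreover have "(\<Sum>g\<in>keys a. single g (lookup a g)) = a" by (rule poly_mapping_eqI)
    (simp add: lookup_sum lookup_single when_def sum.delta in_keys_iff cong: if_cong)
 ultimately show ?thesis by simp
qed

lemma P_dense:
 assumes "closed_subspace P S" "!!g. g \<in> G ==> pres_gen av G w R g \<in> S"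
 shows "carrier P \<subseteq> S"
proof
 fix x assume x: "x |: P"
 have "\<exists>s\<in>S. nrm P (x \<ominus>\<^sub>P s) < e" if "0 < e" for e using emb_dense[OF x that] emb_in_closed[OF assms] by blast
 then show "x \<in> S" using assms(1) x by (auto simp: closed_subspace_def nclosed_def)
qed

text \<open>The universal property of a presented space. The relations are tested against an
  arbitrary additive \<open>L\<close> with the right values on multiples of generators, so that a
  user of the lemma never meets the linear extension built here. The bound on generators is the
  bound of the resulting map.\<close>

lemma P_lift:
 assumes Z: "banach_space av Z" and b: "!!g. g \<in> G ==> b g |: Z"
  and C: "0 \<le> C" "!!g. g \<in> G ==> nrm Z (b g) \<le> C * w g"
  and R: "!!L t. (!!a b. a \<in> FG ==> b \<in> FG ==> L (a + b) = L a \<oplus>\<^sub>Z L b) ==>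
    (!!a b. a \<in> FG ==> b \<in> FG ==> L (a - b) = L a \<ominus>\<^sub>Z L b) ==>
    (!!g c. g \<in> G ==> L (single g c) = c \<odot>\<^sub>Z b g) ==> t \<in> R ==> L t = \<zero>\<^sub>Z"
 shows "\<exists>\<Phi>. bl P Z \<Phi> \<and> (\<forall>g\<in>G. \<Phi> (pres_gen av G w R g) = b g) \<and>
   (\<forall>x\<in>carrier P. nrm Z (\<Phi> x) \<le> C * nrm P x)"
proof -
 interpret Z: seminormed av Z using Z na by (rule banach_seminormed[rotated])
 define L where "L a = (\<Oplus>\<^sub>Z g\<in>keys a. lookup a g \<odot>\<^sub>Z b g)" for a
 have L_eq: "L a = (\<Oplus>\<^sub>Z g\<in>S. lookup a g \<odot>\<^sub>Z b g)" if "finite S" "keys a \<subseteq> S" "S \<subseteq> G" for a S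
  unfolding L_def using that b by (intro Z.M.add.finprod_mono_neutral_cong_left) (auto simp: in_keys_iff)
 have Lc: "L a |: Z" if "a \<in> FG" for a
  unfolding L_def using that b by (intro Z.M.finsum_closed) (auto simp: FG_def)
 have L_add: "L (a + c) = L a \<oplus>\<^sub>Z L c" if "a \<in> FG" "c \<in> FG" for a c
 proof -
  let ?S = "keys a \<union> keys c"
  have S: "finite ?S" "?S \<subseteq> G" using that by (auto simp: FG_def)
  have "L (a + c) = (\<Oplus>\<^sub>Z g\<in>?S. lookup a g \<odot>\<^sub>Z b g \<oplus>\<^sub>Z lookup c g \<odot>\<^sub>Z b g)"
   unfolding L_eq[OF S(1) Poly_Mapping.keys_add S(2)]
   using S(2) b by (intro Z.M.finsum_cong') (auto simp: lookup_add Z.sm_add_l subset_eq)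
  also have "\<dots> = (\<Oplus>\<^sub>Z g\<in>?S. lookup a g \<odot>\<^sub>Z b g) \<oplus>\<^sub>Z (\<Oplus>\<^sub>Z g\<in>?S. lookup c g \<odot>\<^sub>Z b g)"
   using S(2) b by (intro Z.M.finsum_addf) (auto simp: subset_eq)
  also have "\<dots> = L a \<oplus>\<^sub>Z L c" using L_eq[of ?S a] L_eq[of ?S c] S by simp
  finally show ?thesis .
 qed
 have L_sm: "L (pscale c a) = c \<odot>\<^sub>Z L a" if "a \<in> FG" for a c
 proof -
  have "L (pscale c a) = (\<Oplus>\<^sub>Z g\<in>keys a. lookup (pscale c a) g \<odot>\<^sub>Z b g)"
   using that by (intro L_eq) (auto simp: FG_def in_keys_iff)
  also have "\<dots> = (\<Oplus>\<^sub>Z g\<in>keys a. c \<odot>\<^sub>Z (lookup a g \<odot>\<^sub>Z b g))"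
   using that b by (intro Z.M.finsum_cong') (auto simp: FG_def Z.sm_sm subset_eq)
  also have "\<dots> = c \<odot>\<^sub>Z L a" unfolding L_def using that b by (intro Z.finsum_sm[symmetric]) (auto simp: FG_def)
  finally show ?thesis .
 qed
 have L_diff: "L (a - c) = L a \<ominus>\<^sub>Z L c" if "a \<in> FG" "c \<in> FG" for a c
  using L_add[OF that(1) FG_simps(5)[OF that(2)], of "-1"] L_sm[OF that(2), of "-1"] Lc that
  by (simp add: Z.sm_m1 Z.M.minus_eq)
 have L_single: "L (single g c) = c \<odot>\<^sub>Z b g" if "g \<in> G" for g c
  using L_eq[of "{g}" "single g c"] that b[OF that] by simp
 have L_R: "L t = \<zero>\<^sub>Z" if "t \<in> R" for t by (rule R[OF L_add L_diff L_single that])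
 have L_kspan: "L t = \<zero>\<^sub>Z" if "t \<in> kspan R" for t
 proof -
  have "t \<in> FG \<and> L t = \<zero>\<^sub>Z" using that
  proof (induction rule: kspan_induct)
   case zero
   then show ?case using L_sm[of 0 0] Lc[of 0] by simp
  next
   case (step a c t)
   then have "t \<in> FG" using R_keys by (auto simp: FG_def)
   then show ?case using step L_R[OF step(2)] by (simp add: L_add L_sm)
  qed
  then show ?thesis ..
 qed
 have L_wmax: "nrm Z (L a) \<le> C * wmax av w a" if a: "a \<in> FG" for a unfolding L_def
 proof (rule Z.norm_finsum_le)
  fix g assume "g \<in> keys a"
  then have g: "g \<in> G" using a by (auto simp: FG_def)
  have "nrm Z (lookup a g \<odot>\<^sub>Z b g) \<le> av (lookup a g) * (C * w g)"
   using C(2)[OF g] b[OF g] by (simp add: Z.norm_smult mult_left_mono)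
  also have "\<dots> = C * (av (lookup a g) * w g)" by simp
  also have "\<dots> \<le> C * wmax av w a" using C(1) wmax_ge by (rule mult_left_mono[rotated])
  finally show "nrm Z (lookup a g \<odot>\<^sub>Z b g) \<le> C * wmax av w a" .
 qed (use a b C in \<open>auto simp: FG_def\<close>)
 \<comment> \<open>\<open>L\<close> kills the span of the relations, so its bound by
   \<open>wmax\<close> holds for every representative of a vector and passes to the infimum.\<close>
 have L_sn: "nrm Z (L a) \<le> C * sn a" if a: "a \<in> FG" for a
 proof (cases "C = 0")
  case True
  then show ?thesis using L_wmax[OF a] by simp
 next
  case False
  then have C0: "0 < C" using C by simp
  have "nrm Z (L a) / C \<le> sn a"
  proof (rule sn_ge[OF a])
   fix c assume c: "c \<in> FG" "a - c \<in> kspan R"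
   have "L a = L c" using L_kspan[OF c(2)] L_diff[OF a c(1)] Lc a c Z.sub_eq_0 by simp
   then show "nrm Z (L a) / C \<le> wmax av w c" using L_wmax[OF c(1)] C0 by (simp add: field_simps)
  qed
  then show ?thesis using C0 by (simp add: field_simps)
 qed
 \<comment> \<open>On the dense set of constant sequences some preimage is chosen. The choice is
   harmless: two preimages differ by a vector of seminorm zero, where \<open>L\<close> has norm
   zero.\<close>
 define h where "h x = L (SOME a. a \<in> FG \<and> x = emb a)" for x
 have h_emb: "h (emb a) = L a" if a: "a \<in> FG" for a
 proof -
  define c where "c = (SOME c. c \<in> FG \<and> emb a = emb c)"
  have c: "c \<in> FG" "emb a = emb c" using someI[of "%c. c \<in> FG \<and> emb a = emb c" a] a unfolding c_def by auto
  have "sn (a - c) = 0" using emb_simps(2)[of "a - c"] emb_simps(5)[OF a c(1)] c a by (simp add: emb_simps)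
  then have "nrm Z (L a \<ominus>\<^sub>Z L c) \<le> 0" using L_sn[of "a - c"] a c L_diff[OF a c(1)] by simp
  moreover have "0 \<le> nrm Z (L a \<ominus>\<^sub>Z L c)" using Lc a c by (intro Z.norm_nonneg) auto
  ultimately have "nrm Z (L a \<ominus>\<^sub>Z L c) = 0" by simp
  then have "L a = L c" using banach_sep[OF Z, of "L a \<ominus>\<^sub>Z L c"] Z.sub_eq_0 Lc a c by simp
  then show ?thesis by (simp add: h_def c_def)
 qed
 have "\<exists>\<Phi>. bl P Z \<Phi> \<and> (\<forall>x\<in>emb ` FG. \<Phi> x = h x) \<and> (\<forall>x\<in>carrier P. nrm Z (\<Phi> x) \<le> C * nrm P x)"
 proof (rule dense_extension[OF P_seminormed Z])
  show "emb ` FG \<subseteq> carrier P" by (auto simp: emb_simps)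
  show "x \<oplus>\<^sub>P y \<in> emb ` FG" if "x \<in> emb ` FG" "y \<in> emb ` FG" for x y
   using that by (auto simp: emb_simps(4)[symmetric])
  show "a \<odot>\<^sub>P x \<in> emb ` FG" if "x \<in> emb ` FG" for a x using that by (auto simp: emb_simps(3)[symmetric])
  show "\<exists>d\<in>emb ` FG. nrm P (x \<ominus>\<^sub>P d) < e" if "x |: P" "0 < e" for x e using emb_dense[OF that] .
  show "h x |: Z" if "x \<in> emb ` FG" for x using that by (auto simp: h_emb Lc)
  show "h (x \<oplus>\<^sub>P y) = h x \<oplus>\<^sub>Z h y" if "x \<in> emb ` FG" "y \<in> emb ` FG" for x y
   using that by (auto simp: emb_simps(4)[symmetric] h_emb L_add)
  show "h (a \<odot>\<^sub>P x) = a \<odot>\<^sub>Z h x" if "x \<in> emb ` FG" for a x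
   using that by (auto simp: emb_simps(3)[symmetric] h_emb L_sm)
  show "nrm Z (h x) \<le> C * nrm P x" if "x \<in> emb ` FG" for x using that by (auto simp: h_emb emb_simps L_sn)
 qed (rule C(1))
 then obtain \<Phi> where \<Phi>: "bl P Z \<Phi>" "\<forall>x\<in>emb ` FG. \<Phi> x = h x" "\<forall>x\<in>carrier P. nrm Z (\<Phi> x) \<le> C * nrm P x" by blast
 have "\<Phi> (pres_gen av G w R g) = b g" if "g \<in> G" for g
  using \<Phi>(2) that b[OF that] by (simp add: pres_gen_emb h_emb L_single)
 then show ?thesis using \<Phi> by blast
qed

end

subsection \<open>Completed tensor products\<close>

lemma tens_pres:
 assumes V: "seminormed av V" and W: "seminormed av W"
 shows "pres av (carrier V \<times> carrier W) (tens_weight V W) (tens_rels V W)"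
proof -
 interpret V: seminormed av V by fact
 interpret W: seminormed av W by fact
 show ?thesis
 proof
  show "0 \<le> tens_weight V W g" if "g \<in> carrier V \<times> carrier W" for g using that by (auto simp: tens_weight_def)
  show "keys t \<subseteq> carrier V \<times> carrier W" if "t \<in> tens_rels V W" for t
   using that unfolding tens_rels_def keys_subset_iff by (auto simp: lookup_minus lookup_single when_def)
 qed
qed

lemma ctens_banach:
 assumes "seminormed av V" "seminormed av W"
 shows "banach_space av (ctens av V W)"
proof -
 interpret pres av "carrier V \<times> carrier W" "tens_weight V W" "tens_rels V W" by (rule tens_pres[OF assms])
 show ?thesis unfolding ctens_def by (rule P_banach)
qed

lemma ctens_seminormed:
 assumes "seminormed av V" "seminormed av W"
 shows "seminormed av (ctens av V W)"
proof -
 interpret seminormed av V by fact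
 show ?thesis using ctens_banach[OF assms] by (rule banach_seminormed[OF na])
qed

text \<open>Each rule is one of the defining relations, and relations have seminorm zero, so the two
  sides have the same class. The constant is 1 because the seminorm of a generator is at most its
  weight.\<close>

lemma pure_tens_bilin:
 assumes V: "seminormed av V" and W: "seminormed av W"
 shows "bilin_map V W (ctens av V W) (pure_tens av V W)"
proof -
 interpret V: seminormed av V by fact
 interpret W: seminormed av W by fact
 interpret pres av "carrier V \<times> carrier W" "tens_weight V W" "tens_rels V W" by (rule tens_pres[OF V W])
 have pe: "pure_tens av V W v w = emb (single (v, w) 1)" for v w by (simp add: pure_tens_def pres_gen_emb)
 have emb_rel: "emb a = emb b" if "a - b \<in> tens_rels V W" "a \<in> FG" "b \<in> FG" for a b
  using sn_kspan[OF kspan_base[OF that(1)]] that by (simp add: emb_def cl_eq Cau_const)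
 show ?thesis unfolding ctens_def
 proof (rule bilinI[OF V W, where C = 1])
  fix v v' w w' a
  assume v: "v |: V" and w: "w |: W"
  show "pure_tens av V W v w |: P" using v w by (simp add: pe emb_simps)
  show "nrm P (pure_tens av V W v w) \<le> 1 * (nrm V v * nrm W w)"
  proof -
   have "tens_weight V W (v, w) = nrm V v * nrm W w" by (simp add: tens_weight_def)
   then show ?thesis using sn_single[of "(v, w)"] v w by (simp add: pe emb_simps)
  qed
  show "pure_tens av V W (a \<odot>\<^sub>V v) w = a \<odot>\<^sub>P pure_tens av V W v w"
  proof -
   have "single (a \<odot>\<^sub>V v, w) 1 - single (v, w) a \<in> tens_rels V W" unfolding tens_rels_def using v w by blast
   then show ?thesis unfolding pe using v w by (subst emb_rel) (auto simp: emb_simps(3)[symmetric])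
  qed
  show "pure_tens av V W v (a \<odot>\<^sub>W w) = a \<odot>\<^sub>P pure_tens av V W v w"
  proof -
   have "single (v, a \<odot>\<^sub>W w) 1 - single (v, w) a \<in> tens_rels V W" unfolding tens_rels_def using v w by blast
   then show ?thesis unfolding pe using v w by (subst emb_rel) (auto simp: emb_simps(3)[symmetric])
  qed
  show "pure_tens av V W (v \<oplus>\<^sub>V v') w = pure_tens av V W v w \<oplus>\<^sub>P pure_tens av V W v' w" if v': "v' |: V"
  proof -
   have "single (v \<oplus>\<^sub>V v', w) 1 - single (v, w) 1 - single (v', w) 1 \<in> tens_rels V W"
    unfolding tens_rels_def using v v' w by blast
   then have "emb (single (v \<oplus>\<^sub>V v', w) 1) = emb (single (v, w) 1 + single (v', w) 1)"
    using v v' w by (intro emb_rel) (auto simp: diff_diff_eq)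
   then show ?thesis unfolding pe using v v' w by (simp add: emb_simps)
  qed
  show "pure_tens av V W v (w \<oplus>\<^sub>W w') = pure_tens av V W v w \<oplus>\<^sub>P pure_tens av V W v w'" if w': "w' |: W"
  proof -
   have "single (v, w \<oplus>\<^sub>W w') 1 - single (v, w) 1 - single (v, w') 1 \<in> tens_rels V W"
    unfolding tens_rels_def using v w' w by blast
   then have "emb (single (v, w \<oplus>\<^sub>W w') 1) = emb (single (v, w) 1 + single (v, w') 1)"
    using v w' w by (intro emb_rel) (auto simp: diff_diff_eq)
   then show ?thesis unfolding pe using v w' w by (simp add: emb_simps)
  qed
 qed
qed

lemma tens_lift_ex:
 assumes V: "seminormed av V" and W: "seminormed av W" and Z: "banach_space av Z" and b: "bilin_map V W Z b"
  and C: "0 \<le> C" "!!v w. v |: V ==> w |: W ==> nrm Z (b v w) \<le> C * (nrm V v * nrm W w)"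
 shows "\<exists>f. bl (ctens av V W) Z f \<and>
    (\<forall>v\<in>carrier V. \<forall>w\<in>carrier W. f (pure_tens av V W v w) = b v w) \<and>
    (\<forall>t\<in>carrier (ctens av V W). nrm Z (f t) \<le> C * nrm (ctens av V W) t)"
proof -
 interpret V: seminormed av V by fact
 interpret W: seminormed av W by fact
 interpret Z: seminormed av Z using Z V.na by (rule banach_seminormed[rotated])
 interpret pres av "carrier V \<times> carrier W" "tens_weight V W" "tens_rels V W" by (rule tens_pres[OF V W])
 note cl = bilin_closed[OF b]
 have "\<exists>\<Phi>. bl P Z \<Phi> \<and>
   (\<forall>g\<in>carrier V \<times> carrier W. \<Phi> (pres_gen av (carrier V \<times> carrier W) (tens_weight V W) (tens_rels V W) g) = (%(v, w). b v w) g) \<and>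
   (\<forall>x\<in>carrier P. nrm Z (\<Phi> x) \<le> C * nrm P x)"
 proof (rule P_lift[OF Z])
  fix L t
  assume L: "!!a b. a \<in> FG ==> b \<in> FG ==> L (a + b) = L a \<oplus>\<^sub>Z L b"
    "!!a b. a \<in> FG ==> b \<in> FG ==> L (a - b) = L a \<ominus>\<^sub>Z L b"
    "!!g c. g \<in> carrier V \<times> carrier W ==> L (single g c) = c \<odot>\<^sub>Z (%(v, w). b v w) g"
   and t: "t \<in> tens_rels V W"
  have fg: "single (v, w) c \<in> FG" if "v |: V" "w |: W" for v w c using that by simp
  have z: "x \<oplus>\<^sub>Z y \<ominus>\<^sub>Z x \<ominus>\<^sub>Z y = \<zero>\<^sub>Z" if "x |: Z" "y |: Z" for x y using that by (simp add: Z.sub_sub)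
  from t show "L t = \<zero>\<^sub>Z" unfolding tens_rels_def
   by (auto simp: L fg cl z bl_add[OF bilin_left[OF b]] bl_add[OF bilin_right[OF b]]
     bl_sm[OF bilin_left[OF b]] bl_sm[OF bilin_right[OF b]])
 qed (use C cl in \<open>auto simp: tens_weight_def\<close>)
 then show ?thesis unfolding ctens_def pure_tens_def by fastforce
qed

lemma tens_lift:
 assumes "seminormed av V" "seminormed av W" "banach_space av Z" "bilin_map V W Z b"
 shows tens_lift_bl: "bl (ctens av V W) Z (tens_lift av V W Z b)"
  and tens_lift_pure: "!!v w. v |: V ==> w |: W ==> tens_lift av V W Z b (pure_tens av V W v w) = b v w"
proof -
 obtain C where "0 < C" "!!v w. v |: V ==> w |: W ==> nrm Z (b v w) \<le> C * (nrm V v * nrm W w)"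
  using bilin_bound[OF assms(4)] by blast
 then have "\<exists>f. bl (ctens av V W) Z f \<and>
    (\<forall>v\<in>carrier V. \<forall>w\<in>carrier W. f (pure_tens av V W v w) = b v w)"
  using tens_lift_ex[OF assms less_imp_le] by blast
 note * = someI_ex[OF this]
 show "bl (ctens av V W) Z (tens_lift av V W Z b)"
  and "!!v w. v |: V ==> w |: W ==> tens_lift av V W Z b (pure_tens av V W v w) = b v w"
  using * unfolding tens_lift_def by blast+
qed

lemma ctens_dense:
 assumes "seminormed av V" "seminormed av W" "closed_subspace (ctens av V W) S"
  and "!!v w. v |: V ==> w |: W ==> pure_tens av V W v w \<in> S"
 shows "carrier (ctens av V W) \<subseteq> S"
proof -
 interpret pres av "carrier V \<times> carrier W" "tens_weight V W" "tens_rels V W"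
  by (rule tens_pres[OF assms(1,2)])
 show ?thesis unfolding ctens_def by (rule P_dense) (use assms(3,4) in \<open>auto simp: ctens_def pure_tens_def\<close>)
qed

lemma ctens_eqI:
 assumes "seminormed av V" "seminormed av W" "seminormed av Z" "separated Z"
  and "bl (ctens av V W) Z f" "bl (ctens av V W) Z g"
  and "!!v w. v |: V ==> w |: W ==> f (pure_tens av V W v w) = g (pure_tens av V W v w)"
  and "x |: (ctens av V W)"
 shows "f x = g x"
proof -
 have "carrier (ctens av V W) \<subseteq> {x \<in> carrier (ctens av V W). f x = g x}"
  by (rule ctens_dense[OF assms(1,2) closed_subspace_eq[OF ctens_seminormed[OF assms(1,2)] assms(3-6)]])
    (use assms(7) bilin_closed[OF pure_tens_bilin[OF assms(1,2)]] in auto)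
 then show ?thesis using assms(8) by blast
qed

text \<open>\<open>tens_lift\<close> is an arbitrary choice that promises no particular norm. By
  density of elementary tensors it coincides with the map of \<open>tens_lift_ex\<close> and
  inherits the bound of that map.\<close>

lemma tens_lift_norm:
 assumes "seminormed av V" "seminormed av W" "banach_space av Z" "bilin_map V W Z b"
  and "0 \<le> C" "!!v w. v |: V ==> w |: W ==> nrm Z (b v w) \<le> C * (nrm V v * nrm W w)"
  and t: "t |: (ctens av V W)"
 shows "nrm Z (tens_lift av V W Z b t) \<le> C * nrm (ctens av V W) t"
proof -
 interpret V: seminormed av V by fact
 have Z: "seminormed av Z" using assms(3) V.na by (rule banach_seminormed[rotated])
 obtain f where f: "bl (ctens av V W) Z f" "\<forall>v\<in>carrier V. \<forall>w\<in>carrier W. f (pure_tens av V W v w) = b v w"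
   "\<forall>t\<in>carrier (ctens av V W). nrm Z (f t) \<le> C * nrm (ctens av V W) t"
  using tens_lift_ex[OF assms(1-6)] by blast
 have "tens_lift av V W Z b t = f t"
  using f(2) by (intro ctens_eqI[OF assms(1,2) Z banach_separated[OF assms(3)] tens_lift_bl[OF assms(1-4)] f(1) _ t])
   (auto simp: tens_lift_pure[OF assms(1-4)])
 then show ?thesis using f(3) t by simp
qed

lemma tens_map_bilin:
 assumes "seminormed av V" "seminormed av W" "seminormed av V'" "seminormed av W'" and "bl V V' f" "bl W W' g"
 shows "bilin_map V W (ctens av V' W') (%v w. pure_tens av V' W' (f v) (g w))"
 by (rule bilin_comp[OF assms pure_tens_bilin[OF assms(3,4)]])

lemma tens_map_bl:
 assumes "seminormed av V" "seminormed av W" "seminormed av V'" "seminormed av W'" and "bl V V' f" "bl W W' g"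
 shows "bl (ctens av V W) (ctens av V' W') (tens_map av V W V' W' f g)" and "v |: V ==> w |: W ==>
   tens_map av V W V' W' f g (pure_tens av V W v w) = pure_tens av V' W' (f v) (g w)" unfolding tens_map_def
 using tens_lift[OF assms(1,2) ctens_banach[OF assms(3,4)] tens_map_bilin[OF assms]] by auto

section \<open>Contracting coproducts\<close>

lemma kspace_simps [simp]: "carrier (kspace av) = UNIV" "zero (kspace av) = 0" "add (kspace av) = (+)"
 "smult (kspace av) = (*)" "nrm (kspace av) = av" "mult (kspace av) = (*)" "one (kspace av) = 1"
 by (simp_all add: kspace_def)

lemma (in nonarch) kspace_seminormed: "seminormed av (kspace av)"
proof -
 have "abelian_group (kspace av)"
 proof (rule abelian_groupI)
  show "\<exists>y\<in>carrier (kspace av). y \<oplus>\<^bsub>kspace av\<^esub> x = \<zero>\<^bsub>kspace av\<^esub>" for x by (rule bexI[of _ "- x"]) simp_all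
 qed (simp_all add: add_ac)
 then have "module kring (kspace av)" by (rule moduleI[OF cring_kring]) (simp_all add: algebra_simps)
 then show ?thesis
  by (intro seminormed.intro nonarch_axioms seminormed_axioms.intro) (simp_all add: av_mult av_add)
qed

lemma (in nonarch) kspace_banach: "banach_space av (kspace av)"
 by (rule banach_spaceI[OF kspace_seminormed]) (simp_all add: av_complete)

definition c0_delta :: "'j set => ('j => ('k, 'v) nspace) => 'j => 'v => 'j => 'v" where
 "c0_delta J X j x = (\<lambda>i\<in>J. if i = j then x else \<zero>\<^bsub>X i\<^esub>)"

locale c0 = nonarch av for av :: "'k::field_char_0 => real" +
 fixes J :: "'j set" and X :: "'j => ('k, 'v) nspace"
 assumes X: "j \<in> J ==> seminormed av (X j)"
begin

abbreviation "C \<equiv> c0_coprod J X"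

lemma C_simps:
 "zero C = (\<lambda>j\<in>J. \<zero>\<^bsub>X j\<^esub>)" "add C x y = (\<lambda>j\<in>J. x j \<oplus>\<^bsub>X j\<^esub> y j)" "smult C a x = (\<lambda>j\<in>J. a \<odot>\<^bsub>X j\<^esub> x j)"
 "nrm C x = Sup (insert 0 ((%j. nrm (X j) (x j)) ` J))" by (simp_all add: c0_coprod_def)

lemma C_iff: "x |: C \<longleftrightarrow> x \<in> extensional J \<and> (\<forall>j\<in>J. x j |: (X j)) \<and>
  (\<forall>e>0. finite {j\<in>J. e \<le> nrm (X j) (x j)})" by (auto simp: c0_coprod_def PiE_iff)

lemma C_cl [simp]: "x |: C ==> j \<in> J ==> x j |: (X j)" by (simp add: C_iff)

lemma C_bdd:
 assumes "x |: C"
 shows "bdd_above (insert 0 ((%j. nrm (X j) (x j)) ` J))"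
proof -
 have fin: "finite {j\<in>J. 1 \<le> nrm (X j) (x j)}" using assms by (simp add: C_iff)
 have "(%j. nrm (X j) (x j)) ` J \<subseteq> (%j. nrm (X j) (x j)) ` {j\<in>J. 1 \<le> nrm (X j) (x j)} \<union> {..1}" by auto
 moreover have "bdd_above ((%j. nrm (X j) (x j)) ` {j\<in>J. 1 \<le> nrm (X j) (x j)} \<union> {..1})" using fin by auto
 ultimately have "bdd_above ((%j. nrm (X j) (x j)) ` J)" by (rule bdd_above_mono[rotated])
 then show ?thesis by simp
qed

lemma norm_ge: "x |: C ==> j \<in> J ==> nrm (X j) (x j) \<le> nrm C x"
 unfolding C_simps by (rule cSup_upper[OF _ C_bdd]) auto

lemma norm_le: "0 \<le> B ==> (!!j. j \<in> J ==> nrm (X j) (x j) \<le> B) ==> nrm C x \<le> B"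
 unfolding C_simps by (rule cSup_least) auto

lemma norm_ge0: "x |: C ==> 0 \<le> nrm C x" unfolding C_simps by (rule cSup_upper[OF _ C_bdd]) auto

lemma C_add_cl:
 assumes "x |: C" "y |: C"
 shows "x \<oplus>\<^sub>C y \<in> carrier C"
proof -
 have "finite {j\<in>J. e \<le> nrm (X j) (x j \<oplus>\<^bsub>X j\<^esub> y j)}" if e: "0 < e" for e
 proof (rule finite_subset)
  show "finite ({j\<in>J. e \<le> nrm (X j) (x j)} \<union> {j\<in>J. e \<le> nrm (X j) (y j)})" using assms e by (simp add: C_iff)
  show "{j\<in>J. e \<le> nrm (X j) (x j \<oplus>\<^bsub>X j\<^esub> y j)} \<subseteq> {j\<in>J. e \<le> nrm (X j) (x j)} \<union> {j\<in>J. e \<le> nrm (X j) (y j)}"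
   using seminormed.norm_add[OF X C_cl C_cl] assms by (fastforce simp: le_max_iff_disj)
 qed
 then show ?thesis using assms seminormed.add_cl[OF X] by (simp add: C_iff C_simps cong: conj_cong)
qed

lemma C_sm_cl:
 assumes "x |: C"
 shows "a \<odot>\<^sub>C x \<in> carrier C"
proof -
 have "finite {j\<in>J. e \<le> nrm (X j) (a \<odot>\<^bsub>X j\<^esub> x j)}" if e: "0 < e" for e
 proof (cases "a = 0")
  case True
  then have "{j\<in>J. e \<le> nrm (X j) (a \<odot>\<^bsub>X j\<^esub> x j)} = {}" using assms e seminormed.norm_smult[OF X C_cl] by auto
  then show ?thesis by (simp only: finite.emptyI)
 next
  case False
  then have a: "0 < av a" using av_nonneg[of a] av_eq_0[of a] by linarith
  have "{j\<in>J. e \<le> nrm (X j) (a \<odot>\<^bsub>X j\<^esub> x j)} = {j\<in>J. e / av a \<le> nrm (X j) (x j)}"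
   using assms a seminormed.norm_smult[OF X C_cl] by (auto simp: field_simps)
  then show ?thesis using assms e a by (simp add: C_iff)
 qed
 then show ?thesis using assms seminormed.sm_cl[OF X] by (simp add: C_iff C_simps cong: conj_cong)
qed

lemma C_0_cl: "\<zero>\<^sub>C \<in> carrier C"
proof -
 have "finite {j \<in> J. e \<le> nrm (X j) \<zero>\<^bsub>X j\<^esub>}" if "0 < e" for e
 proof -
  have "{j \<in> J. e \<le> nrm (X j) \<zero>\<^bsub>X j\<^esub>} = {}" using that seminormed.norm_0[OF X] by auto
  then show ?thesis by (simp only: finite.emptyI)
 qed
 then show ?thesis using seminormed.zero_cl[OF X] by (simp add: C_iff C_simps cong: conj_cong)
qed

lemma C_ext: "x |: C ==> y |: C ==> (!!j. j \<in> J ==> x j = y j) ==> x = y"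
 by (rule extensionalityI[of x J y]) (auto simp: C_iff)

lemma C_abelian: "abelian_group C"
proof (rule abelian_groupI)
 fix x assume x: "x |: C"
 show "\<exists>y\<in>carrier C. y \<oplus>\<^sub>C x = \<zero>\<^sub>C"
 proof (rule bexI[OF _ C_sm_cl[OF x, of "-1"]], rule C_ext)
  fix j assume j: "j \<in> J"
  interpret seminormed av "X j" by (rule X[OF j])
  show "((- 1) \<odot>\<^sub>C x \<oplus>\<^sub>C x) j = \<zero>\<^sub>C j" using x j by (simp add: C_simps sm_m1 M.l_neg)
 qed (auto intro!: C_add_cl C_sm_cl C_0_cl x)
 show "\<zero>\<^sub>C \<oplus>\<^sub>C x = x"
 proof (rule C_ext)
  fix j assume j: "j \<in> J"
  interpret seminormed av "X j" by (rule X[OF j])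
  show "(\<zero>\<^sub>C \<oplus>\<^sub>C x) j = x j" using x j by (simp add: C_simps)
 qed (auto intro!: C_add_cl C_0_cl x)
 fix y assume y: "y |: C"
 show "x \<oplus>\<^sub>C y = y \<oplus>\<^sub>C x"
 proof (rule C_ext)
  fix j assume j: "j \<in> J"
  interpret seminormed av "X j" by (rule X[OF j])
  show "(x \<oplus>\<^sub>C y) j = (y \<oplus>\<^sub>C x) j" using x y j by (simp add: C_simps M.a_comm)
 qed (auto intro!: C_add_cl x y)
 fix z assume z: "z |: C"
 show "(x \<oplus>\<^sub>C y) \<oplus>\<^sub>C z = x \<oplus>\<^sub>C (y \<oplus>\<^sub>C z)"
 proof (rule C_ext)
  fix j assume j: "j \<in> J"
  interpret seminormed av "X j" by (rule X[OF j])
  show "((x \<oplus>\<^sub>C y) \<oplus>\<^sub>C z) j = (x \<oplus>\<^sub>C (y \<oplus>\<^sub>C z)) j" using x y z j by (simp add: C_simps M.a_assoc)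
 qed (auto intro!: C_add_cl x y z)
qed (auto intro!: C_add_cl C_0_cl)

lemma C_module: "module kring C"
proof (rule moduleI[OF cring_kring C_abelian])
 fix a b x y
 assume x: "x |: C"
 show "a \<odot>\<^sub>C x |: C" by (rule C_sm_cl[OF x])
 show "(a \<oplus>\<^bsub>kring\<^esub> b) \<odot>\<^sub>C x = a \<odot>\<^sub>C x \<oplus>\<^sub>C b \<odot>\<^sub>C x"
 proof (rule C_ext)
  fix j assume j: "j \<in> J"
  interpret seminormed av "X j" by (rule X[OF j])
  show "((a \<oplus>\<^bsub>kring\<^esub> b) \<odot>\<^sub>C x) j = (a \<odot>\<^sub>C x \<oplus>\<^sub>C b \<odot>\<^sub>C x) j" using x j by (simp add: C_simps sm_add_l)
 qed (auto intro!: C_add_cl C_sm_cl x)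
 show "(a \<otimes>\<^bsub>kring\<^esub> b) \<odot>\<^sub>C x = a \<odot>\<^sub>C (b \<odot>\<^sub>C x)"
 proof (rule C_ext)
  fix j assume j: "j \<in> J"
  interpret seminormed av "X j" by (rule X[OF j])
  show "((a \<otimes>\<^bsub>kring\<^esub> b) \<odot>\<^sub>C x) j = (a \<odot>\<^sub>C (b \<odot>\<^sub>C x)) j" using x j by (simp add: C_simps sm_sm)
 qed (auto intro!: C_sm_cl x)
 show "\<one>\<^bsub>kring\<^esub> \<odot>\<^sub>C x = x"
 proof (rule C_ext)
  fix j assume j: "j \<in> J"
  interpret seminormed av "X j" by (rule X[OF j])
  show "(\<one>\<^bsub>kring\<^esub> \<odot>\<^sub>C x) j = x j" using x j by (simp add: C_simps)
 qed (auto intro!: C_sm_cl x)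
 assume y: "y |: C"
 show "a \<odot>\<^sub>C (x \<oplus>\<^sub>C y) = a \<odot>\<^sub>C x \<oplus>\<^sub>C a \<odot>\<^sub>C y"
 proof (rule C_ext)
  fix j assume j: "j \<in> J"
  interpret seminormed av "X j" by (rule X[OF j])
  show "(a \<odot>\<^sub>C (x \<oplus>\<^sub>C y)) j = (a \<odot>\<^sub>C x \<oplus>\<^sub>C a \<odot>\<^sub>C y) j" using x y j by (simp add: C_simps sm_add_r)
 qed (auto intro!: C_add_cl C_sm_cl x y)
qed

lemma C_seminormed: "seminormed av C"
proof (rule seminormed.intro[OF nonarch_axioms C_module], unfold_locales)
 fix x y a
 assume x: "x |: C"
 show "0 \<le> nrm C x" by (rule norm_ge0[OF x])
 have comp: "nrm (X j) ((a \<odot>\<^sub>C z) j) = av a * nrm (X j) (z j)" if "j \<in> J" "z |: C" for j a z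
  using that seminormed.norm_smult[OF X C_cl] by (simp add: C_simps)
 have le: "nrm C (a \<odot>\<^sub>C z) \<le> av a * nrm C z" if "z |: C" for z a
  using that by (intro norm_le) (auto simp: comp norm_ge0 norm_ge intro!: mult_left_mono)
 show "nrm C (a \<odot>\<^sub>C x) = av a * nrm C x"
 proof (rule antisym[OF le[OF x]])
  show "av a * nrm C x \<le> nrm C (a \<odot>\<^sub>C x)"
  proof (cases "a = 0")
   case False
   interpret m: module kring C by (rule C_module)
   have "(1 / a) \<odot>\<^sub>C (a \<odot>\<^sub>C x) = x" using m.smult_assoc1[of "1 / a" a x] m.smult_one[OF x] x False by simp
   then have "av a * nrm C x \<le> av a * (av (1 / a) * nrm C (a \<odot>\<^sub>C x))"
    using le[OF C_sm_cl[OF x], of "1 / a" a] by (intro mult_left_mono) auto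
   also have "\<dots> = av (a * (1 / a)) * nrm C (a \<odot>\<^sub>C x)" by (simp only: av_mult mult.assoc)
   finally show ?thesis using False by simp
  qed (simp add: norm_ge0 C_sm_cl x)
 qed
 assume y: "y |: C"
 show "nrm C (x \<oplus>\<^sub>C y) \<le> max (nrm C x) (nrm C y)"
 proof (rule norm_le)
  fix j assume j: "j \<in> J"
  have "nrm (X j) (x j \<oplus>\<^bsub>X j\<^esub> y j) \<le> max (nrm (X j) (x j)) (nrm (X j) (y j))"
   using seminormed.norm_add[OF X[OF j] C_cl[OF x j] C_cl[OF y j]] .
  also have "\<dots> \<le> max (nrm C x) (nrm C y)" using norm_ge[OF x j] norm_ge[OF y j] by (rule max.mono)
  finally show "nrm (X j) ((x \<oplus>\<^sub>C y) j) \<le> max (nrm C x) (nrm C y)" using j by (simp add: C_simps)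
 qed (use norm_ge0[OF x] in \<open>simp add: le_max_iff_disj\<close>)
qed

sublocale C: seminormed av C by (rule C_seminormed)

lemma C_sub:
 assumes "x |: C" "y |: C" "j \<in> J"
 shows "(x \<ominus>\<^sub>C y) j = x j \<ominus>\<^bsub>X j\<^esub> y j"
proof -
 interpret seminormed av "X j" by (rule X[OF assms(3)])
 have "x \<ominus>\<^sub>C y = x \<oplus>\<^sub>C (- 1) \<odot>\<^sub>C y" using assms by (simp add: C.sm_m1 C.M.minus_eq)
 then show ?thesis using assms by (simp add: C_simps sm_m1 M.minus_eq)
qed

lemma C_separated:
 assumes "!!j. j \<in> J ==> separated (X j)"
 shows "separated C" unfolding separated_def
proof (intro ballI impI)
 fix x assume x: "x |: C" "nrm C x = 0"
 show "x = \<zero>\<^sub>C"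
 proof (rule C_ext[OF x(1) C_0_cl])
  fix j assume j: "j \<in> J"
  have "nrm (X j) (x j) \<le> 0" using norm_ge[OF x(1) j] x(2) by simp
  moreover have "0 \<le> nrm (X j) (x j)" using seminormed.norm_nonneg[OF X[OF j] C_cl[OF x(1) j]] .
  ultimately have "x j = \<zero>\<^bsub>X j\<^esub>" using assms[OF j] C_cl[OF x(1) j] by (simp add: separated_def)
  then show "x j = \<zero>\<^sub>C j" using j by (simp add: C_simps)
 qed
qed

abbreviation "\<delta> \<equiv> c0_delta J X"

lemma finsupp_cl:
 assumes "x \<in> extensional J" "!!j. j \<in> J ==> x j |: (X j)" "finite F" "!!j. j \<in> J ==> j \<notin> F ==> x j = \<zero>\<^bsub>X j\<^esub>"
 shows "x \<in> carrier C"
proof -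
 have "finite {j\<in>J. e \<le> nrm (X j) (x j)}" if e: "0 < e" for e
 proof (rule finite_subset[OF _ assms(3)])
  show "{j\<in>J. e \<le> nrm (X j) (x j)} \<subseteq> F" using assms(4) seminormed.norm_0[OF X] e by fastforce
 qed
 then show ?thesis using assms by (simp add: C_iff)
qed

lemma \<delta>_cl [simp, intro]: "j \<in> J ==> x |: (X j) ==> \<delta> j x |: C"
 by (rule finsupp_cl[of _ "{j}"]) (auto simp: c0_delta_def seminormed.zero_cl[OF X])

lemma \<delta>_bl:
 assumes j: "j \<in> J"
 shows "bl (X j) C (\<delta> j)"
proof -
 interpret Xj: seminormed av "X j" by (rule X[OF j])
 show ?thesis
 proof (rule blI[where C = 1])
  fix x y a assume x: "x |: (X j)"
  show "\<delta> j x |: C" using j x by simp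
  show "nrm C (\<delta> j x) \<le> 1 * nrm (X j) x"
   using x by (intro norm_le) (auto simp: c0_delta_def seminormed.norm_0[OF X])
  show "\<delta> j (a \<odot>\<^bsub>X j\<^esub> x) = a \<odot>\<^sub>C \<delta> j x"
  proof (rule C_ext)
   fix i assume i: "i \<in> J"
   interpret Xi: seminormed av "X i" by (rule X[OF i])
   show "\<delta> j (a \<odot>\<^bsub>X j\<^esub> x) i = (a \<odot>\<^sub>C \<delta> j x) i" using i by (simp add: C_simps c0_delta_def)
  qed (use x j C_sm_cl in auto)
  assume y: "y |: (X j)"
  show "\<delta> j (x \<oplus>\<^bsub>X j\<^esub> y) = \<delta> j x \<oplus>\<^sub>C \<delta> j y"
  proof (rule C_ext)
   fix i assume i: "i \<in> J"
   interpret Xi: seminormed av "X i" by (rule X[OF i])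
   show "\<delta> j (x \<oplus>\<^bsub>X j\<^esub> y) i = (\<delta> j x \<oplus>\<^sub>C \<delta> j y) i" using i by (simp add: C_simps c0_delta_def)
  qed (use x y j in auto)
 qed
qed

lemma finsupp_in:
 assumes S: "closed_subspace C S" "!!j x. j \<in> J ==> x |: (X j) ==> \<delta> j x \<in> S"
  and x: "x |: C" and F: "finite F" "F \<subseteq> J"
 shows "(\<lambda>j\<in>J. if j \<in> F then x j else \<zero>\<^bsub>X j\<^esub>) \<in> S" using F
proof (induction F rule: finite_induct)
 case empty
 have "(\<lambda>j\<in>J. if j \<in> {} then x j else \<zero>\<^bsub>X j\<^esub>) = \<zero>\<^sub>C" by (simp add: C_simps)
 then show ?case using S(1) by (simp only: closed_subspace_def)
next
 case (insert i F)
 then have i: "i \<in> J" by simp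
 have "(\<lambda>j\<in>J. if j \<in> insert i F then x j else \<zero>\<^bsub>X j\<^esub>) = \<delta> i (x i) \<oplus>\<^sub>C (\<lambda>j\<in>J. if j \<in> F then x j else \<zero>\<^bsub>X j\<^esub>)"
 proof (rule extensionalityI[of _ J])
  fix j assume j: "j \<in> J"
  interpret Xj: seminormed av "X j" by (rule X[OF j])
  show "(\<lambda>j\<in>J. if j \<in> insert i F then x j else \<zero>\<^bsub>X j\<^esub>) j = (\<delta> i (x i) \<oplus>\<^sub>C (\<lambda>j\<in>J. if j \<in> F then x j else \<zero>\<^bsub>X j\<^esub>)) j"
   using insert.hyps j C_cl[OF x j] by (cases "i = j") (auto simp: C_simps c0_delta_def)
 qed (auto simp: C_simps)
 moreover have "(\<lambda>j\<in>J. if j \<in> F then x j else \<zero>\<^bsub>X j\<^esub>) \<in> S" by (rule insert.IH) (use insert.prems in simp)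
 moreover have "\<delta> i (x i) \<in> S" using S(2)[OF i C_cl[OF x i]] .
 ultimately show ?case using S(1) by (simp only: closed_subspace_def)
qed

lemma trunc_approx:
 assumes x: "x |: C" and e: "0 < e"
 shows "\<exists>F. finite F \<and> F \<subseteq> J \<and> (\<lambda>j\<in>J. if j \<in> F then x j else \<zero>\<^bsub>X j\<^esub>) |: C \<and>
   nrm C (x \<ominus>\<^sub>C (\<lambda>j\<in>J. if j \<in> F then x j else \<zero>\<^bsub>X j\<^esub>)) < e"
proof -
 \<comment> \<open>Half of \<open>e\<close> leaves room for the strict inequality: outside
   \<open>F\<close> every coordinate is below \<open>e / 2\<close>, so the supremum is at most
   \<open>e / 2\<close>.\<close>
 define F where "F = {j\<in>J. e / 2 \<le> nrm (X j) (x j)}"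
 have "0 < e / 2" using e by simp
 then have F: "finite F" "F \<subseteq> J" unfolding F_def using x by (simp only: C_iff, blast+)
 let ?t = "\<lambda>j\<in>J. if j \<in> F then x j else \<zero>\<^bsub>X j\<^esub>"
 have t: "?t |: C" using F x by (intro finsupp_cl[of _ F]) (auto simp: seminormed.zero_cl[OF X])
 have "nrm C (x \<ominus>\<^sub>C ?t) \<le> e / 2"
 proof (rule norm_le)
  fix j assume j: "j \<in> J"
  interpret Xj: seminormed av "X j" by (rule X[OF j])
  show "nrm (X j) ((x \<ominus>\<^sub>C ?t) j) \<le> e / 2"
   using j C_cl[OF x j] e unfolding C_sub[OF x t j] by (cases "j \<in> F") (auto simp: F_def)
 qed (use e in simp)
 then show ?thesis using F t e by (intro exI[of _ F]) auto
qed

lemma C_dense: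
 assumes S: "closed_subspace C S" "!!j x. j \<in> J ==> x |: (X j) ==> \<delta> j x \<in> S"
 shows "carrier C \<subseteq> S"
proof
 fix x assume x: "x |: C"
 have "\<exists>s\<in>S. nrm C (x \<ominus>\<^sub>C s) < e" if "0 < e" for e using trunc_approx[OF x that] finsupp_in[OF S x] by blast
 then show "x \<in> S" using S(1) x by (auto simp: closed_subspace_def nclosed_def)
qed

text \<open>A contracting coproduct is universal for families of maps with a common bound, hence the
  single constant \<open>B\<close>. The map is first defined on families of finite support, which
  are dense.\<close>

lemma C_lift:
 assumes Z: "banach_space av Z" and B: "0 \<le> B" and f: "!!j. j \<in> J ==> bl (X j) Z (f j)"
  and bd: "!!j x. j \<in> J ==> x |: (X j) ==> nrm Z (f j x) \<le> B * nrm (X j) x"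
 shows "\<exists>\<Phi>. bl C Z \<Phi> \<and> (\<forall>j\<in>J. \<forall>x\<in>carrier (X j). \<Phi> (\<delta> j x) = f j x)"
proof -
 interpret Z: seminormed av Z using Z na by (rule banach_seminormed[rotated])
 have f0: "f j \<zero>\<^bsub>X j\<^esub> = \<zero>\<^sub>Z" if "j \<in> J" for j by (rule bl_zero[OF X[OF that] Z.seminormed_axioms f[OF that]])
 define supp where "supp x = {j\<in>J. x j \<noteq> \<zero>\<^bsub>X j\<^esub>}" for x
 define D where "D = {x \<in> carrier C. finite (supp x)}"
 define h where "h x = (\<Oplus>\<^sub>Z j\<in>supp x. f j (x j))" for x
 have fc: "f j (x j) |: Z" if "x |: C" "j \<in> J" for x j using bl_closed[OF f[OF that(2)] C_cl[OF that]] .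
 have h_eq: "h x = (\<Oplus>\<^sub>Z j\<in>F. f j (x j))" if "finite F" "supp x \<subseteq> F" "F \<subseteq> J" "x |: C" for x F
  unfolding h_def using that fc f0
  by (intro Z.M.add.finprod_mono_neutral_cong_left) (auto simp: supp_def subset_eq)
 have supp_add: "supp (x \<oplus>\<^sub>C y) \<subseteq> supp x \<union> supp y" for x y
  using seminormed.zero_cl[OF X] abelian_monoid.l_zero[OF abelian_group.axioms(1)[OF module.axioms(2)[OF seminormed.axioms(2)[OF X]]]]
  by (auto simp: supp_def C_simps)
 have supp_sm: "supp (a \<odot>\<^sub>C x) \<subseteq> supp x" for a x using seminormed.sm_0r[OF X] by (auto simp: supp_def C_simps)
 have suppJ: "supp x \<subseteq> J" for x by (auto simp: supp_def)
 have "\<exists>\<Phi>. bl C Z \<Phi> \<and> (\<forall>x\<in>D. \<Phi> x = h x) \<and> (\<forall>x\<in>carrier C. nrm Z (\<Phi> x) \<le> B * nrm C x)"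
 proof (rule dense_extension[OF C_seminormed Z])
  show "D \<subseteq> carrier C" by (auto simp: D_def)
  show "x \<oplus>\<^sub>C y \<in> D" if "x \<in> D" "y \<in> D" for x y
   using that finite_subset[OF supp_add, of x y] by (auto simp: D_def)
  show "a \<odot>\<^sub>C x \<in> D" if "x \<in> D" for a x using that finite_subset[OF supp_sm, of x a] by (auto simp: D_def)
  show "\<exists>d\<in>D. nrm C (x \<ominus>\<^sub>C d) < e" if x: "x |: C" and e: "0 < e" for x e
  proof -
   obtain F where F: "finite F" "F \<subseteq> J" "(\<lambda>j\<in>J. if j \<in> F then x j else \<zero>\<^bsub>X j\<^esub>) |: C"
    "nrm C (x \<ominus>\<^sub>C (\<lambda>j\<in>J. if j \<in> F then x j else \<zero>\<^bsub>X j\<^esub>)) < e" using trunc_approx[OF x e] by blast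
   have "supp (\<lambda>j\<in>J. if j \<in> F then x j else \<zero>\<^bsub>X j\<^esub>) \<subseteq> F" by (auto simp: supp_def)
   then have "(\<lambda>j\<in>J. if j \<in> F then x j else \<zero>\<^bsub>X j\<^esub>) \<in> D" using F finite_subset by (simp add: D_def)
   then show ?thesis using F(4) by blast
  qed
  show "h x |: Z" if "x \<in> D" for x
   unfolding h_def using that fc suppJ[of x] by (intro Z.M.finsum_closed) (auto simp: D_def)
  show "h (x \<oplus>\<^sub>C y) = h x \<oplus>\<^sub>Z h y" if xy: "x \<in> D" "y \<in> D" for x y
  proof -
   let ?F = "supp x \<union> supp y"
   have F: "finite ?F" "?F \<subseteq> J" using that suppJ by (auto simp: D_def)
   have c: "x |: C" "y |: C" using xy by (auto simp: D_def)
   have "h (x \<oplus>\<^sub>C y) = (\<Oplus>\<^sub>Z j\<in>?F. f j (x j) \<oplus>\<^sub>Z f j (y j))"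
    unfolding h_eq[OF F(1) supp_add F(2) C_add_cl[OF c]] using F(2) fc[OF c(1)] fc[OF c(2)] c
    by (intro Z.M.finsum_cong') (auto simp: C_simps bl_add[OF f] subset_eq)
   also have "\<dots> = (\<Oplus>\<^sub>Z j\<in>?F. f j (x j)) \<oplus>\<^sub>Z (\<Oplus>\<^sub>Z j\<in>?F. f j (y j))"
    using F(2) fc[OF c(1)] fc[OF c(2)] by (intro Z.M.finsum_addf) (auto simp: subset_eq)
   also have "\<dots> = h x \<oplus>\<^sub>Z h y" using h_eq[of ?F x] h_eq[of ?F y] F c by simp
   finally show ?thesis .
  qed
  show "h (a \<odot>\<^sub>C x) = a \<odot>\<^sub>Z h x" if x: "x \<in> D" for a x
  proof -
   have c: "x |: C" "finite (supp x)" using x by (auto simp: D_def)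
   have "h (a \<odot>\<^sub>C x) = (\<Oplus>\<^sub>Z j\<in>supp x. a \<odot>\<^sub>Z f j (x j))" unfolding h_eq[OF c(2) supp_sm suppJ C_sm_cl[OF c(1)]]
    using suppJ[of x] fc[OF c(1)] c by (intro Z.M.finsum_cong') (auto simp: C_simps bl_sm[OF f] subset_eq)
   also have "\<dots> = a \<odot>\<^sub>Z h x" unfolding h_def
    using suppJ[of x] fc[OF c(1)] by (intro Z.finsum_sm[symmetric]) auto
   finally show ?thesis .
  qed
  show "nrm Z (h x) \<le> B * nrm C x" if x: "x \<in> D" for x unfolding h_def
  proof (rule Z.norm_finsum_le)
   have c: "x |: C" using x by (auto simp: D_def)
   show "(%j. f j (x j)) \<in> supp x \<rightarrow> carrier Z" using suppJ[of x] fc[OF c] by auto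
   show "0 \<le> B * nrm C x" using B norm_ge0[OF c] by simp
   show "nrm Z (f j (x j)) \<le> B * nrm C x" if "j \<in> supp x" for j
    using bd[OF _ C_cl[OF c], of j] mult_left_mono[OF norm_ge[OF c] B, of j] that suppJ[of x]
    by (meson order.trans subset_eq)
  qed
 qed (rule B)
 then obtain \<Phi> where \<Phi>: "bl C Z \<Phi>" "\<forall>x\<in>D. \<Phi> x = h x" by blast
 have "\<Phi> (\<delta> j x) = f j x" if j: "j \<in> J" and x: "x |: (X j)" for j x
 proof -
  have s: "supp (\<delta> j x) \<subseteq> {j}" by (auto simp: supp_def c0_delta_def)
  then have "\<delta> j x \<in> D" using j x finite_subset by (auto simp: D_def)
  then have "\<Phi> (\<delta> j x) = h (\<delta> j x)" using \<Phi> by blast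
  also have "\<dots> = f j x"
  proof -
   have "\<delta> j x j = x" using j by (simp add: c0_delta_def)
   then show ?thesis using h_eq[of "{j}" "\<delta> j x"] s j x bl_closed[OF f[OF j] x] by simp
  qed
  finally show ?thesis .
 qed
 then show ?thesis using \<Phi> by blast
qed

end

section \<open>Seminormed algebras\<close>

text \<open>The tensor algebra and \<open>U\<close> arise from Banach spaces by overwriting
  \<open>mult\<close> and \<open>one\<close>; linear and metric facts pass through this
  change.\<close>

lemma seminormed_update [simp]: "seminormed av (V\<lparr>mult := m, one := e\<rparr>) = seminormed av V"
 by (simp add: seminormed_def seminormed_axioms_def module_def module_axioms_def abelian_group_def
   abelian_group_axioms_def abelian_monoid_def)

lemma separated_update [simp]: "separated (V\<lparr>mult := m, one := e\<rparr>) = separated V" by (simp add: separated_def)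

lemma a_minus_update [simp]: "a_minus (V\<lparr>mult := m, one := e\<rparr>) = a_minus V"
 by (intro ext) (simp add: a_minus_def a_inv_def)

lemma bl_update [simp]: "bl (V\<lparr>mult := m, one := e\<rparr>) W = bl V W" "bl W (V\<lparr>mult := m, one := e\<rparr>) = bl W V"
 by (intro ext; simp add: bounded_linear_map_def)+

lemma nclosed_update [simp]: "nclosed (V\<lparr>mult := m, one := e\<rparr>) S = nclosed V S" by (simp add: nclosed_def)

lemma closed_subspace_update [simp]: "closed_subspace (V\<lparr>mult := m, one := e\<rparr>) S = closed_subspace V S"
 by (simp add: closed_subspace_def)

locale snalg = seminormed av A + A?: ring A
 for av :: "'k::field_char_0 => real" and A :: "('k, 'v) nspace" (structure) +
 assumes mult_bilin: "bilin_map A A A (mult A)"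
begin

lemma sm_mult_l: "x |: A ==> y |: A ==> (a \<odot> x) \<otimes> y = a \<odot> (x \<otimes> y)" using bl_sm[OF bilin_left[OF mult_bilin]] .

lemma sm_mult_r: "x |: A ==> y |: A ==> x \<otimes> (a \<odot> y) = a \<odot> (x \<otimes> y)"
 using bl_sm[OF bilin_right[OF mult_bilin]] .

lemma mult_bl_l: "x |: A ==> bl A A (%y. x \<otimes> y)" using bilin_right[OF mult_bilin] .

lemma mult_bl_r: "y |: A ==> bl A A (%x. x \<otimes> y)" using bilin_left[OF mult_bilin] .

definition prodl :: "'v list => 'v" where "prodl xs = foldr (\<otimes>) xs \<one>"

lemma prodl_simps [simp]: "prodl [] = \<one>" "prodl (x # xs) = x \<otimes> prodl xs" by (simp_all add: prodl_def)

lemma prodl_cl [simp, intro]: "set xs \<subseteq> carrier A ==> prodl xs |: A" by (induction xs) auto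

lemma prodl_append: "set xs \<subseteq> carrier A ==> set ys \<subseteq> carrier A ==> prodl (xs @ ys) = prodl xs \<otimes> prodl ys"
 by (induction xs) (auto simp: m_assoc)

lemma comm_bilin: "bilin_map A A A (commutator A)"
proof -
 have "bilin_map A A A (%x y. x \<otimes> y \<oplus> (- 1) \<odot> (y \<otimes> x))"
  by (intro bilin_plus[OF seminormed_axioms seminormed_axioms seminormed_axioms mult_bilin]
    bilin_scale[OF seminormed_axioms seminormed_axioms seminormed_axioms] bilin_swap[OF mult_bilin])
 then show ?thesis by (simp add: bilin_map_def commutator_def sm_m1 minus_eq bounded_linear_map_def Pi_iff)
qed

lemma comm_cl [simp]: "x |: A ==> y |: A ==> commutator A x y |: A" by (simp add: commutator_def)

end

lemma banach_algebra_snalg: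
 assumes "na_field av" "banach_algebra av A"
 shows "snalg av A"
proof -
 have b: "banach_space av A" "ring A" using assms(2) by (simp_all add: banach_algebra_def)
 interpret seminormed av A by (rule banach_seminormed[OF assms(1) b(1)])
 interpret ring A by (rule b(2))
 obtain C where C: "\<forall>x\<in>carrier A. \<forall>y\<in>carrier A. nrm A (x \<otimes>\<^sub>A y) \<le> C * (nrm A x * nrm A y)"
  using assms(2) unfolding banach_algebra_def by blast
 have "bilin_map A A A (mult A)" by (rule bilinI[OF seminormed_axioms seminormed_axioms, where C = C])
    (use assms(2) C in \<open>auto simp: banach_algebra_def l_distr r_distr\<close>)
 then show ?thesis by unfold_locales
qed

section \<open>The analytic tensor algebra\<close>

text \<open>Summing over arbitrary finite sets around the keys makes convolution additive without
  regard to keys that cancel.\<close>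

lemma list_conv_eq:
 assumes "finite S" "finite T" "keys a \<subseteq> S" "keys b \<subseteq> T"
 shows "list_conv a b = (\<Sum>u\<in>S. \<Sum>v\<in>T. single (u @ v) (lookup a u * lookup b v))"
proof -
 have "list_conv a b = (\<Sum>u\<in>keys a. \<Sum>v\<in>T. single (u @ v) (lookup a u * lookup b v))"
  unfolding list_conv_def using assms by (intro sum.cong refl sum.mono_neutral_left) (auto simp: in_keys_iff)
 also have "\<dots> = (\<Sum>u\<in>S. \<Sum>v\<in>T. single (u @ v) (lookup a u * lookup b v))"
  using assms by (intro sum.mono_neutral_left) (auto simp: in_keys_iff)
 finally show ?thesis .
qed

lemma list_conv_add_left: "list_conv (a + b) c = list_conv a c + list_conv b c"
 using Poly_Mapping.keys_add[of a b] by (simp add: list_conv_eq[of "keys a \<union> keys b" "keys c"]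
   lookup_add distrib_right single_add sum.distrib)

lemma list_conv_add_right: "list_conv c (a + b) = list_conv c a + list_conv c b"
 using Poly_Mapping.keys_add[of a b] by (simp add: list_conv_eq[of "keys c" "keys a \<union> keys b"]
   lookup_add distrib_left single_add sum.distrib)

lemma keys_pscale: "keys (pscale c a) \<subseteq> keys a" by (auto simp: in_keys_iff)

lemma list_conv_pscale_left: "list_conv (pscale c a) b = pscale c (list_conv a b)" using keys_pscale[of c a]
 by (simp add: list_conv_eq[of "keys a" "keys b"] pscale_sum mult.assoc)

lemma list_conv_pscale_right: "list_conv a (pscale c b) = pscale c (list_conv a b)" using keys_pscale[of c b]
 by (simp add: list_conv_eq[of "keys a" "keys b"] pscale_sum mult.left_commute)

lemma list_conv_diff_left: "list_conv (a - b) c = list_conv a c - list_conv b c"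
 using list_conv_add_left[of a "- b" c] list_conv_pscale_left[of "-1" b c] by simp

lemma list_conv_diff_right: "list_conv c (a - b) = list_conv c a - list_conv c b"
 using list_conv_add_right[of c a "- b"] list_conv_pscale_right[of c "-1" b] by simp

lemma list_conv_single [simp]: "list_conv (single u c) (single v d) = single (u @ v) (c * d)"
 by (subst list_conv_eq[of "{u}" "{v}"]) auto

lemma list_conv_expand_right: "list_conv a b = (\<Sum>v\<in>keys b. pscale (lookup b v) (list_conv a (single v 1)))"
proof -
 have "list_conv a (single v 1) =
   (\<Sum>u\<in>keys a. single (u @ v) (lookup a u))" for v by (subst list_conv_eq[of "keys a" "{v}"]) auto
 then show ?thesis by (simp add: list_conv_def pscale_sum mult.commute) (rule sum.swap)
qed

lemma list_conv_expand_left: "list_conv a b = (\<Sum>u\<in>keys a. pscale (lookup a u) (list_conv (single u 1) b))"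
proof -
 have "list_conv (single u 1) b =
   (\<Sum>v\<in>keys b. single (u @ v) (lookup b v))" for u by (subst list_conv_eq[of "{u}" "keys b"]) auto
 then show ?thesis by (simp add: list_conv_def pscale_sum)
qed

lemma kspan_sum: "(!!i. i \<in> A ==> f i \<in> kspan R) ==> sum f A \<in> kspan R"
 by (induction A rule: infinite_finite_induct) (auto intro: kspan_add simp: kspan_0)

lemma (in pres) FG_sum: "(!!i. i \<in> A ==> f i \<in> FG) ==> sum f A \<in> FG"
 by (induction A rule: infinite_finite_induct) auto

lemma (in pres) wmax_sum:
 assumes "!!i. i \<in> A ==> f i \<in> FG" "!!i. i \<in> A ==> wmax av w (f i) \<le> B" "0 \<le> B"
 shows "wmax av w (sum f A) \<le> B" using assms(1,2)
proof (induction A rule: infinite_finite_induct)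
 case (insert x F)
 have "wmax av w (f x + sum f F) \<le> max (wmax av w (f x)) (wmax av w (sum f F))"
  using insert by (intro wmax_add FG_sum) auto
 also have "\<dots> \<le> B" using insert by simp
 finally show ?case using insert.hyps by simp
qed (use assms(3) in \<open>simp_all add: wmax_def\<close>)

lemma (in pres) Cau_bounded:
 assumes "X \<in> Cau"
 shows "\<exists>B>0. \<forall>n. sn (X n) \<le> B"
proof -
 have "Bseq (%n. sn (X n))" using sn_convergent[OF assms] convergentI convergent_imp_Bseq by blast
 then obtain B where "0 < B" "\<forall>n. norm (sn (X n)) \<le> B" unfolding Bseq_def by blast
 then show ?thesis using CauD(1)[OF assms] by (intro exI[of _ B]) auto
qed

lemma seminormed_rescale:
 assumes "seminormed av V" "0 \<le> c"
 shows "seminormed av (rescale c V)"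
proof -
 interpret seminormed av V by fact
 have "module kring (rescale c V)"
  using module_axioms by (simp add: rescale_def module_def module_axioms_def abelian_group_def
   abelian_group_axioms_def abelian_monoid_def)
 then show ?thesis by (intro seminormed.intro nonarch_axioms seminormed_axioms.intro)
    (use assms(2) mult_left_mono[OF norm_add assms(2)] in
    \<open>auto simp: rescale_def norm_smult max_mult_distrib_left\<close>)
qed

lemma rescale_simps [simp]:
 "carrier (rescale c V) = carrier V" "zero (rescale c V) = zero V" "add (rescale c V) = add V"
 "smult (rescale c V) = smult V" "nrm (rescale c V) x = c * nrm V x" "a_minus (rescale c V) = a_minus V"
 by (simp_all add: rescale_def a_minus_def a_inv_def fun_eq_iff)

lemma in_tpow_gens: "vs \<in> tpow_gens V n \<longleftrightarrow> set vs \<subseteq> carrier V \<and> length vs = n" by (simp add: tpow_gens_def)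

locale talg = seminormed av V for av :: "'k::field_char_0 => real" and V :: "('k, 'v) nspace" (structure) +
 fixes r :: real
 assumes r: "0 < r"
begin

lemma tpow_pres: "pres av (tpow_gens V n) (tpow_weight V) (tpow_rels V n)"
proof
 show "0 \<le> tpow_weight V g" if "g \<in> tpow_gens V n" for g
  using that by (auto simp: tpow_weight_def in_tpow_gens subset_iff intro!: prod_list_nonneg)
 show "keys t \<subseteq> tpow_gens V n" if t: "t \<in> tpow_rels V n" for t
 proof -
  have z: "lookup (single k c) g = 0" if "k \<in> tpow_gens V n" "g \<notin> tpow_gens V n" for k g and c :: 'k
   using that by (auto simp: lookup_single when_def)
  consider us ws v v' where "t = single (us @ [v \<oplus> v'] @ ws) 1 - single (us @ [v] @ ws) 1
     - single (us @ [v'] @ ws) 1" "us @ [v] @ ws \<in> tpow_gens V n" "v' |: V"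
   | us ws a v where "t = single (us @ [a \<odot> v] @ ws) 1 - single (us @ [v] @ ws) a"
     "us @ [v] @ ws \<in> tpow_gens V n" using t unfolding tpow_rels_def by blast
  then show ?thesis
  proof cases
   case 1
   then have k: "us @ [v \<oplus> v'] @ ws \<in> tpow_gens V n" "us @ [v'] @ ws \<in> tpow_gens V n"
    by (auto simp: in_tpow_gens)
   show ?thesis unfolding keys_subset_iff 1(1) lookup_minus
    using z[OF k(1), of _ 1] z[OF k(2), of _ 1] z[OF 1(2), of _ 1] by simp
  next
   case 2
   then have k: "us @ [a \<odot> v] @ ws \<in> tpow_gens V n" by (auto simp: in_tpow_gens)
   show ?thesis unfolding keys_subset_iff 2(1) lookup_minus using z[OF k, of _ 1] z[OF 2(2), of _ a] by simp
  qed
 qed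
qed

sublocale pw: pres av "tpow_gens V n" "tpow_weight V" "tpow_rels V n" for n by (rule tpow_pres)

abbreviation "sN n \<equiv> pres_seminorm av (tpow_gens V n) (tpow_weight V) (tpow_rels V n)"
abbreviation "cl n \<equiv> pres_class av (tpow_gens V n) (tpow_weight V) (tpow_rels V n)"
abbreviation "CAU n \<equiv> pres_cauchy av (tpow_gens V n) (tpow_weight V) (tpow_rels V n)"

text \<open>A relation followed by a word is again a relation of the same kind, with the word
  absorbed into the suffix \<open>ws\<close>. This is why concatenation descends to the
  quotients.\<close>

lemma conv_rel_right:
 assumes "t \<in> tpow_rels V l" "x \<in> tpow_gens V m"
 shows "list_conv t (single x 1) \<in> tpow_rels V (l + m)"
proof -
 consider us ws v v' where "t = single (us @ [v \<oplus> v'] @ ws) 1 - single (us @ [v] @ ws) 1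
    - single (us @ [v'] @ ws) 1" "us @ [v] @ ws \<in> tpow_gens V l" "v' |: V"
  | us ws a v where "t = single (us @ [a \<odot> v] @ ws) 1 - single (us @ [v] @ ws) a"
    "us @ [v] @ ws \<in> tpow_gens V l" using assms(1) unfolding tpow_rels_def by blast
 then show ?thesis
 proof cases
  case 1
  have "list_conv t (single x 1) = single (us @ [v \<oplus> v'] @ (ws @ x)) 1 - single (us @ [v] @ (ws @ x)) 1
    - single (us @ [v'] @ (ws @ x)) 1" by (simp add: 1 list_conv_diff_left)
  moreover have "us @ [v] @ (ws @ x) \<in> tpow_gens V (l + m)" using 1 assms(2) by (auto simp: in_tpow_gens)
  ultimately show ?thesis using 1(3) unfolding tpow_rels_def by blast
 next
  case 2
  have "list_conv t (single x 1) = single (us @ [a \<odot> v] @ (ws @ x)) 1 - single (us @ [v] @ (ws @ x)) a"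
   by (simp add: 2 list_conv_diff_left)
  moreover have "us @ [v] @ (ws @ x) \<in> tpow_gens V (l + m)" using 2 assms(2) by (auto simp: in_tpow_gens)
  ultimately show ?thesis unfolding tpow_rels_def by blast
 qed
qed

lemma conv_rel_left:
 assumes "t \<in> tpow_rels V l" "x \<in> tpow_gens V m"
 shows "list_conv (single x 1) t \<in> tpow_rels V (m + l)"
proof -
 consider us ws v v' where "t = single (us @ [v \<oplus> v'] @ ws) 1 - single (us @ [v] @ ws) 1
    - single (us @ [v'] @ ws) 1" "us @ [v] @ ws \<in> tpow_gens V l" "v' |: V"
  | us ws a v where "t = single (us @ [a \<odot> v] @ ws) 1 - single (us @ [v] @ ws) a"
    "us @ [v] @ ws \<in> tpow_gens V l" using assms(1) unfolding tpow_rels_def by blast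
 then show ?thesis
 proof cases
  case 1
  have "list_conv (single x 1) t = single ((x @ us) @ [v \<oplus> v'] @ ws) 1 - single ((x @ us) @ [v] @ ws) 1
    - single ((x @ us) @ [v'] @ ws) 1" by (simp add: 1 list_conv_diff_right)
  moreover have "(x @ us) @ [v] @ ws \<in> tpow_gens V (m + l)" using 1 assms(2) by (auto simp: in_tpow_gens)
  ultimately show ?thesis using 1(3) unfolding tpow_rels_def by blast
 next
  case 2
  have "list_conv (single x 1) t = single ((x @ us) @ [a \<odot> v] @ ws) 1 - single ((x @ us) @ [v] @ ws) a"
   by (simp add: 2 list_conv_diff_right)
  moreover have "(x @ us) @ [v] @ ws \<in> tpow_gens V (m + l)" using 2 assms(2) by (auto simp: in_tpow_gens)
  ultimately show ?thesis unfolding tpow_rels_def by blast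
 qed
qed

lemma conv_kspan_right:
 assumes "t \<in> kspan (tpow_rels V l)" "b \<in> pw.FG m"
 shows "list_conv t b \<in> kspan (tpow_rels V (l + m))" using assms(1)
proof (induction rule: kspan_induct)
 case zero
 then show ?case using list_conv_pscale_left[of 0 0 b] kspan_0 by simp
next
 case (step a c t)
 have "list_conv t b \<in> kspan (tpow_rels V (l + m))" unfolding list_conv_expand_right[of t b]
  by (rule kspan_sum, rule kspan_pscale, rule kspan_base, rule conv_rel_right[OF step(2)])
    (use assms(2) in \<open>auto simp: pw.FG_def\<close>)
 then show ?case using step by (auto simp: list_conv_add_left list_conv_pscale_left intro: kspan_add kspan_pscale)
qed

lemma conv_kspan_left:
 assumes "t \<in> kspan (tpow_rels V l)" "b \<in> pw.FG m"
 shows "list_conv b t \<in> kspan (tpow_rels V (m + l))" using assms(1)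
proof (induction rule: kspan_induct)
 case zero
 then show ?case using list_conv_pscale_right[of b 0 0] kspan_0 by simp
next
 case (step a c t)
 have "list_conv b t \<in> kspan (tpow_rels V (m + l))" unfolding list_conv_expand_left[of b t]
  by (rule kspan_sum, rule kspan_pscale, rule kspan_base, rule conv_rel_left[OF step(2)])
    (use assms(2) in \<open>auto simp: pw.FG_def\<close>)
 then show ?case using step by (auto simp: list_conv_add_right list_conv_pscale_right intro: kspan_add kspan_pscale)
qed

lemma conv_FG: "a \<in> pw.FG l ==> b \<in> pw.FG m ==> list_conv a b \<in> pw.FG (l + m)"
 unfolding list_conv_def by (intro pw.FG_sum pw.FG_simps) (auto simp: pw.FG_def in_tpow_gens subset_iff)

lemma conv_wmax:
 assumes "a \<in> pw.FG l" "b \<in> pw.FG m"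
 shows "wmax av (tpow_weight V) (list_conv a b) \<le> wmax av (tpow_weight V) a * wmax av (tpow_weight V) b"
 unfolding list_conv_def
proof (intro pw.wmax_sum[where n = "l + m"] pw.FG_sum)
 fix u v assume u: "u \<in> keys a" and v: "v \<in> keys b"
 then have uv: "u \<in> tpow_gens V l" "v \<in> tpow_gens V m" using assms by (auto simp: pw.FG_def)
 then show "single (u @ v) (lookup a u * lookup b v) \<in> pw.FG (l + m)"
  by (intro pw.FG_simps) (auto simp: in_tpow_gens)
 have "wmax av (tpow_weight V) (single (u @ v) (lookup a u * lookup b v))
   \<le> (av (lookup a u) * tpow_weight V u) * (av (lookup b v) * tpow_weight V v)"
  using pw.w_nonneg[OF uv(1)] pw.w_nonneg[OF uv(2)]
  by (intro pw.wmax_le) (auto simp: lookup_single when_def av_mult tpow_weight_def split: if_splits)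
 also have "\<dots> \<le> wmax av (tpow_weight V) a * wmax av (tpow_weight V) b"
  using pw.w_nonneg[OF uv(1)] pw.w_nonneg[OF uv(2)] by (intro mult_mono pw.wmax_ge) auto
 finally show "wmax av (tpow_weight V) (single (u @ v) (lookup a u * lookup b v))
   \<le> wmax av (tpow_weight V) a * wmax av (tpow_weight V) b" .
qed (use assms in \<open>auto simp: pw.FG_def in_tpow_gens subset_iff intro!: pw.FG_simps\<close>)

text \<open>The infima defining the seminorms need not be attained. Representatives within
  \<open>1 / real (Suc n)\<close> of the infimum are multiplied, and the resulting bound is passed
  to the limit.\<close>

lemma conv_sn:
 assumes a: "a \<in> pw.FG l" and b: "b \<in> pw.FG m"
 shows "sN (l + m) (list_conv a b) \<le> sN l a * sN m b"
proof (rule LIMSEQ_le_const)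
 have "(%n. 1 / real (Suc n)) \<longlonglongrightarrow> 0" using LIMSEQ_inverse_real_of_nat by (simp add: inverse_eq_divide)
 then have "(%n. (sN l a + 1 / real (Suc n)) * (sN m b + 1 / real (Suc n))) \<longlonglongrightarrow> (sN l a + 0) * (sN m b + 0)"
  by (intro tendsto_intros)
 then show "(%n. (sN l a + 1 / real (Suc n)) * (sN m b + 1 / real (Suc n))) \<longlonglongrightarrow> sN l a * sN m b" by simp
 have "sN (l + m) (list_conv a b) \<le> (sN l a + 1 / real (Suc n)) * (sN m b + 1 / real (Suc n))" for n
 proof -
  obtain a' where a': "a' \<in> pw.FG l" "a - a' \<in> kspan (tpow_rels V l)" "wmax av (tpow_weight V) a' < sN l a + 1 / real (Suc n)"
   using pw.sn_lessE[OF a, of "sN l a + 1 / real (Suc n)"] by auto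
  obtain b' where b': "b' \<in> pw.FG m" "b - b' \<in> kspan (tpow_rels V m)" "wmax av (tpow_weight V) b' < sN m b + 1 / real (Suc n)"
   using pw.sn_lessE[OF b, of "sN m b + 1 / real (Suc n)"] by auto
  have "list_conv a b - list_conv a' b' = list_conv (a - a') b + list_conv a' (b - b')"
   by (simp add: list_conv_diff_left list_conv_diff_right)
  then have "sN (l + m) (list_conv a b) \<le> wmax av (tpow_weight V) (list_conv a' b')"
   using conv_kspan_right[OF a'(2) b] conv_kspan_left[OF b'(2) a'(1)]
   by (intro pw.sn_le conv_FG a' b') (auto intro: kspan_add)
  also have "\<dots> \<le> wmax av (tpow_weight V) a' * wmax av (tpow_weight V) b'" by (rule conv_wmax[OF a'(1) b'(1)])
  also have "\<dots> \<le> (sN l a + 1 / real (Suc n)) * (sN m b + 1 / real (Suc n))"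
   using a' b' pw.wmax_nonneg by (intro mult_mono) (auto intro: add_nonneg_nonneg pw.sn_nonneg[OF a])
  finally show ?thesis .
 qed
 then show "\<exists>N. \<forall>n\<ge>N. sN (l + m) (list_conv a b) \<le> (sN l a + 1 / real (Suc n)) * (sN m b + 1 / real (Suc n))" by blast
qed

text \<open>Adding and subtracting the mixed product of \<open>a\<close> and \<open>b'\<close>
  leaves just these two vectors to be bounded. The estimate gives both that products of Cauchy
  sequences are Cauchy and that the class of a product does not depend on representatives.\<close>

lemma conv_diff_sn:
 assumes F: "a \<in> pw.FG l" "a' \<in> pw.FG l" "b \<in> pw.FG m" "b' \<in> pw.FG m" and B: "sN l a \<le> B" "sN m b' \<le> B"
 shows "sN (l + m) (list_conv a' b' - list_conv a b) \<le> B * max (sN l (a' - a)) (sN m (b' - b))"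
proof -
 have B0: "0 \<le> B" using pw.sn_nonneg[OF F(1)] B by simp
 have d: "a' - a \<in> pw.FG l" "b' - b \<in> pw.FG m" using F by auto
 have "list_conv a' b' - list_conv a b = list_conv (a' - a) b' + list_conv a (b' - b)"
  by (simp add: list_conv_diff_left list_conv_diff_right)
 then have "sN (l + m) (list_conv a' b' - list_conv a b)
   \<le> max (sN (l + m) (list_conv (a' - a) b')) (sN (l + m) (list_conv a (b' - b)))"
  using pw.sn_add[OF conv_FG[OF d(1) F(4)] conv_FG[OF F(1) d(2)]] by simp
 also have "\<dots> \<le> B * max (sN l (a' - a)) (sN m (b' - b))"
 proof (rule max.boundedI)
  have "sN (l + m) (list_conv (a' - a) b') \<le> sN l (a' - a) * sN m b'" by (rule conv_sn[OF d(1) F(4)])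
  also have "\<dots> \<le> max (sN l (a' - a)) (sN m (b' - b)) * B"
   using B pw.sn_nonneg[OF d(1)] pw.sn_nonneg[OF F(4)] by (intro mult_mono) (auto simp: le_max_iff_disj)
  finally show "sN (l + m) (list_conv (a' - a) b') \<le> B * max (sN l (a' - a)) (sN m (b' - b))" by (simp add: mult.commute)
  have "sN (l + m) (list_conv a (b' - b)) \<le> sN l a * sN m (b' - b)" by (rule conv_sn[OF F(1) d(2)])
  also have "\<dots> \<le> B * max (sN l (a' - a)) (sN m (b' - b))"
   using B B0 pw.sn_nonneg[OF d(2)] by (intro mult_mono) auto
  finally show "sN (l + m) (list_conv a (b' - b)) \<le> B * max (sN l (a' - a)) (sN m (b' - b))" .
 qed
 finally show ?thesis .
qed

lemma conv_Cau:
 assumes X: "X \<in> CAU l" and Y: "Y \<in> CAU m"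
 shows "(%n. list_conv (X n) (Y n)) \<in> CAU (l + m)"
proof (rule pw.CauI)
 fix e :: real assume e: "0 < e"
 obtain A where A: "0 < A" "\<forall>n. sN l (X n) \<le> A" using pw.Cau_bounded[OF X] by blast
 obtain B where B: "0 < B" "\<forall>n. sN m (Y n) \<le> B" using pw.Cau_bounded[OF Y] by blast
 let ?B = "max A B"
 have B0: "0 < ?B" using A by simp
 then have e': "0 < e / ?B" using e by simp
 obtain N where N: "\<forall>i\<ge>N. \<forall>j\<ge>N. sN l (X i - X j) < e / ?B" using pw.CauD(2)[OF X e'] by blast
 obtain M where M: "\<forall>i\<ge>M. \<forall>j\<ge>M. sN m (Y i - Y j) < e / ?B" using pw.CauD(2)[OF Y e'] by blast
 have "sN (l + m) (list_conv (X i) (Y i) - list_conv (X j) (Y j)) < e" if ij: "i \<ge> max N M" "j \<ge> max N M" for i j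
 proof -
  have "sN (l + m) (list_conv (X i) (Y i) - list_conv (X j) (Y j)) \<le> ?B * max (sN l (X i - X j)) (sN m (Y i - Y j))"
   using A B by (intro conv_diff_sn pw.CauD(1)[OF X] pw.CauD(1)[OF Y]) (auto simp: le_max_iff_disj)
  also have "\<dots> < ?B * (e / ?B)" using B0 N M ij by (intro mult_strict_left_mono) auto
  finally show ?thesis using B0 by simp
 qed
 then show "\<exists>N. \<forall>i\<ge>N. \<forall>j\<ge>N. sN (l + m) (list_conv (X i) (Y i) - list_conv (X j) (Y j)) < e"
  by (intro exI[of _ "max N M"]) simp
qed (intro conv_FG pw.CauD(1)[OF X] pw.CauD(1)[OF Y])

lemma tpow_mult_cl:
 assumes X: "X \<in> CAU l" and Y: "Y \<in> CAU m"
 shows "tpow_mult av V l m (cl l X) (cl m Y) = cl (l + m) (%n. list_conv (X n) (Y n))"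
proof -
 have eq: "cl (l + m) (%n. list_conv (X' n) (Y' n)) = cl (l + m) (%n. list_conv (X n) (Y n))"
  if "X' \<in> cl l X" "Y' \<in> cl m Y" for X' Y'
 proof -
  have X': "X' \<in> CAU l" "(%n. sN l (X' n - X n)) \<longlonglongrightarrow> 0" using that by (auto simp: pres_class_def)
  have Y': "Y' \<in> CAU m" "(%n. sN m (Y' n - Y n)) \<longlonglongrightarrow> 0" using that by (auto simp: pres_class_def)
  obtain A where A: "0 < A" "\<forall>n. sN l (X n) \<le> A" using pw.Cau_bounded[OF X] by blast
  obtain B where B: "0 < B" "\<forall>n. sN m (Y' n) \<le> B" using pw.Cau_bounded[OF Y'(1)] by blast
  have le: "sN (l + m) (list_conv (X' n) (Y' n) - list_conv (X n) (Y n)) \<le> max A B * max (sN l (X' n - X n)) (sN m (Y' n - Y n))" for n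
   using A B by (intro conv_diff_sn pw.CauD(1)[OF X] pw.CauD(1)[OF Y] pw.CauD(1)[OF X'(1)] pw.CauD(1)[OF Y'(1)])
     (auto simp: le_max_iff_disj)
  have "(%n. sN (l + m) (list_conv (X' n) (Y' n) - list_conv (X n) (Y n))) \<longlonglongrightarrow> 0"
  proof (rule tendsto_sandwich[OF _ _ tendsto_const])
   show "(%n. max A B * max (sN l (X' n - X n)) (sN m (Y' n - Y n))) \<longlonglongrightarrow> 0"
    using tendsto_mult_left[OF tendsto_max[OF X'(2) Y'(2)], of "max A B"] by simp
   show "\<forall>\<^sub>F n in sequentially. sN (l + m) (list_conv (X' n) (Y' n) - list_conv (X n) (Y n)) \<le> max A B * max (sN l (X' n - X n)) (sN m (Y' n - Y n))"
    using le by simp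
   show "\<forall>\<^sub>F n in sequentially. 0 \<le> sN (l + m) (list_conv (X' n) (Y' n) - list_conv (X n) (Y n))"
    by (intro always_eventually allI pw.sn_nonneg pw.FG_simps conv_FG pw.CauD(1)[OF X] pw.CauD(1)[OF Y] pw.CauD(1)[OF X'(1)] pw.CauD(1)[OF Y'(1)])
  qed
  then show ?thesis using pw.cl_eq[OF conv_Cau[OF X'(1) Y'(1)] conv_Cau[OF X Y]] by simp
 qed
 have "tpow_mult av V l m (cl l X) (cl m Y) = (\<Union>X'\<in>cl l X. \<Union>Y'\<in>cl m Y. cl (l + m) (%n. list_conv (X' n) (Y' n)))"
  by (simp add: tpow_mult_def tpow_class_def)
 also have "\<dots> = (\<Union>X'\<in>cl l X. \<Union>Y'\<in>cl m Y. cl (l + m) (%n. list_conv (X n) (Y n)))"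
  using eq by (intro SUP_cong refl) auto
 also have "\<dots> = cl (l + m) (%n. list_conv (X n) (Y n))" using pw.cl_self[OF X] pw.cl_self[OF Y] by auto
 finally show ?thesis .
qed

abbreviation "TP n \<equiv> tpow av V n"

lemma TP_seminormed: "seminormed av (TP n)" and TP_separated: "separated (TP n)"
 unfolding tpow_def by (rule pw.P_seminormed, rule pw.P_separated)

lemma TP_carrierE:
 assumes "p |: (TP n)"
 obtains X where "X \<in> CAU n" "p = cl n X" using assms unfolding tpow_def pw.P_carrier by blast

lemma tpow_mult_norm:
 assumes "p |: (TP l)" "q |: (TP m)"
 shows "nrm (TP (l + m)) (tpow_mult av V l m p q) \<le> nrm (TP l) p * nrm (TP m) q"
proof -
 obtain X where X: "X \<in> CAU l" "p = cl l X" using TP_carrierE[OF assms(1)] .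
 obtain Y where Y: "Y \<in> CAU m" "q = cl m Y" using TP_carrierE[OF assms(2)] .
 show ?thesis unfolding X(2) Y(2) tpow_mult_cl[OF X(1) Y(1)] tpow_def
 proof (rule LIMSEQ_le)
  show "(%n. sN (l + m) (list_conv (X n) (Y n))) \<longlonglongrightarrow> nrm (pw.P (l + m)) (cl (l + m) (%n. list_conv (X n) (Y n)))"
   by (rule pw.P_norm[OF conv_Cau[OF X(1) Y(1)]])
  show "(%n. sN l (X n) * sN m (Y n)) \<longlonglongrightarrow> nrm (pw.P l) (cl l X) * nrm (pw.P m) (cl m Y)"
   by (rule tendsto_mult[OF pw.P_norm[OF X(1)] pw.P_norm[OF Y(1)]])
  show "\<exists>N. \<forall>n\<ge>N. sN (l + m) (list_conv (X n) (Y n)) \<le> sN l (X n) * sN m (Y n)"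
   using conv_sn[OF pw.CauD(1)[OF X(1)] pw.CauD(1)[OF Y(1)]] by blast
 qed
qed

lemma tpow_mult_bilin: "bilin_map (TP l) (TP m) (TP (l + m)) (tpow_mult av V l m)"
proof (rule bilinI[OF TP_seminormed TP_seminormed, where C = 1])
 fix p q p' q' a assume p: "p |: (TP l)" and q: "q |: (TP m)"
 obtain X where X: "X \<in> CAU l" "p = cl l X" using TP_carrierE[OF p] .
 obtain Y where Y: "Y \<in> CAU m" "q = cl m Y" using TP_carrierE[OF q] .
 show "tpow_mult av V l m p q |: (TP (l + m))"
  using conv_Cau[OF X(1) Y(1)] by (simp add: X Y tpow_mult_cl tpow_def)
 show "tpow_mult av V l m (a \<odot>\<^bsub>TP l\<^esub> p) q = a \<odot>\<^bsub>TP (l + m)\<^esub> tpow_mult av V l m p q"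
  using conv_Cau[OF X(1) Y(1)] X(1) Y(1) pw.Cau_pscale[OF X(1), of a]
  by (simp add: X(2) Y(2) tpow_mult_cl tpow_def pw.P_sm list_conv_pscale_left)
 show "tpow_mult av V l m p (a \<odot>\<^bsub>TP m\<^esub> q) = a \<odot>\<^bsub>TP (l + m)\<^esub> tpow_mult av V l m p q"
  using conv_Cau[OF X(1) Y(1)] X(1) Y(1) pw.Cau_pscale[OF Y(1), of a]
  by (simp add: X(2) Y(2) tpow_mult_cl tpow_def pw.P_sm list_conv_pscale_right)
 show "nrm (TP (l + m)) (tpow_mult av V l m p q) \<le> 1 * (nrm (TP l) p * nrm (TP m) q)"
  using tpow_mult_norm[OF p q] by simp
 {
  assume "p' |: (TP l)"
  then obtain X' where X': "X' \<in> CAU l" "p' = cl l X'" by (rule TP_carrierE)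
  show "tpow_mult av V l m (p \<oplus>\<^bsub>TP l\<^esub> p') q = tpow_mult av V l m p q \<oplus>\<^bsub>TP (l + m)\<^esub> tpow_mult av V l m p' q"
   using conv_Cau[OF X(1) Y(1)] conv_Cau[OF X'(1) Y(1)] X(1) Y(1) X'(1) pw.Cau_add[OF X(1) X'(1)]
   by (simp add: X(2) Y(2) X'(2) tpow_mult_cl tpow_def pw.P_add list_conv_add_left)
 }
 {
  assume "q' |: (TP m)"
  then obtain Y' where Y': "Y' \<in> CAU m" "q' = cl m Y'" by (rule TP_carrierE)
  show "tpow_mult av V l m p (q \<oplus>\<^bsub>TP m\<^esub> q') = tpow_mult av V l m p q \<oplus>\<^bsub>TP (l + m)\<^esub> tpow_mult av V l m p q'"
   using conv_Cau[OF X(1) Y(1)] conv_Cau[OF X(1) Y'(1)] X(1) Y(1) Y'(1) pw.Cau_add[OF Y(1) Y'(1)]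
   by (simp add: X(2) Y(2) Y'(2) tpow_mult_cl tpow_def pw.P_add list_conv_add_right)
 }
qed

abbreviation "ptp vs \<equiv> pure_tpow av V (length vs) vs"

lemma pure_tpow_emb: "pure_tpow av V n vs = pw.emb n (single vs 1)"
 by (simp add: pure_tpow_def tpow_class_def pw.emb_def)

lemma pure_tpow_cl [simp]: "set vs \<subseteq> carrier V ==> length vs = n ==> pure_tpow av V n vs |: (TP n)"
 unfolding pure_tpow_emb tpow_def by (intro pw.emb_simps pw.FG_simps) (simp add: in_tpow_gens)

lemma tpow_mult_pure:
 assumes "set us \<subseteq> carrier V" "set vs \<subseteq> carrier V" "length us = l" "length vs = m"
 shows "tpow_mult av V l m (pure_tpow av V l us) (pure_tpow av V m vs) = pure_tpow av V (l + m) (us @ vs)"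
proof -
 have "us \<in> tpow_gens V l" "vs \<in> tpow_gens V m" using assms by (auto simp: in_tpow_gens)
 then show ?thesis unfolding pure_tpow_emb pw.emb_def
  by (subst tpow_mult_cl) (auto intro!: pw.Cau_const pw.FG_simps)
qed

abbreviation "T \<equiv> tens_alg av r V"
abbreviation "TX \<equiv> %n. rescale (r ^ n) (TP n)"

sublocale cc: c0 av UNIV TX
 by (intro c0.intro nonarch_axioms c0_axioms.intro seminormed_rescale TP_seminormed) (use r in simp)

lemma T_def: "T = cc.C\<lparr>mult := mult T, one := one T\<rparr>" by (simp add: tens_alg_def)

lemma T_seminormed: "seminormed av T" using cc.C_seminormed by (subst T_def) simp

lemma T_separated: "separated T"
proof -
 have "separated (TX n)" for n using TP_separated[of n] r by (simp add: separated_def)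
 then show ?thesis using cc.C_separated by (subst T_def) simp
qed

lemma T_simps: "carrier T = carrier cc.C" "add T = add cc.C" "zero T = zero cc.C" "smult T = smult cc.C" "nrm T = nrm cc.C"
 by (simp_all add: tens_alg_def)

lemma T_mult: "(x \<otimes>\<^sub>T y) n = (\<Oplus>\<^bsub>TP n\<^esub>l\<in>{..n}. tpow_mult av V l (n - l) (x l) (y (n - l)))"
 by (simp add: tens_alg_def)

lemma T_mult_term:
 assumes "x |: T" "y |: T" "l \<le> n"
 shows "tpow_mult av V l (n - l) (x l) (y (n - l)) |: (TP n)"
  and "r ^ n * nrm (TP n) (tpow_mult av V l (n - l) (x l) (y (n - l)))
   \<le> (r ^ l * nrm (TP l) (x l)) * (r ^ (n - l) * nrm (TP (n - l)) (y (n - l)))"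
proof -
 have xy: "x l |: (TP l)" "y (n - l) |: (TP (n - l))"
  using assms cc.C_cl[of x l] cc.C_cl[of y "n - l"] by (simp_all add: T_simps)
 have n: "l + (n - l) = n" using assms by simp
 show "tpow_mult av V l (n - l) (x l) (y (n - l)) |: (TP n)"
  using bilin_closed[OF tpow_mult_bilin xy] n by simp
 have "r ^ n = r ^ l * r ^ (n - l)" using n by (metis power_add)
 then show "r ^ n * nrm (TP n) (tpow_mult av V l (n - l) (x l) (y (n - l)))
   \<le> (r ^ l * nrm (TP l) (x l)) * (r ^ (n - l) * nrm (TP (n - l)) (y (n - l)))"
  using tpow_mult_norm[OF xy] n r mult_left_mono[of _ _ "r ^ l * r ^ (n - l)"] by (simp add: mult_ac)
qed

lemma T_mult_norm_le:
 assumes "x |: T" "y |: T" "0 \<le> B"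
  and "!!l. l \<le> n ==> (r ^ l * nrm (TP l) (x l)) * (r ^ (n - l) * nrm (TP (n - l)) (y (n - l))) \<le> B"
 shows "r ^ n * nrm (TP n) ((x \<otimes>\<^sub>T y) n) \<le> B"
proof -
 interpret TX: seminormed av "TX n" by (rule cc.X) simp
 have fs: "finsum (TX n) = finsum (TP n)" by (simp add: rescale_def finsum_def)
 have "nrm (TX n) ((\<Oplus>\<^bsub>TX n\<^esub>l\<in>{..n}. tpow_mult av V l (n - l) (x l) (y (n - l)))) \<le> B"
 proof (rule TX.norm_finsum_le[OF _ _ assms(3)])
  show "nrm (TX n) (tpow_mult av V l (n - l) (x l) (y (n - l))) \<le> B" if "l \<in> {..n}" for l
   using T_mult_term(2)[OF assms(1,2), of l n] assms(4)[of l] that by simp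
 qed (use T_mult_term(1)[OF assms(1,2)] in auto)
 then show ?thesis by (simp add: T_mult fs)
qed

lemma T_coord_bound: "x |: T ==> 0 \<le> r ^ l * nrm (TP l) (x l)" "x |: T ==> r ^ l * nrm (TP l) (x l) \<le> nrm T x"
 using seminormed.norm_nonneg[OF cc.X cc.C_cl, of l x] cc.norm_ge[of x l] by (simp_all add: T_simps)

text \<open>The convolution of two families tending to zero tends to zero: in high total degree at
  least one of the two degrees is high, so one factor is small while the other stays
  bounded.\<close>

lemma T_mult_cl:
 assumes x: "x |: T" and y: "y |: T"
 shows "x \<otimes>\<^sub>T y \<in> carrier T"
proof -
 have nc: "(x \<otimes>\<^sub>T y) n |: (TP n)" for n
 proof -
  interpret TP: seminormed av "TP n" by (rule TP_seminormed)
  show ?thesis unfolding T_mult by (intro TP.M.finsum_closed) (auto intro: T_mult_term(1)[OF x y])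
 qed
 have "finite {n. e \<le> r ^ n * nrm (TP n) ((x \<otimes>\<^sub>T y) n)}" if e: "0 < e" for e
 proof -
  \<comment> \<open>The summand 1 makes \<open>B\<close> positive, so that dividing by it is
    legitimate.\<close>
  define B where "B = max (nrm T x) (nrm T y) + 1"
  have B: "0 < B" "nrm T x \<le> B" "nrm T y \<le> B" using T_coord_bound[OF x, of 0] by (auto simp: B_def)
  have e2: "0 < e / (2 * B)" using e B by simp
  have "finite {n. e / (2 * B) \<le> r ^ n * nrm (TP n) (x n)}" "finite {n. e / (2 * B) \<le> r ^ n * nrm (TP n) (y n)}"
   using x y e2 by (auto simp: T_simps cc.C_iff)
  then obtain N where N: "!!n. n \<ge> N ==> r ^ n * nrm (TP n) (x n) < e / (2 * B) \<and> r ^ n * nrm (TP n) (y n) < e / (2 * B)"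
  proof -
   assume f: "finite {n. e / (2 * B) \<le> r ^ n * nrm (TP n) (x n)}" "finite {n. e / (2 * B) \<le> r ^ n * nrm (TP n) (y n)}"
   then obtain N where "\<forall>n\<in>{n. e / (2 * B) \<le> r ^ n * nrm (TP n) (x n)} \<union> {n. e / (2 * B) \<le> r ^ n * nrm (TP n) (y n)}. n < N"
    using finite_nat_set_iff_bounded[THEN iffD1, OF finite_UnI[OF f]] by blast
   then show thesis by (intro that[of N]) (auto simp: not_le[symmetric])
  qed
  have "r ^ n * nrm (TP n) ((x \<otimes>\<^sub>T y) n) < e" if n: "n \<ge> 2 * N" for n
  proof -
   have "r ^ n * nrm (TP n) ((x \<otimes>\<^sub>T y) n) \<le> e / 2"
   proof (rule T_mult_norm_le[OF x y])
    fix l assume l: "l \<le> n"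
    have bx: "0 \<le> r ^ l * nrm (TP l) (x l)" "r ^ l * nrm (TP l) (x l) \<le> B"
     and bY: "0 \<le> r ^ (n - l) * nrm (TP (n - l)) (y (n - l))" "r ^ (n - l) * nrm (TP (n - l)) (y (n - l)) \<le> B"
     using T_coord_bound[OF x, of l] T_coord_bound[OF y, of "n - l"] B by auto
    have eB: "e / (2 * B) * B = e / 2" "B * (e / (2 * B)) = e / 2" using B by auto
    \<comment> \<open>This is where \<open>n \<ge> 2 * N\<close> is used: the two degrees cannot
      both be below \<open>N\<close>.\<close>
    consider "l \<ge> N" | "n - l \<ge> N" using n l by linarith
    then show "(r ^ l * nrm (TP l) (x l)) * (r ^ (n - l) * nrm (TP (n - l)) (y (n - l))) \<le> e / 2"
    proof cases
     case 1
     then have "(r ^ l * nrm (TP l) (x l)) * (r ^ (n - l) * nrm (TP (n - l)) (y (n - l))) \<le> e / (2 * B) * B"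
      using bx bY N[OF 1] e2 by (intro mult_mono) auto
     then show ?thesis using eB by simp
    next
     case 2
     then have "(r ^ l * nrm (TP l) (x l)) * (r ^ (n - l) * nrm (TP (n - l)) (y (n - l))) \<le> B * (e / (2 * B))"
      using bx bY N[OF 2] e2 B by (intro mult_mono) auto
     then show ?thesis using eB by simp
    qed
   qed (use e in simp)
   then show ?thesis using e by simp
  qed
  then have "{n. e \<le> r ^ n * nrm (TP n) ((x \<otimes>\<^sub>T y) n)} \<subseteq> {..<2 * N}" by (auto simp: not_le[symmetric])
  then show ?thesis using finite_subset by blast
 qed
 then show ?thesis using nc by (simp add: T_simps cc.C_iff)
qed

lemma T_mult_norm:
 assumes x: "x |: T" and y: "y |: T"
 shows "nrm T (x \<otimes>\<^sub>T y) \<le> nrm T x * nrm T y"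
proof -
 interpret T: seminormed av T by (rule T_seminormed)
 have "nrm cc.C (x \<otimes>\<^sub>T y) \<le> nrm T x * nrm T y"
 proof (rule cc.norm_le)
  show "0 \<le> nrm T x * nrm T y" using x y by simp
  show "nrm (TX n) ((x \<otimes>\<^sub>T y) n) \<le> nrm T x * nrm T y" for n
   using T_mult_norm_le[OF x y, of "nrm T x * nrm T y" n] x y
    mult_mono[OF T_coord_bound(2)[OF x] T_coord_bound(2)[OF y] _ T_coord_bound(1)[OF y]] by simp
 qed
 then show ?thesis by (simp add: T_simps)
qed

lemma T_bilin: "bilin_map T T T (mult T)"
proof (rule bilinI[OF T_seminormed T_seminormed, where C = 1])
 fix x y z a assume x: "x |: T" and y: "y |: T"
 show "x \<otimes>\<^sub>T y |: T" by (rule T_mult_cl[OF x y])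
 show "nrm T (x \<otimes>\<^sub>T y) \<le> 1 * (nrm T x * nrm T y)" using T_mult_norm[OF x y] by simp
 have c: "x l |: (TP l)" if "x |: T" for x l using cc.C_cl[of x l] that by (simp add: T_simps)
 have b: "bl (TP (n - l)) (TP n) (tpow_mult av V l (n - l) p)" if "l \<le> n" "p |: (TP l)" for n l p
  using bilin_right[OF tpow_mult_bilin[of l "n - l"] that(2)] that(1) by simp
 have b': "bl (TP l) (TP n) (%p. tpow_mult av V l (n - l) p q)" if "l \<le> n" "q |: (TP (n - l))" for n l q
  using bilin_left[OF tpow_mult_bilin[of l "n - l"] that(2)] that(1) by simp
 show "(a \<odot>\<^sub>T x) \<otimes>\<^sub>T y = a \<odot>\<^sub>T (x \<otimes>\<^sub>T y)"
 proof
  fix n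
  interpret TP: seminormed av "TP n" by (rule TP_seminormed)
  have "((a \<odot>\<^sub>T x) \<otimes>\<^sub>T y) n = (\<Oplus>\<^bsub>TP n\<^esub>l\<in>{..n}. a \<odot>\<^bsub>TP n\<^esub> tpow_mult av V l (n - l) (x l) (y (n - l)))"
   unfolding T_mult using T_mult_term(1)[OF x y] bl_sm[OF b' c[OF x]] c[OF y]
   by (intro TP.M.finsum_cong') (auto simp: T_simps cc.C_simps)
  also have "\<dots> = (a \<odot>\<^sub>T (x \<otimes>\<^sub>T y)) n"
   using T_mult_term(1)[OF x y] by (simp add: T_simps cc.C_simps T_mult TP.finsum_sm)
  finally show "((a \<odot>\<^sub>T x) \<otimes>\<^sub>T y) n = (a \<odot>\<^sub>T (x \<otimes>\<^sub>T y)) n" .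
 qed
 show "x \<otimes>\<^sub>T (a \<odot>\<^sub>T y) = a \<odot>\<^sub>T (x \<otimes>\<^sub>T y)"
 proof
  fix n
  interpret TP: seminormed av "TP n" by (rule TP_seminormed)
  have "(x \<otimes>\<^sub>T (a \<odot>\<^sub>T y)) n = (\<Oplus>\<^bsub>TP n\<^esub>l\<in>{..n}. a \<odot>\<^bsub>TP n\<^esub> tpow_mult av V l (n - l) (x l) (y (n - l)))"
   unfolding T_mult using T_mult_term(1)[OF x y] bl_sm[OF b[OF _ c[OF x]] c[OF y]]
   by (intro TP.M.finsum_cong') (auto simp: T_simps cc.C_simps)
  also have "\<dots> = (a \<odot>\<^sub>T (x \<otimes>\<^sub>T y)) n"
   using T_mult_term(1)[OF x y] by (simp add: T_simps cc.C_simps T_mult TP.finsum_sm)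
  finally show "(x \<otimes>\<^sub>T (a \<odot>\<^sub>T y)) n = (a \<odot>\<^sub>T (x \<otimes>\<^sub>T y)) n" .
 qed
 assume z: "z |: T"
 show "x \<otimes>\<^sub>T (y \<oplus>\<^sub>T z) = x \<otimes>\<^sub>T y \<oplus>\<^sub>T x \<otimes>\<^sub>T z"
 proof
  fix n
  interpret TP: seminormed av "TP n" by (rule TP_seminormed)
  have "(x \<otimes>\<^sub>T (y \<oplus>\<^sub>T z)) n = (\<Oplus>\<^bsub>TP n\<^esub>l\<in>{..n}. tpow_mult av V l (n - l) (x l) (y (n - l)) \<oplus>\<^bsub>TP n\<^esub> tpow_mult av V l (n - l) (x l) (z (n - l)))"
   unfolding T_mult using T_mult_term(1)[OF x y] T_mult_term(1)[OF x z] bl_add[OF b[OF _ c[OF x]] c[OF y] c[OF z]]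
   by (intro TP.M.finsum_cong') (auto simp: T_simps cc.C_simps)
  also have "\<dots> = (x \<otimes>\<^sub>T y \<oplus>\<^sub>T x \<otimes>\<^sub>T z) n"
   using T_mult_term(1)[OF x y] T_mult_term(1)[OF x z] by (simp add: T_simps cc.C_simps T_mult TP.M.finsum_addf)
  finally show "(x \<otimes>\<^sub>T (y \<oplus>\<^sub>T z)) n = (x \<otimes>\<^sub>T y \<oplus>\<^sub>T x \<otimes>\<^sub>T z) n" .
 qed
next
 fix x y z assume x: "x |: T" and z: "z |: T" and y: "y |: T"
 have c: "x l |: (TP l)" if "x |: T" for x l using cc.C_cl[of x l] that by (simp add: T_simps)
 have b': "bl (TP l) (TP n) (%p. tpow_mult av V l (n - l) p q)" if "l \<le> n" "q |: (TP (n - l))" for n l q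
  using bilin_left[OF tpow_mult_bilin[of l "n - l"] that(2)] that(1) by simp
 show "(x \<oplus>\<^sub>T z) \<otimes>\<^sub>T y = x \<otimes>\<^sub>T y \<oplus>\<^sub>T z \<otimes>\<^sub>T y"
 proof
  fix n
  interpret TP: seminormed av "TP n" by (rule TP_seminormed)
  have "((x \<oplus>\<^sub>T z) \<otimes>\<^sub>T y) n = (\<Oplus>\<^bsub>TP n\<^esub>l\<in>{..n}. tpow_mult av V l (n - l) (x l) (y (n - l)) \<oplus>\<^bsub>TP n\<^esub> tpow_mult av V l (n - l) (z l) (y (n - l)))"
   unfolding T_mult using T_mult_term(1)[OF x y] T_mult_term(1)[OF z y] bl_add[OF b' c[OF x] c[OF z]] c[OF y]
   by (intro TP.M.finsum_cong') (auto simp: T_simps cc.C_simps)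
  also have "\<dots> = (x \<otimes>\<^sub>T y \<oplus>\<^sub>T z \<otimes>\<^sub>T y) n"
   using T_mult_term(1)[OF x y] T_mult_term(1)[OF z y] by (simp add: T_simps cc.C_simps T_mult TP.M.finsum_addf)
  finally show "((x \<oplus>\<^sub>T z) \<otimes>\<^sub>T y) n = (x \<otimes>\<^sub>T y \<oplus>\<^sub>T z \<otimes>\<^sub>T y) n" .
 qed
qed

lemma T_delta_mult:
 assumes p: "p |: (TP l)" and q: "q |: (TP m)"
 shows "cc.\<delta> l p \<otimes>\<^sub>T cc.\<delta> m q = cc.\<delta> (l + m) (tpow_mult av V l m p q)"
proof
 fix n
 interpret TP: seminormed av "TP n" by (rule TP_seminormed)
 have z: "tpow_mult av V i (n - i) a \<zero>\<^bsub>TP (n - i)\<^esub> = \<zero>\<^bsub>TP n\<^esub>" if "i \<le> n" "a |: (TP i)" for i a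
  using bl_zero[OF TP_seminormed TP_seminormed bilin_right[OF tpow_mult_bilin[of i "n - i"] that(2)]] that(1) by simp
 have z': "tpow_mult av V i (n - i) \<zero>\<^bsub>TP i\<^esub> b = \<zero>\<^bsub>TP n\<^esub>" if "i \<le> n" "b |: (TP (n - i))" for i b
  using bl_zero[OF TP_seminormed TP_seminormed bilin_left[OF tpow_mult_bilin[of i "n - i"] that(2)]] that(1) by simp
 have zc: "\<zero>\<^bsub>TP j\<^esub> |: (TP j)" for j using seminormed.zero_cl[OF TP_seminormed] .
 have t: "tpow_mult av V i (n - i) (cc.\<delta> l p i) (cc.\<delta> m q (n - i)) =
   (if i = l \<and> n = l + m then tpow_mult av V l m p q else \<zero>\<^bsub>TP n\<^esub>)" if "i \<le> n" for i
  using that p q z z' zc by (auto simp: c0_delta_def)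
 have "(cc.\<delta> l p \<otimes>\<^sub>T cc.\<delta> m q) n = (\<Oplus>\<^bsub>TP n\<^esub>i\<in>{..n}. if i = l \<and> n = l + m then tpow_mult av V l m p q else \<zero>\<^bsub>TP n\<^esub>)"
  unfolding T_mult using t bilin_closed[OF tpow_mult_bilin p q] by (intro TP.M.finsum_cong') auto
 also have "\<dots> = cc.\<delta> (l + m) (tpow_mult av V l m p q) n"
 proof (cases "n = l + m")
  case True
  have "(\<Oplus>\<^bsub>TP n\<^esub>i\<in>{..n}. if i = l \<and> n = l + m then tpow_mult av V l m p q else \<zero>\<^bsub>TP n\<^esub>)
    = (\<Oplus>\<^bsub>TP n\<^esub>i\<in>{..n}. if l = i then tpow_mult av V l m p q else \<zero>\<^bsub>TP n\<^esub>)"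
   using True bilin_closed[OF tpow_mult_bilin p q] zc by (intro TP.M.finsum_cong') auto
  also have "\<dots> = tpow_mult av V l m p q"
   using True bilin_closed[OF tpow_mult_bilin p q] by (intro TP.M.finsum_singleton) auto
  finally show ?thesis using True by (simp add: c0_delta_def)
 next
  case False
  then show ?thesis by (simp add: c0_delta_def)
 qed
 finally show "(cc.\<delta> l p \<otimes>\<^sub>T cc.\<delta> m q) n = cc.\<delta> (l + m) (tpow_mult av V l m p q) n" .
qed

text \<open>The word \<open>vs\<close>, placed in its degree. Words span a dense subspace and play
  the part of a basis in all arguments about the tensor algebra.\<close>

definition PT :: "'v list => nat => ('k, 'v) tpow" where
 "PT vs = cc.\<delta> (length vs) (pure_tpow av V (length vs) vs)"

lemma PT_cl [simp, intro]: "set vs \<subseteq> carrier V ==> PT vs |: T"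
 unfolding PT_def T_simps by (intro cc.\<delta>_cl) simp_all

lemma PT_mult: "set us \<subseteq> carrier V ==> set vs \<subseteq> carrier V ==> PT us \<otimes>\<^sub>T PT vs = PT (us @ vs)"
 unfolding PT_def by (subst T_delta_mult) (simp_all add: tpow_mult_pure)

lemma T_one: "\<one>\<^sub>T = PT []" by (rule ext) (simp add: tens_alg_def PT_def c0_delta_def)

lemma TP_dense:
 assumes "closed_subspace (TP n) S" "!!vs. vs \<in> tpow_gens V n ==> pure_tpow av V n vs \<in> S"
 shows "carrier (TP n) \<subseteq> S"
 using pw.P_dense[of n S] assms by (simp add: tpow_def pure_tpow_emb pw.pres_gen_emb)

lemma T_dense:
 assumes S: "closed_subspace T S" "!!vs. set vs \<subseteq> carrier V ==> PT vs \<in> S"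
 shows "carrier T \<subseteq> S"
proof -
 have S': "closed_subspace cc.C S" using S(1) by (subst (asm) T_def) simp
 have "cc.\<delta> n p \<in> S" if "p |: (TX n)" for n p
 proof -
  have bl: "bl (TP n) cc.C (cc.\<delta> n)"
  proof -
   have "bl (TX n) cc.C (cc.\<delta> n)" by (rule cc.\<delta>_bl) simp
   then obtain C where "\<forall>x\<in>carrier (TP n). nrm cc.C (cc.\<delta> n x) \<le> C * (r ^ n * nrm (TP n) x)"
    unfolding bounded_linear_map_def by auto
   then show ?thesis using \<open>bl (TX n) cc.C (cc.\<delta> n)\<close>
    by (intro blI[where C = "C * r ^ n"]) (auto simp: bounded_linear_map_def mult.assoc)
  qed
  have "carrier (TP n) \<subseteq> {p \<in> carrier (TP n). cc.\<delta> n p \<in> S}"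
  proof (rule TP_dense)
   show "closed_subspace (TP n) {p \<in> carrier (TP n). cc.\<delta> n p \<in> S}"
    by (rule closed_subspace_vimage[OF TP_seminormed cc.C_seminormed bl S'])
   fix vs assume vs: "vs \<in> tpow_gens V n"
   then show "pure_tpow av V n vs \<in> {p \<in> carrier (TP n). cc.\<delta> n p \<in> S}"
    using S(2)[of vs] pure_tpow_cl[of vs n] by (auto simp: PT_def in_tpow_gens)
  qed
  then show ?thesis using that by auto
 qed
 then have "carrier cc.C \<subseteq> S" by (intro cc.C_dense[OF S']) auto
 then show ?thesis by (simp add: T_simps)
qed

lemma T_eqI:
 assumes "seminormed av W" "separated W" "bl T W f" "bl T W g"
  and "!!vs. set vs \<subseteq> carrier V ==> f (PT vs) = g (PT vs)" "x |: T"
 shows "f x = g x"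
proof -
 have "carrier T \<subseteq> {x \<in> carrier T. f x = g x}"
  by (rule T_dense[OF closed_subspace_eq[OF T_seminormed assms(1-4)]]) (use assms(5) in auto)
 then show ?thesis using assms(6) by blast
qed

text \<open>Associativity is concatenation on words. It is extended by density one factor at a time:
  the first becomes arbitrary in \<open>a2\<close>, the second in \<open>a3\<close>, the third in
  \<open>a4\<close>.\<close>

lemma T_ring: "ring T"
proof -
 interpret T: seminormed av T by (rule T_seminormed)
 note bl_l = bilin_right[OF T_bilin] and bl_r = bilin_left[OF T_bilin]
 note sep = T_seminormed T_separated
 note cmp = bl_comp[OF T_seminormed T_seminormed]
 have a1: "(PT us \<otimes>\<^sub>T PT vs) \<otimes>\<^sub>T PT ws = PT us \<otimes>\<^sub>T (PT vs \<otimes>\<^sub>T PT ws)"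
  if "set us \<subseteq> carrier V" "set vs \<subseteq> carrier V" "set ws \<subseteq> carrier V" for us vs ws
  using that by (simp add: PT_mult)
 have a2: "(x \<otimes>\<^sub>T PT vs) \<otimes>\<^sub>T PT ws = x \<otimes>\<^sub>T (PT vs \<otimes>\<^sub>T PT ws)"
  if "x |: T" "set vs \<subseteq> carrier V" "set ws \<subseteq> carrier V" for x vs ws
  by (rule T_eqI[OF sep cmp[OF bl_r bl_r] bl_r a1 that(1)]) (use that in \<open>auto intro: T_mult_cl\<close>)
 have a3: "(x \<otimes>\<^sub>T y) \<otimes>\<^sub>T PT ws = x \<otimes>\<^sub>T (y \<otimes>\<^sub>T PT ws)" if "x |: T" "y |: T" "set ws \<subseteq> carrier V" for x y ws
  by (rule T_eqI[OF sep cmp[OF bl_l bl_r] cmp[OF bl_r bl_l] a2 that(2)]) (use that in auto)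
 have a4: "(x \<otimes>\<^sub>T y) \<otimes>\<^sub>T z = x \<otimes>\<^sub>T (y \<otimes>\<^sub>T z)" if "x |: T" "y |: T" "z |: T" for x y z
  by (rule T_eqI[OF sep bl_l cmp[OF bl_l bl_l] a3 that(3)]) (use that in \<open>auto intro: T_mult_cl\<close>)
 have one: "\<one>\<^sub>T |: T" by (simp add: T_one)
 have l1: "\<one>\<^sub>T \<otimes>\<^sub>T x = x" if "x |: T" for x
  by (rule T_eqI[OF sep bl_l bl_id _ that]) (use one in \<open>auto simp: T_one PT_mult\<close>)
 have r1: "x \<otimes>\<^sub>T \<one>\<^sub>T = x" if "x |: T" for x
  by (rule T_eqI[OF sep bl_r bl_id _ that]) (use one in \<open>auto simp: T_one PT_mult\<close>)
 show ?thesis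
 proof (rule ringI[OF T.M.abelian_group_axioms])
  show "monoid T" by (rule monoidI) (use one l1 r1 a4 T_mult_cl in auto)
 qed (auto simp: bl_add[OF bl_l] bl_add[OF bl_r])
qed

lemma T_snalg: "snalg av T" by (intro snalg.intro T_seminormed T_ring snalg_axioms.intro T_bilin)

sublocale T: snalg av T by (rule T_snalg)

lemma T_incl: "tens_alg_incl av V v = PT [v]" by (rule ext) (simp add: tens_alg_incl_def PT_def c0_delta_def)

lemma incl_bl: "bl V T (%v. PT [v])"
proof -
 interpret pw1: pres av "tpow_gens V 1" "tpow_weight V" "tpow_rels V 1" by (rule tpow_pres)
 have rel: "pw.emb 1 a = pw.emb 1 b" if "a - b \<in> tpow_rels V 1" "a \<in> pw.FG 1" "b \<in> pw.FG 1" for a b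
  using pw.sn_kspan[OF kspan_base[OF that(1)]] that by (simp add: pw.emb_def pw.cl_eq pw.Cau_const)
 have g: "[v] \<in> tpow_gens V 1" if "v |: V" for v using that by (simp add: in_tpow_gens)
 have "bl V (TX 1) (%v. pure_tpow av V 1 [v])"
 proof (rule blI[where C = r])
  fix v v' a assume v: "v |: V"
  show "pure_tpow av V 1 [v] |: (TX 1)" using v by simp
  show "nrm (TX 1) (pure_tpow av V 1 [v]) \<le> r * nrm V v"
   using pw.sn_single[OF g[OF v]] r v pw.emb_simps(2)[OF pw.FG_simps(6)[OF g[OF v]]]
   by (simp add: pure_tpow_emb tpow_def tpow_weight_def)
  have "single ([] @ [a \<odot> v] @ []) 1 - single ([] @ [v] @ []) a \<in> tpow_rels V 1"
   unfolding tpow_rels_def using g[OF v] by fastforce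
  then have "pw.emb 1 (single [a \<odot> v] 1) = pw.emb 1 (pscale a (single [v] 1))" using g v by (intro rel) auto
  then show "pure_tpow av V 1 [a \<odot> v] = a \<odot>\<^bsub>TX 1\<^esub> pure_tpow av V 1 [v]"
   using pw.emb_simps(3)[OF pw.FG_simps(6)[OF g[OF v]]] by (simp only: pure_tpow_emb tpow_def rescale_simps)
  assume v': "v' |: V"
  have "single ([] @ [v \<oplus> v'] @ []) 1 - single ([] @ [v] @ []) 1 - single ([] @ [v'] @ []) 1 \<in> tpow_rels V 1"
   unfolding tpow_rels_def using g[OF v] v' by fastforce
  then have "pw.emb 1 (single [v \<oplus> v'] 1) = pw.emb 1 (single [v] 1 + single [v'] 1)"
   using g v v' by (intro rel) (auto simp: diff_diff_eq)
  then show "pure_tpow av V 1 [v \<oplus> v'] = pure_tpow av V 1 [v] \<oplus>\<^bsub>TX 1\<^esub> pure_tpow av V 1 [v']"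
   using pw.emb_simps(4)[OF pw.FG_simps(6)[OF g[OF v]] pw.FG_simps(6)[OF g[OF v']]] by (simp only: pure_tpow_emb tpow_def rescale_simps)
 qed
 then have "bl V cc.C (%v. cc.\<delta> 1 (pure_tpow av V 1 [v]))"
  using bl_comp[OF seminormed_axioms cc.X _ cc.\<delta>_bl] by blast
 then show ?thesis unfolding PT_def by (subst T_def) simp
qed

text \<open>The bound on words is a hypothesis of its own, because the product of \<open>E\<close>
  may increase norms by a constant at every multiplication, and a bound on single letters does not
  control that. The factor \<open>r ^ length vs\<close> is what the norm of the tensor algebra
  allows in that degree.\<close>

lemma T_lift:
 assumes E: "banach_space av E" "snalg av E" and f: "bl V E f"
  and K: "0 \<le> K" "!!vs. set vs \<subseteq> carrier V ==> nrm E (snalg.prodl E (map f vs)) \<le> K * (r ^ length vs * prod_list (map (nrm V) vs))"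
 shows "\<exists>\<Phi>. bl T E \<Phi> \<and> (\<forall>vs. set vs \<subseteq> carrier V \<longrightarrow> \<Phi> (PT vs) = snalg.prodl E (map f vs)) \<and>
   (\<forall>x\<in>carrier T. \<forall>y\<in>carrier T. \<Phi> (x \<otimes>\<^sub>T y) = \<Phi> x \<otimes>\<^sub>E \<Phi> y) \<and> \<Phi> \<one>\<^sub>T = \<one>\<^sub>E"
proof -
 interpret E: snalg av E by (rule E(2))
 have Es: "seminormed av E" by (rule E.seminormed_axioms)
 have fc: "set (map f vs) \<subseteq> carrier E" if "set vs \<subseteq> carrier V" for vs using that bl_closed[OF f] by auto
 have rp: "0 \<le> r ^ n" for n using r by simp
 \<comment> \<open>The n-th tensor power is mapped with bound \<open>K * r ^ n\<close>. In the norm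
   rescaled by \<open>r ^ n\<close> this is \<open>K\<close> in every degree, which is the common
   bound that \<open>C_lift\<close> asks for.\<close>
 have "\<exists>\<Phi>. bl (pw.P n) E \<Phi> \<and>
   (\<forall>g\<in>tpow_gens V n. \<Phi> (pres_gen av (tpow_gens V n) (tpow_weight V) (tpow_rels V n) g) = E.prodl (map f g)) \<and>
   (\<forall>x\<in>carrier (pw.P n). nrm E (\<Phi> x) \<le> (K * r ^ n) * nrm (pw.P n) x)" for n
 proof (rule pw.P_lift[OF E(1)])
  fix L t
  assume L: "!!a b. a \<in> pw.FG n ==> b \<in> pw.FG n ==> L (a + b) = L a \<oplus>\<^sub>E L b"
    "!!a b. a \<in> pw.FG n ==> b \<in> pw.FG n ==> L (a - b) = L a \<ominus>\<^sub>E L b"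
    "!!g c. g \<in> tpow_gens V n ==> L (single g c) = c \<odot>\<^sub>E E.prodl (map f g)"
   and t: "t \<in> tpow_rels V n"
  have pl: "E.prodl (map f (us @ [v] @ ws)) = E.prodl (map f us) \<otimes>\<^sub>E (f v \<otimes>\<^sub>E E.prodl (map f ws))"
   if "set (us @ [v] @ ws) \<subseteq> carrier V" for us v ws
   using fc[of us] fc[of ws] fc[of "[v]"] that by (simp add: E.prodl_append)
  consider us ws v v' where "t = single (us @ [v \<oplus> v'] @ ws) 1 - single (us @ [v] @ ws) 1
     - single (us @ [v'] @ ws) 1" "us @ [v] @ ws \<in> tpow_gens V n" "v' |: V"
   | us ws a v where "t = single (us @ [a \<odot> v] @ ws) 1 - single (us @ [v] @ ws) a"
     "us @ [v] @ ws \<in> tpow_gens V n" using t unfolding tpow_rels_def by blast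
  then show "L t = \<zero>\<^sub>E"
  proof cases
   case 1
   then have s: "set us \<subseteq> carrier V" "set ws \<subseteq> carrier V" "v |: V" "length us + Suc (length ws) = n"
    by (auto simp: in_tpow_gens)
   have g: "us @ [x] @ ws \<in> tpow_gens V n" if "x |: V" for x using s that by (auto simp: in_tpow_gens)
   let ?p = "%x. E.prodl (map f us) \<otimes>\<^sub>E (f x \<otimes>\<^sub>E E.prodl (map f ws))"
   have Lx: "L (single (us @ [x] @ ws) 1) = ?p x" if x: "x |: V" for x
    using L(3)[OF g[OF x], of 1] pl[of us x ws] s x fc[of us] fc[of ws] bl_closed[OF f x] by simp
   have "L t = ?p (v \<oplus> v') \<ominus>\<^sub>E ?p v \<ominus>\<^sub>E ?p v'"
    unfolding 1(1) using g s 1(3) Lx by (simp add: L(2) pw.FG_simps del: append.simps append_Cons)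
   also have "?p (v \<oplus> v') = ?p v \<oplus>\<^sub>E ?p v'" using s 1(3) fc[of us] fc[of ws] bl_closed[OF f]
    by (simp add: bl_add[OF f] E.l_distr E.r_distr)
   also have "?p v \<oplus>\<^sub>E ?p v' \<ominus>\<^sub>E ?p v \<ominus>\<^sub>E ?p v' = \<zero>\<^sub>E"
    using s 1(3) fc[of us] fc[of ws] bl_closed[OF f] by (simp add: E.sub_sub)
   finally show ?thesis .
  next
   case 2
   then have s: "set us \<subseteq> carrier V" "set ws \<subseteq> carrier V" "v |: V" "length us + Suc (length ws) = n"
    by (auto simp: in_tpow_gens)
   have g: "us @ [x] @ ws \<in> tpow_gens V n" if "x |: V" for x using s that by (auto simp: in_tpow_gens)
   let ?p = "%x. E.prodl (map f us) \<otimes>\<^sub>E (f x \<otimes>\<^sub>E E.prodl (map f ws))"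
   have Lx: "L (single (us @ [x] @ ws) c) = c \<odot>\<^sub>E ?p x" if x: "x |: V" for x c
    using L(3)[OF g[OF x], of c] pl[of us x ws] s x by simp
   have "L t = 1 \<odot>\<^sub>E ?p (a \<odot> v) \<ominus>\<^sub>E a \<odot>\<^sub>E ?p v"
    unfolding 2(1) using g s Lx by (simp add: L(2) pw.FG_simps del: append.simps append_Cons)
   also have "\<dots> = \<zero>\<^sub>E" using s fc[of us] fc[of ws] bl_closed[OF f]
    by (simp add: bl_sm[OF f] E.sm_mult_l E.sm_mult_r)
   finally show ?thesis .
  qed
 next
  fix g assume "g \<in> tpow_gens V n"
  then show "E.prodl (map f g) |: E" "nrm E (E.prodl (map f g)) \<le> K * r ^ n * tpow_weight V g"
   using K(2)[of g] fc[of g] by (auto simp: in_tpow_gens tpow_weight_def mult.assoc)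
 qed (use K(1) rp in simp)
 then obtain h where h: "!!n. bl (TP n) E (h n)"
   "!!n vs. vs \<in> tpow_gens V n ==> h n (pure_tpow av V n vs) = E.prodl (map f vs)"
   "!!n x. x |: (TP n) ==> nrm E (h n x) \<le> (K * r ^ n) * nrm (TP n) x"
  unfolding tpow_def pure_tpow_emb pw.pres_gen_emb by metis
 have "\<exists>\<Phi>. bl cc.C E \<Phi> \<and> (\<forall>j\<in>UNIV. \<forall>x\<in>carrier (TX j). \<Phi> (cc.\<delta> j x) = h j x)"
 proof (rule cc.C_lift[OF E(1) K(1)])
  show "nrm E (h j x) \<le> K * nrm (TX j) x" if "x |: (TX j)" for j x
   using h(3)[of x j] that by (simp add: mult.assoc)
  then show "bl (TX j) E (h j)" for j using h(1)[of j] unfolding bounded_linear_map_def by auto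
 qed
 then obtain \<Phi> where \<Phi>': "bl cc.C E \<Phi>" "!!j x. x |: (TP j) ==> \<Phi> (cc.\<delta> j x) = h j x" by auto
 have \<Phi>: "bl T E \<Phi>" "!!j x. x |: (TP j) ==> \<Phi> (cc.\<delta> j x) = h j x"
  by (subst T_def, simp add: \<Phi>'(1)) (rule \<Phi>'(2))
 have PT: "\<Phi> (PT vs) = E.prodl (map f vs)" if "set vs \<subseteq> carrier V" for vs
  using that \<Phi>(2) h(2) by (simp add: PT_def in_tpow_gens)
 have sep: "separated E" using E(1) by (rule banach_separated)
 note T_s = T_seminormed
 have m1: "\<Phi> (PT us \<otimes>\<^sub>T PT vs) = \<Phi> (PT us) \<otimes>\<^sub>E \<Phi> (PT vs)" if "set us \<subseteq> carrier V" "set vs \<subseteq> carrier V" for us vs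
  using that PT fc[of us] fc[of vs] by (simp add: PT_mult E.prodl_append)
 have m2: "\<Phi> (x \<otimes>\<^sub>T PT vs) = \<Phi> x \<otimes>\<^sub>E \<Phi> (PT vs)" if "x |: T" "set vs \<subseteq> carrier V" for x vs
  by (rule T_eqI[OF Es sep bl_comp[OF T_s T_s T.mult_bl_r \<Phi>(1)] bl_comp[OF T_s Es \<Phi>(1) E.mult_bl_r] m1 that(1)])
    (use that bl_closed[OF \<Phi>(1)] in auto)
 have m3: "\<Phi> (x \<otimes>\<^sub>T y) = \<Phi> x \<otimes>\<^sub>E \<Phi> y" if "x |: T" "y |: T" for x y
  by (rule T_eqI[OF Es sep bl_comp[OF T_s T_s T.mult_bl_l \<Phi>(1)] bl_comp[OF T_s Es \<Phi>(1) E.mult_bl_l] m2 that(2)])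
    (use that bl_closed[OF \<Phi>(1)] in auto)
 have "\<Phi> \<one>\<^sub>T = \<one>\<^sub>E" using PT[of "[]"] by (simp add: T_one)
 then show ?thesis using \<Phi>(1) PT m3 by blast
qed

end

section \<open>Quotients, the two halves and the Cartan part\<close>

locale nq = T: snalg av T + ideal N T
 for av :: "'k::field_char_0 => real" and T :: "('k, 'v) nspace" (structure) and N
begin

abbreviation "Q \<equiv> nquot T N"
definition q where "q x = N +> x"

lemma N_sub: "N \<subseteq> carrier T" using a_Hcarr by auto

text \<open>Ideals are ring-theoretic here; they are stable under scalars because scaling is
  multiplication by a multiple of the unit.\<close>

lemma N_sm: "x \<in> N ==> c \<odot> x \<in> N"
proof -
 assume x: "x \<in> N"
 have "(c \<odot> \<one>) \<otimes> x \<in> N" using x by (intro I_l_closed) auto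
 moreover have "(c \<odot> \<one>) \<otimes> x = c \<odot> x" using x N_sub by (simp add: T.sm_mult_l subset_iff)
 ultimately show ?thesis by simp
qed

lemma Q_carrier: "carrier Q = q ` carrier T" by (auto simp: nquot_def FactRing_def A_RCOSETS_def' q_def)

lemma Q_simps: "add Q = add (T Quot N)" "mult Q = mult (T Quot N)" "zero Q = zero (T Quot N)" "one Q = q \<one>"
 "carrier Q = carrier (T Quot N)" by (simp_all add: nquot_def q_def FactRing_def)

lemma q_hom: "q \<in> ring_hom T (T Quot N)" using rcos_ring_hom by (simp add: q_def[abs_def])

lemma q_cl [simp, intro]: "x |: T ==> q x |: Q" by (auto simp: Q_carrier)

lemma q_add: "x |: T ==> y |: T ==> q (x \<oplus> y) = q x \<oplus>\<^sub>Q q y"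
 and q_mult: "x |: T ==> y |: T ==> q (x \<otimes> y) = q x \<otimes>\<^sub>Q q y"
 using ring_hom_add[OF q_hom] ring_hom_mult[OF q_hom] by (simp_all add: Q_simps)

lemma q_mem: "x |: T ==> y \<in> q x \<longleftrightarrow> y |: T \<and> y \<ominus> x \<in> N"
proof -
 assume x: "x |: T"
 have "y \<in> q x \<longleftrightarrow> (\<exists>h\<in>N. y = h \<oplus> x)" by (simp add: q_def a_r_coset_def' )
 also have "\<dots> \<longleftrightarrow> y |: T \<and> y \<ominus> x \<in> N"
 proof safe
  fix h assume h: "h \<in> N"
  then have hc: "h |: T" using N_sub by auto
  show "h \<oplus> x |: T" using hc x by simp
  show "h \<oplus> x \<ominus> x \<in> N" using hc x h by simp
 next
  assume y: "y |: T" and n: "y \<ominus> x \<in> N"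
  show "\<exists>h\<in>N. y = h \<oplus> x" by (rule bexI[OF _ n]) (use x y in simp)
 qed
 finally show ?thesis .
qed

lemma q_self: "x |: T ==> x \<in> q x"
 by (simp add: q_mem zero_closed[OF] additive_subgroup.zero_closed[OF is_additive_subgroup])

lemma q_eq: "x |: T ==> y \<in> q x ==> q y = q x"
proof -
 assume x: "x |: T" and y: "y \<in> q x"
 then have "y \<in> N +> x" by (simp add: q_def)
 then show ?thesis using a_repr_independence'[OF _ x] by (simp add: q_def)
qed

lemma q_sm: "x |: T ==> q (c \<odot> x) = c \<odot>\<^sub>Q q x"
proof -
 assume x: "x |: T"
 have eq: "N +> (c \<odot> y) = q (c \<odot> x)" if "y \<in> q x" for y
 proof -
  have y: "y |: T" "y \<ominus> x \<in> N" using that x by (auto simp: q_mem)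
  have "c \<odot> y \<ominus> c \<odot> x \<in> N" using N_sm[OF y(2), of c] x y by (simp add: T.sm_sub)
  then have "c \<odot> y \<in> q (c \<odot> x)" using x y by (simp add: q_mem)
  then show ?thesis using q_eq[of "c \<odot> x" "c \<odot> y"] x by (simp add: q_def)
 qed
 have "c \<odot>\<^sub>Q q x = (\<Union>y\<in>q x. N +> (c \<odot> y))" by (simp add: nquot_def)
 also have "\<dots> = (\<Union>y\<in>q x. q (c \<odot> x))" using eq by (intro SUP_cong refl) auto
 also have "\<dots> = q (c \<odot> x)" using q_self[OF x] by auto
 finally show ?thesis by simp
qed

lemma q_norm: "nrm Q (q x) = Inf (nrm T ` q x)" by (simp add: nquot_def)

lemma q_norm_le: "x |: T ==> y \<in> q x ==> nrm Q (q x) \<le> nrm T y"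
 unfolding q_norm by (rule cInf_lower) (auto simp: q_mem intro!: bdd_belowI[of _ 0])

lemma q_norm_ge: "x |: T ==> (!!y. y \<in> q x ==> B \<le> nrm T y) ==> B \<le> nrm Q (q x)"
 unfolding q_norm by (rule cInf_greatest) (use q_self in auto)

lemma q_norm_less:
 assumes "x |: T" "nrm Q (q x) < e"
 obtains y where "y |: T" "q y = q x" "nrm T y < e"
proof -
 have "\<not> (\<forall>y. y \<in> q x \<longrightarrow> e \<le> nrm T y)" using q_norm_ge[OF assms(1), of e] assms(2) by auto
 then show ?thesis using that q_eq[OF assms(1)] q_mem[OF assms(1)] by auto
qed

lemma Q_seminormed: "seminormed av Q"
proof -
 have ab: "abelian_group Q"
 proof -
  interpret R: ring "T Quot N" by (rule quotient_is_ring)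
  show ?thesis
  proof (rule abelian_groupI)
   fix x assume "x |: Q"
   then show "\<exists>y\<in>carrier Q. y \<oplus>\<^sub>Q x = \<zero>\<^sub>Q"
    using R.l_neg[of x] by (intro bexI[of _ "\<ominus>\<^bsub>T Quot N\<^esub> x"]) (simp_all add: Q_simps)
  qed (simp_all add: Q_simps R.a_ac)
 qed
 have mod: "module kring Q" by (rule moduleI[OF cring_kring ab])
    (auto simp: Q_carrier q_sm[symmetric] q_add[symmetric] T.sm_add_l T.sm_add_r T.sm_sm)
 show ?thesis
 proof (intro seminormed.intro T.nonarch_axioms seminormed_axioms.intro mod)
  fix x assume "x |: Q"
  then obtain x' where x': "x' |: T" "x = q x'" by (auto simp: Q_carrier)
  show "0 \<le> nrm Q x" unfolding x'(2) using x'(1) by (intro q_norm_ge) (auto simp: q_mem)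
  have le: "nrm Q (c \<odot>\<^sub>Q q z) \<le> av c * nrm Q (q z)" if z: "z |: T" for c z
  proof (cases "c = 0")
   case True
   have "q (0 \<odot> z) = q \<zero>" using z by simp
   then show ?thesis using q_norm_le[of "\<zero>" "\<zero>"] q_self[of "\<zero>"] True z by (simp add: q_sm[symmetric])
  next
   case False
   then have c: "0 < av c" using T.av_nonneg[of c] T.av_eq_0[of c] by linarith
   have "nrm Q (q (c \<odot> z)) / av c \<le> nrm Q (q z)"
   proof (rule q_norm_ge[OF z])
    fix y assume y: "y \<in> q z"
    then have yc: "y |: T" using z by (simp add: q_mem)
    have "q (c \<odot> z) = q (c \<odot> y)" using q_eq[OF z y] z yc by (simp add: q_sm)
    then have "nrm Q (q (c \<odot> z)) \<le> nrm T (c \<odot> y)"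
     using q_norm_le[OF T.sm_cl[OF yc] q_self[OF T.sm_cl[OF yc]], of c] by simp
    then show "nrm Q (q (c \<odot> z)) / av c \<le> nrm T y" using c yc by (simp add: T.norm_smult field_simps)
   qed
   then show ?thesis using c z by (simp add: q_sm[symmetric] field_simps)
  qed
  fix c
  show "nrm Q (c \<odot>\<^sub>Q x) = av c * nrm Q x" unfolding x'(2)
  proof (rule antisym[OF le[OF x'(1)]])
   show "av c * nrm Q (q x') \<le> nrm Q (c \<odot>\<^sub>Q q x')"
   proof (cases "c = 0")
    case True
    then show ?thesis using q_norm_ge[of "\<zero>" 0] x'(1) by (simp add: q_sm[symmetric]) (auto simp: q_mem)
   next
    case False
    have "nrm Q ((1 / c) \<odot>\<^sub>Q q (c \<odot> x')) \<le> av (1 / c) * nrm Q (q (c \<odot> x'))" using x'(1) by (intro le) auto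
    also have "(1 / c) \<odot>\<^sub>Q q (c \<odot> x') = q x'" using x'(1) False by (simp add: q_sm[symmetric] T.sm_sm)
    finally have "av c * nrm Q (q x') \<le> av c * (av (1 / c) * nrm Q (q (c \<odot> x')))"
     by (rule mult_left_mono) simp
    also have "\<dots> = av (c * (1 / c)) * nrm Q (q (c \<odot> x'))" by (simp only: T.av_mult mult.assoc)
    finally show ?thesis using False x'(1) by (simp add: q_sm)
   qed
  qed
  fix y assume "y |: Q"
  then obtain y' where y': "y' |: T" "y = q y'" by (auto simp: Q_carrier)
  show "nrm Q (x \<oplus>\<^sub>Q y) \<le> max (nrm Q x) (nrm Q y)"
  proof (rule field_le_epsilon)
   fix e :: real assume e: "0 < e"
   have "nrm Q (q x') < max (nrm Q x) (nrm Q y) + e" using e x' by (simp add: max_def)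
   then obtain u where u: "u |: T" "q u = x" "nrm T u < max (nrm Q x) (nrm Q y) + e"
    using q_norm_less[OF x'(1)] x' by metis
   have "nrm Q (q y') < max (nrm Q x) (nrm Q y) + e" using e y' by (simp add: max_def)
   then obtain v where v: "v |: T" "q v = y" "nrm T v < max (nrm Q x) (nrm Q y) + e"
    using q_norm_less[OF y'(1)] y' by metis
   have "nrm Q (q (u \<oplus> v)) \<le> nrm T (u \<oplus> v)" using u v by (intro q_norm_le q_self) auto
   also have "\<dots> \<le> max (nrm Q x) (nrm Q y) + e" using u v by (intro T.norm_add_le) auto
   finally show "nrm Q (x \<oplus>\<^sub>Q y) \<le> max (nrm Q x) (nrm Q y) + e" using u v by (simp add: q_add)
  qed
 qed
qed

lemma q_bl: "bl T Q q" by (rule blI[where C = 1]) (auto simp: q_add q_sm intro!: q_norm_le q_self)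

text \<open>The map is constant on cosets, so its bound holds for every representative and hence for
  the quotient norm, which is their infimum.\<close>

lemma Q_lift:
 assumes E: "seminormed av E" and \<Phi>: "bl T E \<Phi>" and N0: "!!x. x \<in> N ==> \<Phi> x = \<zero>\<^sub>E"
 shows "\<exists>\<Psi>. bl Q E \<Psi> \<and> (\<forall>x\<in>carrier T. \<Psi> (q x) = \<Phi> x)"
proof -
 interpret E: seminormed av E by fact
 have Ts: "seminormed av T" by (rule T.seminormed_axioms)
 define \<Psi> where "\<Psi> P = \<Phi> (SOME x. x \<in> P)" for P
 have same: "\<Phi> y = \<Phi> x" if "x |: T" "y \<in> q x" for x y
 proof -
  have y: "y |: T" "y \<ominus> x \<in> N" using that by (auto simp: q_mem)
  then have "\<Phi> y \<ominus>\<^sub>E \<Phi> x = \<zero>\<^sub>E" using N0[OF y(2)] bl_sub[OF Ts E \<Phi> y(1) that(1)] by simp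
  then show ?thesis using E.sub_eq_0[OF bl_closed[OF \<Phi> y(1)] bl_closed[OF \<Phi> that(1)]] by simp
 qed
 have \<Psi>q: "\<Psi> (q x) = \<Phi> x" if x: "x |: T" for x
  unfolding \<Psi>_def by (rule same[OF x]) (rule someI[of "%y. y \<in> q x", OF q_self[OF x]])
 obtain C where C: "0 < C" "!!x. x |: T ==> nrm E (\<Phi> x) \<le> C * nrm T x" using bl_bound[OF Ts \<Phi>] by blast
 have "bl Q E \<Psi>"
 proof (rule blI[where C = C])
  fix P a assume "P |: Q"
  then obtain x where x: "x |: T" "P = q x" by (auto simp: Q_carrier)
  show "\<Psi> P |: E" using x by (simp add: \<Psi>q bl_closed[OF \<Phi>])
  show "\<Psi> (a \<odot>\<^sub>Q P) = a \<odot>\<^sub>E \<Psi> P" using x by (simp add: q_sm[symmetric] \<Psi>q bl_sm[OF \<Phi>])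
  have "nrm E (\<Phi> x) / C \<le> nrm Q (q x)"
  proof (rule q_norm_ge[OF x(1)])
   fix y assume y: "y \<in> q x"
   then show "nrm E (\<Phi> x) / C \<le> nrm T y"
    using same[OF x(1) y] C(2)[of y] x(1) C(1) by (simp add: q_mem field_simps)
  qed
  then show "nrm E (\<Psi> P) \<le> C * nrm Q P" using x C(1) by (simp add: \<Psi>q field_simps)
  fix P' assume "P' |: Q"
  then obtain y where y: "y |: T" "P' = q y" by (auto simp: Q_carrier)
  show "\<Psi> (P \<oplus>\<^sub>Q P') = \<Psi> P \<oplus>\<^sub>E \<Psi> P'" using x y by (simp add: q_add[symmetric] \<Psi>q bl_add[OF \<Phi>])
 qed
 then show ?thesis using \<Psi>q by blast
qed

end

text \<open>Left and right multiplication by x commute, so powers of their difference expand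
  binomially; the induction step is Pascal's rule. At \<open>n = 1 - a i j\<close> the right-hand
  side is the Serre element, so maps that only respect brackets can be tested on it.\<close>

lemma (in snalg) ad_binomial:
 assumes x: "x |: A" and y: "y |: A"
 shows "((commutator A x) ^^ n) y =
  (\<Oplus>m\<in>{0..n}. ((- 1) ^ m * of_nat (n choose m)) \<odot> (x [^] (n - m) \<otimes> y \<otimes> x [^] m))"
proof (induction n)
 case 0
 show ?case using x y by simp
next
 case (Suc n)
 define t where "t l m = x [^] l \<otimes> y \<otimes> x [^] m" for l m :: nat
 define c :: "nat => nat => 'k" where "c n m = (- 1) ^ m * of_nat (n choose m)" for n m
 have tc [simp]: "t l m |: A" for l m using x y by (simp add: t_def)
 have xt: "x \<otimes> t l m = t (Suc l) m" for l m
  using x y nat_pow_Suc2[OF x, of l] by (simp add: t_def m_assoc del: nat_pow_Suc)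
 have tx: "t l m \<otimes> x = t l (Suc m)" for l m using x y by (simp add: t_def m_assoc)
 let ?S = "%n. (\<Oplus>m\<in>{..n}. c n m \<odot> t (n - m) m)"
 have Sc: "?S n |: A" for n by (intro M.finsum_closed) auto
 \<comment> \<open>Left multiplication keeps the index m. The sum is padded by the term at
   \<open>Suc n\<close>, whose binomial coefficient is zero, so that it runs over the same range as
   the sum in \<open>3\<close>.\<close>
 have 1: "x \<otimes> ?S n = (\<Oplus>m\<in>{..Suc n}. c n m \<odot> t (Suc n - m) m)"
 proof -
  have "x \<otimes> ?S n = (\<Oplus>m\<in>{..n}. x \<otimes> (c n m \<odot> t (n - m) m))"
   using x by (intro bl_finsum[OF seminormed_axioms seminormed_axioms mult_bl_l]) auto
  also have "\<dots> = (\<Oplus>m\<in>{..n}. c n m \<odot> t (Suc n - m) m)"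
   using x by (intro M.finsum_cong') (auto simp: sm_mult_r xt Suc_diff_le)
  also have "\<dots> = (\<Oplus>m\<in>{..Suc n}. c n m \<odot> t (Suc n - m) m)"
   by (subst M.finsum_Suc) (auto simp: c_def binomial_eq_0 simp del: binomial_Suc_n intro!: M.finsum_closed)
  finally show ?thesis .
 qed
 have 2: "?S n \<otimes> x = (\<Oplus>m\<in>{..n}. c n m \<odot> t (n - m) (Suc m))"
 proof -
  have "?S n \<otimes> x = (\<Oplus>m\<in>{..n}. (c n m \<odot> t (n - m) m) \<otimes> x)"
   using x by (intro bl_finsum[OF seminormed_axioms seminormed_axioms mult_bl_r]) auto
  also have "\<dots> = (\<Oplus>m\<in>{..n}. c n m \<odot> t (n - m) (Suc m))"
   using x by (intro M.finsum_cong') (auto simp: sm_mult_l tx)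
  finally show ?thesis .
 qed
 \<comment> \<open>Right multiplication raises m by one; after reindexing the new term at 0 gets the
   coefficient zero.\<close>
 have 3: "(\<Oplus>m\<in>{..Suc n}. (if m = 0 then 0 else c n (m - 1)) \<odot> t (Suc n - m) m) = ?S n \<otimes> x"
  unfolding 2 by (subst M.finsum_Suc2) (auto intro!: M.finsum_closed)
 have "commutator A x (?S n) = x \<otimes> ?S n \<oplus> (- 1) \<odot> (?S n \<otimes> x)"
  using Sc[of n] x by (simp add: commutator_def sm_m1 minus_eq)
 also have "\<dots> = (\<Oplus>m\<in>{..Suc n}. c n m \<odot> t (Suc n - m) m \<oplus> (- 1) \<odot> ((if m = 0 then 0 else c n (m - 1)) \<odot> t (Suc n - m) m))"
  unfolding 1 3[symmetric] by (subst finsum_sm) (auto intro!: M.finsum_addf[symmetric] simp del: M.finsum_Suc)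
 also have "\<dots> = ?S (Suc n)"
 proof (intro M.finsum_cong')
  fix m assume m: "m \<in> {..Suc n}"
  have "c n m + - 1 * (if m = 0 then 0 else c n (m - 1)) = c (Suc n) m"
   by (cases m) (simp_all add: c_def algebra_simps)
  then show "c n m \<odot> t (Suc n - m) m \<oplus> (- 1) \<odot> ((if m = 0 then 0 else c n (m - 1)) \<odot> t (Suc n - m) m)
    = c (Suc n) m \<odot> t (Suc n - m) m" by (simp only: sm_sm tc sm_cl sm_add_l[symmetric])
 qed auto
 finally have "commutator A x (?S n) = ?S (Suc n)" .
 then show ?case using Suc.IH by (simp add: c_def t_def atLeast0AtMost)
qed

lemma comm_hom:
 assumes "snalg av A" "snalg av B" "bl A B f" and "!!x y. x |: A ==> y |: A ==> f (x \<otimes>\<^sub>A y) = f x \<otimes>\<^sub>B f y"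
  and "x |: A" "y |: A"
 shows "f (commutator A x y) = commutator B (f x) (f y)"
proof -
 interpret A: snalg av A by fact
 interpret B: snalg av B by fact
 show ?thesis using assms(4-6)
  by (simp add: commutator_def bl_sub[OF A.seminormed_axioms B.seminormed_axioms assms(3)])
qed

lemma (in snalg) ad_pow_cl: "x |: A ==> y |: A ==> ((commutator A x) ^^ n) y |: A" by (induction n) auto

lemma comm_hom_pow:
 assumes "snalg av A" "snalg av B" "bl A B f" and "!!x y. x |: A ==> y |: A ==> f (x \<otimes>\<^sub>A y) = f x \<otimes>\<^sub>B f y"
  and "x |: A" "y |: A"
 shows "f (((commutator A x) ^^ n) y) = ((commutator B (f x)) ^^ n) (f y)"
proof (induction n)
 case (Suc n)
 interpret A: snalg av A by fact
 show ?case using Suc comm_hom[OF assms(1-5) A.ad_pow_cl[OF assms(5,6)]] by simp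
qed simp

section \<open>The space of generators and the two halves of the enveloping algebra\<close>

lemma (in nonarch) V0_c0: "c0 av I (%_. kspace av)"
 by (intro c0.intro nonarch_axioms c0_axioms.intro kspace_seminormed)

lemma (in nonarch) V0_seminormed: "seminormed av (V0 av I)"
proof -
 interpret c0 av I "%_. kspace av" by (rule V0_c0)
 show ?thesis unfolding V0_def by (rule C_seminormed)
qed

lemma V0_gen_delta: "V0_gen I i = c0_delta I (%_. kspace av) i 1"
 by (rule ext) (simp add: V0_gen_def c0_delta_def restrict_def)

lemma (in nonarch) V0_gen_cl: "i \<in> I ==> V0_gen I i |: (V0 av I)"
proof -
 assume i: "i \<in> I"
 interpret c0 av I "%_. kspace av" by (rule V0_c0)
 show ?thesis unfolding V0_def V0_gen_delta[of I i av] using i by (intro \<delta>_cl) auto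
qed

lemma (in nonarch) V0_dense:
 assumes "closed_subspace (V0 av I) S" "!!i. i \<in> I ==> V0_gen I i \<in> S"
 shows "carrier (V0 av I) \<subseteq> S"
proof -
 interpret c0 av I "%_. kspace av" by (rule V0_c0)
 show ?thesis unfolding V0_def
 proof (rule C_dense)
  show "closed_subspace C S" using assms(1) by (simp add: V0_def)
  fix j x assume j: "j \<in> I"
  have "\<delta> j (x \<odot>\<^bsub>kspace av\<^esub> 1) = x \<odot>\<^sub>C \<delta> j 1" using j by (intro bl_sm[OF \<delta>_bl]) auto
  then have "\<delta> j x = x \<odot>\<^sub>C V0_gen I j" by (simp add: V0_gen_delta[of I j av])
  then show "\<delta> j x \<in> S" using assms j by (simp add: closed_subspace_def V0_def)
 qed
qed

locale uhalf = nonarch av for av :: "'k::field_char_0 => real" +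
 fixes I :: "'i set" and a :: "'i => 'i => int" and r :: real
 assumes r0: "0 < r"
begin

sublocale talg av "V0 av I" r by (intro talg.intro V0_seminormed talg_axioms.intro r0)

lemma T_gen_PT: "T_gen av I i = PT [V0_gen I i]" by (simp add: T_gen_def T_incl)

lemma T_gen_cl: "i \<in> I ==> T_gen av I i |: T" by (simp add: T_gen_PT V0_gen_cl)

lemma serre_ad: "i \<in> I ==> j \<in> I ==>
  serre av I a r i j = ((commutator T (T_gen av I i)) ^^ nat (1 - a i j)) (T_gen av I j)"
 by (simp add: serre_def Let_def T.ad_binomial T_gen_cl)

lemma serre_ideal_ideal: "ideal (serre_ideal av I a r) T" unfolding serre_ideal_def Let_def
proof (rule T.i_Intersect)
 have "carrier T \<in> {J. ideal J T \<and> nclosed T J \<and> (\<forall>i\<in>I. \<forall>j\<in>I. i \<noteq> j \<longrightarrow> serre av I a r i j \<in> J)}"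
  by (auto simp: T.oneideal nclosed_def serre_ad T.ad_pow_cl T_gen_cl)
 then show "{J. ideal J T \<and> nclosed T J \<and> (\<forall>i\<in>I. \<forall>j\<in>I. i \<noteq> j \<longrightarrow> serre av I a r i j \<in> J)} \<noteq> {}" by blast
qed auto

lemma serre_in: "i \<in> I ==> j \<in> I ==> i \<noteq> j ==> serre av I a r i j \<in> serre_ideal av I a r"
 unfolding serre_ideal_def Let_def by auto

lemma serre_ideal_least:
 assumes "ideal J T" "nclosed T J" "!!i j. i \<in> I ==> j \<in> I ==> i \<noteq> j ==> serre av I a r i j \<in> J"
 shows "serre_ideal av I a r \<subseteq> J" unfolding serre_ideal_def Let_def using assms by blast

sublocale nq: nq av T "serre_ideal av I a r" by (intro nq.intro T_snalg serre_ideal_ideal)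

abbreviation "UH \<equiv> U_half av I a r"

lemma UH_def: "UH = nq.Q" by (simp add: U_half_def)

lemma UH_seminormed: "seminormed av UH" unfolding UH_def by (rule nq.Q_seminormed)

lemma q_bl': "bl T UH nq.q" unfolding UH_def by (rule nq.q_bl)

lemma UH_one: "\<one>\<^bsub>UH\<^esub> = nq.q \<one>\<^sub>T" unfolding UH_def by (simp add: nq.Q_simps)

lemma UH_one_cl: "\<one>\<^bsub>UH\<^esub> |: UH" using nq.q_cl[OF T.one_closed] unfolding UH_one by (simp only: UH_def)

lemma UH_gen: "U_half_gen av I a r i = nq.q (T_gen av I i)" by (simp add: U_half_gen_def nq.q_def)

lemma UH_gen_cl: "i \<in> I ==> U_half_gen av I a r i |: UH" by (simp add: UH_gen UH_def T_gen_cl)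

lemma UH_gen_mult: "i \<in> I ==> x |: T ==> U_half_gen av I a r i \<otimes>\<^bsub>UH\<^esub> nq.q x = nq.q (T_gen av I i \<otimes>\<^sub>T x)"
 unfolding UH_gen UH_def by (simp add: nq.q_mult T_gen_cl)

lemma UH_mult_cl: "i \<in> I ==> y |: UH ==> U_half_gen av I a r i \<otimes>\<^bsub>UH\<^esub> y |: UH"
 using UH_gen_mult T_gen_cl by (auto simp: UH_def nq.Q_carrier)

text \<open>A word arises from the empty word by left multiplications with letters. A letter is
  first a basis vector of \<open>V0\<close> and then, by density of their span, arbitrary.\<close>

lemma UH_dense:
 assumes S: "closed_subspace UH S" and 1: "\<one>\<^bsub>UH\<^esub> \<in> S"
  and step: "!!i y. i \<in> I ==> y \<in> S ==> U_half_gen av I a r i \<otimes>\<^bsub>UH\<^esub> y \<in> S"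
 shows "carrier UH \<subseteq> S"
proof -
 let ?S = "{x \<in> carrier T. nq.q x \<in> S}"
 have cs: "closed_subspace T ?S" by (rule closed_subspace_vimage[OF T_seminormed UH_seminormed q_bl' S])
 have "PT vs \<in> ?S" if "set vs \<subseteq> carrier (V0 av I)" for vs using that
 proof (induction vs)
  case Nil
  then show ?case using 1 by (simp add: UH_one T_one[symmetric])
 next
  case (Cons v vs)
  then have IH: "PT vs |: T" "nq.q (PT vs) \<in> S" by auto
  \<comment> \<open>For a fixed remaining word the admissible first letters form a closed subspace
    of \<open>V0\<close>, so basis vectors suffice.\<close>
  have "carrier (V0 av I) \<subseteq> {v \<in> carrier (V0 av I). PT [v] \<otimes>\<^sub>T PT vs \<in> ?S}"
  proof (rule V0_dense)
   show "closed_subspace (V0 av I) {v \<in> carrier (V0 av I). PT [v] \<otimes>\<^sub>T PT vs \<in> ?S}"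
    by (rule closed_subspace_vimage[OF V0_seminormed T_seminormed
      bl_comp[OF V0_seminormed T_seminormed incl_bl T.mult_bl_r[OF IH(1)]] cs])
   fix i assume i: "i \<in> I"
   have "nq.q (PT [V0_gen I i] \<otimes>\<^sub>T PT vs) \<in> S"
    using step[OF i IH(2)] UH_gen_mult[OF i IH(1)] by (simp add: T_gen_PT)
   then show "V0_gen I i \<in> {v \<in> carrier (V0 av I). PT [v] \<otimes>\<^sub>T PT vs \<in> ?S}"
    using i IH(1) by (simp add: V0_gen_cl)
  qed
  then have "PT [v] \<otimes>\<^sub>T PT vs \<in> ?S" using Cons.prems by auto
  then show ?case using Cons.prems by (simp add: PT_mult)
 qed
 then have "carrier T \<subseteq> ?S" by (rule T_dense[OF cs])
 then show ?thesis by (auto simp: UH_def nq.Q_carrier)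
qed

text \<open>Of the induced homomorphism only the value at 1 and the effect of left multiplication by
  generators are recorded; these two facts determine it and are what the later computation on triple
  tensors consumes.\<close>

lemma UH_lift:
 assumes E: "banach_space av E" "snalg av E" and f: "bl (V0 av I) E f"
  and K: "0 \<le> K" "!!vs. set vs \<subseteq> carrier (V0 av I) ==> nrm E (snalg.prodl E (map f vs)) \<le> K * (r ^ length vs * prod_list (map (nrm (V0 av I)) vs))"
  and serre: "!!i j. i \<in> I ==> j \<in> I ==> i \<noteq> j ==>
   ((commutator E (f (V0_gen I i))) ^^ nat (1 - a i j)) (f (V0_gen I j)) = \<zero>\<^sub>E"
 shows "\<exists>\<Psi>. bl UH E \<Psi> \<and> \<Psi> \<one>\<^bsub>UH\<^esub> = \<one>\<^sub>E \<and>
   (\<forall>i\<in>I. \<forall>y\<in>carrier UH. \<Psi> (U_half_gen av I a r i \<otimes>\<^bsub>UH\<^esub> y) = f (V0_gen I i) \<otimes>\<^sub>E \<Psi> y)"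
proof -
 interpret E: snalg av E by (rule E(2))
 have Es: "seminormed av E" by (rule E.seminormed_axioms)
 obtain \<Phi> where \<Phi>: "bl T E \<Phi>" "\<forall>vs. set vs \<subseteq> carrier (V0 av I) \<longrightarrow> \<Phi> (PT vs) = E.prodl (map f vs)"
   "!!x y. x |: T ==> y |: T ==> \<Phi> (x \<otimes>\<^sub>T y) = \<Phi> x \<otimes>\<^sub>E \<Phi> y" "\<Phi> \<one>\<^sub>T = \<one>\<^sub>E" using T_lift[OF E f K] by blast
 have gen: "\<Phi> (T_gen av I i) = f (V0_gen I i)" if i: "i \<in> I" for i
  using \<Phi>(2) V0_gen_cl[OF i] bl_closed[OF f V0_gen_cl[OF i]] by (simp add: T_gen_PT)
 \<comment> \<open>The kernel is a closed ideal containing the Serre elements, so it contains the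
   closed ideal they generate.\<close>
 let ?J = "{x \<in> carrier T. \<Phi> x = \<zero>\<^sub>E}"
 have zbl: "bl T E (%_. \<zero>\<^sub>E)" by (rule blI[where C = 0]) auto
 have cs: "closed_subspace T ?J"
  by (rule closed_subspace_eq[OF T_seminormed Es banach_separated[OF E(1)] \<Phi>(1) zbl])
 have neg: "\<ominus>\<^sub>T x \<in> ?J" if "x \<in> ?J" for x using that bl_neg[OF T_seminormed Es \<Phi>(1), of x] by simp
 have "serre_ideal av I a r \<subseteq> ?J"
 proof (rule serre_ideal_least)
  show "ideal ?J T"
  proof (rule idealI[OF T_ring])
   show "subgroup ?J (add_monoid T)" using neg bl_zero[OF T_seminormed Es \<Phi>(1)]
    by (intro T.M.add.subgroupI) (auto simp: bl_add[OF \<Phi>(1)] a_inv_def[symmetric])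
  qed (auto simp: \<Phi>(3) bl_closed[OF \<Phi>(1)])
  show "nclosed T ?J" using cs by (simp add: closed_subspace_def)
  fix i j assume ij: "i \<in> I" "j \<in> I" "i \<noteq> j"
  have "\<Phi> (serre av I a r i j) = \<zero>\<^sub>E"
  proof -
   have "\<Phi> (serre av I a r i j) = ((commutator E (\<Phi> (T_gen av I i))) ^^ nat (1 - a i j)) (\<Phi> (T_gen av I j))"
    unfolding serre_ad[OF ij(1,2)]
    by (rule comm_hom_pow[OF T_snalg E(2) \<Phi>(1) \<Phi>(3) T_gen_cl[OF ij(1)] T_gen_cl[OF ij(2)]])
   then show ?thesis using serre[OF ij] by (simp add: gen ij)
  qed
  then show "serre av I a r i j \<in> ?J" using ij by (simp add: serre_ad T.ad_pow_cl T_gen_cl)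
 qed
 then obtain \<Psi> where \<Psi>: "bl UH E \<Psi>" "\<forall>x\<in>carrier T. \<Psi> (nq.q x) = \<Phi> x"
  using nq.Q_lift[OF Es \<Phi>(1)] unfolding UH_def by blast
 have "\<Psi> (U_half_gen av I a r i \<otimes>\<^bsub>UH\<^esub> y) = f (V0_gen I i) \<otimes>\<^sub>E \<Psi> y" if i: "i \<in> I" and y: "y |: UH" for i y
 proof -
  obtain x where x: "x |: T" "y = nq.q x" using y by (auto simp: UH_def nq.Q_carrier)
  show ?thesis using i x \<Psi>(2) \<Phi>(3)[OF T_gen_cl[OF i] x(1)] gen[OF i] by (simp add: UH_gen_mult T_gen_cl)
 qed
 then show ?thesis using \<Psi> \<Phi>(4) by (intro exI[of _ \<Psi>]) (auto simp: UH_one)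
qed

end

section \<open>The Cartan part: monomials in the commuting generators\<close>

context nonarch
begin

lemma H0_c0: "c0 av (multi_indices I) (%_. kspace av)"
 by (intro c0.intro nonarch_axioms c0_axioms.intro kspace_seminormed)

lemma H0_seminormed: "seminormed av (H0 av I)" using c0.C_seminormed[OF H0_c0] unfolding H0_def by simp

definition Hmon :: "'i set => ('i \<Rightarrow>\<^sub>0 nat) => ('i \<Rightarrow>\<^sub>0 nat) => 'k" where
 "Hmon I n = c0_delta (multi_indices I) (%_. kspace av) n 1"

lemma Hmon_cl: "n \<in> multi_indices I ==> Hmon I n |: (H0 av I)"
 using c0.\<delta>_cl[OF H0_c0, of n I 1] by (simp add: Hmon_def H0_def)

lemma H0_one: "\<one>\<^bsub>H0 av I\<^esub> = Hmon I 0" by (rule ext) (simp add: H0_def Hmon_def c0_delta_def restrict_def)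

lemma H0_gen: "H0_gen I i = Hmon I (single i 1)"
 by (rule ext) (simp add: H0_gen_def Hmon_def c0_delta_def restrict_def)

lemma mi_simps [simp]: "0 \<in> multi_indices I" "l \<in> multi_indices I ==> m \<in> multi_indices I ==> l + m \<in> multi_indices I"
 "i \<in> I ==> single i k \<in> multi_indices I"
 using Poly_Mapping.keys_add[of l m] by (auto simp: multi_indices_def split: if_splits)

text \<open>The product in \<open>H0\<close> sums over all splittings of n. A sum over an infinite
  set would be zero by convention, so the finiteness of the set of splittings has to be
  established.\<close>

lemma Hmon_mult:
 assumes "l \<in> multi_indices I" "m \<in> multi_indices I"
 shows "Hmon I l \<otimes>\<^bsub>H0 av I\<^esub> Hmon I m = Hmon I (l + m)"
proof
 fix n :: "'a \<Rightarrow>\<^sub>0 nat"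
 have fin: "(\<Sum>(l', m')\<in>{(l', m'). l' + m' = n}. Hmon I l l' * Hmon I m m') = (if n = l + m then 1 else 0 :: 'k)"
  if n: "n \<in> multi_indices I"
 proof -
  have z: "Hmon I l l' * Hmon I m m' = (if (l', m') = (l, m) then 1 else 0 :: 'k)" if lm: "l' + m' = n" for l' m'
  proof -
   have "l' \<in> multi_indices I" "m' \<in> multi_indices I"
    using n unfolding lm[symmetric] multi_indices_def mem_Collect_eq keys_subset_iff lookup_add by auto
   then show ?thesis by (auto simp: Hmon_def c0_delta_def)
  qed
  have "(\<Sum>(l', m')\<in>{(l', m'). l' + m' = n}. Hmon I l l' * Hmon I m m')
    = (\<Sum>p\<in>{(l', m'). l' + m' = n}. if p = (l, m) then 1 else 0 :: 'k)"
  proof (intro sum.cong refl)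
   fix p assume "p \<in> {(l', m'). l' + m' = n}"
   then show "(case p of (l', m') => Hmon I l l' * Hmon I m m') = (if p = (l, m) then 1 else 0 :: 'k)"
    using z[of "fst p" "snd p"] by (simp add: split_beta)
  qed
  also have "\<dots> = (if n = l + m then 1 else 0)"
  proof (cases "finite {(l', m'). l' + m' = n}")
   case True
   then show ?thesis by (auto simp: sum.delta)
  next
   case False
   \<comment> \<open>Both parts of a splitting of n are dominated by n and hence supported in its
     finite support.\<close>
   have "finite {f :: 'a \<Rightarrow>\<^sub>0 nat. \<forall>x. lookup f x \<le> lookup n x}"
   proof -
    let ?F = "{f :: 'a \<Rightarrow>\<^sub>0 nat. \<forall>x. lookup f x \<le> lookup n x}"
    have "(%f. restrict (lookup f) (keys n)) ` ?F \<subseteq> (\<Pi>\<^sub>E x\<in>keys n. {..lookup n x})" by auto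
    moreover have "finite (\<Pi>\<^sub>E x\<in>keys n. {..lookup n x})" by (intro finite_PiE) auto
    ultimately have "finite ((%f. restrict (lookup f) (keys n)) ` ?F)" by (rule finite_subset)
    moreover have "inj_on (%f. restrict (lookup f) (keys n)) ?F"
    proof (rule inj_onI, rule poly_mapping_eqI)
     fix f g :: "'a \<Rightarrow>\<^sub>0 nat" and x
     assume f: "f \<in> ?F" "g \<in> ?F" and eq: "restrict (lookup f) (keys n) = restrict (lookup g) (keys n)"
     show "lookup f x = lookup g x"
     proof (cases "x \<in> keys n")
      case True
      then show ?thesis using fun_cong[OF eq, of x] by simp
     next
      case False
      then have "lookup n x = 0" by (simp add: in_keys_iff)
      then show ?thesis using f by (metis (no_types, lifting) le_zero_eq mem_Collect_eq)
     qed
    qed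
    ultimately show ?thesis by (rule finite_imageD)
   qed
   then have "finite ({f :: 'a \<Rightarrow>\<^sub>0 nat. \<forall>x. lookup f x \<le> lookup n x} \<times>
     {f :: 'a \<Rightarrow>\<^sub>0 nat. \<forall>x. lookup f x \<le> lookup n x})" by blast
   moreover have "{(l', m'). l' + m' = n} \<subseteq> {f :: 'a \<Rightarrow>\<^sub>0 nat. \<forall>x. lookup f x \<le> lookup n x} \<times>
     {f :: 'a \<Rightarrow>\<^sub>0 nat. \<forall>x. lookup f x \<le> lookup n x}" by (auto simp: lookup_add)
   ultimately have "finite {(l', m'). l' + m' = n}" by (rule finite_subset[rotated])
   then show ?thesis using False by blast
  qed
  finally show ?thesis .
 qed
 show "(Hmon I l \<otimes>\<^bsub>H0 av I\<^esub> Hmon I m) n = Hmon I (l + m) n"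
  using fin assms by (simp add: H0_def Hmon_def[of I "l + m"] c0_delta_def restrict_def)
qed

lemma mi_induct [consumes 1, case_names zero step]:
 assumes "n \<in> multi_indices I" "P 0"
  and step: "!!i n. i \<in> I ==> n \<in> multi_indices I ==> P n ==> P (single i 1 + n)"
 shows "P n" using assms(1)
proof (induction "\<Sum>i\<in>keys n. lookup n i" arbitrary: n rule: less_induct)
 case less
 show ?case
 proof (cases "n = 0")
  case False
  then obtain i where i: "i \<in> keys n" by fastforce
  define n' where "n' = n - single i 1"
  have li: "0 < lookup n i" using i by (simp add: in_keys_iff)
  have n: "n = single i 1 + n'"
   by (rule poly_mapping_eqI) (use li in \<open>auto simp: n'_def lookup_add lookup_minus lookup_single when_def\<close>)
  have kn: "keys n' \<subseteq> keys n" by (auto simp: n'_def in_keys_iff lookup_minus)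
  have "(\<Sum>j\<in>keys n'. lookup n' j) = (\<Sum>j\<in>keys n. lookup n' j)"
   using kn by (intro sum.mono_neutral_left) (auto simp: in_keys_iff)
  also have "\<dots> < (\<Sum>j\<in>keys n. lookup n j)"
   using i li by (intro sum_strict_mono_ex1) (auto simp: n'_def lookup_minus lookup_single when_def)
  finally have "P n'" using less kn by (auto simp: multi_indices_def)
  then show ?thesis using step[of i n'] i less.prems kn n by (auto simp: multi_indices_def)
 qed (use assms(2) in simp)
qed

text \<open>Monomials are reached from the constant one by raising one exponent at a time, and their
  scalar multiples are the images of the summands of the coproduct.\<close>

lemma H0_dense:
 assumes S: "closed_subspace (H0 av I) S" and 1: "Hmon I 0 \<in> S"
  and step: "!!i n. i \<in> I ==> n \<in> multi_indices I ==> Hmon I n \<in> S ==> Hmon I (single i 1 + n) \<in> S"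
 shows "carrier (H0 av I) \<subseteq> S"
proof -
 interpret c0 av "multi_indices I" "%_. kspace av" by (rule H0_c0)
 have mon: "Hmon I n \<in> S" if "n \<in> multi_indices I" for n using that
 proof (induction rule: mi_induct)
  case (step i n)
  then show ?case by (rule assms(3))
 qed (rule 1)
 have S': "closed_subspace C S" using S by (simp add: H0_def)
 have "carrier C \<subseteq> S"
 proof (rule C_dense[OF S'])
  fix n x assume n: "n \<in> multi_indices I"
  have "\<delta> n (x \<odot>\<^bsub>kspace av\<^esub> 1) = x \<odot>\<^sub>C \<delta> n 1" using n by (intro bl_sm[OF \<delta>_bl]) auto
  then have "\<delta> n x = x \<odot>\<^sub>C Hmon I n" by (simp add: Hmon_def)
  then show "\<delta> n x \<in> S" using S' mon[OF n] by (simp add: closed_subspace_def)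
 qed
 then show ?thesis by (simp add: H0_def)
qed

text \<open>Monomials form an orthonormal basis, so every bounded family of values extends to a
  bounded map.\<close>

lemma H0_lift:
 assumes E: "banach_space av E" and g: "!!n. n \<in> multi_indices I ==> g n |: E"
  and K: "0 \<le> K" "!!n. n \<in> multi_indices I ==> nrm E (g n) \<le> K"
 shows "\<exists>\<Psi>. bl (H0 av I) E \<Psi> \<and> (\<forall>n\<in>multi_indices I. \<Psi> (Hmon I n) = g n)"
proof -
 interpret c0 av "multi_indices I" "%_. kspace av" by (rule H0_c0)
 interpret E: seminormed av E by (rule banach_seminormed[OF na E])
 have "\<exists>\<Psi>. bl C E \<Psi> \<and> (\<forall>n\<in>multi_indices I. \<forall>x\<in>carrier (kspace av). \<Psi> (\<delta> n x) = x \<odot>\<^sub>E g n)"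
 proof (rule C_lift[OF E K(1)])
  fix n assume n: "n \<in> multi_indices I"
  show bd: "nrm E (x \<odot>\<^sub>E g n) \<le> K * nrm (kspace av) x" for x
   using mult_left_mono[OF K(2)[OF n], of "av x"] g[OF n] by (simp add: E.norm_smult mult.commute)
  show "bl (kspace av) E (%x. x \<odot>\<^sub>E g n)"
   using bd g[OF n] by (intro blI[where C = K]) (auto simp: E.sm_add_l E.sm_sm)
 qed
 then obtain \<Psi> where "bl C E \<Psi>" "\<forall>n\<in>multi_indices I. \<Psi> (\<delta> n 1) = 1 \<odot>\<^sub>E g n" by auto
 then show ?thesis using g by (intro exI[of _ \<Psi>]) (auto simp: Hmon_def H0_def)
qed

end

section \<open>Square-zero extensions\<close>

lemma closed_subspace_Ball:
 assumes "seminormed av V" "!!b. b \<in> B ==> closed_subspace V {x \<in> carrier V. P b x}"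
 shows "closed_subspace V {x \<in> carrier V. \<forall>b\<in>B. P b x}"
proof -
 interpret seminormed av V by fact
 have "P b x" if x: "x |: V" and ap: "\<forall>e>0. \<exists>s\<in>{x \<in> carrier V. \<forall>b\<in>B. P b x}. nrm V (x \<ominus>\<^sub>V s) < e" and b: "b \<in> B" for x b
 proof -
  have "\<forall>e>0. \<exists>s\<in>{x \<in> carrier V. P b x}. nrm V (x \<ominus>\<^sub>V s) < e" using ap b by fast
  then show ?thesis using assms(2)[OF b] x by (auto simp: closed_subspace_def nclosed_def)
 qed
 then show ?thesis using assms(2) unfolding closed_subspace_def nclosed_def by auto
qed

definition sqz_ext :: "('k, 'v) nspace => ('v => 'v => 'v) => ('k, 'v \<times> 'v) nspace" where
 "sqz_ext U m = \<lparr>carrier = carrier U \<times> carrier U,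
   mult = (%x y. (fst x \<otimes>\<^sub>U fst y, (fst x \<otimes>\<^sub>U snd y \<oplus>\<^sub>U snd x \<otimes>\<^sub>U fst y) \<oplus>\<^sub>U m (fst x) (fst y))),
   one = (\<one>\<^sub>U, \<zero>\<^sub>U), zero = (\<zero>\<^sub>U, \<zero>\<^sub>U),
   add = (%x y. (fst x \<oplus>\<^sub>U fst y, snd x \<oplus>\<^sub>U snd y)),
   smult = (%a x. (a \<odot>\<^sub>U fst x, a \<odot>\<^sub>U snd x)),
   nrm = (%x. max (nrm U (fst x)) (nrm U (snd x)))\<rparr>"

lemma sqz_simps: "carrier (sqz_ext U m) = carrier U \<times> carrier U"
 "(a, a') \<otimes>\<^bsub>sqz_ext U m\<^esub> (b, b') = (a \<otimes>\<^sub>U b, (a \<otimes>\<^sub>U b' \<oplus>\<^sub>U a' \<otimes>\<^sub>U b) \<oplus>\<^sub>U m a b)"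
 "\<one>\<^bsub>sqz_ext U m\<^esub> = (\<one>\<^sub>U, \<zero>\<^sub>U)" "\<zero>\<^bsub>sqz_ext U m\<^esub> = (\<zero>\<^sub>U, \<zero>\<^sub>U)"
 "(a, a') \<oplus>\<^bsub>sqz_ext U m\<^esub> (b, b') = (a \<oplus>\<^sub>U b, a' \<oplus>\<^sub>U b')"
 "c \<odot>\<^bsub>sqz_ext U m\<^esub> (a, a') = (c \<odot>\<^sub>U a, c \<odot>\<^sub>U a')"
 "nrm (sqz_ext U m) (a, a') = max (nrm U a) (nrm U a')" by (simp_all add: sqz_ext_def)

text \<open>The cocycle identity is precisely associativity of the product of
  \<open>sqz_ext U m\<close>, and the two normalisation conditions make the pair of
  \<open>\<one>\<close> and \<open>\<zero>\<close> its unit.\<close>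

locale sqz = U: snalg av U for av :: "'k::field_char_0 => real" and U :: "('k, 'v) nspace" (structure) +
 fixes m :: "'v => 'v => 'v"
 assumes m_bilin: "bilin_map U U U m" and cocycle: "a |: U ==> b |: U ==> c |: U ==>
   a \<otimes> m b c \<oplus> m a (b \<otimes> c) = m (a \<otimes> b) c \<oplus> m a b \<otimes> c"
  and m_1l: "a |: U ==> m \<one> a = \<zero>"
  and m_1r: "a |: U ==> m a \<one> = \<zero>"
begin

abbreviation "E \<equiv> sqz_ext U m"

lemma m_cl [simp, intro]: "a |: U ==> b |: U ==> m a b |: U" by (rule bilin_closed[OF m_bilin])

lemma m_add_l: "a |: U ==> a' |: U ==> b |: U ==> m (a \<oplus> a') b = m a b \<oplus> m a' b"
 and m_add_r: "a |: U ==> b |: U ==> b' |: U ==> m a (b \<oplus> b') = m a b \<oplus> m a b'"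
 and m_sm_l: "a |: U ==> b |: U ==> m (c \<odot> a) b = c \<odot> m a b"
 and m_sm_r: "a |: U ==> b |: U ==> m a (c \<odot> b) = c \<odot> m a b"
 using bl_add[OF bilin_left[OF m_bilin]] bl_add[OF bilin_right[OF m_bilin]]
  bl_sm[OF bilin_left[OF m_bilin]] bl_sm[OF bilin_right[OF m_bilin]] by auto

lemma E_abelian: "abelian_group E"
proof (rule abelian_groupI)
 fix x assume "x |: E"
 then show "\<exists>y\<in>carrier E. y \<oplus>\<^sub>E x = \<zero>\<^sub>E"
  by (intro bexI[of _ "(\<ominus> fst x, \<ominus> snd x)"]) (auto simp: sqz_simps U.l_neg)
qed (auto simp: sqz_simps U.a_ac)

lemma E_seminormed: "seminormed av E"
proof (intro seminormed.intro U.nonarch_axioms seminormed_axioms.intro)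
 show "module kring E" by (rule moduleI[OF cring_kring E_abelian])
    (auto simp: sqz_simps U.sm_add_l U.sm_add_r U.sm_sm)
 fix x assume x: "x |: E"
 then show "0 \<le> nrm E x" by (auto simp: sqz_simps le_max_iff_disj)
 show "nrm E (c \<odot>\<^sub>E x) = av c * nrm E x" for c
  using x by (auto simp: sqz_simps U.norm_smult max_mult_distrib_left)
 fix y assume y: "y |: E"
 have c: "fst x |: U" "snd x |: U" "fst y |: U" "snd y |: U" using x y by (auto simp: sqz_simps)
 show "nrm E (x \<oplus>\<^sub>E y) \<le> max (nrm E x) (nrm E y)"
  using U.norm_add[OF c(1,3)] U.norm_add[OF c(2,4)] unfolding sqz_ext_def by simp linarith
qed

lemma E_ring: "ring E"
proof (rule ringI[OF E_abelian])
 show "monoid E"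
 proof (rule monoidI)
  fix x y z assume "x |: E" "y |: E" "z |: E"
  then obtain a a' b b' c c' where e: "x = (a, a')" "y = (b, b')" "z = (c, c')" and
   cl: "a |: U" "a' |: U" "b |: U" "b' |: U" "c |: U" "c' |: U" by (auto simp: sqz_simps)
  \<comment> \<open>The part common to both bracketings; what remains on either side is one side of
    the cocycle identity.\<close>
  let ?R = "a \<otimes> (b \<otimes> c') \<oplus> (a \<otimes> (b' \<otimes> c) \<oplus> a' \<otimes> (b \<otimes> c))"
  have 1: "((a \<otimes> b) \<otimes> c' \<oplus> (a \<otimes> b' \<oplus> a' \<otimes> b \<oplus> m a b) \<otimes> c) \<oplus> m (a \<otimes> b) c = ?R \<oplus> (m (a \<otimes> b) c \<oplus> m a b \<otimes> c)"
   using cl by (simp add: U.l_distr U.m_assoc U.a_ac)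
  have 2: "(a \<otimes> (b \<otimes> c' \<oplus> b' \<otimes> c \<oplus> m b c) \<oplus> a' \<otimes> (b \<otimes> c)) \<oplus> m a (b \<otimes> c) = ?R \<oplus> (a \<otimes> m b c \<oplus> m a (b \<otimes> c))"
   using cl by (simp add: U.r_distr U.a_ac)
  show "x \<otimes>\<^sub>E y \<otimes>\<^sub>E z = x \<otimes>\<^sub>E (y \<otimes>\<^sub>E z)"
   unfolding e sqz_simps 1 2 using cocycle[OF cl(1,3,5)] cl by (simp add: U.m_assoc)
 qed (auto simp: sqz_simps m_1l m_1r)
qed (auto simp: sqz_simps U.l_distr U.r_distr m_add_l m_add_r U.a_ac)

lemma E_bilin: "bilin_map E E E (mult E)"
proof -
 obtain C where C: "0 < C" "!!v w. v |: U ==> w |: U ==> nrm U (v \<otimes> w) \<le> C * (nrm U v * nrm U w)"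
  using bilin_bound[OF U.mult_bilin] by blast
 obtain M where M: "0 < M" "!!v w. v |: U ==> w |: U ==> nrm U (m v w) \<le> M * (nrm U v * nrm U w)"
  using bilin_bound[OF m_bilin] by blast
 interpret E: ring E by (rule E_ring)
 show ?thesis
 proof (rule bilinI[OF E_seminormed E_seminormed, where C = "max C M"])
  fix x y assume "x |: E" "y |: E"
  then obtain a a' b b' where e: "x = (a, a')" "y = (b, b')" and cl: "a |: U" "a' |: U" "b |: U" "b' |: U"
   by (auto simp: sqz_simps)
  let ?X = "max (nrm U a) (nrm U a')" and ?Y = "max (nrm U b) (nrm U b')"
  have mm: "K * (nrm U u * nrm U v) \<le> max C M * (?X * ?Y)"
   if "K \<le> max C M" "0 < K" "u = a \<or> u = a'" "v = b \<or> v = b'" for K u v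
   using that cl by (intro mult_mono) (auto simp: le_max_iff_disj)
  have t: "nrm U (u \<otimes> v) \<le> max C M * (?X * ?Y)" if "u = a \<or> u = a'" "v = b \<or> v = b'" for u v
   using C(2)[of u v] mm[of C u v] C(1) that cl by fastforce
  have t': "nrm U (m a b) \<le> max C M * (?X * ?Y)" using M(2)[of a b] mm[of M a b] M(1) cl by fastforce
  show "nrm E (x \<otimes>\<^sub>E y) \<le> max C M * (nrm E x * nrm E y)" unfolding e sqz_simps using cl t t'
   by (intro max.boundedI U.norm_add_le) auto
 qed (auto simp: sqz_simps U.l_distr U.r_distr m_add_l m_add_r U.a_ac
   U.sm_mult_l U.sm_mult_r m_sm_l m_sm_r U.sm_add_r)
qed

lemma E_snalg: "snalg av E" by (intro snalg.intro E_seminormed E_ring snalg_axioms.intro E_bilin)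

sublocale E: snalg av E by (rule E_snalg)

lemma E_neg: "a |: U ==> a' |: U ==> \<ominus>\<^sub>E (a, a') = (\<ominus> a, \<ominus> a')"
 using E.sm_m1[of "(a, a')"] by (simp add: sqz_simps U.sm_m1)

lemma E_sub: "a |: U ==> a' |: U ==> b |: U ==> b' |: U ==>
  (a, a') \<ominus>\<^sub>E (b, b') = (a \<ominus> b, a' \<ominus> b')" by (simp add: E.minus_eq E_neg sqz_simps U.minus_eq)

lemma E_banach:
 assumes "banach_space av U"
 shows "banach_space av E"
proof (rule banach_spaceI[OF E_seminormed])
 fix x assume x: "x |: E" "nrm E x = 0"
 then obtain a b where ab: "x = (a, b)" "a |: U" "b |: U" by (auto simp: sqz_simps)
 have "max (nrm U a) (nrm U b) = 0" using x ab by (simp add: sqz_simps)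
 moreover have "0 \<le> nrm U a" "0 \<le> nrm U b" using ab by simp_all
 ultimately have "nrm U a = 0" "nrm U b = 0" by linarith+
 then have "a = \<zero>" "b = \<zero>" using ab banach_sep[OF assms] by blast+
 then show "x = \<zero>\<^sub>E" using ab by (simp add: sqz_simps)
next
 show "normed_complete E" unfolding normed_complete_def
 proof (intro allI impI, elim conjE)
  fix X :: "nat => 'v \<times> 'v"
  assume Xc: "\<forall>n. X n |: E" and cau: "\<forall>e>0. \<exists>N. \<forall>m\<ge>N. \<forall>n\<ge>N. nrm E (X m \<ominus>\<^sub>E X n) < e"
  have c: "fst (X n) |: U" "snd (X n) |: U" for n using Xc by (auto simp: sqz_simps mem_Times_iff)
  have d: "nrm E (X i \<ominus>\<^sub>E (a, b)) = max (nrm U (fst (X i) \<ominus> a)) (nrm U (snd (X i) \<ominus> b))"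
   if "a |: U" "b |: U" for i a b using E_sub[OF c[of i] that] by (simp add: sqz_simps)
  have "\<exists>N. \<forall>i\<ge>N. \<forall>j\<ge>N. nrm U (fst (X i) \<ominus> fst (X j)) < e" "\<exists>N. \<forall>i\<ge>N. \<forall>j\<ge>N. nrm U (snd (X i) \<ominus> snd (X j)) < e" if "0 < e" for e
   using cau that d[OF c, of _ _] by (metis max_less_iff_conj prod.collapse)+
  then obtain k l where kl: "k |: U" "(%n. nrm U (fst (X n) \<ominus> k)) \<longlonglongrightarrow> 0"
    "l |: U" "(%n. nrm U (snd (X n) \<ominus> l)) \<longlonglongrightarrow> 0"
   using banach_complete[OF assms, of "%n. fst (X n)"] banach_complete[OF assms, of "%n. snd (X n)"] c by metis
  then have "(%n. nrm E (X n \<ominus>\<^sub>E (k, l))) \<longlonglongrightarrow> 0" using tendsto_max[OF kl(2,4)] by (simp add: d)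
  then show "\<exists>l\<in>carrier E. (%n. nrm E (X n \<ominus>\<^sub>E l)) \<longlonglongrightarrow> 0" using kl by (intro bexI[of _ "(k, l)"]) (auto simp: sqz_simps)
 qed
qed

lemma E_fst_bl: "bl E U fst" and E_snd_bl: "bl E U snd" by (rule blI[where C = 1]; auto simp: sqz_simps)+

lemma E_comm: "a |: U ==> a' |: U ==> b |: U ==> b' |: U ==> commutator E (a, a') (b, b') = (commutator U a b,
   (commutator U a b' \<ominus> commutator U b a') \<oplus> (m a b \<ominus> m b a))"
 by (simp add: commutator_def sqz_simps E_sub U.ag)

text \<open>The second component of a word telescopes into terms in which a single letter is altered.\<close>

lemma E_list_bound:
 fixes e t :: "'x => 'v" and w :: "'x => real"
 assumes X: "!!x. x \<in> X ==> e x |: U" "!!x. x \<in> X ==> t x |: U" "!!x. x \<in> X ==> 0 \<le> w x"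
  and Kt: "0 \<le> Kt" "!!x. x \<in> X ==> nrm U (t x) \<le> Kt * w x"
  and K: "0 \<le> K" "!!us. set us \<subseteq> X ==> nrm U (U.prodl (map e us)) \<le> K * prod_list (map w us)"
 shows "\<exists>B\<ge>0. \<forall>us. set us \<subseteq> X \<longrightarrow> nrm E (E.prodl (map (%x. (e x, t x)) us)) \<le> B * prod_list (map w us)"
proof -
 obtain C where C: "0 < C" "!!v w. v |: U ==> w |: U ==> nrm U (v \<otimes> w) \<le> C * (nrm U v * nrm U w)"
  using bilin_bound[OF U.mult_bilin] by blast
 obtain M where M: "0 < M" "!!v w. v |: U ==> w |: U ==> nrm U (m v w) \<le> M * (nrm U v * nrm U w)"
  using bilin_bound[OF m_bilin] by blast
 define W where "W us = prod_list (map w us)" for us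
 have W0: "0 \<le> W us" if "set us \<subseteq> X" for us
  using that X(3) by (auto simp: W_def subset_iff intro!: prod_list_nonneg)
 define P where "P us = U.prodl (map e us)" for us
 have Pc: "P us |: U" if "set us \<subseteq> X" for us unfolding P_def using that X(1) by (intro U.prodl_cl) auto
 have PK: "nrm U (P us) \<le> K * W us" if "set us \<subseteq> X" for us using K(2)[OF that] by (simp add: P_def W_def)
 define D where "D us = snd (E.prodl (map (%x. (e x, t x)) us))" for us
 have pE: "E.prodl (map (%x. (e x, t x)) us) = (P us, D us) \<and> D us |: U" if "set us \<subseteq> X" for us using that
 proof (induction us)
  case Nil
  then show ?case by (simp add: sqz_simps P_def D_def)
 next
  case (Cons v vs)
  then obtain d where d: "E.prodl (map (%x. (e x, t x)) vs) = (P vs, d)" "d |: U" by auto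
  have "P vs |: U" "e v |: U" "t v |: U" using Cons.prems X Pc by auto
  then show ?case using d by (simp add: sqz_simps P_def D_def)
 qed
 have D_Cons: "D (v # vs) = (e v \<otimes> D vs \<oplus> t v \<otimes> P vs) \<oplus> m (e v) (P vs)" if "set (v # vs) \<subseteq> X" for v vs
 proof -
  have "E.prodl (map (%x. (e x, t x)) (v # vs)) = (e v, t v) \<otimes>\<^sub>E (P vs, D vs)"
   using conjunct1[OF pE[of vs]] that by simp
  then show ?thesis unfolding D_def[of "v # vs"] sqz_simps by simp
 qed
 have e1: "nrm U (e v) \<le> K * w v" if "v \<in> X" for v using PK[of "[v]"] that X(1) by (simp add: P_def W_def)
 \<comment> \<open>The two constants belong to the two ways of altering a letter v: replacing it by
   \<open>t v\<close>, or merging it with the rest of the word through m.\<close>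
 define B where "B = max (C * (K * (C * (Kt * K)))) (C * (K * (M * (K * K))))"
 have B0: "0 \<le> B" using C M K Kt by (auto simp: B_def le_max_iff_disj)
 \<comment> \<open>The second component is estimated with an arbitrary unaltered prefix in front.
   The induction then lengthens the prefix instead of multiplying the estimate by one more letter,
   so the constant of the product is paid a fixed number of times and not once per letter.\<close>
 have bd: "nrm U (P us \<otimes> D vs) \<le> B * (W us * W vs)" if "set us \<subseteq> X" "set vs \<subseteq> X" for us vs using that
 proof (induction vs arbitrary: us)
  case Nil
  then have "P us \<otimes> D [] = \<zero>" using Pc by (simp add: D_def sqz_simps)
  then show ?case using B0 W0[of us] Nil by (simp add: W_def)
 next
  case (Cons v vs)
  then have v: "v \<in> X" "set vs \<subseteq> X" by auto
  note cl = X(1)[OF v(1)] X(2)[OF v(1)] Pc[OF v(2)] Pc[OF Cons.prems(1)] conjunct2[OF pE[OF v(2)]]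
  have WW: "0 \<le> W us" "0 \<le> w v" "0 \<le> W vs" using W0 Cons.prems v X(3) by auto
  \<comment> \<open>The letter v either stays and joins the prefix, or is the one that is altered,
    in one of two ways.\<close>
  have eq: "P us \<otimes> D (v # vs) = (P (us @ [v]) \<otimes> D vs \<oplus> P us \<otimes> (t v \<otimes> P vs)) \<oplus> P us \<otimes> m (e v) (P vs)"
  proof -
   have "P (us @ [v]) = P us \<otimes> e v"
    using Cons.prems v X(1) by (subst P_def, subst map_append, subst U.prodl_append) (auto simp: P_def)
   then show ?thesis unfolding D_Cons[OF Cons.prems(2)] using cl by (simp add: U.r_distr U.m_assoc)
  qed
  have 1: "nrm U (P (us @ [v]) \<otimes> D vs) \<le> B * (W us * W (v # vs))"
   using Cons.IH[of "us @ [v]"] Cons.prems v by (simp add: W_def mult_ac)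
  have 2: "nrm U (P us \<otimes> (t v \<otimes> P vs)) \<le> B * (W us * W (v # vs))"
  proof -
   have "nrm U (t v \<otimes> P vs) \<le> C * (nrm U (t v) * nrm U (P vs))" using C(2) cl by blast
   also have "\<dots> \<le> C * ((Kt * w v) * (K * W vs))"
    using C(1) Kt PK[OF v(2)] WW v(1) K(1) cl by (intro mult_left_mono mult_mono) auto
   finally have t: "nrm U (t v \<otimes> P vs) \<le> C * ((Kt * w v) * (K * W vs))" .
   have "nrm U (P us \<otimes> (t v \<otimes> P vs)) \<le> C * (nrm U (P us) * nrm U (t v \<otimes> P vs))" using C(2) cl by blast
   also have "\<dots> \<le> C * ((K * W us) * (C * ((Kt * w v) * (K * W vs))))"
    using C(1) t PK[OF Cons.prems(1)] WW K(1) cl by (intro mult_left_mono mult_mono) auto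
   also have "\<dots> = (C * (K * (C * (Kt * K)))) * (W us * W (v # vs))" by (simp add: W_def mult_ac)
   also have "\<dots> \<le> B * (W us * W (v # vs))" using WW by (intro mult_right_mono) (auto simp: B_def W_def)
   finally show ?thesis .
  qed
  have 3: "nrm U (P us \<otimes> m (e v) (P vs)) \<le> B * (W us * W (v # vs))"
  proof -
   have "nrm U (m (e v) (P vs)) \<le> M * (nrm U (e v) * nrm U (P vs))" using M(2) cl by blast
   also have "\<dots> \<le> M * ((K * w v) * (K * W vs))"
    using M(1) e1[OF v(1)] PK[OF v(2)] WW K(1) cl by (intro mult_left_mono mult_mono) auto
   finally have t: "nrm U (m (e v) (P vs)) \<le> M * ((K * w v) * (K * W vs))" .
   have "nrm U (P us \<otimes> m (e v) (P vs)) \<le> C * (nrm U (P us) * nrm U (m (e v) (P vs)))" using C(2) cl by blast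
   also have "\<dots> \<le> C * ((K * W us) * (M * ((K * w v) * (K * W vs))))"
    using C(1) t PK[OF Cons.prems(1)] WW K(1) cl by (intro mult_left_mono mult_mono) auto
   also have "\<dots> = (C * (K * (M * (K * K)))) * (W us * W (v # vs))" by (simp add: W_def mult_ac)
   also have "\<dots> \<le> B * (W us * W (v # vs))" using WW by (intro mult_right_mono) (auto simp: B_def W_def)
   finally show ?thesis .
  qed
  show ?case unfolding eq using 1 2 3 cl Cons.prems v Pc[of "us @ [v]"] by (intro U.norm_add_le) auto
 qed
 have "nrm E (E.prodl (map (%x. (e x, t x)) us)) \<le> max K B * prod_list (map w us)" if us: "set us \<subseteq> X" for us
 proof -
  \<comment> \<open>The empty prefix is the unit, so the estimate applies to the second component
    itself.\<close>
  have "nrm U (D us) \<le> B * W us" using bd[of "[]" us] us pE[OF us] by (simp add: P_def W_def)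
  moreover have "K * W us \<le> max K B * W us" "B * W us \<le> max K B * W us" using W0[OF us] by (auto intro!: mult_right_mono)
  ultimately show ?thesis using PK[OF us] pE[OF us] by (simp add: sqz_simps W_def)
 qed
 then show ?thesis using B0 by (intro exI[of _ "max K B"]) auto
qed

end

text \<open>The first letter of one list occurs in the other and is moved to its front past the
  letters before it. Lists with equal multiplicities thus have the same product, which makes
  monomials in commuting elements well defined.\<close>

lemma (in snalg) prodl_perm:
 fixes f :: "'x => 'v"
 assumes "f ` set xs \<subseteq> carrier A" "!!x y. x \<in> set xs ==> y \<in> set xs ==> f x \<otimes> f y = f y \<otimes> f x"
  and "count_list xs = count_list ys"
 shows "prodl (map f xs) = prodl (map f ys)" using assms
proof (induction xs arbitrary: ys)
 case (Cons x xs)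
 have sets: "set ys = set (x # xs)" using fun_cong[OF Cons.prems(3)]
  by (metis (no_types) count_list_0_iff subsetI subset_antisym)
 then obtain us vs where ys: "ys = us @ x # vs" by (metis list.set_intros(1) split_list)
 have cl: "f ` set us \<subseteq> carrier A" "f ` set vs \<subseteq> carrier A" "f x |: A"
 proof -
  have "f ` set ys \<subseteq> carrier A" using Cons.prems(1) by (simp only: sets)
  then show "f ` set us \<subseteq> carrier A" "f ` set vs \<subseteq> carrier A" "f x |: A" by (auto simp: ys)
 qed
 have comm: "prodl (map f us) \<otimes> f x = f x \<otimes> prodl (map f us)"
 proof -
  have "\<forall>u\<in>set us. f u \<otimes> f x = f x \<otimes> f u" using Cons.prems(2) sets ys by auto
  then show ?thesis using cl(1)
  proof (induction us)
   case (Cons u us)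
   then have c: "f u |: A" "prodl (map f us) |: A" by auto
   have "f u \<otimes> prodl (map f us) \<otimes> f x = f u \<otimes> (f x \<otimes> prodl (map f us))"
    using Cons c cl(3) by (simp add: m_assoc)
   also have "\<dots> = (f u \<otimes> f x) \<otimes> prodl (map f us)" using c cl(3) by (simp add: m_assoc)
   also have "f u \<otimes> f x = f x \<otimes> f u" using Cons.prems by simp
   also have "(f x \<otimes> f u) \<otimes> prodl (map f us) = f x \<otimes> (f u \<otimes> prodl (map f us))"
    using c cl(3) by (simp add: m_assoc)
   finally show ?case by simp
  qed (use cl in simp)
 qed
 have "count_list xs z = count_list (us @ vs) z" for z
  using fun_cong[OF Cons.prems(3), of z] ys by (simp split: if_splits)
 then have "prodl (map f xs) = prodl (map f (us @ vs))" using Cons.prems(1,2) by (intro Cons.IH) auto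
 moreover have "set (map f us) \<subseteq> carrier A" "set (map f vs) \<subseteq> carrier A" using cl by auto
 ultimately show ?case unfolding ys using cl comm by (simp add: prodl_append m_assoc[symmetric])
next
 case Nil
 then have "count_list ys z = 0" for z by (metis count_list.simps(1))
 then have "ys = []" by (metis count_list_0_iff list.set_intros(1) neq_Nil_conv)
 then show ?case by simp
qed

lemma (in snalg) jacobi:
 assumes "x |: A" "y |: A" "z |: A"
 shows "commutator A (commutator A x y) z \<oplus> commutator A (commutator A y z) x \<oplus> commutator A (commutator A z x) y = \<zero>"
 using assms unfolding commutator_def by algebra

section \<open>Bounded Hochschild cocycles of the analytic enveloping algebra\<close>

lemma (in talg) PT_norm:
 assumes "set vs \<subseteq> carrier V"
 shows "nrm T (PT vs) \<le> r ^ length vs * prod_list (map (nrm V) vs)"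
proof -
 have g: "vs \<in> tpow_gens V (length vs)" using assms by (simp add: in_tpow_gens)
 have 0: "0 \<le> r ^ length vs * prod_list (map (nrm V) vs)"
  using r pw.w_nonneg[OF g] by (simp add: tpow_weight_def)
 have "nrm (TX n) (PT vs n) \<le> r ^ length vs * prod_list (map (nrm V) vs)" for n
 proof (cases "n = length vs")
  case True
  have "nrm (TP n) (pure_tpow av V n vs) \<le> prod_list (map (nrm V) vs)"
   using pw.sn_single[OF g] pw.emb_simps(2)[OF pw.FG_simps(6)[OF g]] True
   by (simp add: pure_tpow_emb tpow_def tpow_weight_def)
  then show ?thesis using True r by (simp add: PT_def c0_delta_def)
 next
  case False
  then show ?thesis using 0 seminormed.norm_0[OF TP_seminormed] by (simp add: PT_def c0_delta_def)
 qed
 then have "nrm cc.C (PT vs) \<le> r ^ length vs * prod_list (map (nrm V) vs)" using 0 by (intro cc.norm_le) auto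
 then show ?thesis by (simp add: T_simps)
qed

lemma prod_list_scale: "prod_list (map (%x. c * f x) xs) = c ^ length xs * prod_list (map f xs)" for c :: real
 by (induction xs) (simp_all add: mult_ac)

section \<open>The analytic enveloping algebra, its triangular decomposition and its Lie
  subalgebra\<close>

locale uan = nonarch av for av :: "'k::field_char_0 => real" +
 fixes I :: "'i set" and a :: "'i => 'i => int" and r s :: real and U :: "('k, ('k, 'i) uel) nspace" (structure)
 assumes r0: "0 < r" and s0: "0 < s" and U_an: "is_U_an av I a r s U"
begin

sublocale hr: uhalf av I a r by unfold_locales (rule r0)
sublocale hs: uhalf av I a s by unfold_locales (rule s0)

abbreviation "H \<equiv> H0 av I"
abbreviation "UT \<equiv> U_tens av I a r s"
abbreviation "em \<equiv> U_minus_emb av I a r s"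
abbreviation "ez \<equiv> U_zero_emb av I a r s"
abbreviation "ep \<equiv> U_plus_emb av I a r s"
abbreviation "F \<equiv> U_F av I a r s"
abbreviation "HH \<equiv> U_H av I a r s"
abbreviation "EE \<equiv> U_E av I a r s"
abbreviation "WW \<equiv> ctens av hr.UH H"

lemma U_rec: "\<exists>m0 e0. U = (U_space av I a r s)\<lparr>mult := m0, one := e0\<rparr>"
 using U_an unfolding is_U_an_def by blast

lemma U_balg: "banach_algebra av U" using U_an unfolding is_U_an_def by blast

lemma em_hom: "em \<in> ring_hom hr.UH U" and ez_hom: "ez \<in> ring_hom H U" and ep_hom: "ep \<in> ring_hom hs.UH U"
 using U_an unfolding is_U_an_def by blast+

lemma U_tens_eq: "y |: hr.UH ==> h |: H ==> x |: hs.UH ==> UT y h x = em y \<otimes> ez h \<otimes> ep x"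
 using U_an unfolding is_U_an_def by blast

lemma U_comm:
 assumes "i \<in> I" "j \<in> I"
 shows "commutator U (HH i) (EE j) = of_int (a i j) \<odot> EE j"
  and "commutator U (HH i) (F j) = of_int (- a i j) \<odot> F j"
  and "commutator U (EE i) (F j) = (if i = j then HH i else \<zero>)"
 using U_an assms unfolding is_U_an_def by blast+

lemma U_banach: "banach_space av U" using U_balg by (simp add: banach_algebra_def)

lemma U_snalg: "snalg av U" by (rule banach_algebra_snalg[OF na U_balg])

sublocale U: snalg av U by (rule U_snalg)

lemma W_seminormed: "seminormed av WW" by (rule ctens_seminormed[OF hr.UH_seminormed H0_seminormed])

lemma U_space_eq: "U_space av I a r s = ctens av WW hs.UH" by (simp add: U_space_def)

lemma U_carrier: "carrier U = carrier (ctens av WW hs.UH)"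
proof -
 obtain m0 e0 where "U = (ctens av WW hs.UH)\<lparr>mult := m0, one := e0\<rparr>" using U_rec unfolding U_space_eq by blast
 then show ?thesis by simp
qed

lemma bl_U_iff: "bl V U f \<longleftrightarrow> bl V (ctens av WW hs.UH) f"
 and bl_U_iff': "bl U V' f' \<longleftrightarrow> bl (ctens av WW hs.UH) V' f'"
 and cs_U_iff: "closed_subspace U S \<longleftrightarrow> closed_subspace (ctens av WW hs.UH) S"
proof -
 obtain m0 e0 where U: "U = (ctens av WW hs.UH)\<lparr>mult := m0, one := e0\<rparr>"
  using U_rec unfolding U_space_eq by blast
 show "bl V U f \<longleftrightarrow> bl V (ctens av WW hs.UH) f" "bl U V' f' \<longleftrightarrow> bl (ctens av WW hs.UH) V' f'"
  "closed_subspace U S \<longleftrightarrow> closed_subspace (ctens av WW hs.UH) S" unfolding U by simp_all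
qed

lemma bilin_hr: "bilin_map hr.UH H WW (pure_tens av hr.UH H)"
 by (rule pure_tens_bilin[OF hr.UH_seminormed H0_seminormed])

lemma bilin_W: "bilin_map WW hs.UH (ctens av WW hs.UH) (pure_tens av WW hs.UH)"
 by (rule pure_tens_bilin[OF W_seminormed hs.UH_seminormed])

lemma H_one_cl: "\<one>\<^sub>H |: H" by (simp add: H0_one Hmon_cl)

lemma UT_bl1: "h |: H ==> x |: hs.UH ==> bl hr.UH U (%y. UT y h x)" unfolding U_tens_def bl_U_iff
 by (rule bl_comp[OF hr.UH_seminormed W_seminormed bilin_left[OF bilin_hr] bilin_left[OF bilin_W]])

lemma UT_bl2: "y |: hr.UH ==> x |: hs.UH ==> bl H U (%h. UT y h x)" unfolding U_tens_def bl_U_iff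
 by (rule bl_comp[OF H0_seminormed W_seminormed bilin_right[OF bilin_hr] bilin_left[OF bilin_W]])

lemma UT_bl3: "y |: hr.UH ==> h |: H ==> bl hs.UH U (UT y h)" unfolding U_tens_def bl_U_iff
 by (rule bilin_right[OF bilin_W bilin_closed[OF bilin_hr]])

lemma em_bl: "bl hr.UH U em" unfolding U_minus_emb_def[abs_def] by (rule UT_bl1[OF H_one_cl hs.UH_one_cl])

lemma ez_bl: "bl H U ez" unfolding U_zero_emb_def[abs_def] by (rule UT_bl2[OF hr.UH_one_cl hs.UH_one_cl])

lemma ep_bl: "bl hs.UH U ep" unfolding U_plus_emb_def[abs_def] by (rule UT_bl3[OF hr.UH_one_cl H_one_cl])

lemma em_1: "em \<one>\<^bsub>hr.UH\<^esub> = \<one>" and ez_1: "ez \<one>\<^sub>H = \<one>" and ep_1: "ep \<one>\<^bsub>hs.UH\<^esub> = \<one>"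
 using em_hom ez_hom ep_hom by (auto simp: ring_hom_def)

lemma em_cl [simp]: "y |: hr.UH ==> em y |: U" by (rule bl_closed[OF em_bl])
lemma ez_cl [simp]: "h |: H ==> ez h |: U" by (rule bl_closed[OF ez_bl])
lemma ep_cl [simp]: "x |: hs.UH ==> ep x |: U" by (rule bl_closed[OF ep_bl])

lemma gens_cl [simp]: "i \<in> I ==> F i |: U" "i \<in> I ==> HH i |: U" "i \<in> I ==> EE i |: U"
 using hr.UH_gen_cl hs.UH_gen_cl Hmon_cl[of "single i 1" I] by (simp_all add: U_F_def U_H_def U_E_def H0_gen)

lemma UT_cl [simp]: "y |: hr.UH ==> h |: H ==> x |: hs.UH ==> UT y h x |: U" by (rule bl_closed[OF UT_bl3])

lemma em_gen: "i \<in> I ==> y |: hr.UH ==> em (U_half_gen av I a r i \<otimes>\<^bsub>hr.UH\<^esub> y) = F i \<otimes> em y"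
 using ring_hom_mult[OF em_hom hr.UH_gen_cl] by (simp add: U_F_def)

lemma ep_gen: "i \<in> I ==> x |: hs.UH ==> ep (U_half_gen av I a s i \<otimes>\<^bsub>hs.UH\<^esub> x) = EE i \<otimes> ep x"
 using ring_hom_mult[OF ep_hom hs.UH_gen_cl] by (simp add: U_E_def)

lemma ez_mon: "i \<in> I ==> n \<in> multi_indices I ==> ez (Hmon I (single i 1 + n)) = HH i \<otimes> ez (Hmon I n)"
 using ring_hom_mult[OF ez_hom Hmon_cl Hmon_cl, of "single i 1" n] by (simp add: Hmon_mult U_H_def H0_gen)

lemma U_dense:
 assumes S: "closed_subspace U S" and UT: "!!y h x. y |: hr.UH ==> h |: H ==> x |: hs.UH ==> UT y h x \<in> S"
 shows "carrier U \<subseteq> S" unfolding U_carrier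
proof (rule ctens_dense[OF W_seminormed hs.UH_seminormed S[unfolded cs_U_iff]])
 fix t x assume t: "t |: WW" and x: "x |: hs.UH"
 have "carrier WW \<subseteq> {t \<in> carrier WW. pure_tens av WW hs.UH t x \<in> S}"
 proof (rule ctens_dense[OF hr.UH_seminormed H0_seminormed])
  show "closed_subspace WW {t \<in> carrier WW. pure_tens av WW hs.UH t x \<in> S}"
   by (rule closed_subspace_vimage[OF W_seminormed ctens_seminormed[OF W_seminormed hs.UH_seminormed]
      bilin_left[OF bilin_W x] S[unfolded cs_U_iff]])
  show "pure_tens av hr.UH H y h \<in> {t \<in> carrier WW. pure_tens av WW hs.UH t x \<in> S}"
   if "y |: hr.UH" "h |: H" for y h
   using UT[OF that x] bilin_closed[OF bilin_hr that] by (simp add: U_tens_def)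
 qed
 then show "pure_tens av WW hs.UH t x \<in> S" using t by blast
qed

text \<open>By the triangular decomposition an elementary tensor is a product of one element from
  each embedded factor, and each factor is exhausted by left multiplication with its own
  generators.\<close>

lemma U_generated:
 assumes S: "closed_subspace U S" and 1: "\<one> \<in> S" and mult: "!!u v. u \<in> S ==> v \<in> S ==> u \<otimes> v \<in> S"
  and gens: "!!i. i \<in> I ==> F i \<in> S \<and> HH i \<in> S \<and> EE i \<in> S"
 shows "carrier U \<subseteq> S"
proof -
 have m: "em y \<in> S" if "y |: hr.UH" for y
 proof -
  have "carrier hr.UH \<subseteq> {y \<in> carrier hr.UH. em y \<in> S}"
  proof (rule hr.UH_dense[OF closed_subspace_vimage[OF hr.UH_seminormed U.seminormed_axioms em_bl S]])
   show "\<one>\<^bsub>hr.UH\<^esub> \<in> {y \<in> carrier hr.UH. em y \<in> S}" using hr.UH_one_cl 1 by (simp add: em_1)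
   show "U_half_gen av I a r i \<otimes>\<^bsub>hr.UH\<^esub> y \<in> {y \<in> carrier hr.UH. em y \<in> S}"
    if "i \<in> I" "y \<in> {y \<in> carrier hr.UH. em y \<in> S}" for i y
    using that gens mult by (auto simp: em_gen hr.UH_mult_cl)
  qed
  then show ?thesis using that by blast
 qed
 have p: "ep x \<in> S" if "x |: hs.UH" for x
 proof -
  have "carrier hs.UH \<subseteq> {x \<in> carrier hs.UH. ep x \<in> S}"
  proof (rule hs.UH_dense[OF closed_subspace_vimage[OF hs.UH_seminormed U.seminormed_axioms ep_bl S]])
   show "\<one>\<^bsub>hs.UH\<^esub> \<in> {y \<in> carrier hs.UH. ep y \<in> S}" using hs.UH_one_cl 1 by (simp add: ep_1)
   show "U_half_gen av I a s i \<otimes>\<^bsub>hs.UH\<^esub> y \<in> {y \<in> carrier hs.UH. ep y \<in> S}"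
    if "i \<in> I" "y \<in> {y \<in> carrier hs.UH. ep y \<in> S}" for i y
    using that gens mult by (auto simp: ep_gen hs.UH_mult_cl)
  qed
  then show ?thesis using that by blast
 qed
 have z: "ez h \<in> S" if "h |: H" for h
 proof -
  have "carrier H \<subseteq> {h \<in> carrier H. ez h \<in> S}"
  proof (rule H0_dense[OF closed_subspace_vimage[OF H0_seminormed U.seminormed_axioms ez_bl S]])
   show "Hmon I 0 \<in> {h \<in> carrier H. ez h \<in> S}" using H_one_cl 1 ez_1 by (simp add: H0_one)
   show "Hmon I (single i 1 + n) \<in> {h \<in> carrier H. ez h \<in> S}"
    if "i \<in> I" "n \<in> multi_indices I" "Hmon I n \<in> {h \<in> carrier H. ez h \<in> S}" for i n
    using that gens mult ez_mon[OF that(1,2)] by (auto simp: Hmon_cl simp del: One_nat_def)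
  qed
  then show ?thesis using that by blast
 qed
 show ?thesis by (rule U_dense[OF S]) (simp add: U_tens_eq m p z mult)
qed

abbreviation "g \<equiv> g_an av I a r s U"

lemma g_simps: "add g = add U" "zero g = zero U" "smult g = smult U" "nrm g = nrm U"
 by (simp_all add: g_an_def)

definition lie_closed :: "('k, 'i) uel set => bool" where
 "lie_closed L \<longleftrightarrow> L \<subseteq> carrier U \<and> F ` I \<union> HH ` I \<union> EE ` I \<subseteq> L \<and> \<zero> \<in> L \<and>
   (\<forall>x\<in>L. \<forall>y\<in>L. x \<oplus> y \<in> L \<and> commutator U x y \<in> L) \<and> (\<forall>c. \<forall>x\<in>L. c \<odot> x \<in> L) \<and> nclosed U L"

lemma lie_closedD:
 assumes "lie_closed L"
 shows "F ` I \<union> HH ` I \<union> EE ` I \<subseteq> L" "\<zero> \<in> L" "x \<in> L ==> y \<in> L ==> x \<oplus> y \<in> L"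
  "x \<in> L ==> y \<in> L ==> commutator U x y \<in> L" "x \<in> L ==> c \<odot> x \<in> L" "nclosed U L"
 using assms unfolding lie_closed_def by auto

text \<open>Membership tested against every closed Lie subalgebra that contains the generators; the
  closure properties of \<open>g\<close> are inherited from these.\<close>

lemma g_mem: "x |: g \<longleftrightarrow> (\<forall>L. lie_closed L \<longrightarrow> x \<in> L)"
 unfolding g_an_def closed_lie_hull_def lie_closed_def[symmetric] by simp

lemma g_sub: "carrier g \<subseteq> carrier U"
proof
 fix x assume "x |: g"
 moreover have "lie_closed (carrier U)" by (auto simp: nclosed_def lie_closed_def)
 ultimately show "x |: U" by (simp add: g_mem)
qed

lemma g_gens: "i \<in> I ==> F i |: g" "i \<in> I ==> HH i |: g" "i \<in> I ==> EE i |: g"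
 unfolding g_mem using lie_closedD(1) by blast+

lemma g_comm: "x |: g ==> y |: g ==> commutator U x y |: g" by (simp add: g_mem lie_closedD(4))

lemma g_closed: "closed_subspace U (carrier g)" unfolding closed_subspace_def
proof (intro conjI ballI allI)
 show "nclosed U (carrier g)" unfolding nclosed_def
 proof (intro ballI impI)
  fix x assume x: "x |: U" and ap: "\<forall>e>0. \<exists>s\<in>carrier g. nrm U (x \<ominus> s) < e"
  have "x \<in> L" if L: "lie_closed L" for L
  proof -
   have "carrier g \<subseteq> L" using L by (auto simp: g_mem)
   then have "\<forall>e>0. \<exists>s\<in>L. nrm U (x \<ominus> s) < e" using ap by blast
   then show "x \<in> L" using lie_closedD(6)[OF L] x unfolding nclosed_def by blast
  qed
  then show "x |: g" by (simp add: g_mem)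
 qed
qed (use g_sub in \<open>auto simp: g_mem lie_closedD\<close>)

lemma g_cs: "\<zero> |: g" "x |: g ==> y |: g ==> x \<oplus> y |: g" "x |: g ==> c \<odot> x |: g"
 using g_closed unfolding closed_subspace_def by auto

definition lsum :: "'i list => ('i \<Rightarrow>\<^sub>0 nat)" where "lsum is = sum_list (map (%i. single i 1) is)"

lemma lsum_mi: "set is \<subseteq> I ==> lsum is \<in> multi_indices I"
 by (induction "is") (auto simp: lsum_def simp del: One_nat_def)

lemma HH_prodl: "set is \<subseteq> I ==> U.prodl (map HH is) = ez (Hmon I (lsum is))"
proof (induction "is")
 case Nil
 then show ?case using ez_1 by (simp add: lsum_def H0_one)
next
 case (Cons i "is")
 then show ?case using ez_mon[of i "lsum is"] lsum_mi[of "is"] by (simp add: lsum_def)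
qed

text \<open>A word in the Cartan generators is the image of a single monomial, of norm at most one.
  Its norm is therefore at most the bound of \<open>ez\<close>, whatever its length. The trivial
  weights bring this into the form that \<open>E_list_bound\<close> expects.\<close>

lemma HH_bound: "\<exists>K\<ge>0. \<forall>is. set is \<subseteq> I \<longrightarrow> nrm U (U.prodl (map HH is)) \<le> K * prod_list (map (%_. 1) is)"
proof -
 obtain C where C: "0 < C" "!!x. x |: H ==> nrm U (ez x) \<le> C * nrm H x"
  using bl_bound[OF H0_seminormed ez_bl] by blast
 have "nrm H (Hmon I n) \<le> 1" for n
 proof -
  interpret hc: c0 av "multi_indices I" "%_. kspace av" by (rule H0_c0)
  have "nrm hc.C (Hmon I n) \<le> 1" by (rule hc.norm_le) (auto simp: Hmon_def c0_delta_def)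
  then show ?thesis by (simp add: H0_def)
 qed
 then have "nrm U (ez (Hmon I n)) \<le> C" if "n \<in> multi_indices I" for n
  using order.trans[OF C(2)[OF Hmon_cl[OF that]] mult_left_mono[of "nrm H (Hmon I n)" 1 C]] C(1) by simp
 then show ?thesis using C(1) lsum_mi by (intro exI[of _ C]) (auto simp: HH_prodl map_replicate_const prod_list_replicate)
qed

lemma HH_comm: "i \<in> I ==> j \<in> I ==> HH i \<otimes> HH j = HH j \<otimes> HH i"
 using HH_prodl[of "[i, j]"] HH_prodl[of "[j, i]"] by (simp add: lsum_def add.commute)

lemma lsum_count: "lookup (lsum is) i = count_list is i"
 by (induction "is") (auto simp: lsum_def lookup_add lookup_single when_def)

lemma lsum_ex: "n \<in> multi_indices I ==> \<exists>is. set is \<subseteq> I \<and> lsum is = n"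
proof (induction rule: mi_induct)
 case zero
 then show ?case by (intro exI[of _ "[]"]) (simp add: lsum_def)
next
 case (step i n)
 then obtain "is" where "set is \<subseteq> I" "lsum is = n" by blast
 then show ?case using step by (intro exI[of _ "i # is"]) (simp add: lsum_def)
qed

end

text \<open>The equation \<open>t_lie\<close> is the second component of the statement that pairing
  x with \<open>t x\<close> preserves brackets into the square-zero extension; the first component
  is automatic.\<close>

locale hoch = uan av I a r s U + sqz av U m
 for av :: "'k::field_char_0 => real" and I :: "'i set" and a r s and U (structure) and m +
 fixes t
 assumes t_cl: "x |: g ==> t x |: U" and t_add: "x |: g ==> y |: g ==> t (x \<oplus> y) = t x \<oplus> t y"
  and t_sm: "x |: g ==> t (c \<odot> x) = c \<odot> t x"
  and t_bd: "\<exists>C. \<forall>x\<in>carrier g. nrm U (t x) \<le> C * nrm U x"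
  and t_lie: "x |: g ==> y |: g ==> t (commutator U x y) =
   (commutator U x (t y) \<ominus> commutator U y (t x)) \<oplus> (m x y \<ominus> m y x)"
begin

definition \<phi> where "\<phi> x = (x, t x)"

lemma gU: "x |: g ==> x |: U" using g_sub by blast

lemma \<phi>_cl [simp]: "x |: g ==> \<phi> x |: E" by (simp add: \<phi>_def sqz_simps t_cl gU)

lemma \<phi>_lie: "x |: g ==> y |: g ==> commutator E (\<phi> x) (\<phi> y) = \<phi> (commutator U x y)"
proof -
 assume xy: "x |: g" "y |: g"
 have "\<ominus> commutator U y (t x) = commutator U (t x) y"
  unfolding commutator_def using xy t_cl gU by (simp add: U.neg_sub)
 have "commutator U (t x) y = \<ominus> commutator U y (t x)"
  unfolding commutator_def using xy t_cl gU by (simp add: U.neg_sub)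
 then show ?thesis
  unfolding \<phi>_def t_lie[OF xy] using E_comm[OF gU[OF xy(1)] t_cl[OF xy(1)] gU[OF xy(2)] t_cl[OF xy(2)]] by simp
qed

lemma \<phi>_sm: "x |: g ==> \<phi> (c \<odot> x) = c \<odot>\<^sub>E \<phi> x" by (simp add: \<phi>_def sqz_simps t_sm)

lemma \<phi>_0: "\<phi> \<zero> = \<zero>\<^sub>E" using \<phi>_sm[OF g_cs(1), of 0] \<phi>_cl[OF g_cs(1)] by simp

lemma t_bdE: obtains C where "0 < C" "!!x. x |: g ==> nrm U (t x) \<le> C * nrm U x"
proof -
 obtain C where C: "\<forall>x\<in>carrier g. nrm U (t x) \<le> C * nrm U x" using t_bd ..
 have "nrm U (t x) \<le> max C 1 * nrm U x" if x: "x |: g" for x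
  using C x mult_right_mono[of C "max C 1" "nrm U x"] gU[OF x] by fastforce
 then show ?thesis by (intro that[of "max C 1"]) auto
qed

lemma \<phi>_comp_bl:
 assumes V: "seminormed av V" and j: "bl V U j" and jg: "!!v. v |: V ==> j v |: g"
 shows "bl V E (%v. \<phi> (j v))"
proof -
 interpret V: seminormed av V by fact
 obtain C where C: "0 < C" "!!x. x |: g ==> nrm U (t x) \<le> C * nrm U x" using t_bdE by blast
 obtain D where D: "0 < D" "!!x. x |: V ==> nrm U (j x) \<le> D * nrm V x" using bl_bound[OF V j] by blast
 show ?thesis
 proof (rule blI[where C = "max D (C * D)"])
  fix x assume x: "x |: V"
  have "nrm U (j x) \<le> max D (C * D) * nrm V x"
   using D(2)[OF x] mult_right_mono[of D "max D (C * D)" "nrm V x"] x by fastforce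
  moreover have "nrm U (t (j x)) \<le> max D (C * D) * nrm V x"
  proof -
   have "nrm U (t (j x)) \<le> C * (D * nrm V x)"
    using order.trans[OF C(2)[OF jg[OF x]] mult_left_mono[OF D(2)[OF x], of C]] C(1) by simp
   also have "\<dots> \<le> max D (C * D) * nrm V x" using x mult_right_mono[of "C * D" "max D (C * D)" "nrm V x"] by (simp add: mult.assoc)
   finally show ?thesis .
  qed
  ultimately show "nrm E (\<phi> (j x)) \<le> max D (C * D) * nrm V x" by (simp add: \<phi>_def sqz_simps)
 qed (use jg in \<open>auto simp: \<phi>_def sqz_simps bl_add[OF j] bl_sm[OF j] t_add t_sm t_cl gU\<close>)
qed

text \<open>All iterated commutators stay inside \<open>g\<close>, where \<open>\<phi>\<close>
  preserves brackets.\<close>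

lemma serre_zero:
 assumes "x |: g" "y |: g" "((commutator U x) ^^ n) y = \<zero>"
 shows "((commutator E (\<phi> x)) ^^ n) (\<phi> y) = \<zero>\<^sub>E"
proof -
 have "((commutator U x) ^^ n) y |: g \<and> ((commutator E (\<phi> x)) ^^ n) (\<phi> y) = \<phi> (((commutator U x) ^^ n) y)" for n
  by (induction n) (use assms in \<open>auto simp: g_comm \<phi>_lie\<close>)
 then show ?thesis using assms(3) by (simp add: \<phi>_0)
qed

text \<open>Stated for a bounded homomorphism e and a radius q, so that both halves are instances:
  \<open>em\<close> with r and \<open>ep\<close> with s.\<close>

lemma half_lift:
 assumes q0: "0 < q" and e_bl: "bl (U_half av I a q) U e" and e_hom: "e \<in> ring_hom (U_half av I a q) U"
  and eg: "!!i. i \<in> I ==> e (U_half_gen av I a q i) |: g"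
 shows "\<exists>\<Psi>. bl (U_half av I a q) E \<Psi> \<and> \<Psi> \<one>\<^bsub>U_half av I a q\<^esub> = \<one>\<^sub>E \<and>
   (\<forall>i\<in>I. \<forall>y\<in>carrier (U_half av I a q). \<Psi> (U_half_gen av I a q i \<otimes>\<^bsub>U_half av I a q\<^esub> y) = \<phi> (e (U_half_gen av I a q i)) \<otimes>\<^sub>E \<Psi> y)"
proof -
 interpret h: uhalf av I a q by unfold_locales (rule q0)
 interpret V0: seminormed av "V0 av I" by (rule V0_seminormed)

 define f where "f x = e (h.nq.q x)" for x
 define j where "j v = f (h.PT [v])" for v
 have f_mult: "f (x \<otimes>\<^bsub>h.T\<^esub> y) = f x \<otimes> f y" if "x |: h.T" "y |: h.T" for x y
  using ring_hom_mult[OF e_hom, of "h.nq.q x" "h.nq.q y"] that by (simp add: f_def h.nq.q_mult h.UH_def)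
 have f_bl: "bl h.T U f"
  unfolding f_def[abs_def] by (rule bl_comp[OF h.T_seminormed h.UH_seminormed h.q_bl' e_bl])
 have j_bl: "bl (V0 av I) U j"
  unfolding j_def[abs_def] by (rule bl_comp[OF V0_seminormed h.T_seminormed h.incl_bl f_bl])
 have j_gen: "j (V0_gen I i) = e (U_half_gen av I a q i)" for i by (simp add: j_def f_def h.UH_gen h.T_gen_PT)
 have jg: "j v |: g" if "v |: (V0 av I)" for v
  using V0_dense[OF closed_subspace_vimage[OF V0_seminormed U.seminormed_axioms j_bl g_closed]] that
  by (auto simp: j_gen eg V0_gen_cl)
 have j_prodl: "U.prodl (map j vs) = f (h.PT vs)" if "set vs \<subseteq> carrier (V0 av I)" for vs using that
 proof (induction vs)
  case Nil
  then show ?case using ring_hom_one[OF e_hom] by (simp add: f_def h.UH_one h.T_one)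
 next
  case (Cons v vs)
  then have "h.PT (v # vs) = h.PT [v] \<otimes>\<^bsub>h.T\<^esub> h.PT vs" by (simp add: h.PT_mult)
  then show ?case using Cons by (simp add: f_mult j_def)
 qed
 obtain K where K: "0 < K" "!!x. x |: h.T ==> nrm U (f x) \<le> K * nrm h.T x"
  using bl_bound[OF h.T_seminormed f_bl] by blast
 \<comment> \<open>A word in \<open>U\<close> is the image under f of a word of the tensor algebra,
   whose norm already accounts for \<open>q ^ length vs\<close>. So a letter gets the weight q times
   its norm, and the bound of f is the only constant, independent of the length.\<close>
 have Kb: "nrm U (U.prodl (map j vs)) \<le> K * prod_list (map (%v. q * nrm (V0 av I) v) vs)" if vs: "set vs \<subseteq> carrier (V0 av I)" for vs
  using order.trans[OF K(2)[OF h.PT_cl[OF vs]] mult_left_mono[OF h.PT_norm[OF vs], of K]] K(1)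
  unfolding j_prodl[OF vs] prod_list_scale by simp
 obtain C where C: "0 < C" "!!x. x |: g ==> nrm U (t x) \<le> C * nrm U x" using t_bdE by blast
 have "nrm U (j v) \<le> K * (q * nrm (V0 av I) v)" if "v |: (V0 av I)" for v
  using Kb[of "[v]"] that bl_closed[OF j_bl that] by simp
 then have tb: "nrm U (t (j v)) \<le> (C * K) * (q * nrm (V0 av I) v)" if "v |: (V0 av I)" for v
  using order.trans[OF C(2)[OF jg[OF that]] mult_left_mono[of "nrm U (j v)" "K * (q * nrm (V0 av I) v)" C]] C(1) that
  by (simp add: mult.assoc)
 \<comment> \<open>Words in the extension obey the same weights with another constant, which is the
   hypothesis on words in \<open>UH_lift\<close>.\<close>
 have "\<exists>B\<ge>0. \<forall>vs. set vs \<subseteq> carrier (V0 av I) \<longrightarrow>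
   nrm E (E.prodl (map (%v. (j v, t (j v))) vs)) \<le> B * prod_list (map (%v. q * nrm (V0 av I) v) vs)"
  by (rule E_list_bound[OF _ _ _ _ tb less_imp_le[OF K(1)] Kb]) (use jg t_cl gU q0 C K in auto)
 then obtain B where B: "0 \<le> B" "!!vs. set vs \<subseteq> carrier (V0 av I) ==>
   nrm E (E.prodl (map (%v. \<phi> (j v)) vs)) \<le> B * (q ^ length vs * prod_list (map (nrm (V0 av I)) vs))"
  unfolding \<phi>_def prod_list_scale by blast
 have "((commutator E (\<phi> (j (V0_gen I i)))) ^^ nat (1 - a i k)) (\<phi> (j (V0_gen I k))) = \<zero>\<^sub>E"
  if ij: "i \<in> I" "k \<in> I" "i \<noteq> k" for i k
 proof -
  \<comment> \<open>The Serre element is zero in the half, so the iterated commutator vanishes in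
    \<open>U\<close> and, by \<open>serre_zero\<close>, also in the extension.\<close>
  have "h.nq.q (serre av I a q i k) = h.nq.q \<zero>\<^bsub>h.T\<^esub>"
   using h.serre_in[OF ij] h.nq.N_sub by (intro h.nq.q_eq) (auto simp: h.nq.q_mem)
  then have "f (serre av I a q i k) = \<zero>"
   using bl_zero[OF h.T_seminormed U.seminormed_axioms f_bl] by (simp add: f_def)
  moreover have "f (serre av I a q i k) = ((commutator U (j (V0_gen I i))) ^^ nat (1 - a i k)) (j (V0_gen I k))"
   unfolding h.serre_ad[OF ij(1,2)] j_def h.T_gen_PT[symmetric]
   by (rule comm_hom_pow[where f = f, OF h.T_snalg U_snalg f_bl f_mult]) (use ij h.T_gen_cl in auto)
  ultimately show ?thesis using serre_zero[OF jg[OF V0_gen_cl[OF ij(1)]] jg[OF V0_gen_cl[OF ij(2)]]] by simp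
 qed
 from h.UH_lift[OF E_banach[OF U_banach] E_snalg \<phi>_comp_bl[OF V0_seminormed j_bl jg] B this]
 show ?thesis by (auto simp: j_gen h.UH_def)
qed

text \<open>A multi-index is represented by some list of generators, and the product of their lifts
  does not depend on the list: the Cartan generators commute in \<open>U\<close>, and
  \<open>\<phi>\<close> preserves brackets, so their lifts commute as well. The bound of
  \<open>E_list_bound\<close> is uniform in the length because the letters have weight one.\<close>

lemma \<Psi>z_ex: "\<exists>\<Psi>. bl H E \<Psi> \<and> \<Psi> \<one>\<^sub>H = \<one>\<^sub>E \<and>
   (\<forall>i\<in>I. \<forall>n\<in>multi_indices I. \<Psi> (Hmon I (single i 1 + n)) = \<phi> (HH i) \<otimes>\<^sub>E \<Psi> (Hmon I n))"
proof -
 obtain K where K: "0 \<le> K" "!!is. set is \<subseteq> I ==> nrm U (U.prodl (map HH is)) \<le> K * prod_list (map (%_. 1) is)"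
  using HH_bound by blast
 obtain C where C: "0 < C" "!!x. x |: g ==> nrm U (t x) \<le> C * nrm U x" using t_bdE by blast
 have tb: "nrm U (t (HH i)) \<le> (C * K) * 1" if "i \<in> I" for i
  using order.trans[OF C(2)[OF g_gens(2)[OF that]] mult_left_mono[of "nrm U (HH i)" K C]] K(2)[of "[i]"] C(1) that by simp
 have "\<exists>B\<ge>0. \<forall>is. set is \<subseteq> I \<longrightarrow>
   nrm E (E.prodl (map (%i. (HH i, t (HH i))) is)) \<le> B * prod_list (map (%_. 1) is)"
  by (rule E_list_bound[OF _ _ _ _ tb K]) (use g_gens t_cl C K in auto)
 then obtain B where B: "0 \<le> B" "!!is. set is \<subseteq> I ==> nrm E (E.prodl (map (%i. \<phi> (HH i)) is)) \<le> B"
  unfolding \<phi>_def by (auto simp: map_replicate_const prod_list_replicate)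
 define ls where "ls n = (SOME is. set is \<subseteq> I \<and> lsum is = n)" for n
 have ls: "set (ls n) \<subseteq> I" "lsum (ls n) = n" if "n \<in> multi_indices I" for n
  using someI_ex[OF lsum_ex[OF that]] unfolding ls_def by auto
 let ?g = "%n. E.prodl (map (%i. \<phi> (HH i)) (ls n))"
 have gc: "set (map (%i. \<phi> (HH i)) is) \<subseteq> carrier E" if "set is \<subseteq> I" for "is" using that g_gens by auto
 obtain \<Psi> where \<Psi>: "bl H E \<Psi>" "!!n. n \<in> multi_indices I ==> \<Psi> (Hmon I n) = ?g n"
  using H0_lift[OF E_banach[OF U_banach], of I ?g B] E.prodl_cl[OF gc[OF ls(1)]] B ls(1) by blast
 have comm: "\<phi> (HH i) \<otimes>\<^sub>E \<phi> (HH j) = \<phi> (HH j) \<otimes>\<^sub>E \<phi> (HH i)" if "i \<in> I" "j \<in> I" for i j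
 proof -
  have "commutator U (HH i) (HH j) = \<zero>" using that HH_comm[OF that] by (simp add: commutator_def)
  then have "commutator E (\<phi> (HH i)) (\<phi> (HH j)) = \<zero>\<^sub>E" using \<phi>_lie[OF g_gens(2) g_gens(2)] that \<phi>_0 by simp
  then show ?thesis unfolding commutator_def using that g_gens(2) by (subst (asm) E.sub_eq_0) auto
 qed
 have "\<Psi> (Hmon I (single i 1 + n)) = \<phi> (HH i) \<otimes>\<^sub>E \<Psi> (Hmon I n)"
  if i: "i \<in> I" and n: "n \<in> multi_indices I" for i n
 proof -
  let ?n = "single i 1 + n"
  have mi: "?n \<in> multi_indices I" using i n by (intro mi_simps) auto
  \<comment> \<open>The list chosen for the larger multi-index need not extend the one chosen for n,
    but it has the same multiplicities as i followed by that one.\<close>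
  have cnt: "count_list (ls ?n) j = count_list (i # ls n) j" for j
   using ls(2)[OF mi] ls(2)[OF n] lsum_count[of "ls ?n" j] lsum_count[of "ls n" j]
   by (cases "i = j") (simp_all add: lookup_add lookup_single when_def)
  have "?g ?n = E.prodl (map (%i. \<phi> (HH i)) (i # ls n))"
  proof -
   have "\<phi> (HH i') |: E" if "i' \<in> I" for i' using g_gens that by simp
   then show ?thesis using ls(1)[OF mi] cnt comm by (intro E.prodl_perm) (auto simp: subset_iff)
  qed
  then show ?thesis using \<Psi>(2)[OF n] \<Psi>(2)[OF mi] by simp
 qed
 \<comment> \<open>The only list with multi-index zero is the empty one, so the choice made for it
   is harmless.\<close>
 moreover have "\<Psi> \<one>\<^sub>H = \<one>\<^sub>E"
 proof -
  have "count_list (ls 0) z = 0" for z using lsum_count[of "ls 0" z] ls(2)[of 0] by simp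
  then have "ls 0 = []" by (metis count_list_0_iff list.set_intros(1) neq_Nil_conv)
  then show ?thesis using \<Psi>(2)[of 0] by (simp add: H0_one)
 qed
 ultimately show ?thesis using \<Psi>(1) by blast
qed

text \<open>On elementary tensors the candidate is the product of the three partial lifts; it is
  bounded and linear by construction. Multiplicativity is established for left multiplication by
  generators, in the order F, H, E in which moving a letter to its place produces only letters
  already treated.\<close>

lemma derivation_ex: "\<exists>D. bl U U D \<and>
  (\<forall>x\<in>carrier U. \<forall>y\<in>carrier U. D (x \<otimes> y) = (x \<otimes> D y \<oplus> D x \<otimes> y) \<oplus> m x y)"
proof -
 obtain \<Psi>m where \<Psi>m: "bl hr.UH E \<Psi>m" "\<Psi>m \<one>\<^bsub>hr.UH\<^esub> = \<one>\<^sub>E"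
   "!!i y. i \<in> I ==> y |: hr.UH ==> \<Psi>m (U_half_gen av I a r i \<otimes>\<^bsub>hr.UH\<^esub> y) = \<phi> (F i) \<otimes>\<^sub>E \<Psi>m y"
  using half_lift[OF r0 em_bl em_hom] g_gens(1) unfolding U_F_def by blast
 obtain \<Psi>z where \<Psi>z: "bl H E \<Psi>z" "\<Psi>z \<one>\<^sub>H = \<one>\<^sub>E"
   "!!i n. i \<in> I ==> n \<in> multi_indices I ==> \<Psi>z (Hmon I (single i 1 + n)) = \<phi> (HH i) \<otimes>\<^sub>E \<Psi>z (Hmon I n)"
  using \<Psi>z_ex by blast
 obtain \<Psi>p where \<Psi>p: "bl hs.UH E \<Psi>p" "\<Psi>p \<one>\<^bsub>hs.UH\<^esub> = \<one>\<^sub>E"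
   "!!i y. i \<in> I ==> y |: hs.UH ==> \<Psi>p (U_half_gen av I a s i \<otimes>\<^bsub>hs.UH\<^esub> y) = \<phi> (EE i) \<otimes>\<^sub>E \<Psi>p y"
  using half_lift[OF s0 ep_bl ep_hom] g_gens(3) unfolding U_E_def by blast
 note EB = E_banach[OF U_banach]
 have sepE: "separated E" using EB by (rule banach_separated)
 note Us = U.seminormed_axioms and Es = E_seminormed
 let ?b1 = "%y h. \<Psi>m y \<otimes>\<^sub>E \<Psi>z h"
 have b1: "bilin_map hr.UH H E ?b1"
  by (rule bilin_comp[OF hr.UH_seminormed H0_seminormed Es Es \<Psi>m(1) \<Psi>z(1) E_bilin])
 define \<Phi>1 where "\<Phi>1 = tens_lift av hr.UH H E ?b1"
 have \<Phi>1: "bl WW E \<Phi>1" "!!y h. y |: hr.UH ==> h |: H ==> \<Phi>1 (pure_tens av hr.UH H y h) = ?b1 y h"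
  unfolding \<Phi>1_def using tens_lift[OF hr.UH_seminormed H0_seminormed EB b1] by auto
 let ?b2 = "%w x. \<Phi>1 w \<otimes>\<^sub>E \<Psi>p x"
 have b2: "bilin_map WW hs.UH E ?b2"
  by (rule bilin_comp[OF W_seminormed hs.UH_seminormed Es Es \<Phi>1(1) \<Psi>p(1) E_bilin])
 define \<Phi> where "\<Phi> = tens_lift av WW hs.UH E ?b2"
 have \<Phi>: "bl U E \<Phi>" unfolding \<Phi>_def bl_U_iff' by (rule tens_lift_bl[OF W_seminormed hs.UH_seminormed EB b2])
 have \<Phi>_UT: "\<Phi> (UT y h x) = \<Psi>m y \<otimes>\<^sub>E \<Psi>z h \<otimes>\<^sub>E \<Psi>p x" if "y |: hr.UH" "h |: H" "x |: hs.UH" for y h x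
  unfolding \<Phi>_def U_tens_def
  using tens_lift_pure[OF W_seminormed hs.UH_seminormed EB b2 bilin_closed[OF bilin_hr that(1,2)] that(3)]
   \<Phi>1(2)[OF that(1,2)] by simp
 note \<Phi>c = bl_closed[OF \<Phi>] bl_closed[OF \<Psi>m(1)] bl_closed[OF \<Psi>z(1)] bl_closed[OF \<Psi>p(1)]
 have UT1: "UT \<one>\<^bsub>hr.UH\<^esub> \<one>\<^sub>H \<one>\<^bsub>hs.UH\<^esub> = \<one>" using em_1 by (simp add: U_minus_emb_def)
 have \<Phi>_1: "\<Phi> \<one> = \<one>\<^sub>E" using \<Phi>_UT[OF hr.UH_one_cl H_one_cl hs.UH_one_cl] \<Psi>m(2) \<Psi>z(2) \<Psi>p(2) by (simp add: UT1)
 have \<phi>g: "\<phi> (F i) |: E" "\<phi> (HH i) |: E" "\<phi> (EE i) |: E" if "i \<in> I" for i using g_gens that by auto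
 have UTm: "UT y h x = em y \<otimes> UT \<one>\<^bsub>hr.UH\<^esub> h x" if "y |: hr.UH" "h |: H" "x |: hs.UH" for y h x
  using that hr.UH_one_cl by (simp add: U_tens_eq em_1 U.m_assoc)
 \<comment> \<open>Multiplicativity restricted to a fixed left factor u, with an independent value e
   for it: as long as \<open>\<Phi>\<close> is not known to be multiplicative, the lift of u is
   prescribed and not computed.\<close>
 define G where "G u e \<longleftrightarrow> (\<forall>v\<in>carrier U. \<Phi> (u \<otimes> v) = e \<otimes>\<^sub>E \<Phi> v)" for u e
 have G_I: "G u e" if u: "u |: U" and e: "e |: E"
   and UT: "!!y h x. y |: hr.UH ==> h |: H ==> x |: hs.UH ==> \<Phi> (u \<otimes> UT y h x) = e \<otimes>\<^sub>E \<Phi> (UT y h x)" for u e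
 proof -
  have "closed_subspace U {v \<in> carrier U. \<Phi> (u \<otimes> v) = e \<otimes>\<^sub>E \<Phi> v}"
   by (rule closed_subspace_eq[OF Us Es sepE bl_comp[OF Us Us U.mult_bl_l[OF u] \<Phi>] bl_comp[OF Us Es \<Phi> E.mult_bl_l[OF e]]])
  from U_dense[OF this] UT show ?thesis unfolding G_def by auto
 qed
 text \<open>Moving a letter \<^term>\<open>w\<close> past a letter \<^term>\<open>u\<close> with which it commutes up to \<^term>\<open>z\<close>.\<close>
 have move: "\<Phi> (w \<otimes> (u \<otimes> v)) = d \<otimes>\<^sub>E \<Phi> (u \<otimes> v)" if cl: "w |: U" "u |: U" "v |: U" "d |: E" "e |: E"
   and z: "commutator U w u = z" "commutator E d e = c" and G: "G u e"
   and v: "\<Phi> (w \<otimes> v) = d \<otimes>\<^sub>E \<Phi> v" "\<Phi> (z \<otimes> v) = c \<otimes>\<^sub>E \<Phi> v" for w u v d e z c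
 proof -
  have zc: "z |: U" "c |: E" using z cl by auto
  have "w \<otimes> u = z \<oplus> u \<otimes> w" using z(1) cl zc unfolding commutator_def by (subst (asm) U.sub_eq_iff) auto
  then have "w \<otimes> (u \<otimes> v) = z \<otimes> v \<oplus> u \<otimes> (w \<otimes> v)" using cl zc by (simp add: U.m_assoc[symmetric] U.l_distr)
  then have "\<Phi> (w \<otimes> (u \<otimes> v)) = \<Phi> (z \<otimes> v) \<oplus>\<^sub>E \<Phi> (u \<otimes> (w \<otimes> v))" using cl zc by (simp add: bl_add[OF \<Phi>])
  also have "\<dots> = c \<otimes>\<^sub>E \<Phi> v \<oplus>\<^sub>E e \<otimes>\<^sub>E (d \<otimes>\<^sub>E \<Phi> v)" using v G cl unfolding G_def by simp
  also have "\<dots> = (c \<oplus>\<^sub>E e \<otimes>\<^sub>E d) \<otimes>\<^sub>E \<Phi> v" using cl zc \<Phi>c(1)[OF cl(3)] by (simp add: E.l_distr E.m_assoc)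
  also have "c \<oplus>\<^sub>E e \<otimes>\<^sub>E d = d \<otimes>\<^sub>E e" using z(2) cl zc unfolding commutator_def by (subst (asm) E.sub_eq_iff) auto
  also have "(d \<otimes>\<^sub>E e) \<otimes>\<^sub>E \<Phi> v = d \<otimes>\<^sub>E \<Phi> (u \<otimes> v)"
   using G cl \<Phi>c(1)[OF cl(3)] unfolding G_def by (simp add: E.m_assoc)
  finally show ?thesis .
 qed
 have G_sm: "G (k \<odot> u) (k \<odot>\<^sub>E e)" if "G u e" "u |: U" "e |: E" for k u e
  using that \<Phi>c(1) unfolding G_def by (auto simp: U.sm_mult_l E.sm_mult_l bl_sm[OF \<Phi>])
 \<comment> \<open>A letter F is absorbed by the leftmost tensor factor, so nothing has to be
   moved.\<close>
 have G_F: "G (F i) (\<phi> (F i))" if i: "i \<in> I" for i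
 proof (rule G_I)
  fix y h x assume c: "y |: hr.UH" "h |: H" "x |: hs.UH"
  have "F i \<otimes> UT y h x = UT (U_half_gen av I a r i \<otimes>\<^bsub>hr.UH\<^esub> y) h x"
   using c i by (simp add: U_tens_eq hr.UH_mult_cl em_gen U.m_assoc)
  then show "\<Phi> (F i \<otimes> UT y h x) = \<phi> (F i) \<otimes>\<^sub>E \<Phi> (UT y h x)"
   using c i \<Phi>c \<phi>g[OF i] by (simp add: \<Phi>_UT hr.UH_mult_cl \<Psi>m(3) E.m_assoc)
 qed (use i \<phi>g in auto)
 \<comment> \<open>The element u travels through the letters F of the left factor. Each passage
   costs a commutator with one of these letters, for which \<open>G\<close> has to be known
   already.\<close>
 have induct_y: "\<Phi> (u \<otimes> UT y h x) = e \<otimes>\<^sub>E \<Phi> (UT y h x)"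
  if u: "u |: U" and e: "e |: E" and hx: "h |: H" "x |: hs.UH" and y: "y |: hr.UH"
   and base: "\<Phi> (u \<otimes> UT \<one>\<^bsub>hr.UH\<^esub> h x) = e \<otimes>\<^sub>E \<Phi> (UT \<one>\<^bsub>hr.UH\<^esub> h x)"
   and z: "!!i. i \<in> I ==> G (commutator U u (F i)) (commutator E e (\<phi> (F i)))" for u e h x y
 proof -
  let ?Y = "{y \<in> carrier hr.UH. \<Phi> (u \<otimes> UT y h x) = e \<otimes>\<^sub>E \<Phi> (UT y h x)}"
  have cs: "closed_subspace hr.UH ?Y" by (rule closed_subspace_eq[OF hr.UH_seminormed Es sepE
     bl_comp[OF hr.UH_seminormed Us bl_comp[OF hr.UH_seminormed Us UT_bl1[OF hx] U.mult_bl_l[OF u]] \<Phi>]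
     bl_comp[OF hr.UH_seminormed Es bl_comp[OF hr.UH_seminormed Us UT_bl1[OF hx] \<Phi>] E.mult_bl_l[OF e]]])
  have "carrier hr.UH \<subseteq> ?Y"
  proof (rule hr.UH_dense[OF cs])
   show "\<one>\<^bsub>hr.UH\<^esub> \<in> ?Y" using base hr.UH_one_cl by simp
   fix i y assume i: "i \<in> I" and y: "y \<in> ?Y"
   have eq: "UT (U_half_gen av I a r i \<otimes>\<^bsub>hr.UH\<^esub> y) h x = F i \<otimes> UT y h x"
    using y hx i by (simp add: U_tens_eq hr.UH_mult_cl em_gen U.m_assoc)
   have "\<Phi> (u \<otimes> (F i \<otimes> UT y h x)) = e \<otimes>\<^sub>E \<Phi> (F i \<otimes> UT y h x)"
    using z[OF i] y hx i u e \<phi>g[OF i] by (intro move[OF _ _ _ _ _ refl refl G_F[OF i]]) (auto simp: G_def)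
   then show "U_half_gen av I a r i \<otimes>\<^bsub>hr.UH\<^esub> y \<in> ?Y" using y i by (simp add: eq hr.UH_mult_cl)
  qed
  then show ?thesis using y by blast
 qed
 have cs_h: "closed_subspace H {h \<in> carrier H. \<Phi> (u \<otimes> UT \<one>\<^bsub>hr.UH\<^esub> h x) = e \<otimes>\<^sub>E \<Phi> (UT \<one>\<^bsub>hr.UH\<^esub> h x)}"
  if u: "u |: U" and e: "e |: E" and x: "x |: hs.UH" for u e x
  by (rule closed_subspace_eq[OF H0_seminormed Es sepE
    bl_comp[OF H0_seminormed Us bl_comp[OF H0_seminormed Us UT_bl2[OF hr.UH_one_cl x] U.mult_bl_l[OF u]] \<Phi>]
    bl_comp[OF H0_seminormed Es bl_comp[OF H0_seminormed Us UT_bl2[OF hr.UH_one_cl x] \<Phi>] E.mult_bl_l[OF e]]])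
 \<comment> \<open>With 1 on the left, \<open>HH i\<close> is absorbed by the middle factor; passing
   a letter \<open>F j\<close> leaves a multiple of that letter, covered by
   \<open>G_F\<close>.\<close>
 have G_H: "G (HH i) (\<phi> (HH i))" if i: "i \<in> I" for i
 proof (rule G_I)
  fix y h x assume c: "y |: hr.UH" "h |: H" "x |: hs.UH"
  note one = hr.UH_one_cl
  let ?S = "{h \<in> carrier H. \<Phi> (HH i \<otimes> UT \<one>\<^bsub>hr.UH\<^esub> h x) = \<phi> (HH i) \<otimes>\<^sub>E \<Phi> (UT \<one>\<^bsub>hr.UH\<^esub> h x)}"
  have Hi: "HH i |: U" using i by simp
  note cs = cs_h[OF Hi \<phi>g(2)[OF i] c(3)]
  have mon: "Hmon I n \<in> ?S" if n: "n \<in> multi_indices I" for n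
  proof -
   have mi: "single i 1 + n \<in> multi_indices I" using i n by (intro mi_simps) auto
   have "HH i \<otimes> UT \<one>\<^bsub>hr.UH\<^esub> (Hmon I n) x = UT \<one>\<^bsub>hr.UH\<^esub> (Hmon I (single i 1 + n)) x"
    using c one i n Hmon_cl[OF n] Hmon_cl[OF mi] ez_mon[OF i n] by (simp add: U_tens_eq em_1 U.m_assoc)
   then show ?thesis
    using c one i n Hmon_cl[OF n] Hmon_cl[OF mi] \<Psi>z(3)[OF i n] \<phi>g(2)[OF i] \<Phi>c by (simp add: \<Phi>_UT \<Psi>m(2) E.m_assoc)
  qed
  have "carrier H \<subseteq> ?S" by (rule H0_dense[OF cs]) (use mon i in \<open>blast intro: mi_simps\<close>)+
  then have base: "\<Phi> (HH i \<otimes> UT \<one>\<^bsub>hr.UH\<^esub> h x) = \<phi> (HH i) \<otimes>\<^sub>E \<Phi> (UT \<one>\<^bsub>hr.UH\<^esub> h x)" using c by blast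
  show "\<Phi> (HH i \<otimes> UT y h x) = \<phi> (HH i) \<otimes>\<^sub>E \<Phi> (UT y h x)"
  proof (rule induct_y[OF Hi \<phi>g(2)[OF i] c(2,3,1) base])
   fix j assume j: "j \<in> I"
   show "G (commutator U (HH i) (F j)) (commutator E (\<phi> (HH i)) (\<phi> (F j)))"
    using G_sm[OF G_F[OF j] _ \<phi>g(1)[OF j]] i j g_gens by (simp add: \<phi>_lie U_comm \<phi>_sm)
  qed
 qed (use i \<phi>g in auto)
 have G_0: "G \<zero> \<zero>\<^sub>E" unfolding G_def using \<Phi>c(1) bl_zero[OF Us Es \<Phi>] by simp
 \<comment> \<open>\<open>EE i\<close> passes the Cartan letters at the cost of multiples of itself
   and a letter \<open>F j\<close> at the cost of \<open>HH i\<close> or zero, which is why the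
   Cartan generators come before.\<close>
 have G_E: "G (EE i) (\<phi> (EE i))" if i: "i \<in> I" for i
 proof (rule G_I)
  fix y h x assume c: "y |: hr.UH" "h |: H" "x |: hs.UH"
  note one = hr.UH_one_cl
  let ?S = "{h \<in> carrier H. \<Phi> (EE i \<otimes> UT \<one>\<^bsub>hr.UH\<^esub> h x) = \<phi> (EE i) \<otimes>\<^sub>E \<Phi> (UT \<one>\<^bsub>hr.UH\<^esub> h x)}"
  have Ei: "EE i |: U" using i by simp
  note cs = cs_h[OF Ei \<phi>g(3)[OF i] c(3)]
  have "carrier H \<subseteq> ?S"
  proof (rule H0_dense[OF cs])
   \<comment> \<open>With no Cartan letter in the way, \<open>EE i\<close> is absorbed by the
     rightmost factor.\<close>
   have "EE i \<otimes> UT \<one>\<^bsub>hr.UH\<^esub> \<one>\<^sub>H x = UT \<one>\<^bsub>hr.UH\<^esub> \<one>\<^sub>H (U_half_gen av I a s i \<otimes>\<^bsub>hs.UH\<^esub> x)"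
    using c one i H_one_cl by (simp add: U_tens_eq em_1 ez_1 ep_gen hs.UH_mult_cl)
   then have "\<one>\<^sub>H \<in> ?S"
    using c one i H_one_cl \<phi>g(3)[OF i] \<Phi>c by (simp add: \<Phi>_UT \<Psi>m(2) \<Psi>z(2) \<Psi>p(3) hs.UH_mult_cl)
   then show "Hmon I 0 \<in> ?S" by (simp add: H0_one)
   fix j n assume j: "j \<in> I" and n: "n \<in> multi_indices I" and S: "Hmon I n \<in> ?S"
   have mi: "single j 1 + n \<in> multi_indices I" using j n by (intro mi_simps) auto
   let ?v = "UT \<one>\<^bsub>hr.UH\<^esub> (Hmon I n) x"
   have vc: "?v |: U" using c one Hmon_cl[OF n] by simp
   have eq: "UT \<one>\<^bsub>hr.UH\<^esub> (Hmon I (single j 1 + n)) x = HH j \<otimes> ?v"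
    using c one j n Hmon_cl[OF n] Hmon_cl[OF mi] ez_mon[OF j n] by (simp add: U_tens_eq em_1 U.m_assoc)
   have z: "commutator U (EE i) (HH j) = of_int (- a j i) \<odot> EE i"
   proof -
    have "commutator U (EE i) (HH j) = \<ominus> commutator U (HH j) (EE i)"
     unfolding commutator_def using i j by (simp add: U.neg_sub)
    then show ?thesis using i j by (simp add: U_comm U.sm_neg)
   qed
   then have z': "commutator E (\<phi> (EE i)) (\<phi> (HH j)) = of_int (- a j i) \<odot>\<^sub>E \<phi> (EE i)"
    using \<phi>_lie[OF g_gens(3)[OF i] g_gens(2)[OF j]] \<phi>_sm[OF g_gens(3)[OF i]] by simp
   have "\<Phi> (EE i \<otimes> (HH j \<otimes> ?v)) = \<phi> (EE i) \<otimes>\<^sub>E \<Phi> (HH j \<otimes> ?v)"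
   proof (rule move[OF Ei _ vc \<phi>g(3)[OF i] \<phi>g(2)[OF j] z z' G_H[OF j]])
    show v: "\<Phi> (EE i \<otimes> ?v) = \<phi> (EE i) \<otimes>\<^sub>E \<Phi> ?v" using S by simp
    show "\<Phi> (of_int (- a j i) \<odot> EE i \<otimes> ?v) = of_int (- a j i) \<odot>\<^sub>E \<phi> (EE i) \<otimes>\<^sub>E \<Phi> ?v"
     using v vc Ei \<phi>g(3)[OF i] \<Phi>c(1)[OF vc] by (simp add: U.sm_mult_l E.sm_mult_l bl_sm[OF \<Phi>])
   qed (use j in simp)
   then show "Hmon I (single j 1 + n) \<in> ?S" using Hmon_cl[OF mi] by (simp add: eq del: One_nat_def)
  qed
  then have base: "\<Phi> (EE i \<otimes> UT \<one>\<^bsub>hr.UH\<^esub> h x) = \<phi> (EE i) \<otimes>\<^sub>E \<Phi> (UT \<one>\<^bsub>hr.UH\<^esub> h x)" using c by blast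
  show "\<Phi> (EE i \<otimes> UT y h x) = \<phi> (EE i) \<otimes>\<^sub>E \<Phi> (UT y h x)"
  proof (rule induct_y[OF Ei \<phi>g(3)[OF i] c(2,3,1) base])
   fix j assume j: "j \<in> I"
   show "G (commutator U (EE i) (F j)) (commutator E (\<phi> (EE i)) (\<phi> (F j)))"
    using G_H[OF i] G_0 i j g_gens by (cases "i = j") (simp_all add: \<phi>_lie U_comm \<phi>_0)
  qed
 qed (use i \<phi>g in auto)
 have G_gen: "\<Phi> u = e" if "G u e" "u |: U" "e |: E" for u e
  using that \<Phi>_1 unfolding G_def by (metis E.r_one U.one_closed U.r_one)
 have gen: "\<Phi> (F i) = \<phi> (F i)" "\<Phi> (HH i) = \<phi> (HH i)" "\<Phi> (EE i) = \<phi> (EE i)" if "i \<in> I" for i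
  using G_gen[OF G_F[OF that]] G_gen[OF G_H[OF that]] G_gen[OF G_E[OF that]] \<phi>g[OF that] that by auto
 \<comment> \<open>The left factors for which multiplicativity holds against all v are closed under
   products and limits and contain the generators.\<close>
 have mult: "\<Phi> (u \<otimes> v) = \<Phi> u \<otimes>\<^sub>E \<Phi> v" if "u |: U" "v |: U" for u v
 proof -
  let ?S = "{u \<in> carrier U. \<forall>v\<in>carrier U. \<Phi> (u \<otimes> v) = \<Phi> u \<otimes>\<^sub>E \<Phi> v}"
  have cs: "closed_subspace U ?S"
   by (rule closed_subspace_Ball[OF Us], rule closed_subspace_eq[OF Us Es sepE])
     (auto intro!: bl_comp[OF Us Us U.mult_bl_r \<Phi>] bl_comp[OF Us Es \<Phi> E.mult_bl_r] \<Phi>c)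
  have "carrier U \<subseteq> ?S"
  proof (rule U_generated[OF cs])
   show "\<one> \<in> ?S" using \<Phi>_1 \<Phi>c by simp
   show "u \<otimes> v \<in> ?S" if "u \<in> ?S" "v \<in> ?S" for u v using that \<Phi>c by (auto simp: U.m_assoc E.m_assoc)
   show "F i \<in> ?S \<and> HH i \<in> ?S \<and> EE i \<in> ?S" if "i \<in> I" for i
    using G_F[OF that] G_H[OF that] G_E[OF that] gen[OF that] that unfolding G_def by simp
  qed
  then show ?thesis using that by blast
 qed
 \<comment> \<open>The same induction: \<open>\<Phi>\<close> is a section of the first projection
   because \<open>\<phi>\<close> is one on generators.\<close>
 have fst: "fst (\<Phi> u) = u" if "u |: U" for u
 proof -
  let ?S = "{u \<in> carrier U. fst (\<Phi> u) = u}"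
  have cs: "closed_subspace U ?S"
   by (rule closed_subspace_eq[OF Us Us banach_separated[OF U_banach] bl_comp[OF Us Es \<Phi> E_fst_bl] bl_id])
  have "carrier U \<subseteq> ?S"
  proof (rule U_generated[OF cs])
   show "\<one> \<in> ?S" using \<Phi>_1 by (simp add: sqz_simps)
   show "u \<otimes> v \<in> ?S" if "u \<in> ?S" "v \<in> ?S" for u v
    using that by (cases "\<Phi> u"; cases "\<Phi> v") (auto simp: mult sqz_simps)
   show "F i \<in> ?S \<and> HH i \<in> ?S \<and> EE i \<in> ?S" if "i \<in> I" for i using gen[OF that] that by (simp add: \<phi>_def)
  qed
  then show ?thesis using that by blast
 qed
 \<comment> \<open>As first components are preserved, the second component of multiplicativity is
   the required identity for the map sending u to \<open>snd (\<Phi> u)\<close>.\<close>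
 have "snd (\<Phi> (x \<otimes> y)) = (x \<otimes> snd (\<Phi> y) \<oplus> snd (\<Phi> x) \<otimes> y) \<oplus> m x y" if "x |: U" "y |: U" for x y
  using mult[OF that] fst[OF that(1)] fst[OF that(2)] by (cases "\<Phi> x"; cases "\<Phi> y") (simp add: sqz_simps)
 then show ?thesis using bl_comp[OF Us Es \<Phi> E_snd_bl] by (intro exI[of _ "%u. snd (\<Phi> u)"]) auto
qed

end

section \<open>Bounded Lie algebra cohomology in low degrees\<close>

lemma tuples_Suc: "xs \<in> tuples L (Suc n) \<longleftrightarrow> (\<exists>x ys. xs = x # ys \<and> x |: L \<and> ys \<in> tuples L n)"
 by (cases xs) (auto simp: tuples_def)

lemma tuples_0: "xs \<in> tuples L 0 \<longleftrightarrow> xs = []" by (auto simp: tuples_def)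

lemma ce_diff_1:
 assumes "seminormed av M" "xs = [x, y]" "xs \<in> tuples L 2"
  and "f [br x y] |: M" "act x (f [y]) |: M" "act y (f [x]) |: M"
 shows "ce_diff L br M act 1 f xs = (act x (f [y]) \<ominus>\<^sub>M act y (f [x])) \<ominus>\<^sub>M f [br x y]"
proof -
 interpret seminormed av M by fact
 have "{..<Suc 1} = {0, 1::nat}" by auto
 moreover have "{..<1} = {0::nat}" by auto
 ultimately show ?thesis using assms(2-)
  by (simp add: ce_diff_def omit_def numeral_2_eq_2 sm_neg M.finsum_insert ag)
qed

lemma (in seminormed) finsum_initial:
 shows "h 0 |: V ==> finsum V h {..<Suc 0} = h 0"
  and "h 0 |: V ==> h 1 |: V ==> finsum V h {..<2} = h 1 \<oplus> h 0"
  and "h 0 |: V ==> h 1 |: V ==> h 2 |: V ==> finsum V h {..<Suc 2} = h 2 \<oplus> (h 1 \<oplus> h 0)"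
proof -
 have s: "{..<Suc 0} = {0}" "{..<2} = {1, 0::nat}" "{..<Suc 2} = {2, 1, 0::nat}" by auto
 show "h 0 |: V ==> finsum V h {..<Suc 0} = h 0" unfolding s by (simp add: M.finsum_insert)
 show "h 0 |: V ==> h 1 |: V ==> finsum V h {..<2} = h 1 \<oplus> h 0" unfolding s by (simp add: M.finsum_insert)
 show "h 0 |: V ==> h 1 |: V ==> h 2 |: V ==> finsum V h {..<Suc 2} = h 2 \<oplus> (h 1 \<oplus> h 0)"
  unfolding s by (simp add: M.finsum_insert)
qed

text \<open>With \<open>i < j\<close> the entry at j is removed first, so that i still points to its
  original entry; the remaining argument stays behind the bracket.\<close>

lemma ce_diff_2:
 assumes "seminormed av M" "xs = [x, y, z]" "xs \<in> tuples L (Suc 2)"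
  and "f [br x y, z] |: M" "f [br x z, y] |: M" "f [br y z, x] |: M"
  and "act x (f [y, z]) |: M" "act y (f [x, z]) |: M" "act z (f [x, y]) |: M"
 shows "ce_diff L br M act 2 f xs =
  ((f [br x z, y] \<ominus>\<^sub>M f [br x y, z]) \<ominus>\<^sub>M f [br y z, x]) \<oplus>\<^sub>M
  ((act x (f [y, z]) \<ominus>\<^sub>M act y (f [x, z])) \<oplus>\<^sub>M act z (f [x, y]))"
proof -
 interpret seminormed av M by fact
 define t where "t i j = ((- 1) ^ (i + j)) \<odot>\<^sub>M f (br (xs ! i) (xs ! j) # omit i (omit j xs))" for i j :: nat
 define u where "u i = ((- 1) ^ i) \<odot>\<^sub>M act (xs ! i) (f (omit i xs))" for i :: nat
 have t: "t 0 1 = \<ominus>\<^sub>M f [br x y, z]" "t 0 2 = f [br x z, y]" "t 1 2 = \<ominus>\<^sub>M f [br y z, x]"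
  using assms(4-6) by (simp_all add: t_def assms(2) omit_def sm_neg)
 have u: "u 0 = act x (f [y, z])" "u 1 = \<ominus>\<^sub>M act y (f [x, z])" "u 2 = act z (f [x, y])"
  using assms(7-9) by (simp_all add: u_def assms(2) omit_def sm_neg numeral_2_eq_2)
 define H where "H j = (\<Oplus>\<^sub>M i\<in>{..<j}. t i j)" for j
 have H: "H 0 = \<zero>\<^sub>M" "H 1 = t 0 1" "H 2 = t 1 2 \<oplus>\<^sub>M t 0 2"
  using finsum_initial(1)[of "%i. t i 1"] finsum_initial(2)[of "%i. t i 2"] t assms(4-6)
  by (simp_all add: H_def)
 have "ce_diff L br M act 2 f xs = finsum M H {..<Suc 2} \<oplus>\<^sub>M finsum M u {..<Suc 2}"
  using assms(3) by (simp add: ce_diff_def H_def[abs_def] t_def u_def[abs_def])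
 also have "\<dots> = (H 2 \<oplus>\<^sub>M (H 1 \<oplus>\<^sub>M H 0)) \<oplus>\<^sub>M (u 2 \<oplus>\<^sub>M (u 1 \<oplus>\<^sub>M u 0))"
  using H t u assms(4-9) by (subst (1 2) finsum_initial(3)) auto
 also have "\<dots> = ((f [br x z, y] \<ominus>\<^sub>M f [br x y, z]) \<ominus>\<^sub>M f [br y z, x]) \<oplus>\<^sub>M
  ((act x (f [y, z]) \<ominus>\<^sub>M act y (f [x, z])) \<oplus>\<^sub>M act z (f [x, y]))"
  unfolding H t u using assms(4-9) by (simp add: ag)
 finally show ?thesis .
qed

text \<open>The coset of f is the only element of the quotient, hence equal to the subset of
  coboundaries; and it contains the sum of f and the zero cochain.\<close>

lemma Hb_trivial:
 assumes "carrier (Hb L br M act n) = {\<one>\<^bsub>Hb L br M act n\<^esub>}" "seminormed av M"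
  and "(\<lambda>xs\<in>tuples L n. \<zero>\<^sub>M) \<in> Bb L br M act n" "f \<in> Zb L br M act n"
 shows "f \<in> Bb L br M act n"
proof -
 interpret seminormed av M by fact
 let ?G = "cocycle_group L br M act n" and ?B = "Bb L br M act n"
 have "?B #>\<^sub>?G f |: (?G Mod ?B)" using assms(4) by (auto simp: FactGroup_def RCOSETS_def cocycle_group_def)
 then have "?B #>\<^sub>?G f = ?B" using assms(1) by (simp add: Hb_def FactGroup_def)
 moreover have "(\<lambda>xs\<in>tuples L n. \<zero>\<^sub>M) \<otimes>\<^sub>?G f \<in> ?B #>\<^sub>?G f" using assms(3) by (auto simp: r_coset_def)
 moreover have "(\<lambda>xs\<in>tuples L n. \<zero>\<^sub>M) \<otimes>\<^sub>?G f = f"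
 proof -
  have f: "f \<in> tuples L n \<rightarrow>\<^sub>E carrier M" using assms(4) by (auto simp: Zb_def Cb_def)
  show ?thesis
  proof (rule extensionalityI[of _ "tuples L n"])
   show "f \<in> extensional (tuples L n)" using f by (simp add: PiE_def)
   show "((\<lambda>xs\<in>tuples L n. \<zero>\<^sub>M) \<otimes>\<^sub>?G f) xs = f xs" if "xs \<in> tuples L n" for xs
    using PiE_mem[OF f that] that by (simp add: cocycle_group_def)
  qed (simp add: cocycle_group_def)
 qed
 ultimately show ?thesis by simp
qed

context uan
begin

abbreviation "br \<equiv> commutator U"

text \<open>The antisymmetrisation of a Hochschild cocycle is a Lie cocycle: this is the Jacobi identity
 in the corresponding square-zero extension.\<close>

lemma hochschild_trivial:
 assumes H2: "carrier (Hb g br U br 2) = {\<one>\<^bsub>Hb g br U br 2\<^esub>}" and m: "sqz av U m"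
 shows "\<exists>D. bl U U D \<and>
  (\<forall>x\<in>carrier U. \<forall>y\<in>carrier U. D (x \<otimes> y) = (x \<otimes> D y \<oplus> D x \<otimes> y) \<oplus> m x y)"
proof -
 interpret sqz av U m by fact
 note gU = subsetD[OF g_sub]
 define \<mu> where "\<mu> x y = m x y \<ominus> m y x" for x y
 have \<mu>_cl: "\<mu> x y |: U" if "x |: U" "y |: U" for x y using that by (simp add: \<mu>_def)
 have \<mu>_bilin: "bilin_map U U U \<mu>"
 proof -
  have "bilin_map U U U (%x y. m x y \<oplus> (- 1) \<odot> m y x)"
   by (intro bilin_plus[OF U.seminormed_axioms U.seminormed_axioms U.seminormed_axioms m_bilin]
     bilin_scale[OF U.seminormed_axioms U.seminormed_axioms U.seminormed_axioms] bilin_swap[OF m_bilin])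
  then show ?thesis by (simp add: bilin_map_def \<mu>_def U.sm_m1 U.minus_eq bounded_linear_map_def Pi_iff)
 qed
 have \<mu>_anti: "\<mu> y x = \<ominus> \<mu> x y" if "x |: U" "y |: U" for x y using that by (simp add: \<mu>_def U.neg_sub)
 have br_anti: "br y x = \<ominus> br x y" if "x |: U" "y |: U" for x y
  using that by (simp add: commutator_def U.neg_sub)
 \<comment> \<open>The Jacobi identity in the extension for x, y and z with second component zero;
   each double commutator contributes one bracketed pair of terms.\<close>
 have jac: "(\<mu> (br x y) z \<ominus> br z (\<mu> x y)) \<oplus> (\<mu> (br y z) x \<ominus> br x (\<mu> y z)) \<oplus> (\<mu> (br z x) y \<ominus> br y (\<mu> z x)) = \<zero>"
  if xyz: "x |: U" "y |: U" "z |: U" for x y z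
 proof -
  have c: "(a, \<zero>) |: E" if "a |: U" for a using that by (simp add: sqz_simps)
  have br0: "br a \<zero> = \<zero>" if "a |: U" for a using that by (simp add: commutator_def)
  have 1: "commutator E (a, \<zero>) (b, \<zero>) = (br a b, \<mu> a b)" if "a |: U" "b |: U" for a b
   using E_comm[of a "\<zero>" b "\<zero>"] that by (simp add: br0 \<mu>_def)
  have 2: "commutator E (br a b, \<mu> a b) (d, \<zero>) = (br (br a b) d, \<mu> (br a b) d \<ominus> br d (\<mu> a b))"
   if "a |: U" "b |: U" "d |: U" for a b d
  proof -
   have "commutator E (br a b, \<mu> a b) (d, \<zero>) =
     (br (br a b) d, (br (br a b) \<zero> \<ominus> br d (\<mu> a b)) \<oplus> \<mu> (br a b) d)"
    unfolding \<mu>_def[of "br a b" d] by (rule E_comm) (use that \<mu>_cl in auto)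
   then show ?thesis using that \<mu>_cl[of a b] \<mu>_cl[of "br a b" d] by (simp add: br0 U.ag)
  qed
  show ?thesis using E.jacobi[OF c[OF xyz(1)] c[OF xyz(2)] c[OF xyz(3)]] xyz by (simp add: 1 2 sqz_simps)
 qed
 \<comment> \<open>The arguments are swapped for the sake of the sign: a cochain with coboundary
   \<open>\<omega>\<close> then satisfies \<open>t_lie\<close> with
   \<open>m x y \<ominus> m y x\<close> as it stands.\<close>
 define \<omega> where "\<omega> = (\<lambda>xs\<in>tuples g 2. \<mu> (xs ! 1) (xs ! 0))"
 have \<omega>2: "\<omega> [x, y] = \<mu> y x" if "x |: g" "y |: g" for x y using that by (simp add: \<omega>_def tuples_def)
 have tup2: "\<exists>x y. xs = [x, y] \<and> x |: g \<and> y |: g" if "xs \<in> tuples g 2" for xs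
  using that by (auto simp: numeral_2_eq_2 tuples_Suc tuples_0)
 have tup3: "\<exists>x y z. xs = [x, y, z] \<and> x |: g \<and> y |: g \<and> z |: g" if "xs \<in> tuples g (Suc 2)" for xs
  using that by (auto simp: numeral_2_eq_2 tuples_Suc tuples_0)
 have tI: "[x, y] \<in> tuples g 2" if "x |: g" "y |: g" for x y using that by (simp add: tuples_def)
 obtain K where K: "0 < K" "!!v w. v |: U ==> w |: U ==> nrm U (\<mu> v w) \<le> K * (nrm U v * nrm U w)"
  using bilin_bound[OF \<mu>_bilin] by blast
 have "\<omega> \<in> Cb g U 2" unfolding Cb_def
 proof (intro CollectI conjI ballI allI impI)
  show "\<omega> \<in> tuples g 2 \<rightarrow>\<^sub>E carrier U" using tup2 gU \<mu>_cl by (fastforce simp: \<omega>_def)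
  fix xs assume xs: "xs \<in> tuples g 2"
  then obtain x y where xy: "xs = [x, y]" "x |: g" "y |: g" using tup2 by blast
  fix i :: nat assume i: "i < 2"
  then have i2: "i = 0 \<or> i = 1" by linarith
  {
   fix u v assume u: "u |: g" and v: "v |: g"
   show "\<omega> (xs[i := u \<oplus>\<^sub>g v]) = \<omega> (xs[i := u]) \<oplus> \<omega> (xs[i := v])" using i2 xy u v gU g_cs(2)[OF u v]
    by (auto simp: g_simps \<omega>2 bl_add[OF bilin_left[OF \<mu>_bilin]] bl_add[OF bilin_right[OF \<mu>_bilin]])
  }
  {
   fix c u assume u: "u |: g"
   show "\<omega> (xs[i := c \<odot>\<^sub>g u]) = c \<odot> \<omega> (xs[i := u])" using i2 xy u gU g_cs(3)[OF u]
    by (auto simp: g_simps \<omega>2 bl_sm[OF bilin_left[OF \<mu>_bilin]] bl_sm[OF bilin_right[OF \<mu>_bilin]])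
  }
  fix j :: nat assume j: "j < 2" and eq: "i \<noteq> j \<and> xs ! i = xs ! j"
  then have "x = y" using i2 xy by (cases "j = 0") (auto simp: less_2_cases_iff)
  then show "\<omega> xs = \<zero>" using xy gU by (simp add: \<omega>2 \<mu>_def)
 next
  have "nrm U (\<omega> xs) \<le> K * prod_list (map (nrm g) xs)" if xs: "xs \<in> tuples g 2" for xs
  proof -
   obtain x y where xy: "xs = [x, y]" "x |: g" "y |: g" using tup2[OF xs] by blast
   then show ?thesis using K(2)[of y x] gU by (simp add: \<omega>2 g_simps mult_ac)
  qed
  then show "\<exists>C. \<forall>xs\<in>tuples g 2. nrm U (\<omega> xs) \<le> C * prod_list (map (nrm g) xs)" by blast
 qed
 moreover have "ce_diff g br U br 2 \<omega> = (\<lambda>xs\<in>tuples g (Suc 2). \<zero>)"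
 proof (rule extensionalityI[of _ "tuples g (Suc 2)"])
  fix xs assume xs: "xs \<in> tuples g (Suc 2)"
  then obtain x y z where xyz: "xs = [x, y, z]" "x |: g" "y |: g" "z |: g" using tup3 by blast
  note c = gU[OF xyz(2)] gU[OF xyz(3)] gU[OF xyz(4)]
  note gb = g_comm[OF xyz(2,3)] g_comm[OF xyz(2,4)] g_comm[OF xyz(3,4)]
  have "ce_diff g br U br 2 \<omega> xs =
   ((\<mu> y (br x z) \<ominus> \<mu> z (br x y)) \<ominus> \<mu> x (br y z)) \<oplus> ((br x (\<mu> z y) \<ominus> br y (\<mu> z x)) \<oplus> br z (\<mu> y x))"
   using ce_diff_2[where f = \<omega> and br = br and act = br, OF U.seminormed_axioms xyz(1) xs] xyz c gb \<mu>_cl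
   by (simp add: \<omega>2)
  also have "\<mu> y (br x z) = \<mu> (br z x) y"
   using c \<mu>_anti[of "br x z" y] br_anti[of x z] bl_neg[OF U.seminormed_axioms U.seminormed_axioms bilin_left[OF \<mu>_bilin, of y], of "br x z"]
   by simp
  also have "\<mu> z (br x y) = \<ominus> \<mu> (br x y) z" using c \<mu>_anti[of "br x y" z] by simp
  also have "\<mu> x (br y z) = \<ominus> \<mu> (br y z) x" using c \<mu>_anti[of "br y z" x] by simp
  also have "br x (\<mu> z y) = \<ominus> br x (\<mu> y z)"
   using c \<mu>_anti[of y z] \<mu>_cl[of y z] bl_neg[OF U.seminormed_axioms U.seminormed_axioms bilin_right[OF U.comm_bilin, of x], of "\<mu> y z"] by simp
  also have "br z (\<mu> y x) = \<ominus> br z (\<mu> x y)"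
   using c \<mu>_anti[of x y] \<mu>_cl[of x y] bl_neg[OF U.seminormed_axioms U.seminormed_axioms bilin_right[OF U.comm_bilin, of z], of "\<mu> x y"] by simp
  also have "((\<mu> (br z x) y \<ominus> \<ominus> \<mu> (br x y) z) \<ominus> \<ominus> \<mu> (br y z) x) \<oplus> ((\<ominus> br x (\<mu> y z) \<ominus> br y (\<mu> z x)) \<oplus> \<ominus> br z (\<mu> x y))
   = (\<mu> (br x y) z \<ominus> br z (\<mu> x y)) \<oplus> (\<mu> (br y z) x \<ominus> br x (\<mu> y z)) \<oplus> (\<mu> (br z x) y \<ominus> br y (\<mu> z x))"
   using c \<mu>_cl by (simp add: U.ag)
  also have "\<dots> = \<zero>" by (rule jac[OF c])
  finally show "ce_diff g br U br 2 \<omega> xs = (\<lambda>xs\<in>tuples g (Suc 2). \<zero>) xs" using xs by simp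
 qed (auto simp: ce_diff_def)
 ultimately have "\<omega> \<in> Zb g br U br 2" by (simp add: Zb_def)
 \<comment> \<open>\<open>Hb_trivial\<close> asks for zero to be a coboundary; it is the coboundary
   of the zero 1-cochain.\<close>
 moreover have "(\<lambda>xs\<in>tuples g 2. \<zero>) \<in> Bb g br U br 2"
 proof -
  let ?z = "\<lambda>xs\<in>tuples g 1. \<zero>"
  have z1: "?z [x] = \<zero>" if "x |: g" for x using that by (simp add: tuples_def)
  have "?z \<in> Cb g U 1" unfolding Cb_def
  proof (intro CollectI conjI ballI allI impI)
   fix xs assume xs: "xs \<in> tuples g 1"
   have up: "?z (xs[i := u]) = \<zero>" if "u |: g" "i < 1" for i u
    using xs that by (auto simp: tuples_def dest: set_update_subset_insert[THEN subsetD])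
   show "?z (xs[i := u \<oplus>\<^sub>g v]) = ?z (xs[i := u]) \<oplus> ?z (xs[i := v])" if "i < 1" "u |: g" "v |: g" for i u v
    using up that g_cs(2)[OF that(2,3)] by (simp add: g_simps)
   show "?z (xs[i := c \<odot>\<^sub>g u]) = c \<odot> ?z (xs[i := u])" if "i < 1" "u |: g" for i c u
    using up that g_cs(3)[OF that(2)] by (simp add: g_simps)
   show "?z xs = \<zero>" using xs by simp
  qed (auto intro!: exI[of _ 0])
  moreover have "ce_diff g br U br 1 ?z = (\<lambda>xs\<in>tuples g 2. \<zero>)"
  proof (rule extensionalityI[of _ "tuples g 2"])
   fix xs assume xs: "xs \<in> tuples g 2"
   then obtain x y where xy: "xs = [x, y]" "x |: g" "y |: g" using tup2 by blast
   have b0: "br x \<zero> = \<zero>" "br y \<zero> = \<zero>" using gU xy by (simp_all add: commutator_def)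
   show "ce_diff g br U br 1 ?z xs = (\<lambda>xs\<in>tuples g 2. \<zero>) xs"
    using ce_diff_1[where f = ?z and br = br and act = br, OF U.seminormed_axioms xy(1) xs] xs xy b0 g_comm[OF xy(2,3)]
    by (simp only: z1) simp
  qed (auto simp: ce_diff_def numeral_2_eq_2)
  ultimately show ?thesis by (auto simp: Bb_def numeral_2_eq_2 intro!: image_eqI[of _ _ ?z])
 qed
 ultimately have "\<omega> \<in> Bb g br U br 2" using Hb_trivial[OF H2 U.seminormed_axioms] by blast
 then obtain f where f: "f \<in> Cb g U 1" "\<omega> = ce_diff g br U br 1 f" by (auto simp: Bb_def numeral_2_eq_2)
 define t where "t x = f [x]" for x
 have one: "[x] \<in> tuples g 1" if "x |: g" for x using that by (simp add: tuples_def)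
 have t_cl: "t x |: U" if "x |: g" for x using f(1) one[OF that] by (auto simp: Cb_def t_def)
 note fC = f(1)[unfolded Cb_def mem_Collect_eq, THEN conjunct2]
 note Cb_add = fC[THEN conjunct1] and Cb_sm = fC[THEN conjunct2, THEN conjunct1]
 obtain C where C: "\<forall>xs\<in>tuples g 1. nrm U (f xs) \<le> C * prod_list (map (nrm g) xs)"
  using fC[THEN conjunct2, THEN conjunct2, THEN conjunct2] by blast
 have "hoch av I a r s U m t"
 proof (intro hoch.intro uan_axioms sqz_axioms hoch_axioms.intro)
  fix x assume x: "x |: g"
  show "t x |: U" by (rule t_cl[OF x])
  show "t (c \<odot> x) = c \<odot> t x" for c
   using bspec[OF Cb_sm one[OF x], rule_format, of 0 x c] x by (simp add: t_def g_simps)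
  fix y assume y: "y |: g"
  show "t (x \<oplus> y) = t x \<oplus> t y"
   using bspec[OF Cb_add one[OF x], rule_format, of 0 x y] x y by (simp add: t_def g_simps)
  note c = gU[OF x] gU[OF y] t_cl[OF x] t_cl[OF y] t_cl[OF g_comm[OF x y]]
  have "\<mu> y x = ce_diff g br U br 1 f [x, y]" using \<omega>2[OF x y] f(2) by simp
  also have "\<dots> = (br x (t y) \<ominus> br y (t x)) \<ominus> t (br x y)" unfolding t_def using c
   by (intro ce_diff_1[OF U.seminormed_axioms refl tI[OF x y]]) (simp_all add: t_def)
  finally have "(br x (t y) \<ominus> br y (t x)) \<ominus> t (br x y) = \<mu> y x" by simp
  then have "br x (t y) \<ominus> br y (t x) = \<mu> y x \<oplus> t (br x y)" using c \<mu>_cl by (subst (asm) U.sub_eq_iff) auto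
  then have "(br x (t y) \<ominus> br y (t x)) \<oplus> \<mu> x y = (\<mu> y x \<oplus> t (br x y)) \<oplus> \<mu> x y" by simp
  also have "\<dots> = t (br x y)" using c \<mu>_cl[of x y] \<mu>_anti[of x y] by (simp add: U.ag)
  finally show "t (br x y) = (br x (t y) \<ominus> br y (t x)) \<oplus> (m x y \<ominus> m y x)" by (simp add: \<mu>_def)
 next
  show "\<exists>C. \<forall>x\<in>carrier g. nrm U (t x) \<le> C * nrm U x"
  proof (intro exI[of _ C] ballI)
   show "nrm U (t x) \<le> C * nrm U x" if "x |: g" for x
    using bspec[OF C one[OF that]] by (simp add: t_def g_simps)
  qed
 qed
 then interpret hoch av I a r s U m t .
 show ?thesis by (rule derivation_ex)
qed

end

section \<open>Formal deformations\<close>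

definition seqs :: "('k, 'v) nspace => (nat => 'v) set" where "seqs U = {x. \<forall>n. x n |: U}"

definition padd :: "('k, 'v) nspace => (nat => 'v) => (nat => 'v) => nat => 'v" where
 "padd U x y = (%n. x n \<oplus>\<^sub>U y n)"

definition psm :: "('k, 'v) nspace => 'k => (nat => 'v) => nat => 'v" where "psm U c x = (%n. c \<odot>\<^sub>U x n)"

text \<open>Multiplication by \<hbar> on coefficient sequences.\<close>

definition psh :: "('k, 'v) nspace => (nat => 'v) => nat => 'v" where
 "psh U x = (%n. case n of 0 => \<zero>\<^sub>U | Suc k => x k)"

definition pcst :: "('k, 'v) nspace => 'v => nat => 'v" where "pcst U a = (%n. if n = 0 then a else \<zero>\<^sub>U)"

text \<open>Division by \<hbar> after the constant coefficient has been dropped;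
  \<open>seq_split\<close> puts the two pieces together again.\<close>

definition ptl :: "(nat => 'v) => nat => 'v" where "ptl x = (%n. x (Suc n))"

text \<open>Congruence modulo \<open>\<hbar> ^ N\<close>.\<close>

definition agree :: "nat => (nat => 'v) => (nat => 'v) => bool" where "agree N x y \<longleftrightarrow> (\<forall>i<N. x i = y i)"

lemma agree_0 [simp]: "agree 0 x y" by (simp add: agree_def)
lemma agree_refl [simp]: "agree N x x" by (simp add: agree_def)
lemma agree_sym: "agree N x y ==> agree N y x" by (simp add: agree_def)
lemma agree_trans: "agree N x y ==> agree N y z ==> agree N x z" by (simp add: agree_def)
lemma agree_mono: "agree N x y ==> M \<le> N ==> agree M x y" by (simp add: agree_def)
lemma agree_padd: "agree N x x' ==> agree N y y' ==> agree N (padd U x y) (padd U x' y')"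
 by (simp add: agree_def padd_def)
lemma agree_psh: "agree N x x' ==> agree (Suc N) (psh U x) (psh U x')"
 by (auto simp: agree_def psh_def split: nat.splits)
lemma agree_ptl: "agree (Suc N) x x' ==> agree N (ptl x) (ptl x')" by (simp add: agree_def ptl_def)
lemma agree_all: "(!!N. agree N x y) ==> x = y" by (rule ext) (metis agree_def lessI)

lemma (in seminormed) seqs_simps [simp, intro]:
 "x \<in> seqs V ==> y \<in> seqs V ==> padd V x y \<in> seqs V" "x \<in> seqs V ==> psm V c x \<in> seqs V"
 "x \<in> seqs V ==> psh V x \<in> seqs V" "a |: V ==> pcst V a \<in> seqs V" "x \<in> seqs V ==> ptl x \<in> seqs V"
 "x \<in> seqs V ==> x n |: V"
 by (auto simp: seqs_def padd_def psm_def psh_def pcst_def ptl_def split: nat.splits)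

lemma (in seminormed) seq_split:
 assumes "x \<in> seqs V"
 shows "x = padd V (pcst V (x 0)) (psh V (ptl x))"
proof
 fix n
 show "x n = padd V (pcst V (x 0)) (psh V (ptl x)) n"
  using seqs_simps(6)[OF assms] by (cases n) (simp_all add: padd_def pcst_def psh_def ptl_def)
qed

text \<open>An \<hbar>-bilinear deformation of the product of \<open>U\<close> on sequences.
  Compatibility with infinite sums in \<hbar> is not assumed: it follows from compatibility with the
  shift, see \<open>mu_agree\<close>. Both the transported product and the ordinary power series
  product are instances.\<close>

locale seqmult = U: snalg av U for av :: "'k::field_char_0 => real" and U :: "('k, 'v) nspace" (structure) +
 fixes mu :: "(nat => 'v) => (nat => 'v) => nat => 'v"
 assumes mu_cl [simp, intro]: "x \<in> seqs U ==> y \<in> seqs U ==> mu x y \<in> seqs U"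
  and mu_add_l: "x \<in> seqs U ==> x' \<in> seqs U ==> y \<in> seqs U ==> mu (padd U x x') y = padd U (mu x y) (mu x' y)"
  and mu_add_r: "x \<in> seqs U ==> y \<in> seqs U ==> y' \<in> seqs U ==> mu x (padd U y y') = padd U (mu x y) (mu x y')"
  and mu_sh_l: "x \<in> seqs U ==> y \<in> seqs U ==> mu (psh U x) y = psh U (mu x y)"
  and mu_sh_r: "x \<in> seqs U ==> y \<in> seqs U ==> mu x (psh U y) = psh U (mu x y)"
  and mu_0: "x \<in> seqs U ==> y \<in> seqs U ==> mu x y 0 = x 0 \<otimes> y 0"
begin

text \<open>The last term keeps the whole second factor. An induction modulo powers of \<hbar> then
  meets just three products: constant by constant, and two that carry a factor \<hbar>.\<close>

lemma mu_split:
 assumes "A \<in> seqs U" "B \<in> seqs U" "C \<in> seqs U" "D \<in> seqs U"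
 shows "mu (padd U A (psh U B)) (padd U C (psh U D)) =
  padd U (padd U (mu A C) (psh U (mu A D))) (psh U (mu B (padd U C (psh U D))))"
proof -
 note c = U.seqs_simps(6)[OF mu_cl[OF assms(1,3)]] U.seqs_simps(6)[OF mu_cl[OF assms(1,4)]]
  U.seqs_simps(6)[OF mu_cl[OF assms(2,3)]] U.seqs_simps(6)[OF mu_cl[OF assms(2,4)]]
 have "mu (padd U A (psh U B)) (padd U C (psh U D)) =
   padd U (padd U (mu A C) (psh U (mu B C))) (psh U (padd U (mu A D) (psh U (mu B D))))"
  and 2: "mu B (padd U C (psh U D)) = padd U (mu B C) (psh U (mu B D))"
  using assms by (simp_all add: mu_add_l mu_add_r mu_sh_l mu_sh_r)
 moreover have "padd U (padd U (mu A C) (psh U (mu B C))) (psh U (padd U (mu A D) (psh U (mu B D)))) n =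
   padd U (padd U (mu A C) (psh U (mu A D))) (psh U (padd U (mu B C) (psh U (mu B D)))) n" for n
  using c by (cases n; cases "n - 1") (auto simp: padd_def psh_def U.a_ac)
 ultimately show ?thesis unfolding 2 by (simp only: fun_eq_iff) simp
qed

text \<open>\<hbar>-adic continuity comes from \<hbar>-bilinearity alone: modulo
  \<open>\<hbar> ^ Suc N\<close> the product is determined by the product of the constant terms and
  by products with tails modulo \<open>\<hbar> ^ N\<close>.\<close>

lemma mu_agree:
 assumes "x \<in> seqs U" "x' \<in> seqs U" "y \<in> seqs U" "y' \<in> seqs U" "agree N x x'" "agree N y y'"
 shows "agree N (mu x y) (mu x' y')" using assms
proof (induction N arbitrary: x x' y y')
 case (Suc N)
 have 0: "x 0 = x' 0" "y 0 = y' 0" using Suc.prems(5,6) by (auto simp: agree_def)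
 note c = Suc.prems(1-4)
 have exp: "mu u v = padd U (padd U (mu (pcst U (u 0)) (pcst U (v 0))) (psh U (mu (pcst U (u 0)) (ptl v)))) (psh U (mu (ptl u) v))"
  if "u \<in> seqs U" "v \<in> seqs U" for u v
  using mu_split[of "pcst U (u 0)" "ptl u" "pcst U (v 0)" "ptl v"] U.seq_split[OF that(1), symmetric] U.seq_split[OF that(2), symmetric] that
  by simp
 have "agree N y y'" using Suc.prems(6) by (rule agree_mono) simp
 then show ?case unfolding exp[OF c(1,3)] exp[OF c(2,4)] 0
  using Suc.prems by (intro agree_padd agree_psh Suc.IH agree_ptl agree_refl) auto
qed simp

text \<open>If y is divisible by \<open>\<hbar> ^ n\<close>, the power is pulled out by n shifts,
  and the constant coefficient of what is left is a product in \<open>U\<close>.\<close>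

lemma mu_lead_r:
 assumes "x \<in> seqs U" "y \<in> seqs U" "!!i. i < n ==> y i = \<zero>"
 shows "mu x y n = x 0 \<otimes> y n" using assms(2,3)
proof (induction n arbitrary: y)
 case 0
 then show ?case using assms(1) by (simp add: mu_0)
next
 case (Suc n)
 have "y = psh U (ptl y)" using Suc.prems(2) by (auto simp: psh_def ptl_def fun_eq_iff split: nat.splits)
 then have "mu x y = psh U (mu x (ptl y))" using mu_sh_r[of x "ptl y"] assms(1) Suc.prems(1) by simp
 then have "mu x y (Suc n) = mu x (ptl y) n" by (simp add: psh_def)
 also have "\<dots> = x 0 \<otimes> ptl y n" using Suc.prems by (intro Suc.IH U.seqs_simps) (auto simp: ptl_def)
 finally show ?case by (simp add: ptl_def)
qed

lemma mu_lead_l: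
 assumes "x \<in> seqs U" "y \<in> seqs U" "!!i. i < n ==> x i = \<zero>"
 shows "mu x y n = x n \<otimes> y 0" using assms(1,3)
proof (induction n arbitrary: x)
 case 0
 then show ?case using assms(2) by (simp add: mu_0)
next
 case (Suc n)
 have "x = psh U (ptl x)" using Suc.prems(2) by (auto simp: psh_def ptl_def fun_eq_iff split: nat.splits)
 then have "mu x y = psh U (mu (ptl x) y)" using mu_sh_l[of "ptl x" y] assms(2) Suc.prems(1) by simp
 then have "mu x y (Suc n) = mu (ptl x) y n" by (simp add: psh_def)
 also have "\<dots> = ptl x n \<otimes> y 0" using Suc.prems by (intro Suc.IH U.seqs_simps) (auto simp: ptl_def)
 finally show ?case by (simp add: ptl_def)
qed

end

lemma seqsI: "(!!n. x n |: V) ==> x \<in> seqs V" by (simp add: seqs_def)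

text \<open>\<open>star_bound\<close> is continuity of a single coefficient on uniformly bounded
  sequences; it is applied to truncations, which are of this kind. The constant may depend on n.
  \<open>hochschild\<close> is the only place where the cohomology of \<open>U\<close> enters the
  construction of the gauge.\<close>

locale deform = seqmult av U star for av :: "'k::field_char_0 => real" and U :: "('k, 'v) nspace" (structure) and star +
 assumes star_sm_l: "x \<in> seqs U ==> y \<in> seqs U ==> star (psm U c x) y = psm U c (star x y)"
  and star_sm_r: "x \<in> seqs U ==> y \<in> seqs U ==> star x (psm U c y) = psm U c (star x y)"
  and star_assoc: "x \<in> seqs U ==> y \<in> seqs U ==> z \<in> seqs U ==> star (star x y) z = star x (star y z)"
  and star_1l: "x \<in> seqs U ==> star (pcst U \<one>) x = x"
  and star_1r: "x \<in> seqs U ==> star x (pcst U \<one>) = x"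
  and star_bound: "\<exists>C>0. \<forall>x\<in>seqs U. \<forall>y\<in>seqs U. \<forall>A\<ge>0. \<forall>B\<ge>0.
   (\<forall>i. nrm U (x i) \<le> A) \<longrightarrow> (\<forall>i. nrm U (y i) \<le> B) \<longrightarrow> nrm U (star x y n) \<le> C * (A * B)"
  and hochschild: "sqz av U m ==> \<exists>D. bl U U D \<and>
   (\<forall>x\<in>carrier U. \<forall>y\<in>carrier U. D (x \<otimes> y) = (x \<otimes> D y \<oplus> D x \<otimes> y) \<oplus> m x y)"
begin

definition tr :: "nat => (nat => 'v => 'v) => 'v => nat => 'v" where
 "tr n f a = (%i. if i \<le> n then f i a else \<zero>)"

definition mon :: "nat => 'v => nat => 'v" where "mon n a = (%i. if i = n then a else \<zero>)"

text \<open>Coefficients up to n are prescribed, so congruence is demanded modulo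
  \<open>\<hbar> ^ Suc n\<close>. Sending the unit to the unit is part of the condition; it keeps
  the next obstruction normalised.\<close>

definition gauge_upto :: "nat => (nat => 'v => 'v) => bool" where
 "gauge_upto n f \<longleftrightarrow> (\<forall>a\<in>carrier U. f 0 a = a) \<and> (\<forall>i\<le>n. bl U U (f i)) \<and>
   (\<forall>i\<le>n. 0 < i \<longrightarrow> f i \<one> = \<zero>) \<and>
   (\<forall>a\<in>carrier U. \<forall>b\<in>carrier U. agree (Suc n) (tr n f (a \<otimes> b)) (star (tr n f a) (tr n f b)))"

lemma gauge_uptoD:
 assumes "gauge_upto n f"
 shows "a |: U ==> f 0 a = a" "i \<le> n ==> bl U U (f i)" "i \<le> n ==> 0 < i ==> f i \<one> = \<zero>"
  "a |: U ==> b |: U ==> agree (Suc n) (tr n f (a \<otimes> b)) (star (tr n f a) (tr n f b))"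
 using assms unfolding gauge_upto_def by blast+

lemma mon_seqs [simp, intro]: "a |: U ==> mon n a \<in> seqs U" by (rule seqsI) (simp add: mon_def)

lemma mon_nth [simp]: "mon n a n = a" "i \<noteq> n ==> mon n a i = \<zero>" by (simp_all add: mon_def)

text \<open>The product of two truncated images has a coefficient q at the next order, where the
  truncated image of \<open>a \<otimes> b\<close> has none. Comparing that coefficient in the
  associativity law gives the cocycle identity for q. A new coefficient D changes it by
  \<open>a \<otimes> D b \<oplus> D a \<otimes> b\<close>, so the congruence at this order is the
  equation solved by \<open>hochschild\<close>.\<close>

lemma gauge_step:
 assumes f: "gauge_upto n f"
 shows "\<exists>D. gauge_upto (Suc n) (f(Suc n := D))"
proof -
 define N where "N = Suc n"
 define t where "t = tr n f"
 define q where "q a b = star (t a) (t b) N" for a b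
 note f0 = gauge_uptoD(1)[OF f] and fbl = gauge_uptoD(2)[OF f] and f1 = gauge_uptoD(3)[OF f]
 note agr = gauge_uptoD(4)[OF f, folded N_def t_def]
 have t_cl [simp, intro]: "t a \<in> seqs U" if "a |: U" for a
  using bl_closed[OF fbl that] by (intro seqsI) (simp add: t_def tr_def)
 have t_add: "t (a \<oplus> b) = padd U (t a) (t b)" if "a |: U" "b |: U" for a b
  using bl_add[OF fbl that] by (auto simp: t_def tr_def padd_def fun_eq_iff)
 have t_sm: "t (c \<odot> a) = psm U c (t a)" if "a |: U" for a c
  using bl_sm[OF fbl that] by (auto simp: t_def tr_def psm_def fun_eq_iff)
 have t0: "t a 0 = a" if "a |: U" for a using f0 that by (simp add: t_def tr_def)
 have tN: "t a N = \<zero>" for a by (simp add: t_def tr_def N_def)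
 have t1: "t \<one> = pcst U \<one>" using f0 f1 by (auto simp: t_def tr_def pcst_def fun_eq_iff)
 have q_cl [simp, intro]: "q a b |: U" if "a |: U" "b |: U" for a b unfolding q_def using that by blast
 have sN: "agree (Suc N) (star (t a) (t b)) (padd U (t (a \<otimes> b)) (mon N (q a b)))" if "a |: U" "b |: U" for a b
  using agr[OF that] U.seqs_simps(6)[OF t_cl, of "a \<otimes> b"] that
  by (auto simp: agree_def padd_def mon_def less_Suc_eq q_def tN)
 have lead_l: "star (mon N u) y N = u \<otimes> y 0" if "u |: U" "y \<in> seqs U" for u y
  using mu_lead_l[of "mon N u" y N] that by simp
 have lead_r: "star y (mon N u) N = y 0 \<otimes> u" if "u |: U" "y \<in> seqs U" for u y
  using mu_lead_r[of y "mon N u" N] that by simp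
 have "sqz av U q"
 proof (intro sqz.intro U.snalg_axioms sqz_axioms.intro)
  \<comment> \<open>Finitely many bounded maps have a common bound; the sum of their constants
    serves. It makes the coefficients of a truncated image uniformly bounded, as
    \<open>star_bound\<close> requires.\<close>
  have "\<exists>K>0. \<forall>i\<le>n. \<forall>a\<in>carrier U. nrm U (f i a) \<le> K * nrm U a"
  proof -
   have "\<exists>K>0. \<forall>a\<in>carrier U. nrm U (f i a) \<le> K * nrm U a" if "i \<le> n" for i
    using bl_bound[OF U.seminormed_axioms fbl[OF that]] by metis
   then obtain k where k: "!!i a. i \<le> n ==> 0 < k i" "!!i a. i \<le> n ==> a |: U ==> nrm U (f i a) \<le> k i * nrm U a"
    by metis
   have "nrm U (f i a) \<le> (\<Sum>i\<le>n. k i) * nrm U a" if "i \<le> n" "a |: U" for i a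
    by (rule order.trans[OF k(2)[OF that]], intro mult_right_mono member_le_sum)
      (use that k(1) in \<open>auto intro: less_imp_le\<close>)
   moreover have "0 < (\<Sum>i\<le>n. k i)" using k(1) by (intro sum_pos) auto
   ultimately show ?thesis by blast
  qed
  then obtain K where K: "0 < K" "!!i a. i \<le> n ==> a |: U ==> nrm U (f i a) \<le> K * nrm U a" by blast
  have tb: "nrm U (t a i) \<le> K * nrm U a" if "a |: U" for a i using K that by (simp add: t_def tr_def)
  obtain C where C: "0 < C" "!!x y A B. x \<in> seqs U ==> y \<in> seqs U ==> 0 \<le> A ==> 0 \<le> B ==>
    (\<forall>i. nrm U (x i) \<le> A) ==> (\<forall>i. nrm U (y i) \<le> B) ==> nrm U (star x y N) \<le> C * (A * B)"
   using star_bound[of N] by blast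
  show "bilin_map U U U q"
  proof (rule bilinI[OF U.seminormed_axioms U.seminormed_axioms, where C = "C * (K * K)"])
   fix a b assume ab: "a |: U" "b |: U"
   show "nrm U (q a b) \<le> C * (K * K) * (nrm U a * nrm U b)"
    using C(2)[OF t_cl t_cl, of a b "K * nrm U a" "K * nrm U b"] tb ab K(1) by (simp add: q_def mult_ac)
   show "q (a \<oplus> a') b = q a b \<oplus> q a' b" if "a' |: U" for a'
    using ab that by (simp add: q_def t_add mu_add_l) (simp add: padd_def)
   show "q a (b \<oplus> b') = q a b \<oplus> q a b'" if "b' |: U" for b'
    using ab that by (simp add: q_def t_add mu_add_r) (simp add: padd_def)
   show "q (c \<odot> a) b = c \<odot> q a b" "q a (c \<odot> b) = c \<odot> q a b" for c
    using ab by (simp_all add: q_def t_sm star_sm_l star_sm_r) (simp_all add: psm_def)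
  qed (simp_all add: q_cl)
 next
  fix a b c assume abc: "a |: U" "b |: U" "c |: U"
  \<comment> \<open>Up to order N the inner product is the image of \<open>a \<otimes> b\<close>
    plus q at order N, and that correction meets only the constant coefficient of the outer
    factor.\<close>
  have "star (star (t a) (t b)) (t c) N = star (padd U (t (a \<otimes> b)) (mon N (q a b))) (t c) N"
   using mu_agree[OF _ _ _ _ sN[OF abc(1,2)] agree_refl, of "t c"] abc by (simp add: agree_def)
  also have "\<dots> = q (a \<otimes> b) c \<oplus> q a b \<otimes> c"
   using abc lead_l[of "q a b" "t c"] by (simp add: mu_add_l t0 q_def[symmetric] padd_def[of U "star _ _"])
  finally have 1: "star (star (t a) (t b)) (t c) N = q (a \<otimes> b) c \<oplus> q a b \<otimes> c" .
  have "star (t a) (star (t b) (t c)) N = star (t a) (padd U (t (b \<otimes> c)) (mon N (q b c))) N"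
   using mu_agree[OF _ _ _ _ agree_refl sN[OF abc(2,3)], of "t a"] abc by (simp add: agree_def)
  also have "\<dots> = q a (b \<otimes> c) \<oplus> a \<otimes> q b c"
   using abc lead_r[of "q b c" "t a"] by (simp add: mu_add_r t0 q_def[symmetric] padd_def[of U "star _ _"])
  finally show "a \<otimes> q b c \<oplus> q a (b \<otimes> c) = q (a \<otimes> b) c \<oplus> q a b \<otimes> c"
   using 1 abc star_assoc[of "t a" "t b" "t c"] by (simp add: U.a_comm)
 next
  fix a assume a: "a |: U"
  show "q \<one> a = \<zero>" "q a \<one> = \<zero>" using a by (simp_all add: q_def t1 star_1l star_1r tN)
 qed
 then interpret sq: sqz av U q .
 obtain D where D: "bl U U D" "!!a b. a |: U ==> b |: U ==> D (a \<otimes> b) = (a \<otimes> D b \<oplus> D a \<otimes> b) \<oplus> q a b"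
  using hochschild[OF sq.sqz_axioms] by blast
 note D_cl = bl_closed[OF D(1)]
 have "D \<one> = D \<one> \<oplus> D \<one>" using D(2)[of "\<one>" "\<one>"] D_cl[of "\<one>"] by (simp add: sq.m_1l)
 then have D1: "D \<one> = \<zero>" using U.add_sub_cancel[of "D \<one>" "D \<one>"] D_cl[of "\<one>"] by simp
 have tr': "tr N (f(N := D)) a = padd U (t a) (mon N (D a))" if "a |: U" for a
  using bl_closed[OF fbl that] D_cl[OF that]
  by (auto simp: t_def tr_def padd_def mon_def N_def fun_eq_iff le_Suc_eq)
 have "agree (Suc N) (padd U (t (a \<otimes> b)) (mon N (D (a \<otimes> b)))) (star (padd U (t a) (mon N (D a))) (padd U (t b) (mon N (D b))))"
  if ab: "a |: U" "b |: U" for a b unfolding agree_def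
 proof (intro allI impI)
  note c = ab D_cl[OF ab(1)] D_cl[OF ab(2)]
  fix i assume "i < Suc N"
  then consider "i < N" | "i = N" by linarith
  then show "padd U (t (a \<otimes> b)) (mon N (D (a \<otimes> b))) i = star (padd U (t a) (mon N (D a))) (padd U (t b) (mon N (D b))) i"
  proof cases
   case 1
   have ag: "agree N (padd U (t u) (mon N (D u))) (t u)" if "u |: U" for u
    using U.seqs_simps(6)[OF t_cl[OF that]] by (auto simp: agree_def padd_def mon_def)
   have "agree N (star (padd U (t a) (mon N (D a))) (padd U (t b) (mon N (D b)))) (star (t a) (t b))"
    using c by (intro mu_agree ag) auto
   then show ?thesis using 1 agr[OF ab] ag[of "a \<otimes> b"] ab by (simp add: agree_def)
  next
   case 2
   \<comment> \<open>The corrections already carry \<open>\<hbar> ^ N\<close>, so at this order they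
     are multiplied by constant coefficients only and their mutual product does not appear.\<close>
   let ?Y = "padd U (t b) (mon N (D b))"
   have "star (padd U (t a) (mon N (D a))) ?Y N = star (t a) ?Y N \<oplus> star (mon N (D a)) ?Y N"
    using mu_add_l[of "t a" "mon N (D a)" ?Y] c by (simp add: padd_def[of U "star _ _"])
   also have "star (t a) ?Y N = q a b \<oplus> star (t a) (mon N (D b)) N"
    using mu_add_r[of "t a" "t b" "mon N (D b)"] c by (simp add: padd_def[of U "star _ _"] q_def)
   also have "star (t a) (mon N (D b)) N = a \<otimes> D b" using lead_r[of "D b" "t a"] c t0 by simp
   also have "star (mon N (D a)) ?Y N = D a \<otimes> ?Y 0" using lead_l[of "D a" ?Y] c by simp
   also have "padd U (t b) (mon N (D b)) 0 = b" using ab by (simp add: padd_def mon_def t0 N_def)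
   finally show ?thesis using 2 D(2)[OF ab] c by (simp add: padd_def mon_def tN U.ag)
  qed
 qed
 then have *: "agree (Suc N) (tr N (f(N := D)) (a \<otimes> b)) (star (tr N (f(N := D)) a) (tr N (f(N := D)) b))"
  if "a |: U" "b |: U" for a b using tr' that by simp
 have "bl U U ((f(N := D)) i)" "0 < i ==> (f(N := D)) i \<one> = \<zero>" if "i \<le> N" for i
  using fbl[of i] f1[of i] D(1) D1 that by (auto simp: N_def le_Suc_eq)
 then have "gauge_upto N (f(N := D))"
  unfolding gauge_upto_def using f0 by (intro conjI ballI allI impI *) (simp_all add: N_def)
 then show ?thesis unfolding N_def by blast
qed

text \<open>Order by order in \<open>\<hbar>\<close>, a cochain trivialising the Hochschild cocycle that obstructs
 multiplicativity modulo \<open>\<hbar> ^ (n + 2)\<close> is the next coefficient of the gauge transformation.\<close>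

lemma gauge_ex:
 obtains T where "!!a. a |: U ==> T 0 a = a" "!!n. bl U U (T n)" "!!n. 0 < n ==> T n \<one> = \<zero>"
  "!!a b. a |: U ==> b |: U ==> (%n. T n (a \<otimes> b)) = star (%n. T n a) (%n. T n b)"
proof -
 have "\<exists>F. \<forall>n. gauge_upto n (F n) \<and> (\<forall>i\<le>n. F (Suc n) i = F n i)"
 \<comment> \<open>Each step keeps the coefficients found so far, so that the diagonal of the chosen
   maps agrees with all of them.\<close>
 proof (rule dependent_nat_choice)
  have *: "agree (Suc 0) (tr 0 (%_ a. a) (a \<otimes> b)) (star (tr 0 (%_ a. a) a) (tr 0 (%_ a. a) b))"
   if "a |: U" "b |: U" for a b
  proof -
   have "tr 0 (%_ a. a) u \<in> seqs U" if "u |: U" for u using that by (intro seqsI) (simp add: tr_def)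
   then show ?thesis using that by (simp add: agree_def mu_0) (simp add: tr_def)
  qed
  show "\<exists>F. gauge_upto 0 F" unfolding gauge_upto_def
   by (intro exI[of _ "%_ a. a"] conjI allI impI ballI *) (simp_all add: bl_id)
  show "\<exists>F'. gauge_upto (Suc n) F' \<and> (\<forall>i\<le>n. F' i = F i)" if F: "gauge_upto n F" for F n
  proof -
   obtain D where "gauge_upto (Suc n) (F(Suc n := D))" using gauge_step[OF F] by blast
   then show ?thesis by (intro exI[of _ "F(Suc n := D)"]) simp
  qed
 qed
 then obtain F where F: "!!n. gauge_upto n (F n)" "!!n i. i \<le> n ==> F (Suc n) i = F n i" by blast
 define T where "T n = F n n" for n
 have FT: "F n i = T i" if "i \<le> n" for n i
  using that by (induction n rule: dec_induct) (simp_all add: T_def F(2))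
 have Tbl: "bl U U (T n)" for n using gauge_uptoD(2)[OF F(1)] by (simp add: T_def)
 have s: "(%n. T n a) \<in> seqs U" if "a |: U" for a by (rule seqsI) (rule bl_closed[OF Tbl that])
 show ?thesis
 proof
  show "T 0 a = a" if "a |: U" for a using gauge_uptoD(1)[OF F(1) that] by (simp add: T_def)
  show "bl U U (T n)" for n by (rule Tbl)
  show "T n \<one> = \<zero>" if "0 < n" for n using gauge_uptoD(3)[OF F(1) _ that] by (simp add: T_def)
  fix a b assume ab: "a |: U" "b |: U"
  show "(%n. T n (a \<otimes> b)) = star (%n. T n a) (%n. T n b)"
  proof (rule agree_all)
   fix N
   have ag: "agree (Suc N) (%n. T n u) (tr N (F N) u)" for u by (simp add: agree_def tr_def FT)
   have tc: "tr N (F N) u \<in> seqs U" if "u |: U" for u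
    using bl_closed[OF gauge_uptoD(2)[OF F(1)] that] by (intro seqsI) (simp add: tr_def)
   have "agree (Suc N) (%n. T n (a \<otimes> b)) (star (tr N (F N) a) (tr N (F N) b))"
    by (rule agree_trans[OF ag gauge_uptoD(4)[OF F(1) ab]])
   moreover have "agree (Suc N) (star (tr N (F N) a) (tr N (F N) b)) (star (%n. T n a) (%n. T n b))"
    using ab by (intro mu_agree s tc agree_sym[OF ag]) auto
   ultimately show "agree N (%n. T n (a \<otimes> b)) (star (%n. T n a) (%n. T n b))"
    by (blast intro: agree_trans agree_mono le_SucI)
  qed
 qed
qed

end

section \<open>The \<hbar>-linear extension of a gauge, its inverse and their growth\<close>

definition gauge :: "('k, 'v) nspace => (nat => 'v => 'v) => (nat => 'v) => nat => 'v" where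
 "gauge V T x = (%n. \<Oplus>\<^sub>V j\<in>{..n}. T (n - j) (x j))"

text \<open>The system is triangular with the identity on the diagonal, so it is solved recursively.
  The guard \<open>j < n\<close> always holds on the range of the sum; it exposes the decrease that
  termination relies on.\<close>

fun gauge_inv :: "('k, 'v) nspace => (nat => 'v => 'v) => (nat => 'v) => nat => 'v" where
 "gauge_inv V T y n = y n \<ominus>\<^sub>V (\<Oplus>\<^sub>V j\<in>{..<n}. T (n - j) (if j < n then gauge_inv V T y j else y j))"

text \<open>The majorant of \<open>gauge_inv\<close>: the same recursion for norms, with
  \<open>C\<close> bounding the coefficient maps and c the weight of the given sequence. A sum
  replaces the maximum, which is generous but positive and monotone.\<close>

fun inv_weight :: "(nat => real) => (nat => real) => nat => real" where
 "inv_weight C c n = c n + (\<Sum>j<n. C (n - j) * (if j < n then inv_weight C c j else 0))"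

declare gauge_inv.simps [simp del] inv_weight.simps [simp del]

lemma inv_weight_pos:
 assumes "!!n. 0 < C n" "!!n. 0 < c n"
 shows "0 < inv_weight C c n"
proof (induction n rule: less_induct)
 case (less n)
 then have "0 \<le> (\<Sum>j<n. C (n - j) * (if j < n then inv_weight C c j else 0))"
  using assms(1) by (intro sum_nonneg mult_nonneg_nonneg) (auto intro: less_imp_le)
 then show ?case using assms(2)[of n] by (subst inv_weight.simps) linarith
qed

definition pmul :: "('k, 'v) nspace => (nat => 'v) => (nat => 'v) => nat => 'v" where
 "pmul V x y = (%n. \<Oplus>\<^sub>V l\<in>{..n}. x l \<otimes>\<^sub>V y (n - l))"

definition pact :: "('k, 'v) nspace => (nat => 'k) => (nat => 'v) => nat => 'v" where
 "pact V a x = (%n. \<Oplus>\<^sub>V l\<in>{..n}. a l \<odot>\<^sub>V x (n - l))"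

lemma (in seminormed) pact_cl [simp, intro]: "x \<in> seqs V ==> pact V a x \<in> seqs V"
 by (intro seqsI) (auto simp: pact_def intro!: M.finsum_closed)

text \<open>Peeling off the constant coefficient of a reduces statements about the action of all
  power series to scalars and the shift.\<close>

lemma (in seminormed) pact_rec:
 assumes "x \<in> seqs V"
 shows "pact V a x = padd V (psm V (a 0) x) (psh V (pact V (ptl a) x))"
proof
 fix n
 note c = seqs_simps(6)[OF assms]
 show "pact V a x n = padd V (psm V (a 0) x) (psh V (pact V (ptl a) x)) n"
 proof (cases n)
  case 0
  then show ?thesis using c by (simp add: pact_def padd_def psm_def psh_def)
 next
  case (Suc k)
  have "pact V a x (Suc k) = (\<Oplus>l\<in>{..k}. a (Suc l) \<odot> x (k - l)) \<oplus> a 0 \<odot> x (Suc k)"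
   unfolding pact_def by (subst M.finsum_Suc2) (use c in auto)
  also have "\<dots> = a 0 \<odot> x (Suc k) \<oplus> (\<Oplus>l\<in>{..k}. a (Suc l) \<odot> x (k - l))"
   using c by (intro M.a_comm M.finsum_closed) auto
  finally show ?thesis using Suc by (simp add: padd_def psm_def psh_def pact_def ptl_def)
 qed
qed

lemma (in seminormed) pact_const:
 assumes "x \<in> seqs V"
 shows "pact V (%n. if n = 0 then c else 0) x = psm V c x"
proof -
 have 1: "pact V (%_. 0) x = (%_. \<zero>)" using seqs_simps(6)[OF assms] by (simp add: pact_def)
 have 2: "ptl (%n. if n = 0 then c else 0) = (%_. 0)" by (simp add: ptl_def fun_eq_iff)
 have "pact V (%n. if n = 0 then c else 0) x = padd V (psm V c x) (psh V (%_. \<zero>))"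
  unfolding pact_rec[OF assms, of "%n. if n = 0 then c else 0"] 1 2 by simp
 then show ?thesis using seqs_simps(6)[OF seqs_simps(2)[OF assms]]
  by (auto simp: padd_def psh_def fun_eq_iff split: nat.splits)
qed

text \<open>Identifies the shift with the action of \<hbar>, so that linearity over power series
  yields compatibility with \<open>psh\<close>.\<close>

lemma (in seminormed) pact_hbar:
 assumes "x \<in> seqs V"
 shows "pact V (%n. if n = 1 then 1 else 0) x = psh V x"
proof -
 have "ptl (%n. if n = 1 then 1 else 0) = (%n. if n = 0 then 1 else 0::'k)" by (auto simp: ptl_def fun_eq_iff)
 then have "pact V (%n. if n = 1 then 1 else 0) x = padd V (psm V 0 x) (psh V (psm V 1 x))"
  by (subst pact_rec[OF assms]) (simp add: pact_const[OF assms])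
 moreover have "psm V 1 x = x" using seqs_simps(6)[OF assms] by (simp add: psm_def)
 ultimately show ?thesis using seqs_simps(6)[OF assms] seqs_simps(6)[OF seqs_simps(3)[OF assms]]
  by (simp add: padd_def psm_def)
qed

lemma (in snalg) pmul_seqmult: "seqmult av A (pmul A)"
proof (intro seqmult.intro snalg_axioms seqmult_axioms.intro)
 fix x y assume x: "x \<in> seqs A" and y: "y \<in> seqs A"
 note c = seqs_simps(6)[OF x] seqs_simps(6)[OF y]
 show "pmul A x y \<in> seqs A" using c by (intro seqsI) (auto simp: pmul_def intro!: M.finsum_closed)
 show "pmul A (padd A x x') y = padd A (pmul A x y) (pmul A x' y)" if "x' \<in> seqs A" for x'
  using c seqs_simps(6)[OF that] by (auto simp: pmul_def padd_def l_distr M.finsum_addf Pi_iff)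
 show "pmul A x (padd A y y') = padd A (pmul A x y) (pmul A x y')" if "y' \<in> seqs A" for y'
  using c seqs_simps(6)[OF that] by (auto simp: pmul_def padd_def r_distr M.finsum_addf Pi_iff)
 show "pmul A x y 0 = x 0 \<otimes> y 0" using c by (simp add: pmul_def)
 show "pmul A (psh A x) y = psh A (pmul A x y)"
 proof
  fix n
  show "pmul A (psh A x) y n = psh A (pmul A x y) n"
  proof (cases n)
   case (Suc k)
   have "pmul A (psh A x) y (Suc k) = (\<Oplus>l\<in>{..k}. x l \<otimes> y (k - l)) \<oplus> \<zero> \<otimes> y (Suc k)"
    unfolding pmul_def by (subst M.finsum_Suc2) (use c in \<open>auto simp: psh_def split: nat.splits\<close>)
   then show ?thesis using c Suc by (simp add: psh_def pmul_def)
  qed (use c in \<open>simp add: pmul_def psh_def\<close>)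
 qed
 show "pmul A x (psh A y) = psh A (pmul A x y)"
 proof
  fix n
  show "pmul A x (psh A y) n = psh A (pmul A x y) n"
  proof (cases n)
   case (Suc k)
   have "pmul A x (psh A y) (Suc k) = x (Suc k) \<otimes> \<zero> \<oplus> (\<Oplus>l\<in>{..k}. x l \<otimes> psh A y (Suc k - l))"
    unfolding pmul_def by (subst M.finsum_Suc) (use c in \<open>auto simp: psh_def split: nat.splits\<close>)
   also have "(\<Oplus>l\<in>{..k}. x l \<otimes> psh A y (Suc k - l)) = (\<Oplus>l\<in>{..k}. x l \<otimes> y (k - l))"
    using c by (intro M.finsum_cong') (auto simp: psh_def Suc_diff_le)
   finally show ?thesis using c Suc by (simp add: psh_def pmul_def)
  qed (use c in \<open>simp add: pmul_def psh_def\<close>)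
 qed
qed

locale gauge_maps = seminormed av V for av :: "'k::field_char_0 => real" and V :: "('k, 'v) nspace" (structure) +
 fixes T :: "nat => 'v => 'v"
 assumes T_0: "a |: V ==> T 0 a = a" and T_bl: "bl V V (T n)"
begin

lemma T_cl [simp, intro]: "a |: V ==> T n a |: V" by (rule bl_closed[OF T_bl])

lemma T_z [simp]: "T n \<zero> = \<zero>" by (rule bl_zero[OF seminormed_axioms seminormed_axioms T_bl])

lemma gauge_cl [simp, intro]: "x \<in> seqs V ==> gauge V T x \<in> seqs V"
 by (intro seqsI) (auto simp: gauge_def intro!: M.finsum_closed)

lemma gauge_rec:
 assumes "x \<in> seqs V"
 shows "gauge V T x n = x n \<oplus> (\<Oplus>j\<in>{..<n}. T (n - j) (x j))"
proof -
 have "{..n} = insert n {..<n}" by auto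
 then show ?thesis using seqs_simps(6)[OF assms] by (simp add: gauge_def M.finsum_insert T_0 Pi_iff)
qed

lemma gauge_add: "x \<in> seqs V ==> y \<in> seqs V ==> gauge V T (padd V x y) = padd V (gauge V T x) (gauge V T y)"
 by (auto simp: gauge_def padd_def bl_add[OF T_bl] M.finsum_addf Pi_iff)

lemma gauge_psm: "x \<in> seqs V ==> gauge V T (psm V c x) = psm V c (gauge V T x)"
 by (auto simp: gauge_def psm_def bl_sm[OF T_bl] finsum_sm)

lemma gauge_psh:
 assumes "x \<in> seqs V"
 shows "gauge V T (psh V x) = psh V (gauge V T x)"
proof
 fix n
 note c = seqs_simps(6)[OF assms]
 show "gauge V T (psh V x) n = psh V (gauge V T x) n"
 proof (cases n)
  case (Suc k)
  have "gauge V T (psh V x) (Suc k) = (\<Oplus>j\<in>{..k}. T (k - j) (x j)) \<oplus> T (Suc k) \<zero>"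
   unfolding gauge_def by (subst M.finsum_Suc2) (use c in \<open>auto simp: psh_def split: nat.splits\<close>)
  then show ?thesis using c Suc by (simp add: psh_def gauge_def M.finsum_closed Pi_iff)
 qed (simp add: gauge_def psh_def)
qed

lemma gauge_pcst:
 assumes "a |: V"
 shows "gauge V T (pcst V a) = (%n. T n a)"
proof
 fix n
 have "gauge V T (pcst V a) n = (\<Oplus>j\<in>{..n}. if 0 = j then T (n - j) a else \<zero>)"
  unfolding gauge_def using assms by (intro M.finsum_cong') (auto simp: pcst_def)
 also have "\<dots> = T n a" using assms M.finsum_singleton[of 0 "{..n}" "%j. T (n - j) a"] by simp
 finally show "gauge V T (pcst V a) n = T n a" .
qed

text \<open>Linearity over all power series follows from linearity over scalars and \<hbar>: modulo
  \<open>\<hbar> ^ N\<close> only finitely many coefficients of a matter, and they are peeled off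
  one by one.\<close>

lemma gauge_pact:
 assumes "x \<in> seqs V"
 shows "gauge V T (pact V a x) = pact V a (gauge V T x)"
proof (rule agree_all)
 fix N
 show "agree N (gauge V T (pact V a x)) (pact V a (gauge V T x))"
 proof (induction N arbitrary: a)
  case (Suc N)
  show ?case unfolding pact_rec[OF assms, of a] pact_rec[OF gauge_cl[OF assms], of a]
   using assms Suc.IH[of "ptl a"] by (simp add: gauge_add gauge_psm gauge_psh agree_padd agree_psh)
 qed simp
qed

lemma gauge_inv_cl [simp, intro]:
 assumes "y \<in> seqs V"
 shows "gauge_inv V T y \<in> seqs V"
proof -
 have "gauge_inv V T y n |: V" for n
 proof (induction n rule: less_induct)
  case (less n)
  then show ?case using seqs_simps(6)[OF assms]
   by (subst gauge_inv.simps) (auto intro!: M.minus_closed M.finsum_closed)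
 qed
 then show ?thesis by (rule seqsI)
qed

lemma gauge_inv_rec:
 assumes "y \<in> seqs V"
 shows "gauge_inv V T y n = y n \<ominus> (\<Oplus>j\<in>{..<n}. T (n - j) (gauge_inv V T y j))"
 using seqs_simps(6)[OF gauge_inv_cl[OF assms]]
 by (subst gauge_inv.simps, intro arg_cong2[of _ _ _ _ "%u v. u \<ominus> v"] refl M.finsum_cong') auto

lemma gauge_gauge_inv:
 assumes "y \<in> seqs V"
 shows "gauge V T (gauge_inv V T y) = y"
proof
 fix n
 have "(\<Oplus>j\<in>{..<n}. T (n - j) (gauge_inv V T y j)) |: V"
  using seqs_simps(6)[OF gauge_inv_cl[OF assms]] by (intro M.finsum_closed) auto
 then show "gauge V T (gauge_inv V T y) n = y n" using seqs_simps(6)[OF assms, of n]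
  by (subst gauge_rec[OF gauge_inv_cl[OF assms]], subst gauge_inv_rec[OF assms]) simp
qed

lemma gauge_inv_gauge:
 assumes "x \<in> seqs V"
 shows "gauge_inv V T (gauge V T x) = x"
proof
 fix n
 note c = seqs_simps(6)[OF assms]
 show "gauge_inv V T (gauge V T x) n = x n"
 proof (induction n rule: less_induct)
  case (less n)
  have s: "(\<Oplus>j\<in>{..<n}. T (n - j) (x j)) |: V" using c by (intro M.finsum_closed) auto
  have "(\<Oplus>j\<in>{..<n}. T (n - j) (gauge_inv V T (gauge V T x) j)) = (\<Oplus>j\<in>{..<n}. T (n - j) (x j))"
   using c less.IH by (intro M.finsum_cong') auto
  then show ?case
   using s c[of n] by (subst gauge_inv_rec[OF gauge_cl[OF assms]]) (simp add: gauge_rec[OF assms])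
 qed
qed

text \<open>Every algebraic property of the inverse is obtained by exhibiting the preimage under
  \<open>gauge\<close>.\<close>

lemma gauge_inv_unique:
 assumes "x \<in> seqs V" "gauge V T x = y"
 shows "gauge_inv V T y = x" using gauge_inv_gauge[OF assms(1)] assms(2) by simp

lemma gauge_inv_add: "x \<in> seqs V ==> y \<in> seqs V ==>
  gauge_inv V T (padd V x y) = padd V (gauge_inv V T x) (gauge_inv V T y)"
 and gauge_inv_psm: "x \<in> seqs V ==> gauge_inv V T (psm V c x) = psm V c (gauge_inv V T x)"
 and gauge_inv_pact: "x \<in> seqs V ==> gauge_inv V T (pact V a x) = pact V a (gauge_inv V T x)"
 by (rule gauge_inv_unique; auto simp: gauge_add gauge_psm gauge_pact gauge_gauge_inv)+

lemma gauge_inv_0: "y \<in> seqs V ==> gauge_inv V T y 0 = y 0" by (subst gauge_inv_rec) auto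

lemma gauge_bound:
 assumes C: "!!n. 0 < C n" "!!n a. a |: V ==> nrm V (T n a) \<le> C n * nrm V a"
  and c: "!!n. 0 < c n" and x: "x \<in> seqs V" "!!n. nrm V (x n) \<le> K * c n"
 shows "nrm V (gauge V T x n) \<le> K * (\<Sum>j\<le>n. C (n - j) * c j)"
proof -
 have K: "0 \<le> K" using order.trans[OF norm_nonneg[OF seqs_simps(6)[OF x(1)]] x(2), of 0] c[of 0]
  by (simp add: zero_le_mult_iff)
 have "nrm V (T (n - j) (x j)) \<le> K * (\<Sum>j\<le>n. C (n - j) * c j)" if j: "j \<le> n" for j
 proof -
  have "nrm V (T (n - j) (x j)) \<le> C (n - j) * (K * c j)"
   by (rule order.trans[OF C(2)[OF seqs_simps(6)[OF x(1)]]], intro mult_left_mono x(2)) (simp add: C(1) less_imp_le)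
  also have "\<dots> = K * (C (n - j) * c j)" by simp
  also have "\<dots> \<le> K * (\<Sum>j\<le>n. C (n - j) * c j)"
   using j C(1) c by (intro mult_left_mono K member_le_sum) (auto intro: less_imp_le)
  finally show ?thesis .
 qed
 moreover have "0 \<le> K * (\<Sum>j\<le>n. C (n - j) * c j)"
  using K C(1) c by (intro mult_nonneg_nonneg sum_nonneg) (auto intro: less_imp_le)
 ultimately show ?thesis unfolding gauge_def using seqs_simps(6)[OF x(1)] by (intro norm_finsum_le) auto
qed

text \<open>A sequence of weight c goes to one of weight \<open>inv_weight C c\<close> with the same
  constant \<open>K\<close>. The new weight may grow at any speed, which is permitted because all
  weights belong to the colimit.\<close>

lemma gauge_inv_bound:
 assumes C: "!!n. 0 < C n" "!!n a. a |: V ==> nrm V (T n a) \<le> C n * nrm V a"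
  and c: "!!n. 0 < c n" and y: "y \<in> seqs V" "!!n. nrm V (y n) \<le> K * c n"
 shows "nrm V (gauge_inv V T y n) \<le> K * inv_weight C c n"
proof (induction n rule: less_induct)
 case (less n)
 have K: "0 \<le> K" using order.trans[OF norm_nonneg[OF seqs_simps(6)[OF y(1)]] y(2), of 0] c[of 0]
  by (simp add: zero_le_mult_iff)
 note w = inv_weight_pos[of C c, OF C(1) c]
 note s = seqs_simps(6)[OF gauge_inv_cl[OF y(1)]]
 have ieq: "inv_weight C c n = c n + (\<Sum>j<n. C (n - j) * inv_weight C c j)" by (subst inv_weight.simps) simp
 have pos: "0 \<le> C (n - j) * inv_weight C c j" for j using C(1) w by (simp add: less_imp_le)
 have "nrm V (T (n - j) (gauge_inv V T y j)) \<le> K * inv_weight C c n" if j: "j < n" for j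
 proof -
  have "nrm V (T (n - j) (gauge_inv V T y j)) \<le> C (n - j) * (K * inv_weight C c j)"
   by (rule order.trans[OF C(2)[OF s]], intro mult_left_mono less.IH j) (simp add: C(1) less_imp_le)
  also have "\<dots> = K * (C (n - j) * inv_weight C c j)" by simp
  also have "\<dots> \<le> K * (\<Sum>j<n. C (n - j) * inv_weight C c j)"
   using j pos by (intro mult_left_mono K member_le_sum) auto
  also have "\<dots> \<le> K * inv_weight C c n" unfolding ieq using c[of n] by (intro mult_left_mono K) auto
  finally show ?thesis .
 qed
 then have "nrm V (\<Oplus>j\<in>{..<n}. T (n - j) (gauge_inv V T y j)) \<le> K * inv_weight C c n"
  using s mult_nonneg_nonneg[OF K less_imp_le[OF w]] by (intro norm_finsum_le) auto
 moreover have "nrm V (y n) \<le> K * inv_weight C c n"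
  by (rule order.trans[OF y(2)], intro mult_left_mono K, unfold ieq) (simp add: pos sum_nonneg)
 ultimately show ?case
  using s by (subst gauge_inv_rec[OF y(1)]) (intro norm_sub_le M.finsum_closed seqs_simps(6)[OF y(1)]; auto)
qed

end

text \<open>Both sides are additive and \<hbar>-linear in each variable, and on constant sequences
  they agree by the hypothesis on \<open>T\<close>; the rest is induction modulo powers of
  \<hbar>.\<close>

lemma (in seqmult) gauge_mult:
 assumes "gauge_maps av U T"
  and T: "!!a b. a |: U ==> b |: U ==> (%n. T n (a \<otimes> b)) = mu (%n. T n a) (%n. T n b)"
  and xy: "x \<in> seqs U" "y \<in> seqs U"
 shows "gauge U T (pmul U x y) = mu (gauge U T x) (gauge U T y)"
proof (rule agree_all)
 fix N
 interpret gauge_maps av U T by fact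
 interpret p: seqmult av U "pmul U" by (rule U.pmul_seqmult)
 have pp: "pmul U (pcst U a) (pcst U b) = pcst U (a \<otimes> b)" if "a |: U" "b |: U" for a b
 proof
  fix n
  show "pmul U (pcst U a) (pcst U b) n = pcst U (a \<otimes> b) n"
  proof (cases n)
   case 0
   then show ?thesis using that by (simp add: p.mu_0) (simp add: pcst_def)
  next
   case (Suc k)
   have "pmul U (pcst U a) (pcst U b) n = (\<Oplus>l\<in>{..n}. \<zero>)"
    unfolding pmul_def using that Suc by (intro U.M.finsum_cong') (auto simp: pcst_def)
   then show ?thesis using Suc by (simp add: pcst_def)
  qed
 qed
 show "agree N (gauge U T (pmul U x y)) (mu (gauge U T x) (gauge U T y))" using xy
 proof (induction N arbitrary: x y)
  case (Suc N)
  let ?a = "pcst U (x 0)" and ?b = "pcst U (y 0)"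
  have x: "x = padd U ?a (psh U (ptl x))" and y: "y = padd U ?b (psh U (ptl y))" by (rule U.seq_split, fact)+
  have c: "x 0 |: U" "y 0 |: U" using Suc.prems by auto
  have "pmul U x y = padd U (padd U (pmul U ?a ?b) (psh U (pmul U ?a (ptl y)))) (psh U (pmul U (ptl x) y))"
   using p.mu_split[of ?a "ptl x" ?b "ptl y"] x y Suc.prems by simp
  then have 1: "gauge U T (pmul U x y) = padd U (padd U (gauge U T (pmul U ?a ?b)) (psh U (gauge U T (pmul U ?a (ptl y)))))
    (psh U (gauge U T (pmul U (ptl x) y)))" using Suc.prems c by (simp add: gauge_add gauge_psh)
  have g: "gauge U T z = padd U (gauge U T (pcst U (z 0))) (psh U (gauge U T (ptl z)))" if "z \<in> seqs U" for z
   using gauge_add[of "pcst U (z 0)" "psh U (ptl z)"] gauge_psh[of "ptl z"] U.seq_split[OF that] that by simp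
  have 2: "mu (gauge U T x) (gauge U T y) = padd U (padd U (mu (gauge U T ?a) (gauge U T ?b)) (psh U (mu (gauge U T ?a) (gauge U T (ptl y)))))
    (psh U (mu (gauge U T (ptl x)) (gauge U T y)))"
   using mu_split[of "gauge U T ?a" "gauge U T (ptl x)" "gauge U T ?b" "gauge U T (ptl y)"]
    g[OF Suc.prems(1)] g[OF Suc.prems(2)] Suc.prems c by simp
  have 3: "gauge U T (pmul U ?a ?b) = mu (gauge U T ?a) (gauge U T ?b)" using c by (simp add: pp gauge_pcst T)
  show ?case unfolding 1 2 3 using Suc.prems c by (intro agree_padd agree_psh Suc.IH agree_refl) auto
 qed simp
qed

section \<open>Morphisms in the Ind-completion\<close>

lemma hom_set_obj: "ind_banach av D ==> u \<in> hom_set (Idx D) i j ==> i \<in> Obj (Idx D) \<and> j \<in> Obj (Idx D)"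
 by (auto simp: ind_banach_def filtered_def is_category_def hom_set_def)

lemma hom_set_cmp: "ind_banach av D ==> u \<in> hom_set (Idx D) i j ==> v \<in> hom_set (Idx D) j l ==>
  Cmp (Idx D) v u \<in> hom_set (Idx D) i l" by (auto simp: ind_banach_def filtered_def is_category_def)

lemma Tr_bl: "ind_banach av D ==> u \<in> hom_set (Idx D) i j ==> bl (Sp D i) (Sp D j) (Tr D u)"
 by (auto simp: ind_banach_def hom_set_def)

lemma Tr_Cmp: "ind_banach av D ==> u \<in> hom_set (Idx D) i j ==> v \<in> hom_set (Idx D) j l ==> x |: (Sp D i) ==>
  Tr D (Cmp (Idx D) v u) x = Tr D v (Tr D u x)" unfolding ind_banach_def by blast

lemma colim_eq_sym: "colim_eq E S f g ==> colim_eq E S g f" unfolding colim_eq_def by metis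

lemma colim_eq_comp: "colim_eq E T f g ==> (!!x. x \<in> S ==> h x \<in> T) ==>
  colim_eq E S (fst f, snd f \<circ> h) (fst g, snd g \<circ> h)" unfolding colim_eq_def by fastforce

text \<open>The two identifications end at different indices. Filteredness is used twice: to bring
  these to a common index, and then to equalise the two resulting arrows from the index of
  g.\<close>

lemma colim_eq_trans:
 assumes E: "ind_banach av E" and 1: "colim_eq E S f g" and 2: "colim_eq E S g h"
  and cl: "!!x. x \<in> S ==> snd f x |: (Sp E (fst f))" "!!x. x \<in> S ==> snd g x |: (Sp E (fst g))"
   "!!x. x \<in> S ==> snd h x |: (Sp E (fst h))"
 shows "colim_eq E S f h"
proof -
 obtain l u v where 1: "u \<in> hom_set (Idx E) (fst f) l" "v \<in> hom_set (Idx E) (fst g) l"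
  "!!x. x \<in> S ==> Tr E u (snd f x) = Tr E v (snd g x)" using 1 unfolding colim_eq_def by blast
 obtain l' u' v' where 2: "u' \<in> hom_set (Idx E) (fst g) l'" "v' \<in> hom_set (Idx E) (fst h) l'"
  "!!x. x \<in> S ==> Tr E u' (snd g x) = Tr E v' (snd h x)" using 2 unfolding colim_eq_def by blast
 have "l \<in> Obj (Idx E)" "l' \<in> Obj (Idx E)" using hom_set_obj[OF E] 1(1) 2(1) by auto
 then obtain m p q where pq: "p \<in> hom_set (Idx E) l m" "q \<in> hom_set (Idx E) l' m"
  using E unfolding ind_banach_def filtered_def by blast
 have "Cmp (Idx E) p v \<in> hom_set (Idx E) (fst g) m" "Cmp (Idx E) q u' \<in> hom_set (Idx E) (fst g) m"
  using hom_set_cmp[OF E] 1 2 pq by blast+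
 then obtain n w where w: "w \<in> hom_set (Idx E) m n" "Cmp (Idx E) w (Cmp (Idx E) p v) = Cmp (Idx E) w (Cmp (Idx E) q u')"
  using E unfolding ind_banach_def filtered_def by blast
 have tr: "Tr E (Cmp (Idx E) w (Cmp (Idx E) b a)) x = Tr E w (Tr E b (Tr E a x))"
  if "a \<in> hom_set (Idx E) i j" "b \<in> hom_set (Idx E) j m" "x |: (Sp E i)" for a b i j x
  using Tr_Cmp[OF E hom_set_cmp[OF E that(1,2)] w(1) that(3)] Tr_Cmp[OF E that] by simp
 have "Tr E (Cmp (Idx E) w (Cmp (Idx E) p u)) (snd f x) = Tr E (Cmp (Idx E) w (Cmp (Idx E) q v')) (snd h x)"
  if x: "x \<in> S" for x
 proof -
  have "Tr E (Cmp (Idx E) w (Cmp (Idx E) p u)) (snd f x) = Tr E (Cmp (Idx E) w (Cmp (Idx E) p v)) (snd g x)"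
   using tr[OF 1(1) pq(1) cl(1)[OF x]] tr[OF 1(2) pq(1) cl(2)[OF x]] 1(3)[OF x] by simp
  also have "\<dots> = Tr E (Cmp (Idx E) w (Cmp (Idx E) q v')) (snd h x)"
   unfolding w(2) using tr[OF 2(1) pq(2) cl(2)[OF x]] tr[OF 2(2) pq(2) cl(3)[OF x]] 2(3)[OF x] by simp
  finally show ?thesis .
 qed
 then show ?thesis unfolding colim_eq_def using hom_set_cmp[OF E hom_set_cmp[OF E _ pq(1)] w(1)] 1(1)
   hom_set_cmp[OF E hom_set_cmp[OF E _ pq(2)] w(1)] 2(2) by blast
qed

text \<open>The objectwise half of \<open>ind_hom\<close>. It is stable under composition and tensor
  products by direct computation and is all that evaluating a composite at an element asks
  for.\<close>

definition obj_bl :: "('o, 'm, 'k::field_char_0, 'v, 'y) ind_scheme => ('p, 'n, 'k, 'w, 'z) ind_scheme => ('o, 'v, 'p, 'w) imor => bool" where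
 "obj_bl D E f \<longleftrightarrow> (\<forall>i\<in>Obj (Idx D). fst (f i) \<in> Obj (Idx E) \<and> bl (Sp D i) (Sp E (fst (f i))) (snd (f i)))"

lemma obj_blD:
 assumes "obj_bl D E f" "i \<in> Obj (Idx D)"
 shows "fst (f i) \<in> Obj (Idx E)" "bl (Sp D i) (Sp E (fst (f i))) (snd (f i))"
  "x |: (Sp D i) ==> snd (f i) x |: (Sp E (fst (f i)))"
 using assms unfolding obj_bl_def bounded_linear_map_def by auto

lemma ind_hom_obj_bl: "ind_hom D E f ==> obj_bl D E f" by (simp add: ind_hom_def obj_bl_def)

text \<open>A morphism of Ind-objects respects identification in the colimit: both sides are
  compared with the value at the index where f and f' become equal. The set S may be a single point,
  which lets elements be treated as maps.\<close>

lemma colim_eq_nat: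
 assumes E: "ind_banach av E" and F: "ind_banach av F" and g: "ind_hom E F g" and ff: "colim_eq E S f f'"
  and cl: "!!x. x \<in> S ==> snd f x |: (Sp E (fst f))" "!!x. x \<in> S ==> snd f' x |: (Sp E (fst f'))"
 shows "colim_eq F S (fst (g (fst f)), snd (g (fst f)) \<circ> snd f) (fst (g (fst f')), snd (g (fst f')) \<circ> snd f')"
proof -
 obtain l u v where l: "u \<in> hom_set (Idx E) (fst f) l" "v \<in> hom_set (Idx E) (fst f') l"
  "!!x. x \<in> S ==> Tr E u (snd f x) = Tr E v (snd f' x)" using ff unfolding colim_eq_def by blast
 note gb = ind_hom_obj_bl[OF g]
 have half: "colim_eq F S (fst (g (fst k)), snd (g (fst k)) \<circ> snd k) (fst (g l), snd (g l) \<circ> (%x. Tr E w (snd k x)))"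
  if "w \<in> hom_set (Idx E) (fst k) l" "!!x. x \<in> S ==> snd k x |: (Sp E (fst k))" for k w
 proof -
  have "colim_eq F (carrier (Sp E (fst k))) (g (fst k)) (fst (g l), snd (g l) \<circ> Tr E w)"
   using g that(1) unfolding ind_hom_def by blast
  from colim_eq_comp[OF this that(2)] show ?thesis by (simp add: o_def)
 qed
 have "colim_eq F S (fst (g l), snd (g l) \<circ> (%x. Tr E u (snd f x))) (fst (g (fst f')), snd (g (fst f')) \<circ> snd f')"
  using colim_eq_sym[OF half[OF l(2) cl(2)]] l(3) by (simp add: colim_eq_def)
 then show ?thesis using hom_set_obj[OF E l(1)] hom_set_obj[OF E l(2)] cl l(1)
  by (intro colim_eq_trans[OF F half[OF l(1) cl(1)]])
    (auto intro!: obj_blD(3)[OF gb] bl_closed[OF Tr_bl[OF E]])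
qed

lemma obj_bl_comp:
 assumes "obj_bl D E f" "obj_bl E F g" "!!i. i \<in> Obj (Idx D) ==> seminormed av (Sp D i)"
  "!!i. i \<in> Obj (Idx E) ==> seminormed av (Sp E i)"
 shows "obj_bl D F (g \<circ>\<^sub>I f)" unfolding obj_bl_def ind_comp_def
proof (intro ballI conjI; simp)
 fix i assume i: "i \<in> Obj (Idx D)"
 note f = obj_blD[OF assms(1) i]
 show "fst (g (fst (f i))) \<in> Obj (Idx F)" by (rule obj_blD(1)[OF assms(2) f(1)])
 show "bl (Sp D i) (Sp F (fst (g (fst (f i))))) (snd (g (fst (f i))) \<circ> snd (f i))"
  using bl_comp[OF assms(3)[OF i] assms(4)[OF f(1)] f(2) obj_blD(2)[OF assms(2) f(1)]] by (simp add: o_def)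
qed

section \<open>Formal power series\<close>

lemma powser_simps [simp]:
 "Obj (Idx (powser X)) = {c. \<forall>n. 0 < c n}" "Sp (powser X) c = wseq c X" "Tr (powser X) u = id"
 by (simp_all add: powser_def)

lemma powser_alg_simps [simp]:
 "Idx (powser_alg av X) = Idx (powser X)" "Sp (powser_alg av X) = Sp (powser X)" "Tr (powser_alg av X) = Tr (powser X)"
 "Idx (powser_halg av X) = Idx (powser X)" "Sp (powser_halg av X) = Sp (powser X)" "Tr (powser_halg av X) = Tr (powser X)"
 "imul (powser_halg av X) = imul (powser_alg av X)" "iunit (powser_halg av X) = iunit (powser_alg av X)"
 "iact (powser_halg av X) = powser_act av X"
 "iunit (powser_alg av X) = (%_. (%n. 1, %a n. if n = 0 then a \<odot>\<^sub>X \<one>\<^sub>X else \<zero>\<^sub>X))"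
 by (simp_all add: powser_def powser_alg_def powser_halg_def ind.defs indalg.defs hindalg.defs)

lemma powser_hom_set: "u \<in> hom_set (Idx (powser X)) c d \<longleftrightarrow> u = (c, d) \<and> (\<forall>n. 0 < c n) \<and> c \<le> d"
 by (auto simp: powser_def hom_set_def)

lemma const_simps [simp]:
 "Idx (ind_const X) = \<lparr>Obj = {()}, Arr = {()}, Dom = %_. (), Cod = %_. (), Idn = %_. (), Cmp = %_ _. ()\<rparr>"
 "Sp (ind_const X) = (%_. X)" "Tr (ind_const X) = (%_. id)" by (simp_all add: ind_const_def)

lemma const_alg_simps [simp]:
 "Idx (const_alg av X) = Idx (ind_const X)" "Sp (const_alg av X) = Sp (ind_const X)" "Tr (const_alg av X) = Tr (ind_const X)"
 by (simp_all add: ind_const_def const_alg_def ind.defs indalg.defs)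

lemma tens_simps [simp]: "Obj (Idx (ind_tens av D E)) = Obj (Idx D) \<times> Obj (Idx E)"
 "Sp (ind_tens av D E) p = ctens av (Sp D (fst p)) (Sp E (snd p))"
 by (simp_all add: ind_tens_def cat_prod_def split_def)

text \<open>The transition maps are inclusions and any two weights have a maximum, so equality in
  the colimit is plain equality of sequences. The object is given by its index category and
  transition maps only, so that the lemma serves the plain object and its algebra versions
  alike.\<close>

lemma powser_colim_eq:
 assumes "Idx E = Idx (powser X)" "Tr E = Tr (powser X)" "!!n. 0 < fst f n" "!!n. 0 < fst g n"
 shows "colim_eq E S f g \<longleftrightarrow> (\<forall>x\<in>S. snd f x = snd g x)"
proof
 assume *: "\<forall>x\<in>S. snd f x = snd g x"
 define m where "m = (%n. max (fst f n) (fst g n))"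
 have "(fst f, m) \<in> hom_set (Idx E) (fst f) m" "(fst g, m) \<in> hom_set (Idx E) (fst g) m"
  using assms by (auto simp: powser_hom_set le_fun_def m_def)
 moreover have "\<forall>x\<in>S. Tr E (fst f, m) (snd f x) = Tr E (fst g, m) (snd g x)" using * assms(2) by simp
 ultimately show "colim_eq E S f g" unfolding colim_eq_def by blast
qed (use assms(2) in \<open>auto simp: colim_eq_def\<close>)

lemma const_colim_eq:
 assumes "Idx E = Idx (ind_const X)" "Tr E = Tr (ind_const X)"
 shows "colim_eq E S f g \<longleftrightarrow> (\<forall>x\<in>S. snd f x = snd g x)" using assms by (auto simp: colim_eq_def hom_set_def)

lemma weighted_seqs_carrier: "x |: (wseq c V) \<longleftrightarrow> x \<in> seqs V \<and> bdd_above (range (%n. nrm V (x n) / c n))"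
 by (simp add: weighted_seqs_def seqs_def)

locale banach = seminormed av V for av :: "'k::field_char_0 => real" and V :: "('k, 'v) nspace" (structure) +
 assumes banach: "banach_space av V"
begin

lemma wseq_carrier: "(!!n. 0 < c n) ==> x |: (wseq c V) \<longleftrightarrow> x \<in> seqs V \<and> (\<exists>K. \<forall>n. nrm V (x n) \<le> K * c n)"
 by (auto simp: weighted_seqs_carrier bdd_above_def divide_le_eq)

lemma wseq_seqs: "x |: (wseq c V) ==> x \<in> seqs V" by (simp add: weighted_seqs_carrier)

lemma wseq_ops: "add (wseq c V) = padd V" "smult (wseq c V) = psm V" "zero (wseq c V) = (%n. \<zero>)"
 by (simp_all add: weighted_seqs_def padd_def[abs_def] psm_def[abs_def] fun_eq_iff)

lemma wseq_le:
 assumes "!!n. 0 < c n" "x |: (wseq c V)"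
 shows "nrm V (x n) \<le> nrm (wseq c V) x * c n"
proof -
 have "nrm V (x n) / c n \<le> nrm (wseq c V) x"
  using cSUP_upper[OF UNIV_I, of "%n. nrm V (x n) / c n" n] assms(2) by (simp add: weighted_seqs_def)
 then show ?thesis using assms(1)[of n] by (simp add: field_simps)
qed

lemma wseq_norm_le:
 assumes "!!n. 0 < c n" "!!n. nrm V (x n) \<le> K * c n"
 shows "nrm (wseq c V) x \<le> K" using assms by (auto simp: weighted_seqs_def divide_le_eq intro!: cSUP_least)

lemma wseq_I:
 assumes "!!n. 0 < c n" "x \<in> seqs V" "!!n. nrm V (x n) \<le> K * c n"
 shows "x |: (wseq c V)" using assms by (auto simp: wseq_carrier)

lemma wseq_seminormed:
 assumes c: "!!n. 0 < c n"
 shows "seminormed av (wseq c V)" (is "seminormed av ?W")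
proof -
 have cl_add: "padd V x y |: ?W" and tri: "nrm ?W (padd V x y) \<le> max (nrm ?W x) (nrm ?W y)"
  if x: "x |: ?W" and y: "y |: ?W" for x y
 proof -
  have b: "nrm V (padd V x y n) \<le> max (nrm ?W x) (nrm ?W y) * c n" for n
  proof -
   have "nrm ?W u * c n \<le> max (nrm ?W x) (nrm ?W y) * c n" if "u = x \<or> u = y" for u
    using that c[of n] by (intro mult_right_mono) auto
   then show ?thesis unfolding padd_def
    using order.trans[OF wseq_le[of c x n, OF c x]] order.trans[OF wseq_le[of c y n, OF c y]]
    by (intro norm_add_le seqs_simps(6) wseq_seqs[OF x] wseq_seqs[OF y]) blast+
  qed
  show "padd V x y |: ?W" using wseq_seqs[OF x] wseq_seqs[OF y] by (intro wseq_I[OF c _ b]) auto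
  show "nrm ?W (padd V x y) \<le> max (nrm ?W x) (nrm ?W y)" by (rule wseq_norm_le[OF c b])
 qed
 have cl_sm: "psm V a x |: ?W" and sm_le: "nrm ?W (psm V a x) \<le> av a * nrm ?W x" if x: "x |: ?W" for a x
 proof -
  have b: "nrm V (psm V a x n) \<le> (av a * nrm ?W x) * c n" for n
   using mult_left_mono[OF wseq_le[OF c x, of n], of "av a"] seqs_simps(6)[OF wseq_seqs[OF x]]
   by (simp add: psm_def norm_smult mult.assoc)
  show "psm V a x |: ?W" using wseq_seqs[OF x] by (intro wseq_I[OF c _ b]) auto
  show "nrm ?W (psm V a x) \<le> av a * nrm ?W x" by (rule wseq_norm_le[OF c b])
 qed
 have z: "(%n. \<zero>) |: ?W" by (rule wseq_I[OF c seqsI, of _ 0]) auto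
 note s = seqs_simps(6)[OF wseq_seqs]
 have ab: "abelian_group ?W"
 proof (rule abelian_groupI)
  fix x assume x: "x |: ?W"
  show "\<exists>y\<in>carrier ?W. y \<oplus>\<^sub>?W x = \<zero>\<^sub>?W"
   using s[OF x] by (intro bexI[of _ "psm V (- 1) x"] cl_sm x) (simp add: wseq_ops padd_def psm_def sm_m1 M.l_neg)
 qed (use s cl_add z in \<open>auto simp: wseq_ops padd_def M.a_ac\<close>)
 have md: "module kring ?W" by (rule moduleI[OF cring_kring ab])
    (use s cl_sm in \<open>auto simp: wseq_ops padd_def psm_def sm_add_l sm_add_r sm_sm\<close>)
 have "nrm ?W (psm V a x) = av a * nrm ?W x" if x: "x |: ?W" for a x
 proof (cases "a = 0")
  case True
  have "0 \<le> nrm ?W y * c 0" if "y |: ?W" for y using order.trans[OF norm_nonneg[OF s[OF that]] wseq_le[OF c that]] .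
  then have "0 \<le> nrm ?W y" if "y |: ?W" for y using that c[of 0] by (simp add: zero_le_mult_iff)
  then show ?thesis using sm_le[OF x, of a] cl_sm[OF x, of a] True by (auto intro: antisym)
 next
  case False
  have "x = psm V (inverse a) (psm V a x)" using s[OF x] False by (simp add: psm_def sm_sm)
  then have "nrm ?W x \<le> av (inverse a) * nrm ?W (psm V a x)" using sm_le[OF cl_sm[OF x], of "inverse a" a] by simp
  then have "av a * nrm ?W x \<le> (av a * av (inverse a)) * nrm ?W (psm V a x)"
   using mult_left_mono[of _ _ "av a"] by (simp add: mult.assoc)
  also have "av a * av (inverse a) = 1" using False by (simp flip: av_mult)
  finally show ?thesis using sm_le[OF x, of a] by simp
 qed
 moreover have "0 \<le> nrm ?W x" if "x |: ?W" for x
  using order.trans[OF norm_nonneg[OF s[OF that]] wseq_le[OF c that], of 0] c[of 0] by (simp add: zero_le_mult_iff)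
 ultimately show ?thesis
  using tri by (intro seminormed.intro nonarch_axioms md seminormed_axioms.intro) (auto simp: wseq_ops)
qed

lemma wseq_coeff_bl:
 assumes "!!n. 0 < c n"
 shows "bl (wseq c V) V (%x. x n)" using wseq_seqs wseq_le[OF assms]
 by (intro blI[where C = "c n"]) (auto simp: wseq_ops padd_def psm_def mult.commute)

text \<open>Limits are taken in each coefficient separately. The Cauchy estimate at coefficient i is
  a multiple of \<open>c i\<close> with a factor independent of i, and this uniformity passes to the
  limit.\<close>

lemma wseq_banach:
 assumes c: "!!n. 0 < c n"
 shows "banach_space av (wseq c V)" (is "banach_space av ?W")
proof (rule banach_spaceI)
 show W: "seminormed av ?W" by (rule wseq_seminormed[OF c])
 then interpret W: seminormed av ?W .
 note s = seqs_simps(6)[OF wseq_seqs]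
 show "x = \<zero>\<^sub>?W" if x: "x |: ?W" "nrm ?W x = 0" for x
  using wseq_le[OF c x(1)] x(2) norm_nonneg[OF s[OF x(1)]] banach_sep[OF banach s[OF x(1)]]
  by (force simp: wseq_ops fun_eq_iff intro: antisym)
 have sub: "(x \<ominus>\<^sub>?W y) n = x n \<ominus> y n" if "x |: ?W" "y |: ?W" for x y n
  using bl_sub[OF W seminormed_axioms wseq_coeff_bl[OF c] that] .
 show "normed_complete ?W" unfolding normed_complete_def
 proof (intro allI impI, elim conjE)
  fix X :: "nat => nat => 'v"
  assume X: "\<forall>n. X n |: ?W" and cau: "\<forall>e>0. \<exists>N. \<forall>m\<ge>N. \<forall>n\<ge>N. nrm ?W (X m \<ominus>\<^sub>?W X n) < e"
  have diff: "nrm V (X m i \<ominus> X n i) \<le> nrm ?W (X m \<ominus>\<^sub>?W X n) * c i" for m n i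
   using wseq_le[of c "X m \<ominus>\<^sub>?W X n" i, OF c] sub X by simp
  have "\<exists>l\<in>carrier V. (%n. nrm V (X n i \<ominus> l)) \<longlonglongrightarrow> 0" for i
  proof (rule banach_complete[OF banach])
   show "X n i |: V" for n using s X by blast
   fix e :: real assume "0 < e"
   then obtain N where N: "\<forall>m\<ge>N. \<forall>n\<ge>N. nrm ?W (X m \<ominus>\<^sub>?W X n) < e / c i"
    using cau c[of i] by (meson divide_pos_pos)
   have "nrm V (X m i \<ominus> X n i) < e" if "m \<ge> N" "n \<ge> N" for m n
    using order.strict_trans1[OF diff[of m i n], of e] N that c[of i] by (simp add: pos_less_divide_eq)
   then show "\<exists>N. \<forall>m\<ge>N. \<forall>n\<ge>N. nrm V (X m i \<ominus> X n i) < e" by blast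
  qed
  then obtain L where L: "!!i. L i |: V" "!!i. (%n. nrm V (X n i \<ominus> L i)) \<longlonglongrightarrow> 0" by metis
  have Xc: "X n i |: V" for n i using s X by blast
  have lim: "nrm V (X m i \<ominus> L i) \<le> e * c i"
   if N: "\<forall>m\<ge>N. \<forall>n\<ge>N. nrm ?W (X m \<ominus>\<^sub>?W X n) < e" and m: "m \<ge> N" and e: "0 < e" for N m i :: nat and e :: real
  proof -
   have "0 < e * c i" using e c by simp
   then obtain M where M: "!!n. n \<ge> M ==> nrm V (X n i \<ominus> L i) < e * c i"
    using LIMSEQ_D[OF L(2)[of i], of "e * c i"] L(1) Xc by auto
   let ?n = "max M N"
   have "nrm ?W (X m \<ominus>\<^sub>?W X ?n) * c i \<le> e * c i"
    using N m c[of i] by (intro mult_right_mono) (auto simp: less_imp_le)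
   then have "nrm V (X m i \<ominus> X ?n i) \<le> e * c i" using diff[of m i ?n] by linarith
   moreover have "nrm V (X ?n i \<ominus> L i) \<le> e * c i" using M[of ?n] by simp
   ultimately show ?thesis using norm_tri[OF Xc[of m i] Xc[of ?n i] L(1)[of i]] by linarith
  qed
  \<comment> \<open>Y m is the error of X m. By \<open>lim\<close> it belongs to the weighted space
    for large m, and then so does the limit, as the difference of X m and Y m.\<close>
  define Y where "Y m i = X m i \<ominus> L i" for m i
  have Ys: "Y m \<in> seqs V" for m using Xc L(1) by (intro seqsI) (simp add: Y_def)
  have Y: "\<exists>N. \<forall>m\<ge>N. Y m |: ?W \<and> nrm ?W (Y m) \<le> e" if e: "0 < e" for e
  proof -
   obtain N where N: "\<forall>m\<ge>N. \<forall>n\<ge>N. nrm ?W (X m \<ominus>\<^sub>?W X n) < e" using cau e by blast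
   have "Y m |: ?W \<and> nrm ?W (Y m) \<le> e" if "m \<ge> N" for m
    using wseq_I[of c "Y m" e, OF c Ys] wseq_norm_le[of c "Y m" e, OF c] lim[OF N that e] by (simp add: Y_def)
   then show ?thesis by blast
  qed
  obtain N where N: "!!m. m \<ge> N ==> Y m |: ?W" using Y[of 1] by auto
  have "L i = (X N \<ominus>\<^sub>?W Y N) i" for i
   using sub[of "X N" "Y N" i] X N[of N] Xc[of N i] L(1)[of i] by (simp add: Y_def ag)
  then have "L = X N \<ominus>\<^sub>?W Y N" by blast
  then have LW: "L |: ?W" using X N[of N] by simp
  have "X m \<ominus>\<^sub>?W L = Y m" for m using sub[of "X m" L] X LW by (simp add: Y_def fun_eq_iff)
  moreover have "(%m. nrm ?W (Y m)) \<longlonglongrightarrow> 0"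
  proof (rule LIMSEQ_I)
   fix e :: real assume "0 < e"
   then obtain N' where "!!m. m \<ge> N' ==> Y m |: ?W \<and> nrm ?W (Y m) \<le> e / 2" using Y[of "e / 2"] by auto
   then have "norm (nrm ?W (Y m) - 0) < e" if "m \<ge> N'" for m
    using W.norm_nonneg[of "Y m"] \<open>0 < e\<close> that by fastforce
   then show "\<exists>no. \<forall>n\<ge>no. norm (nrm ?W (Y n) - 0) < e" by blast
  qed
  ultimately show "\<exists>l\<in>carrier ?W. (%n. nrm ?W (X n \<ominus>\<^sub>?W l)) \<longlonglongrightarrow> 0" using LW by (intro bexI[of _ L]) simp_all
 qed
qed

lemma powser_banach: "ind_banach av (powser V)" unfolding ind_banach_def
proof (intro conjI ballI allI)
 have cat: "is_category (Idx (powser V))" unfolding is_category_def powser_hom_set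
  by (auto simp: powser_def hom_set_def intro: order.trans)
    (auto simp: le_fun_def intro: order.strict_trans2)
 show "filtered (Idx (powser V))" unfolding filtered_def
 proof (intro conjI ballI allI cat)
  show "Obj (Idx (powser V)) \<noteq> {}" using zero_less_one[where 'a = real] by (auto intro: exI[of _ "%_. 1"])
  fix c d assume "c \<in> Obj (Idx (powser V))" "d \<in> Obj (Idx (powser V))"
  then have "(c, %n. max (c n) (d n)) \<in> hom_set (Idx (powser V)) c (%n. max (c n) (d n))"
    "(d, %n. max (c n) (d n)) \<in> hom_set (Idx (powser V)) d (%n. max (c n) (d n))"
   by (auto simp: powser_hom_set le_fun_def)
  then show "\<exists>l. hom_set (Idx (powser V)) c l \<noteq> {} \<and> hom_set (Idx (powser V)) d l \<noteq> {}" by blast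
 next
  fix c d u v assume u: "u \<in> hom_set (Idx (powser V)) c d" "v \<in> hom_set (Idx (powser V)) c d"
  then have "u = v" by (simp add: powser_hom_set)
  moreover have "(d, d) \<in> hom_set (Idx (powser V)) d d"
   using u(1) by (auto simp: powser_hom_set le_fun_def intro: order.strict_trans2)
  ultimately show "\<exists>l. \<exists>w\<in>hom_set (Idx (powser V)) d l. Cmp (Idx (powser V)) w u = Cmp (Idx (powser V)) w v" by blast
 qed
 show "banach_space av (Sp (powser V) c)" if "c \<in> Obj (Idx (powser V))" for c using that wseq_banach by simp
 fix u assume "u \<in> Arr (Idx (powser V))"
 then obtain c d where u: "u = (c, d)" "!!n. 0 < c n" "c \<le> d" by (auto simp: powser_def)
 have d: "0 < d n" for n using u(2)[of n] u(3) by (auto simp: le_fun_def intro: order.strict_trans2)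
 interpret W: seminormed av "wseq c V" by (rule wseq_seminormed[OF u(2)])
 have b: "nrm V (x n) \<le> nrm (wseq c V) x * d n" if x: "x |: (wseq c V)" for x n
  using wseq_le[of c x n, OF u(2) x] mult_left_mono[of "c n" "d n" "nrm (wseq c V) x"] u(3) W.norm_nonneg[OF x]
  by (force simp: le_fun_def)
 have "bl (wseq c V) (wseq d V) (%x. x)" by (rule blI[where C = 1])
    (use wseq_I[of d, OF d wseq_seqs b] wseq_norm_le[of d, OF d b] in \<open>auto simp: wseq_ops\<close>)
 then show "bl (Sp (powser V) (Dom (Idx (powser V)) u)) (Sp (powser V) (Cod (Idx (powser V)) u)) (Tr (powser V) u)"
  by (simp add: u(1) powser_def id_def)
qed simp_all

end

section \<open>Evaluation of the tensor structure on elementary tensors\<close>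

definition obj_sn :: "('k::field_char_0 => real) => ('o, 'm, 'k, 'v, 'z) ind_scheme => bool" where
 "obj_sn av D \<longleftrightarrow> (\<forall>i\<in>Obj (Idx D). seminormed av (Sp D i))"

lemma obj_snD: "obj_sn av D ==> i \<in> Obj (Idx D) ==> seminormed av (Sp D i)" by (simp add: obj_sn_def)

lemma obj_sn_banach: "na_field av ==> ind_banach av D ==> obj_sn av D"
 using banach_seminormed unfolding obj_sn_def ind_banach_def by blast

lemma obj_sn_tens: "obj_sn av D ==> obj_sn av E ==> obj_sn av (ind_tens av D E)"
 by (auto simp: obj_sn_def intro: ctens_seminormed)

lemma ind_tens_map_pure:
 assumes "obj_sn av D" "obj_sn av D'" "obj_sn av E" "obj_sn av E'" "obj_bl D E f" "obj_bl D' E' g"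
  and "i \<in> Obj (Idx D)" "j \<in> Obj (Idx D')" "x |: (Sp D i)" "y |: (Sp D' j)"
 shows "snd (ind_tens_map av D D' E E' f g (i, j)) (pure_tens av (Sp D i) (Sp D' j) x y) =
  pure_tens av (Sp E (fst (f i))) (Sp E' (fst (g j))) (snd (f i) x) (snd (g j) y)"
 unfolding ind_tens_map_def using assms(9,10)
 by (simp add: tens_map_bl(2)[OF obj_snD[OF assms(1,7)] obj_snD[OF assms(2,8)]
   obj_snD[OF assms(3) obj_blD(1)[OF assms(5,7)]] obj_snD[OF assms(4) obj_blD(1)[OF assms(6,8)]]
   obj_blD(2)[OF assms(5,7)] obj_blD(2)[OF assms(6,8)]])

lemma ind_tens_map_fst: "fst (ind_tens_map av D D' E E' f g (i, j)) = (fst (f i), fst (g j))"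
 by (simp add: ind_tens_map_def)

lemma obj_bl_tens:
 assumes "obj_sn av D" "obj_sn av D'" "obj_sn av E" "obj_sn av E'" "obj_bl D E f" "obj_bl D' E' g"
 shows "obj_bl (ind_tens av D D') (ind_tens av E E') (ind_tens_map av D D' E E' f g)"
 unfolding obj_bl_def tens_simps ind_tens_map_def using obj_blD[OF assms(5)] obj_blD[OF assms(6)]
 by (auto intro!: tens_map_bl(1) obj_snD[OF assms(1)] obj_snD[OF assms(2)] obj_snD[OF assms(3)] obj_snD[OF assms(4)])

lemma obj_bl_id: "obj_bl D D ind_id" by (simp add: obj_bl_def ind_id_def id_def bl_id)

lemma ind_swap_pure:
 assumes "obj_sn av D" "obj_sn av E" "i \<in> Obj (Idx D)" "j \<in> Obj (Idx E)" "x |: (Sp D i)" "y |: (Sp E j)"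
 shows "snd (ind_swap av D E (i, j)) (pure_tens av (Sp D i) (Sp E j) x y) = pure_tens av (Sp E j) (Sp D i) y x"
 unfolding ind_swap_def using tens_lift_pure[OF obj_snD[OF assms(1,3)] obj_snD[OF assms(2,4)]
   ctens_banach[OF obj_snD[OF assms(2,4)] obj_snD[OF assms(1,3)]]
   bilin_swap[OF pure_tens_bilin[OF obj_snD[OF assms(2,4)] obj_snD[OF assms(1,3)]]] assms(5,6)] by simp

lemma obj_bl_swap:
 assumes "obj_sn av D" "obj_sn av E"
 shows "obj_bl (ind_tens av D E) (ind_tens av E D) (ind_swap av D E)"
 unfolding obj_bl_def tens_simps ind_swap_def
 by (auto intro!: tens_lift_bl ctens_banach bilin_swap[OF pure_tens_bilin] obj_snD[OF assms(1)] obj_snD[OF assms(2)])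

text \<open>The outer lift can be evaluated once its argument is known to be a bounded bilinear map
  in t and z. For a fixed z the inner lift is bounded, but the bound must be linear in the norm of
  z; this is the purpose of \<open>tens_lift_norm\<close>. Linearity in z is checked on elementary
  tensors.\<close>

lemma tens_assoc_pure:
 assumes X: "seminormed av X" and Y: "seminormed av Y" and Z: "seminormed av Z"
  and xyz: "x |: X" "y |: Y" "z |: Z"
 defines "W \<equiv> ctens av X (ctens av Y Z)"
 shows "tens_lift av (ctens av X Y) Z W (%t z.
   tens_lift av X Y W (%x y. pure_tens av X (ctens av Y Z) x (pure_tens av Y Z y z)) t)
   (pure_tens av (ctens av X Y) Z (pure_tens av X Y x y) z) =
  pure_tens av X (ctens av Y Z) x (pure_tens av Y Z y z)"
proof -
 let ?p = "%z x y. pure_tens av X (ctens av Y Z) x (pure_tens av Y Z y z)"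
 let ?L = "%t z. tens_lift av X Y W (?p z) t"
 note XY = ctens_seminormed[OF X Y] and YZ = ctens_seminormed[OF Y Z]
 note WB = ctens_banach[OF X YZ, folded W_def] and WS = ctens_seminormed[OF X YZ, folded W_def]
 interpret W: seminormed av W by (rule WS)
 interpret Z: seminormed av Z by (rule Z)
 interpret Y: seminormed av Y by (rule Y)
 interpret X: seminormed av X by (rule X)
 note yz = pure_tens_bilin[OF Y Z] and xw = pure_tens_bilin[OF X YZ, folded W_def]
 have p: "bilin_map X Y W (?p z)" if "z |: Z" for z
  by (rule bilin_comp[OF X Y X YZ bl_id bilin_left[OF yz that] xw])
 note L = tens_lift[OF X Y WB p]
 obtain B where B: "0 < B" "!!v w. v |: X ==> w |: (ctens av Y Z) ==>
   nrm W (pure_tens av X (ctens av Y Z) v w) \<le> B * (nrm X v * nrm (ctens av Y Z) w)"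
  using bilin_bound[OF xw] by blast
 obtain B' where B': "0 < B'" "!!v w. v |: Y ==> w |: Z ==>
   nrm (ctens av Y Z) (pure_tens av Y Z v w) \<le> B' * (nrm Y v * nrm Z w)" using bilin_bound[OF yz] by blast
 have pb: "nrm W (?p z x y) \<le> (B * B' * nrm Z z) * (nrm X x * nrm Y y)"
  if "x |: X" "y |: Y" "z |: Z" for x y z
 proof -
  have "nrm W (?p z x y) \<le> B * (nrm X x * (B' * (nrm Y y * nrm Z z)))"
   by (rule order.trans[OF B(2)], use that bilin_closed[OF yz] in blast,
     use that bilin_closed[OF yz] in blast, intro mult_left_mono B'(2)) (use that B(1) in auto)
  then show ?thesis by (simp add: mult_ac)
 qed
 have "bilin_map (ctens av X Y) Z W ?L"
 proof (rule bilinI[OF XY Z, where C = "B * B'"])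
  fix t z assume t: "t |: (ctens av X Y)" and z: "z |: Z"
  show "?L t z |: W" by (rule bl_closed[OF L(1)[OF z] t])
  show "?L (t \<oplus>\<^bsub>ctens av X Y\<^esub> t') z = ?L t z \<oplus>\<^sub>W ?L t' z" if "t' |: (ctens av X Y)" for t'
   by (rule bl_add[OF L(1)[OF z] t that])
  show "?L (a \<odot>\<^bsub>ctens av X Y\<^esub> t) z = a \<odot>\<^sub>W ?L t z" for a by (rule bl_sm[OF L(1)[OF z] t])
  show "?L t (z \<oplus>\<^sub>Z z') = ?L t z \<oplus>\<^sub>W ?L t z'" if z': "z' |: Z" for z'
  proof (rule ctens_eqI[OF X Y WS banach_separated[OF WB] L(1) bl_plus[OF XY WS L(1)[OF z] L(1)[OF z']] _ t])
   fix x y assume "x |: X" "y |: Y"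
   then show "?L (pure_tens av X Y x y) (z \<oplus>\<^sub>Z z') = ?L (pure_tens av X Y x y) z \<oplus>\<^sub>W ?L (pure_tens av X Y x y) z'"
    using z z' bilin_closed[OF yz] by (simp add: L(2) bl_add[OF bilin_right[OF yz]] bl_add[OF bilin_right[OF xw]])
  qed (use z z' in auto)
  show "?L t (a \<odot>\<^sub>Z z) = a \<odot>\<^sub>W ?L t z" for a
  proof (rule ctens_eqI[OF X Y WS banach_separated[OF WB] L(1) bl_scale[OF XY WS L(1)[OF z]] _ t])
   fix x y assume "x |: X" "y |: Y"
   then show "?L (pure_tens av X Y x y) (a \<odot>\<^sub>Z z) = a \<odot>\<^sub>W ?L (pure_tens av X Y x y) z"
    using z bilin_closed[OF yz] by (simp add: L(2) bl_sm[OF bilin_right[OF yz]] bl_sm[OF bilin_right[OF xw]])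
  qed (use z in auto)
  have "nrm W (?L t z) \<le> (B * B' * nrm Z z) * nrm (ctens av X Y) t"
   by (rule tens_lift_norm[OF X Y WB p[OF z] _ pb t]) (use z B(1) B'(1) in auto)
  then show "nrm W (?L t z) \<le> B * B' * (nrm (ctens av X Y) t * nrm Z z)" by (simp add: mult_ac)
 qed
 from tens_lift_pure[OF XY Z WB this bilin_closed[OF pure_tens_bilin[OF X Y] xyz(1,2)] xyz(3)]
 show ?thesis using xyz by (simp add: L(2))
qed

lemma ind_assoc_pure:
 assumes "obj_sn av A" "obj_sn av B" "obj_sn av C" "i \<in> Obj (Idx A)" "j \<in> Obj (Idx B)" "l \<in> Obj (Idx C)"
  and "x |: (Sp A i)" "y |: (Sp B j)" "z |: (Sp C l)"
 shows "snd (ind_assoc av A B C ((i, j), l))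
   (pure_tens av (ctens av (Sp A i) (Sp B j)) (Sp C l) (pure_tens av (Sp A i) (Sp B j) x y) z) =
  pure_tens av (Sp A i) (ctens av (Sp B j) (Sp C l)) x (pure_tens av (Sp B j) (Sp C l) y z)"
 unfolding ind_assoc_def Let_def
 using tens_assoc_pure[OF obj_snD[OF assms(1,4)] obj_snD[OF assms(2,5)] obj_snD[OF assms(3,6)] assms(7-9)]
 by simp

lemma ind_swap_fst: "fst (ind_swap av D E (i, j)) = (j, i)"
 and ind_assoc_fst: "fst (ind_assoc av A B C ((i, j), l)) = (i, (j, l))"
 by (simp_all add: ind_swap_def ind_assoc_def)

lemma pure_tens_cl: "seminormed av V ==> seminormed av W ==> v |: V ==> w |: W ==>
  pure_tens av V W v w |: (ctens av V W)" by (rule bilin_closed[OF pure_tens_bilin])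

context banach
begin

text \<open>The two morphisms may land in different weighted spaces, so they are compared
  coefficient by coefficient in \<open>V\<close>, where density of elementary tensors
  applies.\<close>

lemma tens_powser_eqI:
 assumes E: "Idx E = Idx (powser V)" "Sp E = Sp (powser V)" "Tr E = Tr (powser V)"
  and D: "obj_sn av D" "obj_sn av D'"
  and f: "obj_bl (ind_tens av D D') E f" and g: "obj_bl (ind_tens av D D') E g"
  and eq: "!!i j x y. i \<in> Obj (Idx D) ==> j \<in> Obj (Idx D') ==> x |: (Sp D i) ==> y |: (Sp D' j) ==>
   snd (f (i, j)) (pure_tens av (Sp D i) (Sp D' j) x y) = snd (g (i, j)) (pure_tens av (Sp D i) (Sp D' j) x y)"
 shows "ind_eq (ind_tens av D D') E f g" unfolding ind_eq_def
proof
 fix p assume p: "p \<in> Obj (Idx (ind_tens av D D'))"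
 then obtain i j where ij: "p = (i, j)" "i \<in> Obj (Idx D)" "j \<in> Obj (Idx D')" by auto
 let ?T = "ctens av (Sp D i) (Sp D' j)"
 note sn = obj_snD[OF D(1) ij(2)] obj_snD[OF D(2) ij(3)]
 have w: "!!n. 0 < fst (f p) n" "!!n. 0 < fst (g p) n"
  using obj_blD(1)[OF f p] obj_blD(1)[OF g p] E(1) by auto
 have b: "bl ?T V (%t. snd (h p) t n)" if "h = f \<or> h = g" for h n
 proof -
  have h: "obj_bl (ind_tens av D D') E h" "!!n. 0 < fst (h p) n" using that f g w by auto
  have "bl ?T (wseq (fst (h p)) V) (snd (h p))" using obj_blD(2)[OF h(1) p] E(2) ij by simp
  from bl_comp[OF ctens_seminormed[OF sn] wseq_seminormed[of "fst (h p)", OF h(2)] this wseq_coeff_bl[of "fst (h p)" n, OF h(2)]]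
  show ?thesis .
 qed
 have "snd (f p) t n = snd (g p) t n" if "t |: ?T" for t n using eq[OF ij(2,3)] ij(1)
  by (intro ctens_eqI[OF sn seminormed_axioms banach_separated[OF banach] b b _ that]) auto
 then have "\<forall>t\<in>carrier (Sp (ind_tens av D D') p). snd (f p) t = snd (g p) t"
  using ij by (auto simp: fun_eq_iff)
 then show "colim_eq E (carrier (Sp (ind_tens av D D') p)) (f p) (g p)"
  by (simp add: powser_colim_eq[OF E(1,3) w])
qed

lemma conv_weight_ge:
 assumes "l \<le> n"
 shows "c l * d (n - l) \<le> conv_weight c d n" unfolding conv_weight_def using assms by (intro Max_ge) auto

lemma conv_weight_pos: "(!!n. 0 < c n) ==> (!!n. 0 < d n) ==> 0 < conv_weight c d n"
 using conv_weight_ge[of 0 n c d] by (metis le0 mult_pos_pos order.strict_trans2)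

lemma conv_bound:
 assumes c: "!!n. 0 < c n" and d: "!!n. 0 < d n" and "0 < B" "0 \<le> K" "0 \<le> K'"
  and z: "!!l. l \<le> n ==> z l |: V" "!!l. l \<le> n ==> nrm V (z l) \<le> B * ((K * c l) * (K' * d (n - l)))"
 shows "nrm V (\<Oplus>l\<in>{..n}. z l) \<le> B * (K * K') * conv_weight c d n"
proof (rule norm_finsum_le)
 have nn: "0 \<le> B * (K * K')" using assms(3-5) by simp
 then show "0 \<le> B * (K * K') * conv_weight c d n"
  using mult_nonneg_nonneg[OF nn less_imp_le[OF conv_weight_pos[of c d n, OF c d]]] by simp
 fix l assume "l \<in> {..n}"
 then have l: "l \<le> n" by simp
 have "B * ((K * c l) * (K' * d (n - l))) = B * (K * K') * (c l * d (n - l))" by simp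
 also have "\<dots> \<le> B * (K * K') * conv_weight c d n" by (rule mult_left_mono[OF conv_weight_ge[OF l] nn])
 finally show "nrm V (z l) \<le> B * (K * K') * conv_weight c d n" using z(2)[OF l] by simp
qed (use z(1) in auto)

text \<open>One statement for two convolutions: the product of power series over \<open>U\<close>,
  and the action of power series over the ground field. \<open>conv_weight\<close> dominates every
  term, and by the ultrametric inequality also their sum.\<close>

lemma conv_bilin:
 assumes X: "banach av X" and b: "bilin_map X V V b" and c: "!!n. 0 < c n" and d: "!!n. 0 < d n"
 shows "bilin_map (wseq c X) (wseq d V) (wseq (conv_weight c d) V)
  (%x y n. \<Oplus>l\<in>{..n}. b (x l) (y (n - l)))" (is "bilin_map ?C ?D ?E ?b")
proof -
 interpret X: banach av X by (rule X)
 note e = conv_weight_pos[of c d, OF c d]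
 interpret C: seminormed av ?C by (rule X.wseq_seminormed[OF c])
 interpret D: seminormed av ?D by (rule wseq_seminormed[OF d])
 note b_cl = bilin_closed[OF b]
 obtain B where B: "0 < B" "!!v w. v |: X ==> w |: V ==> nrm V (b v w) \<le> B * (nrm X v * nrm V w)"
  using bilin_bound[OF b] by blast
 have bd: "nrm V (?b x y n) \<le> B * (nrm ?C x * nrm ?D y) * conv_weight c d n"
  if x: "x |: ?C" and y: "y |: ?D" for x y n
 proof (rule conv_bound[OF c d B(1)])
  fix l assume "l \<le> n"
  note xc = X.seqs_simps(6)[OF X.wseq_seqs[OF x]] seqs_simps(6)[OF wseq_seqs[OF y]]
  show "b (x l) (y (n - l)) |: V" using xc by (intro b_cl)
  have "B * (nrm X (x l) * nrm V (y (n - l))) \<le> B * ((nrm ?C x * c l) * (nrm ?D y * d (n - l)))"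
   using X.wseq_le[of c x l, OF c x] wseq_le[of d y "n - l", OF d y] xc B(1) C.norm_nonneg[OF x] c[of l]
   by (intro mult_left_mono mult_mono) auto
  then show "nrm V (b (x l) (y (n - l))) \<le> B * ((nrm ?C x * c l) * (nrm ?D y * d (n - l)))"
   using B(2) xc by (meson order.trans)
 qed (use x y in auto)
 show ?thesis
 proof (rule bilinI[OF C.seminormed_axioms D.seminormed_axioms, where C = B])
  fix x y assume x: "x |: ?C" and y: "y |: ?D"
  note xs = X.seqs_simps(6)[OF X.wseq_seqs[OF x]] and ys = seqs_simps(6)[OF wseq_seqs[OF y]]
  show "?b x y |: ?E" by (rule wseq_I[OF e seqsI bd[OF x y]]) (use xs ys b_cl in auto)
  show "nrm ?E (?b x y) \<le> B * (nrm ?C x * nrm ?D y)" by (rule wseq_norm_le[OF e bd[OF x y]])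
  show "?b (x \<oplus>\<^sub>?C x') y = ?b x y \<oplus>\<^sub>?E ?b x' y" if "x' |: ?C" for x'
   using xs ys X.seqs_simps(6)[OF X.wseq_seqs[OF that]] b_cl
   by (simp add: X.wseq_ops wseq_ops padd_def bl_add[OF bilin_left[OF b]] M.finsum_addf Pi_iff fun_eq_iff)
  show "?b x (y \<oplus>\<^sub>?D y') = ?b x y \<oplus>\<^sub>?E ?b x y'" if "y' |: ?D" for y'
   using xs ys seqs_simps(6)[OF wseq_seqs[OF that]] b_cl
   by (simp add: wseq_ops padd_def bl_add[OF bilin_right[OF b]] M.finsum_addf Pi_iff fun_eq_iff)
  show "?b (r \<odot>\<^sub>?C x) y = r \<odot>\<^sub>?E ?b x y" "?b x (r \<odot>\<^sub>?D y) = r \<odot>\<^sub>?E ?b x y" for r using xs ys b_cl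
   by (simp_all add: X.wseq_ops wseq_ops psm_def bl_sm[OF bilin_left[OF b]] bl_sm[OF bilin_right[OF b]] finsum_sm fun_eq_iff)
 qed
qed

lemma kspace_ban: "banach av (kspace av)"
 by (intro banach.intro kspace_seminormed banach_axioms.intro kspace_banach)

lemma smult_bilin: "bilin_map (kspace av) V V (smult V)"
 by (rule bilinI[OF kspace_seminormed seminormed_axioms, where C = 1])
   (auto simp: sm_add_l sm_add_r sm_sm norm_smult mult.commute)

lemmas pact_bilin = conv_bilin[OF kspace_ban smult_bilin, folded pact_def]

end

locale powser_algebra = banach av U + snalg av U for av :: "'k::field_char_0 => real" and U :: "('k, 'v) nspace" (structure)
begin

lemma ban: "banach av U" ..

lemmas pmul_bilin = conv_bilin[OF ban mult_bilin, folded pmul_def]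

lemma imul_powser: "imul (powser_alg av U) (c, d) = (conv_weight c d,
  tens_lift av (wseq c U) (wseq d U) (wseq (conv_weight c d) U) (pmul U))"
 by (simp add: powser_alg_def indalg.defs ind.defs pmul_def[abs_def])

lemma iact_powser: "powser_act av U (c, d) = (conv_weight c d,
  tens_lift av (wseq c (kspace av)) (wseq d U) (wseq (conv_weight c d) U) (pact U))"
 by (simp add: powser_act_def pact_def[abs_def])

lemma kspace_wseq: "(!!n. 0 < c n) ==> seminormed av (wseq c (kspace av))"
 by (rule banach.wseq_seminormed[OF kspace_ban])

lemma imul_powser_pure:
 assumes "!!n. 0 < c n" "!!n. 0 < d n" "x |: (wseq c U)" "y |: (wseq d U)"
 shows "snd (imul (powser_alg av U) (c, d)) (pure_tens av (wseq c U) (wseq d U) x y) = pmul U x y"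
 using tens_lift_pure[OF wseq_seminormed[of c] wseq_seminormed[of d] wseq_banach[of "conv_weight c d"] pmul_bilin[of c d]]
  assms conv_weight_pos[of c d] by (simp add: imul_powser)

lemma iact_powser_pure:
 assumes "!!n. 0 < c n" "!!n. 0 < d n" "a |: (wseq c (kspace av))" "y |: (wseq d U)"
 shows "snd (powser_act av U (c, d)) (pure_tens av (wseq c (kspace av)) (wseq d U) a y) = pact U a y"
 using tens_lift_pure[OF kspace_wseq[of c] wseq_seminormed[of d] wseq_banach[of "conv_weight c d"] pact_bilin[of c d]]
  assms conv_weight_pos[of c d] by (simp add: iact_powser)

lemma imul_powser_obj_bl: "obj_bl (ind_tens av (powser_halg av U) (powser_halg av U)) (powser_halg av U) (imul (powser_halg av U))"
 unfolding obj_bl_def by (auto simp: imul_powser conv_weight_pos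
   intro!: tens_lift_bl wseq_seminormed wseq_banach pmul_bilin)

lemma iact_powser_obj_bl: "obj_bl (ind_tens av (kpow av) (powser_halg av U)) (powser_halg av U) (iact (powser_halg av U))"
 unfolding obj_bl_def by (auto simp: iact_powser conv_weight_pos
   intro!: tens_lift_bl wseq_seminormed kspace_wseq wseq_banach pact_bilin)

lemma powser_halg_banach: "ind_banach av (powser_halg av U)"
 using powser_banach unfolding ind_banach_def by simp

lemma kpow_obj_sn: "obj_sn av (kpow av)" unfolding obj_sn_def by (auto intro: kspace_wseq)

end

section \<open>Transport of the product\<close>

locale htransport = powser_algebra av U for av :: "'k::field_char_0 => real" and U :: "('k, 'u) nspace" (structure) +
 fixes A :: "('o, 'm, 'k, 'v) hindalg" and \<theta> :: "('o, 'v, weight, nat => 'u) imor"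
 assumes A_alg: "h_algebra av A" and iso: "ind_iso A (powser_halg av U) \<theta>"
  and lin: "h_linear av A (powser_halg av U) \<theta>"
  and unit: "ind_eq (ind_k av) (powser_halg av U) (\<theta> \<circ>\<^sub>I iunit A) (iunit (powser_halg av U))"
  and mult_0: "!!i j z w. i \<in> Obj (Idx A) ==> j \<in> Obj (Idx A) ==> z |: (Sp A i) ==> w |: (Sp A j) ==>
   snd (\<theta> (fst (imul A (i, j)))) (snd (imul A (i, j)) (pure_tens av (Sp A i) (Sp A j) z w)) 0 =
   snd (\<theta> i) z 0 \<otimes> snd (\<theta> j) w 0"
begin

abbreviation "P \<equiv> powser_halg av U"
abbreviation "Ob \<equiv> Obj (Idx A)"

text \<open>Elements of \<open>A\<close> are read as coefficient sequences through
  \<open>\<theta>\<close>. Two elements, possibly at different indices, have the same sequence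
  exactly when they are identified in the colimit, by \<open>ev_eq\<close> and
  \<open>ev_inj\<close>.\<close>

definition ev :: "'o => 'v => nat => 'u" where "ev i z = snd (\<theta> i) z"
definition mi :: "'o => 'o => 'o" where "mi i j = fst (imul A (i, j))"
definition m :: "'o => 'o => 'v => 'v => 'v" where
 "m i j z w = snd (imul A (i, j)) (pure_tens av (Sp A i) (Sp A j) z w)"
definition hi :: "weight => 'o => 'o" where "hi c i = fst (iact A (c, i))"
definition h :: "weight => 'o => (nat => 'k) => 'v => 'v" where
 "h c i a z = snd (iact A (c, i)) (pure_tens av (wseq c (kspace av)) (Sp A i) a z)"

lemma A_banach: "ind_banach av A" and imul_hom: "ind_hom (ind_tens av A A) A (imul A)"
 and iunit_hom: "ind_hom (ind_k av) A (iunit A)"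
 and iact_hom: "ind_hom (ind_tens av (kpow av) A) A (iact A)"
 using A_alg by (simp_all add: h_algebra_def ind_algebra_def)

lemma A_sn: "obj_sn av A" by (rule obj_sn_banach[OF na A_banach])

lemma P_sn: "obj_sn av P" by (rule obj_sn_banach[OF na powser_halg_banach])

lemma k_sn: "obj_sn av (ind_k av)" by (simp add: obj_sn_def kspace_seminormed)

lemma \<theta>_hom: "ind_hom A P \<theta>" using iso by (simp add: ind_iso_def)

lemmas imul_bl = ind_hom_obj_bl[OF imul_hom] and iact_bl = ind_hom_obj_bl[OF iact_hom]
 and iunit_bl = ind_hom_obj_bl[OF iunit_hom]
 and \<theta>_bl = ind_hom_obj_bl[OF \<theta>_hom]

lemma \<theta>_pos: "i \<in> Ob ==> 0 < fst (\<theta> i) n" using obj_blD(1)[OF \<theta>_bl] by simp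

lemma ev_bl: "i \<in> Ob ==> bl (Sp A i) (wseq (fst (\<theta> i)) U) (ev i)"
 using obj_blD(2)[OF \<theta>_bl] by (simp add: ev_def[abs_def])

lemma ev_w: "i \<in> Ob ==> z |: (Sp A i) ==> ev i z |: (wseq (fst (\<theta> i)) U)" by (rule bl_closed[OF ev_bl])

lemma ev_cl [simp, intro]: "i \<in> Ob ==> z |: (Sp A i) ==> ev i z \<in> seqs U" by (rule wseq_seqs[OF ev_w])

lemma ev_add: "i \<in> Ob ==> z |: (Sp A i) ==> w |: (Sp A i) ==> ev i (z \<oplus>\<^bsub>Sp A i\<^esub> w) = padd U (ev i z) (ev i w)"
 using bl_add[OF ev_bl] by (simp add: wseq_ops)

lemma ev_eq:
 assumes "colim_eq A X f g" "x \<in> X" "fst f \<in> Ob" "fst g \<in> Ob" "snd f x |: (Sp A (fst f))" "snd g x |: (Sp A (fst g))"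
 shows "ev (fst f) (snd f x) = ev (fst g) (snd g x)"
proof -
 have "colim_eq A {x} f g" using assms(1,2) unfolding colim_eq_def by blast
 from colim_eq_nat[OF A_banach powser_halg_banach \<theta>_hom this] assms
 have "colim_eq P {x} (fst (\<theta> (fst f)), snd (\<theta> (fst f)) \<circ> snd f) (fst (\<theta> (fst g)), snd (\<theta> (fst g)) \<circ> snd g)" by simp
 then show ?thesis using \<theta>_pos assms(3,4) by (subst (asm) powser_colim_eq[where X = U]) (auto simp: ev_def)
qed

lemma ev_Tr:
 assumes "u \<in> hom_set (Idx A) i j" "z |: (Sp A i)"
 shows "ev i z = ev j (Tr A u z)"
proof -
 have o: "i \<in> Ob" "j \<in> Ob" using hom_set_obj[OF A_banach assms(1)] by auto
 have "colim_eq P (carrier (Sp A i)) (\<theta> i) (fst (\<theta> j), snd (\<theta> j) \<circ> Tr A u)"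
  using \<theta>_hom assms(1) unfolding ind_hom_def by blast
 then show ?thesis using \<theta>_pos o assms(2) by (subst (asm) powser_colim_eq[where X = U]) (auto simp: ev_def)
qed

lemma m_bl: "i \<in> Ob ==> j \<in> Ob ==> bl (ctens av (Sp A i) (Sp A j)) (Sp A (mi i j)) (snd (imul A (i, j)))"
 using obj_blD(2)[OF imul_bl, of "(i, j)"] by (simp add: mi_def)

lemma mi_Ob [simp, intro]: "i \<in> Ob ==> j \<in> Ob ==> mi i j \<in> Ob"
 using obj_blD(1)[OF imul_bl, of "(i, j)"] by (simp add: mi_def)

lemma m_bilin: "i \<in> Ob ==> j \<in> Ob ==> bilin_map (Sp A i) (Sp A j) (Sp A (mi i j)) (m i j)"
 unfolding m_def[abs_def]
 by (intro bl_bilin[OF obj_snD[OF A_sn] obj_snD[OF A_sn] ctens_seminormed pure_tens_bilin m_bl] obj_snD[OF A_sn])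

lemma m_cl [simp, intro]: "i \<in> Ob ==> j \<in> Ob ==> z |: (Sp A i) ==> w |: (Sp A j) ==> m i j z w |: (Sp A (mi i j))"
 by (rule bilin_closed[OF m_bilin])

lemma hi_Ob [simp, intro]: "(!!n. 0 < c n) ==> i \<in> Ob ==> hi c i \<in> Ob"
 using obj_blD(1)[OF iact_bl, of "(c, i)"] by (simp add: hi_def)

lemma h_cl [simp, intro]:
 assumes "!!n. 0 < c n" "i \<in> Ob" "a |: (wseq c (kspace av))" "z |: (Sp A i)"
 shows "h c i a z |: (Sp A (hi c i))"
 using obj_blD(3)[OF iact_bl, of "(c, i)"] assms pure_tens_cl[OF kspace_wseq[of c] obj_snD[OF A_sn]]
 by (simp add: hi_def h_def)

lemma m_Tr:
 assumes "u \<in> hom_set (Idx A) i l" "u' \<in> hom_set (Idx A) j l'" "z |: (Sp A i)" "w |: (Sp A j)"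
 shows "ev (mi i j) (m i j z w) = ev (mi l l') (m l l' (Tr A u z) (Tr A u' w))"
proof -
 have o: "i \<in> Ob" "j \<in> Ob" "l \<in> Ob" "l' \<in> Ob"
  using hom_set_obj[OF A_banach assms(1)] hom_set_obj[OF A_banach assms(2)] by auto
 note sn = obj_snD[OF A_sn]
 let ?T = "Tr (ind_tens av A A) (u, u')"
 have hs: "(u, u') \<in> hom_set (Idx (ind_tens av A A)) (i, j) (l, l')"
  using assms(1,2) by (simp add: ind_tens_def cat_prod_def hom_set_def)
 have T: "?T (pure_tens av (Sp A i) (Sp A j) z w) = pure_tens av (Sp A l) (Sp A l') (Tr A u z) (Tr A u' w)"
  using assms(1,2) tens_map_bl(2)[OF sn[OF o(1)] sn[OF o(2)] sn[OF o(3)] sn[OF o(4)] Tr_bl[OF A_banach assms(1)] Tr_bl[OF A_banach assms(2)] assms(3,4)]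
  by (simp add: ind_tens_def hom_set_def)
 have c: "Tr A u z |: (Sp A l)" "Tr A u' w |: (Sp A l')"
  using bl_closed[OF Tr_bl[OF A_banach assms(1)] assms(3)] bl_closed[OF Tr_bl[OF A_banach assms(2)] assms(4)] .
 have "colim_eq A (carrier (Sp (ind_tens av A A) (i, j))) (imul A (i, j)) (fst (imul A (l, l')), snd (imul A (l, l')) \<circ> ?T)"
  using imul_hom hs unfolding ind_hom_def by blast
 from ev_eq[OF this, of "pure_tens av (Sp A i) (Sp A j) z w"] show ?thesis
  using o T c assms(3,4) m_cl[OF o(1,2) assms(3,4)] m_cl[OF o(3,4) c] mi_Ob[OF o(1,2)] mi_Ob[OF o(3,4)] pure_tens_cl[OF sn[OF o(1)] sn[OF o(2)] assms(3,4)]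
  by (simp add: m_def mi_def)
qed

definition \<sigma> :: "(weight, nat => 'u, 'o, 'v) imor" where
 "\<sigma> = (SOME g. ind_hom P A g \<and> ind_eq A A (g \<circ>\<^sub>I \<theta>) ind_id \<and> ind_eq P P (\<theta> \<circ>\<^sub>I g) ind_id)"

lemma \<sigma>_hom: "ind_hom P A \<sigma>" and \<sigma>_\<theta>: "ind_eq A A (\<sigma> \<circ>\<^sub>I \<theta>) ind_id" and \<theta>_\<sigma>: "ind_eq P P (\<theta> \<circ>\<^sub>I \<sigma>) ind_id"
 using someI_ex[OF conjunct2[OF iso[unfolded ind_iso_def]]] unfolding \<sigma>_def by blast+

lemmas \<sigma>_bl = ind_hom_obj_bl[OF \<sigma>_hom]

lemma \<sigma>_Ob: "(!!n. 0 < c n) ==> fst (\<sigma> c) \<in> Ob" using obj_blD(1)[OF \<sigma>_bl, of c] by simp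

lemma \<sigma>_cl: "(!!n. 0 < c n) ==> x |: (wseq c U) ==> snd (\<sigma> c) x |: (Sp A (fst (\<sigma> c)))"
 using obj_blD(3)[OF \<sigma>_bl, of c] by simp

lemma ev_\<sigma>:
 assumes c: "!!n. 0 < c n" and x: "x |: (wseq c U)"
 shows "ev (fst (\<sigma> c)) (snd (\<sigma> c) x) = x"
proof -
 have "colim_eq P (carrier (Sp P c)) ((\<theta> \<circ>\<^sub>I \<sigma>) c) (ind_id c)" using \<theta>_\<sigma> c unfolding ind_eq_def by simp
 then show ?thesis using c x \<theta>_pos[OF \<sigma>_Ob[OF c]]
  by (subst (asm) powser_colim_eq[where X = U]) (auto simp: ev_def ind_comp_def ind_id_def)
qed

text \<open>An element is identified in the colimit with the image under \<open>\<sigma>\<close> of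
  its sequence, taken at its own weight; two weights carrying the same sequence are joined by a
  common larger one. Elements are encoded as maps from the one-point set, so that
  \<open>colim_eq\<close> speaks about them.\<close>

lemma ev_inj:
 assumes i: "i \<in> Ob" "z |: (Sp A i)" and j: "j \<in> Ob" "w |: (Sp A j)" and eq: "ev i z = ev j w"
 shows "colim_eq A {()} (i, %_. z) (j, %_. w)"
proof -
 have 1: "colim_eq A {()} (fst (\<sigma> (fst (\<theta> i))), %_. snd (\<sigma> (fst (\<theta> i))) (ev i z)) (i, %_. z)"
  if "i \<in> Ob" "z |: (Sp A i)" for i z
 proof -
  have "colim_eq A (carrier (Sp A i)) ((\<sigma> \<circ>\<^sub>I \<theta>) i) (ind_id i)" using \<sigma>_\<theta> that(1) by (simp add: ind_eq_def)
  from colim_eq_comp[OF this, of "{()}" "%_. z"] that(2) show ?thesis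
   by (simp add: ind_comp_def ind_id_def ev_def o_def)
 qed
 have "colim_eq P {()} (fst (\<theta> i), %_. ev i z) (fst (\<theta> j), %_. ev i z)"
  using \<theta>_pos i j by (subst powser_colim_eq[where X = U]) auto
 from colim_eq_nat[OF powser_halg_banach A_banach \<sigma>_hom this] have
  2: "colim_eq A {()} (fst (\<sigma> (fst (\<theta> i))), %_. snd (\<sigma> (fst (\<theta> i))) (ev i z)) (fst (\<sigma> (fst (\<theta> j))), %_. snd (\<sigma> (fst (\<theta> j))) (ev i z))"
  using ev_w[OF i] ev_w[OF j] eq by (simp add: o_def)
 note s = \<sigma>_cl[of "fst (\<theta> i)", OF \<theta>_pos[OF i(1)] ev_w[OF i]] \<sigma>_cl[of "fst (\<theta> j)", OF \<theta>_pos[OF j(1)] ev_w[OF j], folded eq]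
 have "colim_eq A {()} (i, %_. z) (fst (\<sigma> (fst (\<theta> j))), %_. snd (\<sigma> (fst (\<theta> j))) (ev i z))"
  by (rule colim_eq_trans[OF A_banach colim_eq_sym[OF 1[OF i]] 2]) (use s i in auto)
 then show ?thesis by (rule colim_eq_trans[OF A_banach _ 1[OF j, folded eq]]) (use s i j in auto)
qed

text \<open>A weight for which x has norm at most one; the maximum with 1 makes it positive.\<close>

definition cw :: "(nat => 'u) => weight" where "cw x = (%n. max 1 (nrm U (x n)))"

text \<open>The product of \<open>A\<close> at particular representatives of the two sequences;
  \<open>m_star\<close> shows that all other representatives give the same result.\<close>

definition star :: "(nat => 'u) => (nat => 'u) => nat => 'u" where
 "star x y = (let i = fst (\<sigma> (cw x)); j = fst (\<sigma> (cw y)) in ev (mi i j) (m i j (snd (\<sigma> (cw x)) x) (snd (\<sigma> (cw y)) y)))"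

lemma cw_pos: "0 < cw x n" by (simp add: cw_def)

lemma cw_w: "x \<in> seqs U ==> x |: (wseq (cw x) U)" by (rule wseq_I[where K = 1]) (auto simp: cw_def)

text \<open>A given representative and the one used in \<open>star\<close> are joined by transition
  maps, with which the product of \<open>A\<close> is compatible.\<close>

lemma m_star:
 assumes i: "i \<in> Ob" "z |: (Sp A i)" and j: "j \<in> Ob" "w |: (Sp A j)"
 shows "ev (mi i j) (m i j z w) = star (ev i z) (ev j w)"
proof -
 have *: "\<exists>l. \<exists>u\<in>hom_set (Idx A) i l. \<exists>v\<in>hom_set (Idx A) (fst (\<sigma> (cw (ev i z)))) l.
   Tr A u z = Tr A v (snd (\<sigma> (cw (ev i z))) (ev i z))" if "i \<in> Ob" "z |: (Sp A i)" for i z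
  using ev_inj[OF that \<sigma>_Ob[OF cw_pos] \<sigma>_cl[OF cw_pos cw_w[OF ev_cl[OF that]]]] ev_\<sigma>[OF cw_pos cw_w[OF ev_cl[OF that]]]
  unfolding colim_eq_def by simp
 obtain l u v where 1: "u \<in> hom_set (Idx A) i l" "v \<in> hom_set (Idx A) (fst (\<sigma> (cw (ev i z)))) l"
  "Tr A u z = Tr A v (snd (\<sigma> (cw (ev i z))) (ev i z))" using *[OF i] by blast
 obtain l' u' v' where 2: "u' \<in> hom_set (Idx A) j l'" "v' \<in> hom_set (Idx A) (fst (\<sigma> (cw (ev j w)))) l'"
  "Tr A u' w = Tr A v' (snd (\<sigma> (cw (ev j w))) (ev j w))" using *[OF j] by blast
 show ?thesis unfolding star_def Let_def m_Tr[OF 1(1) 2(1) i(2) j(2)] 1(3) 2(3)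
  by (rule m_Tr[OF 1(2) 2(2) \<sigma>_cl[OF cw_pos cw_w[OF ev_cl[OF i]]] \<sigma>_cl[OF cw_pos cw_w[OF ev_cl[OF j]]], symmetric])
qed

text \<open>Additivity of \<open>star\<close> needs two sequences at one common index, since
  addition is defined only within a single space.\<close>

lemma rep2:
 assumes "x \<in> seqs U" "y \<in> seqs U"
 obtains i z w where "i \<in> Ob" "z |: (Sp A i)" "w |: (Sp A i)" "ev i z = x" "ev i w = y"
proof -
 define c where "c n = max (cw x n) (cw y n)" for n
 have c: "!!n. 0 < c n" by (simp add: c_def less_max_iff_disj cw_pos)
 have w: "x |: (wseq c U)" "y |: (wseq c U)"
  using assms by (auto intro!: wseq_I[where K = 1] c simp: c_def cw_def)
 show ?thesis
  by (rule that[OF \<sigma>_Ob[of c, OF c] \<sigma>_cl[of c, OF c w(1)] \<sigma>_cl[of c, OF c w(2)] ev_\<sigma>[of c, OF c w(1)] ev_\<sigma>[of c, OF c w(2)]])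
qed

lemma rep:
 assumes "x \<in> seqs U"
 obtains i z where "i \<in> Ob" "z |: (Sp A i)" "ev i z = x" using rep2[OF assms assms] by blast

lemma ev_unit: "ev (fst (iunit A ())) (snd (iunit A ()) c) = psm U c (pcst U \<one>)"
proof -
 have "fst (iunit A ()) \<in> Ob" using obj_blD(1)[OF iunit_bl, of "()"] by simp
 moreover have "colim_eq P UNIV ((\<theta> \<circ>\<^sub>I iunit A) ()) (iunit P ())" using unit by (simp add: ind_eq_def)
 ultimately have "ev (fst (iunit A ())) (snd (iunit A ()) c) = (%n. if n = 0 then c \<odot> \<one> else \<zero>)"
  using \<theta>_pos by (subst (asm) powser_colim_eq[where X = U]) (auto simp: ev_def ind_comp_def)
 then show ?thesis by (auto simp: psm_def pcst_def fun_eq_iff)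
qed

lemma ev_act:
 assumes c: "!!n. 0 < c n" and i: "i \<in> Ob" "a |: (wseq c (kspace av))" "z |: (Sp A i)"
 shows "ev (hi c i) (h c i a z) = pact U a (ev i z)"
proof -
 let ?p = "pure_tens av (wseq c (kspace av)) (Sp A i) a z"
 have ci: "(c, i) \<in> Obj (Idx (ind_tens av (kpow av) A))" using c i by simp
 have p: "?p |: (Sp (ind_tens av (kpow av) A) (c, i))"
  using pure_tens_cl[OF kspace_wseq[of c] obj_snD[OF A_sn]] c i by simp
 have "colim_eq P (carrier (Sp (ind_tens av (kpow av) A) (c, i))) ((\<theta> \<circ>\<^sub>I iact A) (c, i))
   ((iact P \<circ>\<^sub>I ind_tens_map av (kpow av) A (kpow av) P ind_id \<theta>) (c, i))"
  using lin ci unfolding h_linear_def ind_eq_def by blast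
 moreover have "snd (ind_tens_map av (kpow av) A (kpow av) P ind_id \<theta> (c, i)) ?p = pure_tens av (wseq c (kspace av)) (wseq (fst (\<theta> i)) U) a (ev i z)"
  using ind_tens_map_pure[OF kpow_obj_sn A_sn kpow_obj_sn P_sn obj_bl_id \<theta>_bl, of c i a z] c i
  by (simp add: ind_id_def ev_def)
 ultimately show ?thesis
  using p c \<theta>_pos[OF i(1)] \<theta>_pos[OF hi_Ob[OF c i(1)]] iact_powser_pure[of c "fst (\<theta> i)" a "ev i z"] i ev_w[OF i(1,3)]
  by (subst (asm) powser_colim_eq[where X = U])
    (auto simp: ev_def ind_comp_def ind_tens_map_fst ind_id_def hi_def h_def iact_powser conv_weight_pos)
qed

text \<open>The axioms for \<open>A\<close> are equations between composites of structure maps with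
  tensor products of morphisms. Evaluated on an elementary tensor and pushed through
  \<open>ev\<close>, such a composite becomes an expression in \<open>star\<close>;
  \<open>iact_eval\<close> does the same for the action.\<close>

lemma imul_eval:
 assumes "obj_sn av D" "obj_sn av D'" "obj_bl D A f" "obj_bl D' A g"
  and "i \<in> Obj (Idx D)" "j \<in> Obj (Idx D')" "x |: (Sp D i)" "y |: (Sp D' j)"
 defines "p \<equiv> (imul A \<circ>\<^sub>I ind_tens_map av D D' A A f g) (i, j)" and "t \<equiv> pure_tens av (Sp D i) (Sp D' j) x y"
 shows "fst p \<in> Ob" "snd p t |: (Sp A (fst p))"
  "ev (fst p) (snd p t) = star (ev (fst (f i)) (snd (f i) x)) (ev (fst (g j)) (snd (g j) y))"
proof -
 note c = obj_blD(1)[OF assms(3,5)] obj_blD(3)[OF assms(3,5,7)] obj_blD(1)[OF assms(4,6)] obj_blD(3)[OF assms(4,6,8)]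
 have 1: "fst p = mi (fst (f i)) (fst (g j))" "snd p t = m (fst (f i)) (fst (g j)) (snd (f i) x) (snd (g j) y)"
  using ind_tens_map_pure[OF assms(1,2) A_sn A_sn assms(3-8)]
  by (simp_all add: p_def t_def ind_comp_def ind_tens_map_fst mi_def m_def)
 show "fst p \<in> Ob" "snd p t |: (Sp A (fst p))"
  "ev (fst p) (snd p t) = star (ev (fst (f i)) (snd (f i) x)) (ev (fst (g j)) (snd (g j) y))"
  unfolding 1 using c by (simp_all add: m_star)
qed

lemma iact_eval:
 assumes "obj_sn av D" "obj_bl D A f" and c: "!!n. 0 < c n"
  and "j \<in> Obj (Idx D)" "a |: (wseq c (kspace av))" "y |: (Sp D j)"
 defines "p \<equiv> (iact A \<circ>\<^sub>I ind_tens_map av (kpow av) D (kpow av) A ind_id f) (c, j)"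
  and "t \<equiv> pure_tens av (wseq c (kspace av)) (Sp D j) a y"
 shows "fst p \<in> Ob" "snd p t |: (Sp A (fst p))" "ev (fst p) (snd p t) = pact U a (ev (fst (f j)) (snd (f j) y))"
proof -
 note d = obj_blD(1)[OF assms(2,4)] obj_blD(3)[OF assms(2,4,6)]
 have 1: "fst p = hi c (fst (f j))" "snd p t = h c (fst (f j)) a (snd (f j) y)"
  using ind_tens_map_pure[OF kpow_obj_sn assms(1) kpow_obj_sn A_sn obj_bl_id assms(2), of c j a y] assms(4-6) c
  by (simp_all add: p_def t_def ind_comp_def ind_tens_map_fst hi_def h_def ind_id_def)
 show "fst p \<in> Ob" "snd p t |: (Sp A (fst p))" "ev (fst p) (snd p t) = pact U a (ev (fst (f j)) (snd (f j) y))"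
  unfolding 1 using c d assms(5) by (simp_all add: ev_act)
qed

lemma star_assoc:
 assumes "x \<in> seqs U" "y \<in> seqs U" "z \<in> seqs U"
 shows "star (star x y) z = star x (star y z)"
proof -
 obtain i a where "i \<in> Ob" "a |: (Sp A i)" "ev i a = x" using rep[OF assms(1)] .
 moreover obtain j b where "j \<in> Ob" "b |: (Sp A j)" "ev j b = y" using rep[OF assms(2)] .
 moreover obtain l c where "l \<in> Ob" "c |: (Sp A l)" "ev l c = z" using rep[OF assms(3)] .
 ultimately have r: "i \<in> Ob" "a |: (Sp A i)" "ev i a = x" "j \<in> Ob" "b |: (Sp A j)" "ev j b = y"
   "l \<in> Ob" "c |: (Sp A l)" "ev l c = z" by simp_all
 let ?p = "pure_tens av (ctens av (Sp A i) (Sp A j)) (Sp A l) (pure_tens av (Sp A i) (Sp A j) a b) c"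
 note sn = obj_snD[OF A_sn] and AA = obj_sn_tens[OF A_sn A_sn]
 have p: "?p |: (Sp (ind_tens av (ind_tens av A A) A) ((i, j), l))"
  using r by (simp add: pure_tens_cl ctens_seminormed sn)
 have ce: "colim_eq A (carrier (Sp (ind_tens av (ind_tens av A A) A) ((i, j), l)))
   ((imul A \<circ>\<^sub>I ind_tens_map av (ind_tens av A A) A A A (imul A) ind_id) ((i, j), l))
   ((imul A \<circ>\<^sub>I ind_tens_map av A (ind_tens av A A) A A ind_id (imul A) \<circ>\<^sub>I ind_assoc av A A A) ((i, j), l))"
  using A_alg r unfolding h_algebra_def ind_algebra_def by (simp add: ind_eq_def)
 note L = imul_eval[OF AA A_sn imul_bl obj_bl_id, of "(i, j)" l "pure_tens av (Sp A i) (Sp A j) a b" c]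
  and R = imul_eval[OF A_sn AA obj_bl_id imul_bl, of i "(j, l)" a "pure_tens av (Sp A j) (Sp A l) b c"]
 show ?thesis
  using ev_eq[OF ce p] L R ind_assoc_pure[OF A_sn A_sn A_sn, of i j l a b c] m_star[OF r(1,2,4,5)] m_star[OF r(4,5,7,8)] r
  by (simp add: ind_comp_def ind_assoc_fst ind_id_def pure_tens_cl sn m_def mi_def)
qed

lemma star_unit:
 assumes "x \<in> seqs U"
 shows "star (pcst U \<one>) x = x" "star x (pcst U \<one>) = x"
proof -
 obtain i z where r: "i \<in> Ob" "z |: (Sp A i)" "ev i z = x" using rep[OF assms] .
 have e: "ev (fst (iunit A ())) (snd (iunit A ()) 1) = pcst U \<one>" using ev_unit[of 1] by (simp add: psm_def pcst_def fun_eq_iff)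
 note sn = obj_snD[OF A_sn]
 interpret Si: seminormed av "Sp A i" by (rule sn[OF r(1)])
 have Sb: "banach_space av (Sp A i)" using A_banach r(1) by (simp add: ind_banach_def)
 note b = banach.smult_bilin[OF banach.intro[OF Si.seminormed_axioms banach_axioms.intro[OF Sb]]]
 have pl: "pure_tens av (kspace av) (Sp A i) 1 z |: (Sp (ind_tens av (ind_k av) A) ((), i))"
  and pr: "pure_tens av (Sp A i) (kspace av) z 1 |: (Sp (ind_tens av A (ind_k av)) (i, ()))"
  using r by (simp_all add: pure_tens_cl kspace_seminormed sn)
 have "colim_eq A (carrier (Sp (ind_tens av (ind_k av) A) ((), i)))
   ((imul A \<circ>\<^sub>I ind_tens_map av (ind_k av) A A A (iunit A) ind_id) ((), i)) (ind_lunit av A ((), i))"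
  and "colim_eq A (carrier (Sp (ind_tens av A (ind_k av)) (i, ())))
   ((imul A \<circ>\<^sub>I ind_tens_map av A (ind_k av) A A ind_id (iunit A)) (i, ())) (ind_runit av A (i, ()))"
  using A_alg r unfolding h_algebra_def ind_algebra_def ind_eq_def by simp_all
 note L = ev_eq[OF this(1) pl] and R = ev_eq[OF this(2) pr]
 have "snd (ind_lunit av A ((), i)) (pure_tens av (kspace av) (Sp A i) 1 z) = z"
  "snd (ind_runit av A (i, ())) (pure_tens av (Sp A i) (kspace av) z 1) = z"
  using tens_lift_pure[OF kspace_seminormed Si.seminormed_axioms Sb b, of 1 z]
   tens_lift_pure[OF Si.seminormed_axioms kspace_seminormed Sb bilin_swap[OF b], of z 1] r
  by (simp_all add: ind_lunit_def ind_runit_def)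
 then show "star (pcst U \<one>) x = x" "star x (pcst U \<one>) = x"
  using L R imul_eval[OF k_sn A_sn iunit_bl obj_bl_id, of "()" i 1 z] imul_eval[OF A_sn k_sn obj_bl_id iunit_bl, of i "()" z 1] r e
  by (simp_all add: ind_id_def ind_lunit_def ind_runit_def)
qed

end

context htransport
begin

text \<open>Linearity of the product over power series, read on elementary tensors. With a equal to
  \<hbar> it gives compatibility with the shift, with a constant it gives compatibility with
  scalars.\<close>

lemma star_act:
 assumes c: "!!n. 0 < c n" and a: "a |: (wseq c (kspace av))" and xy: "x \<in> seqs U" "y \<in> seqs U"
 shows "star (pact U a x) y = pact U a (star x y)" "star x (pact U a y) = star (pact U a x) y"
proof -
 obtain i z where "i \<in> Ob" "z |: (Sp A i)" "ev i z = x" using rep[OF xy(1)] .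
 moreover obtain j w where "j \<in> Ob" "w |: (Sp A j)" "ev j w = y" using rep[OF xy(2)] .
 ultimately have r: "i \<in> Ob" "z |: (Sp A i)" "ev i z = x" "j \<in> Ob" "w |: (Sp A j)" "ev j w = y" by simp_all
 note sn = obj_snD[OF A_sn] and kA = obj_sn_tens[OF kpow_obj_sn A_sn] and AA = obj_sn_tens[OF A_sn A_sn]
  and Ak = obj_sn_tens[OF A_sn kpow_obj_sn]
 note ks = kspace_wseq[of c, OF c]
 have sw_bl: "obj_bl (ind_tens av A (kpow av)) A (iact A \<circ>\<^sub>I ind_swap av A (kpow av))"
  by (rule obj_bl_comp[OF obj_bl_swap[OF A_sn kpow_obj_sn] iact_bl obj_snD[OF Ak] obj_snD[OF kA]])
 let ?K = "wseq c (kspace av)"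
 let ?p = "pure_tens av (ctens av ?K (Sp A i)) (Sp A j) (pure_tens av ?K (Sp A i) a z) w"
 let ?q = "pure_tens av (ctens av (Sp A i) ?K) (Sp A j) (pure_tens av (Sp A i) ?K z a) w"
 have p: "?p |: (Sp (ind_tens av (ind_tens av (kpow av) A) A) ((c, i), j))"
  and q: "?q |: (Sp (ind_tens av (ind_tens av A (kpow av)) A) ((i, c), j))"
  using r a by (simp_all add: pure_tens_cl ctens_seminormed sn ks)
 have "colim_eq A (carrier (Sp (ind_tens av (ind_tens av (kpow av) A) A) ((c, i), j)))
   ((imul A \<circ>\<^sub>I ind_tens_map av (ind_tens av (kpow av) A) A A A (iact A) ind_id) ((c, i), j))
   ((iact A \<circ>\<^sub>I ind_tens_map av (kpow av) (ind_tens av A A) (kpow av) A ind_id (imul A) \<circ>\<^sub>I ind_assoc av (kpow av) A A) ((c, i), j))"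
  and "colim_eq A (carrier (Sp (ind_tens av (ind_tens av A (kpow av)) A) ((i, c), j)))
   ((imul A \<circ>\<^sub>I ind_tens_map av A (ind_tens av (kpow av) A) A A ind_id (iact A) \<circ>\<^sub>I ind_assoc av A (kpow av) A) ((i, c), j))
   ((imul A \<circ>\<^sub>I ind_tens_map av (ind_tens av A (kpow av)) A A A (iact A \<circ>\<^sub>I ind_swap av A (kpow av)) ind_id) ((i, c), j))"
  using A_alg r c unfolding h_algebra_def by (simp_all add: ind_eq_def)
 note ce = ev_eq[OF this(1) p] ev_eq[OF this(2) q]
 note act = ev_act[of c i a z, OF c] ev_act[of c j a w, OF c] m_star[OF r(1,2,4,5)]
  and kj = pure_tens_cl[OF ks sn[OF r(1)] a r(2)] pure_tens_cl[OF ks sn[OF r(4)] a r(5)]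
   pure_tens_cl[OF sn[OF r(1)] sn[OF r(4)] r(2,5)] pure_tens_cl[OF sn[OF r(1)] ks r(2) a]
 note L = imul_eval[OF kA A_sn iact_bl obj_bl_id, of "(c, i)" j "pure_tens av ?K (Sp A i) a z" w]
  and R = iact_eval[OF AA imul_bl, of c "(i, j)" a "pure_tens av (Sp A i) (Sp A j) z w"]
 show "star (pact U a x) y = pact U a (star x y)"
  using ce(1) L R ind_assoc_pure[OF kpow_obj_sn A_sn A_sn, of c i j a z w] act kj r a c
  by (simp add: ind_comp_def ind_assoc_fst ind_id_def m_def mi_def h_def hi_def)
 note L = imul_eval[OF A_sn kA obj_bl_id iact_bl, of i "(c, j)" z "pure_tens av ?K (Sp A j) a w"]
  and R = imul_eval[OF Ak A_sn sw_bl obj_bl_id, of "(i, c)" j "pure_tens av (Sp A i) ?K z a" w]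
 show "star x (pact U a y) = star (pact U a x) y"
  using ce(2) L R ind_assoc_pure[OF A_sn kpow_obj_sn A_sn, of i c j z a w] ind_swap_pure[OF A_sn kpow_obj_sn, of i c z a] act kj r a c
  by (simp add: ind_comp_def ind_assoc_fst ind_swap_fst ind_id_def m_def mi_def h_def hi_def)
qed

lemma star_cl: "x \<in> seqs U ==> y \<in> seqs U ==> star x y \<in> seqs U"
 unfolding star_def Let_def by (intro ev_cl mi_Ob m_cl \<sigma>_Ob \<sigma>_cl cw_pos cw_w)

lemma star_seqmult: "seqmult av U star"
proof (intro seqmult.intro snalg_axioms seqmult_axioms.intro)
 fix x y assume xy: "x \<in> seqs U" "y \<in> seqs U"
 show "star x y \<in> seqs U" by (rule star_cl[OF xy])
 interpret k: banach av "kspace av" by (rule kspace_ban)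
 \<comment> \<open>The power series \<hbar> itself, at the constant weight 1.\<close>
 have hb: "(%n. if n = 1 then 1 else 0) |: (wseq (%_. 1) (kspace av))"
  by (rule k.wseq_I[where K = 1]) (auto intro: seqsI)
 show "star (psh U x) y = psh U (star x y)"
  using star_act(1)[OF _ hb xy] pact_hbar[OF xy(1)] pact_hbar[OF star_cl[OF xy]] by simp
 then show "star x (psh U y) = psh U (star x y)"
  using star_act(2)[OF _ hb xy] pact_hbar[OF xy(1)] pact_hbar[OF xy(2)] by simp
 show "star (padd U x x') y = padd U (star x y) (star x' y)" if x': "x' \<in> seqs U" for x'
 proof -
  obtain i z z' where i: "i \<in> Ob" "z |: (Sp A i)" "z' |: (Sp A i)" "ev i z = x" "ev i z' = x'"
   using rep2[OF xy(1) x'] .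
  obtain j w where j: "j \<in> Ob" "w |: (Sp A j)" "ev j w = y" using rep[OF xy(2)] .
  interpret Si: seminormed av "Sp A i" by (rule obj_snD[OF A_sn i(1)])
  show ?thesis
   using m_star[OF i(1) Si.add_cl[OF i(2,3)] j(1,2)] m_star[OF i(1,2) j(1,2)] m_star[OF i(1,3) j(1,2)]
    bl_add[OF bilin_left[OF m_bilin[OF i(1) j(1)] j(2)] i(2,3)] i j by (simp add: ev_add)
 qed
 show "star x (padd U y y') = padd U (star x y) (star x y')" if y': "y' \<in> seqs U" for y'
 proof -
  obtain j w w' where j: "j \<in> Ob" "w |: (Sp A j)" "w' |: (Sp A j)" "ev j w = y" "ev j w' = y'"
   using rep2[OF xy(2) y'] .
  obtain i z where i: "i \<in> Ob" "z |: (Sp A i)" "ev i z = x" using rep[OF xy(1)] .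
  interpret Sj: seminormed av "Sp A j" by (rule obj_snD[OF A_sn j(1)])
  show ?thesis
   using m_star[OF i(1,2) j(1) Sj.add_cl[OF j(2,3)]] m_star[OF i(1,2) j(1,2)] m_star[OF i(1,2) j(1,3)]
    bl_add[OF bilin_right[OF m_bilin[OF i(1) j(1)] i(2)] j(2,3)] i j by (simp add: ev_add)
 qed
 obtain i z where i: "i \<in> Ob" "z |: (Sp A i)" "ev i z = x" using rep[OF xy(1)] .
 obtain j w where j: "j \<in> Ob" "w |: (Sp A j)" "ev j w = y" using rep[OF xy(2)] .
 show "star x y 0 = x 0 \<otimes> y 0"
  using mult_0[OF i(1) j(1) i(2) j(2)] m_star[OF i(1,2) j(1,2)] i j by (simp add: ev_def mi_def m_def)
qed

lemma star_sm:
 assumes "x \<in> seqs U" "y \<in> seqs U"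
 shows "star (psm U c x) y = psm U c (star x y)" "star x (psm U c y) = psm U c (star x y)"
proof -
 interpret k: banach av "kspace av" by (rule kspace_ban)
 have hb: "(%n. if n = 0 then c else 0) |: (wseq (%_. 1) (kspace av))"
  by (rule k.wseq_I[where K = "av c"]) (auto intro: seqsI)
 show 1: "star (psm U c x) y = psm U c (star x y)"
  using star_act(1)[OF _ hb assms] by (simp add: pact_const assms star_cl)
 show "star x (psm U c y) = psm U c (star x y)"
  using star_act(2)[OF _ hb assms] 1 by (simp add: pact_const assms star_cl)
qed

text \<open>Uniformly bounded sequences lie in the space of constant weight 1. There
  \<open>star\<close> is a single bounded bilinear map into a space of some weight d, and reading
  off its n-th coefficient costs the factor \<open>d n\<close>.\<close>

lemma star_bound: "\<exists>C>0. \<forall>x\<in>seqs U. \<forall>y\<in>seqs U. \<forall>a\<ge>0. \<forall>b\<ge>0.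
  (\<forall>i. nrm U (x i) \<le> a) \<longrightarrow> (\<forall>i. nrm U (y i) \<le> b) \<longrightarrow> nrm U (star x y n) \<le> C * (a * b)"
proof -
 let ?W = "wseq (%_. 1) U"
 define i where "i = fst (\<sigma> (%_. 1))"
 define d where "d = fst (\<theta> (mi i i))"
 have i: "i \<in> Ob" unfolding i_def by (rule \<sigma>_Ob) simp
 note sn = obj_snD[OF A_sn] and W = wseq_seminormed[of "%_. 1", OF zero_less_one]
 have d: "0 < d k" for k unfolding d_def by (rule \<theta>_pos[OF mi_Ob[OF i i]])
 have s: "bl ?W (Sp A i) (snd (\<sigma> (%_. 1)))" using obj_blD(2)[OF \<sigma>_bl, of "%_. 1"] by (simp add: i_def)
 have "bilin_map ?W ?W (wseq d U) (%x y. ev (mi i i) (m i i (snd (\<sigma> (%_. 1)) x) (snd (\<sigma> (%_. 1)) y)))"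
  unfolding d_def
  by (rule bl_bilin[OF W W sn[OF mi_Ob[OF i i]] bilin_comp[OF W W sn[OF i] sn[OF i] s s m_bilin[OF i i]] ev_bl[OF mi_Ob[OF i i]]])
 then obtain C where C: "0 < C" "!!x y. x |: ?W ==> y |: ?W ==>
   nrm (wseq d U) (ev (mi i i) (m i i (snd (\<sigma> (%_. 1)) x) (snd (\<sigma> (%_. 1)) y))) \<le> C * (nrm ?W x * nrm ?W y)"
  using bilin_bound by blast
 have "nrm U (star x y n) \<le> (C * d n) * (a * b)"
  if xy: "x \<in> seqs U" "y \<in> seqs U" and ab: "0 \<le> a" "0 \<le> b" and b: "\<forall>i. nrm U (x i) \<le> a" "\<forall>i. nrm U (y i) \<le> b" for x y a b
 proof -
  interpret W: seminormed av ?W by (rule W)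
  have x: "x |: ?W" "nrm ?W x \<le> a" and y: "y |: ?W" "nrm ?W y \<le> b"
   using wseq_I[of "%_. 1" x a] wseq_I[of "%_. 1" y b] wseq_norm_le[of "%_. 1" x a] wseq_norm_le[of "%_. 1" y b] xy b by simp_all
  have sc: "snd (\<sigma> (%_. 1)) u |: (Sp A i)" "ev i (snd (\<sigma> (%_. 1)) u) = u" if "u |: ?W" for u
   using bl_closed[OF s that] ev_\<sigma>[of "%_. 1" u] that by (simp_all add: i_def)
  have st: "star x y = ev (mi i i) (m i i (snd (\<sigma> (%_. 1)) x) (snd (\<sigma> (%_. 1)) y))"
   using m_star[OF i sc(1)[OF x(1)] i sc(1)[OF y(1)]] sc(2)[OF x(1)] sc(2)[OF y(1)] by simp
  have sw: "star x y |: (wseq d U)" unfolding st d_def by (intro ev_w mi_Ob i m_cl sc x y)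
  have "nrm (wseq d U) (star x y) \<le> C * (a * b)"
   by (rule order.trans[OF C(2)[OF x(1) y(1), folded st]], intro mult_left_mono mult_mono x y) (use C(1) ab W.norm_nonneg[OF y(1)] in auto)
  then have "nrm (wseq d U) (star x y) * d n \<le> (C * (a * b)) * d n"
   using d[of n] by (intro mult_right_mono) auto
  then show ?thesis using wseq_le[of d "star x y" n, OF d sw] by (simp add: mult_ac)
 qed
 then show ?thesis using C(1) d[of n] by (intro exI[of _ "C * d n"]) auto
qed

end

context htransport
begin

text \<open>The correction of \<open>\<theta>\<close> by the inverse gauge. The gauge carries the
  power series product to \<open>star\<close>, so the inverse turns \<open>star\<close> back; and as
  its zeroth coefficient is the identity, the reduction modulo \<hbar> is unchanged.\<close>

lemma rectify:
 assumes gm: "gauge_maps av U T" and T_1: "!!n. 0 < n ==> T n \<one> = \<zero>"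
  and T_mult: "!!a b. a |: U ==> b |: U ==> (%n. T n (a \<otimes> b)) = star (%n. T n a) (%n. T n b)"
 shows "\<exists>\<Theta>. ind_iso A P \<Theta> \<and> h_linear av A P \<Theta> \<and> ind_alg_hom av A P \<Theta> \<and>
  (\<forall>i\<in>Ob. \<forall>z\<in>carrier (Sp A i). snd (\<Theta> i) z 0 = ev i z 0)"
proof -
 interpret gauge_maps av U T by fact
 interpret st: seqmult av U star by (rule star_seqmult)
 have "\<exists>C>0. \<forall>a\<in>carrier U. nrm U (T n a) \<le> C * nrm U a" for n
  using bl_bound[OF seminormed_axioms T_bl[of n]] by metis
 then obtain C where C: "!!n. 0 < C n" "!!n a. a |: U ==> nrm U (T n a) \<le> C n * nrm U a" by metis
 let ?R = "gauge_inv U T" and ?G = "gauge U T"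
 \<comment> \<open>A gauge does not preserve a weighted space. Out of weight c the inverse gauge
   does not increase norms when measured at weight \<open>iw c\<close>, nor does the gauge itself at
   weight \<open>fw c\<close>.\<close>
 define iw where "iw = inv_weight C"
 define fw where "fw c n = (\<Sum>j\<le>n. C (n - j) * c j)" for c :: weight and n
 have iw: "0 < iw c n" if "!!n. 0 < c n" for c n unfolding iw_def by (rule inv_weight_pos[OF C(1) that])
 have fw: "0 < fw c n" if "!!n. 0 < c n" for c n unfolding fw_def using C(1) that by (intro sum_pos) auto
 have Gw: "?G x |: (wseq (fw c) U)" "nrm (wseq (fw c) U) (?G x) \<le> nrm (wseq c U) x"
  if c: "!!n. 0 < c n" and x: "x |: (wseq c U)" for c x
 proof -
  have b: "nrm U (?G x n) \<le> nrm (wseq c U) x * fw c n" for n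
   unfolding fw_def by (rule gauge_bound[OF C c wseq_seqs[OF x] wseq_le[of c x, OF c x]])
  show "?G x |: (wseq (fw c) U)" by (rule wseq_I[OF fw[of c, OF c] gauge_cl[OF wseq_seqs[OF x]] b])
  show "nrm (wseq (fw c) U) (?G x) \<le> nrm (wseq c U) x" by (rule wseq_norm_le[OF fw[of c, OF c] b])
 qed
 have Rw: "?R x |: (wseq (iw c) U)" "nrm (wseq (iw c) U) (?R x) \<le> nrm (wseq c U) x"
  if c: "!!n. 0 < c n" and x: "x |: (wseq c U)" for c x
 proof -
  have b: "nrm U (?R x n) \<le> nrm (wseq c U) x * iw c n" for n
   unfolding iw_def by (rule gauge_inv_bound[OF C c wseq_seqs[OF x] wseq_le[of c x, OF c x]])
  show "?R x |: (wseq (iw c) U)" by (rule wseq_I[OF iw[of c, OF c] gauge_inv_cl[OF wseq_seqs[OF x]] b])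
  show "nrm (wseq (iw c) U) (?R x) \<le> nrm (wseq c U) x" by (rule wseq_norm_le[OF iw[of c, OF c] b])
 qed
 have Gbl: "bl (wseq c U) (wseq (fw c) U) ?G" if c: "!!n. 0 < c n" for c
  using Gw[OF c] by (intro blI[where C = 1]) (auto simp: wseq_ops gauge_add gauge_psm wseq_seqs)
 have Rbl: "bl (wseq c U) (wseq (iw c) U) ?R" if c: "!!n. 0 < c n" for c
  using Rw[OF c] by (intro blI[where C = 1]) (auto simp: wseq_ops gauge_inv_add gauge_inv_psm wseq_seqs)
 define \<Theta> where "\<Theta> i = (iw (fst (\<theta> i)), %z. ?R (ev i z))" for i
 \<comment> \<open>The inverse of \<open>\<Theta>\<close>: the gauge, followed by the inverse of
   \<open>\<theta>\<close> at the enlarged weight.\<close>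
 define G where "G c = (fst (\<sigma> (fw c)), %x. snd (\<sigma> (fw c)) (?G x))" for c
 have \<Theta>_pos: "0 < fst (\<Theta> i) n" if "i \<in> Ob" for i n using iw[OF \<theta>_pos[OF that]] by (simp add: \<Theta>_def)
 have \<Theta>_bl: "obj_bl A P \<Theta>" unfolding obj_bl_def
 proof (intro ballI conjI)
  fix i assume i: "i \<in> Ob"
  show "fst (\<Theta> i) \<in> Obj (Idx P)" using \<Theta>_pos[OF i] by simp
  show "bl (Sp A i) (Sp P (fst (\<Theta> i))) (snd (\<Theta> i))"
   using bl_comp[OF obj_snD[OF A_sn i] wseq_seminormed[of "fst (\<theta> i)", OF \<theta>_pos[OF i]] ev_bl[OF i] Rbl[of "fst (\<theta> i)", OF \<theta>_pos[OF i]]]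
   by (simp add: \<Theta>_def)
 qed
 have \<Theta>_hom: "ind_hom A P \<Theta>" unfolding ind_hom_def
 proof (intro conjI ballI allI)
  fix i j u assume u: "u \<in> hom_set (Idx A) i j"
  note o = hom_set_obj[OF A_banach u]
  show "colim_eq P (carrier (Sp A i)) (\<Theta> i) (fst (\<Theta> j), snd (\<Theta> j) \<circ> Tr A u)"
   using o \<Theta>_pos ev_Tr[OF u] by (subst powser_colim_eq[where X = U]) (auto simp: \<Theta>_def)
 qed (use obj_blD[OF \<Theta>_bl] in auto)
 have G_pos: "!!n. 0 < fw c n" if "c \<in> Obj (Idx P)" for c using fw[of c] that by simp
 have G_cl: "?G x |: (Sp P (fw c))" if "c \<in> Obj (Idx P)" "x |: (Sp P c)" for c x
  using Gw(1)[of c x] that by simp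
 have G_hom: "ind_hom P A G" unfolding ind_hom_def
 proof (intro conjI ballI allI)
  fix c assume c: "c \<in> Obj (Idx P)"
  show "fst (G c) \<in> Ob" using \<sigma>_Ob[of "fw c", OF G_pos[OF c]] by (simp add: G_def)
  have "bl (wseq (fw c) U) (Sp A (fst (\<sigma> (fw c)))) (snd (\<sigma> (fw c)))"
   using obj_blD(2)[OF \<sigma>_bl, of "fw c"] G_pos[OF c] by simp
  from bl_comp[OF wseq_seminormed wseq_seminormed Gbl this]
  show "bl (Sp P c) (Sp A (fst (G c))) (snd (G c))" using c G_pos[OF c] by (simp add: G_def)
 next
  fix c d u assume "u \<in> hom_set (Idx P) c d"
  then have u: "c \<in> Obj (Idx P)" "d \<in> Obj (Idx P)" "c \<le> d"
   by (auto simp: powser_hom_set le_fun_def intro: order.strict_trans2)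
  have sub: "x |: (Sp P d)" if "x |: (Sp P c)" for x
   using bl_closed[OF Tr_bl[OF powser_banach, of "(c, d)" c d], of x] u that by (simp add: powser_hom_set)
  have "colim_eq P (carrier (Sp P c)) (fw c, ?G) (fw d, ?G)"
   using G_pos u by (subst powser_colim_eq[where X = U]) auto
  from colim_eq_nat[OF powser_halg_banach A_banach \<sigma>_hom this]
  show "colim_eq A (carrier (Sp P c)) (G c) (fst (G d), snd (G d) \<circ> Tr P u)"
   using G_cl[OF u(1)] G_cl[OF u(2) sub] by (simp add: G_def o_def)
 qed
 have G\<Theta>: "ind_eq A A (G \<circ>\<^sub>I \<Theta>) ind_id" unfolding ind_eq_def
 proof
  fix i assume i: "i \<in> Ob"
  let ?c = "fst (\<theta> i)"
  have p: "!!n. 0 < fw (iw ?c) n" using fw[OF iw[OF \<theta>_pos[OF i]]] .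
  \<comment> \<open>The two gauges cancel on sequences, but the result sits at a larger weight;
    naturality of \<open>\<sigma>\<close> identifies its image with that at the original
    weight.\<close>
  have "colim_eq P (carrier (Sp A i)) (fw (iw ?c), %z. ?G (?R (ev i z))) (?c, ev i)"
   using p \<theta>_pos[OF i] i by (subst powser_colim_eq[where X = U]) (auto simp: gauge_gauge_inv)
  from colim_eq_nat[OF powser_halg_banach A_banach \<sigma>_hom this]
  have 1: "colim_eq A (carrier (Sp A i)) ((G \<circ>\<^sub>I \<Theta>) i) (fst (\<sigma> ?c), %z. snd (\<sigma> ?c) (ev i z))"
   using Gw(1)[OF iw[of ?c, OF \<theta>_pos[OF i]] Rw(1)[of ?c, OF \<theta>_pos[OF i] ev_w[OF i]]] ev_w[OF i]
   by (simp add: ind_comp_def G_def \<Theta>_def o_def)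
  have 2: "colim_eq A (carrier (Sp A i)) (fst (\<sigma> ?c), %z. snd (\<sigma> ?c) (ev i z)) (ind_id i)"
   using \<sigma>_\<theta> i by (simp add: ind_eq_def ind_comp_def o_def ev_def)
  show "colim_eq A (carrier (Sp A i)) ((G \<circ>\<^sub>I \<Theta>) i) (ind_id i)"
  proof (rule colim_eq_trans[OF A_banach 1 2])
   fix z assume z: "z |: (Sp A i)"
   show "snd ((G \<circ>\<^sub>I \<Theta>) i) z |: (Sp A (fst ((G \<circ>\<^sub>I \<Theta>) i)))"
    using obj_blD(3)[OF ind_hom_obj_bl[OF G_hom] obj_blD(1)[OF \<Theta>_bl i] obj_blD(3)[OF \<Theta>_bl i z]] by (simp add: ind_comp_def)
  qed (use \<sigma>_cl[of ?c, OF \<theta>_pos[OF i] ev_w[OF i]] in \<open>auto simp: ind_id_def\<close>)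
 qed
 have \<Theta>G: "ind_eq P P (\<Theta> \<circ>\<^sub>I G) ind_id" unfolding ind_eq_def
 proof
  fix c assume c: "c \<in> Obj (Idx P)"
  have o: "fst (\<sigma> (fw c)) \<in> Ob" by (rule \<sigma>_Ob[of "fw c", OF G_pos[OF c]])
  show "colim_eq P (carrier (Sp P c)) ((\<Theta> \<circ>\<^sub>I G) c) (ind_id c)"
   using \<Theta>_pos[OF o] c ev_\<sigma>[of "fw c", OF G_pos[OF c] G_cl[OF c, simplified]]
   by (subst powser_colim_eq[where X = U])
     (auto simp: ind_comp_def G_def \<Theta>_def ind_id_def gauge_inv_gauge wseq_seqs)
 qed
 \<comment> \<open>Here the vanishing of the higher coefficients at the unit is used: the gauge
   fixes constant multiples of the unit.\<close>
 have R_unit: "?R (psm U c (pcst U \<one>)) = psm U c (pcst U \<one>)" for c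
 proof (rule gauge_inv_unique)
  have "?G (pcst U \<one>) = pcst U \<one>"
   unfolding gauge_pcst[OF one_closed] by (auto simp: T_0 T_1 pcst_def fun_eq_iff)
  then show "?G (psm U c (pcst U \<one>)) = psm U c (pcst U \<one>)" by (simp add: gauge_psm)
 qed auto
 have R_mult: "?R (star x y) = pmul U (?R x) (?R y)" if "x \<in> seqs U" "y \<in> seqs U" for x y
 proof (rule gauge_inv_unique)
  interpret p: seqmult av U "pmul U" by (rule pmul_seqmult)
  show "pmul U (?R x) (?R y) \<in> seqs U" using that by (intro p.mu_cl gauge_inv_cl)
  show "?G (pmul U (?R x) (?R y)) = star x y"
   using st.gauge_mult[OF gm T_mult gauge_inv_cl[OF that(1)] gauge_inv_cl[OF that(2)]] that
   by (simp add: gauge_gauge_inv)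
 qed
 note AA = obj_sn_tens[OF A_sn A_sn] and kA = obj_sn_tens[OF kpow_obj_sn A_sn]
  and PP = obj_sn_tens[OF P_sn P_sn] and kP = obj_sn_tens[OF kpow_obj_sn P_sn]
 have "ind_eq (ind_tens av A A) P (\<Theta> \<circ>\<^sub>I imul A) (imul P \<circ>\<^sub>I ind_tens_map av A A P P \<Theta> \<Theta>)"
 proof (rule tens_powser_eqI[OF _ _ _ A_sn A_sn])
  show "obj_bl (ind_tens av A A) P (\<Theta> \<circ>\<^sub>I imul A)"
   by (rule obj_bl_comp[OF imul_bl \<Theta>_bl obj_snD[OF AA] obj_snD[OF A_sn]])
  show "obj_bl (ind_tens av A A) P (imul P \<circ>\<^sub>I ind_tens_map av A A P P \<Theta> \<Theta>)"
   by (rule obj_bl_comp[OF obj_bl_tens[OF A_sn A_sn P_sn P_sn \<Theta>_bl \<Theta>_bl] imul_powser_obj_bl obj_snD[OF AA] obj_snD[OF PP]])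
  fix i j z w assume r: "i \<in> Ob" "j \<in> Ob" "z |: (Sp A i)" "w |: (Sp A j)"
  show "snd ((\<Theta> \<circ>\<^sub>I imul A) (i, j)) (pure_tens av (Sp A i) (Sp A j) z w) =
    snd ((imul P \<circ>\<^sub>I ind_tens_map av A A P P \<Theta> \<Theta>) (i, j)) (pure_tens av (Sp A i) (Sp A j) z w)"
   using ind_tens_map_pure[OF A_sn A_sn P_sn P_sn \<Theta>_bl \<Theta>_bl r] m_star[OF r(1,3) r(2,4)] R_mult[of "ev i z" "ev j w"] r
    imul_powser_pure[of "fst (\<Theta> i)" "fst (\<Theta> j)" "snd (\<Theta> i) z" "snd (\<Theta> j) w", OF \<Theta>_pos[OF r(1)] \<Theta>_pos[OF r(2)]]
    obj_blD(3)[OF \<Theta>_bl r(1,3)] obj_blD(3)[OF \<Theta>_bl r(2,4)]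
   by (simp add: ind_comp_def ind_tens_map_fst \<Theta>_def mi_def m_def)
 qed simp_all
 moreover have "ind_eq (ind_k av) P (\<Theta> \<circ>\<^sub>I iunit A) (iunit P)"
 proof -
  have "fst (iunit A ()) \<in> Ob" using obj_blD(1)[OF iunit_bl, of "()"] by simp
  moreover have "?R (ev (fst (iunit A ())) (snd (iunit A ()) c)) = (%n. if n = 0 then c \<odot> \<one> else \<zero>)" for c
   unfolding ev_unit R_unit by (auto simp: psm_def pcst_def fun_eq_iff)
  ultimately have "colim_eq P UNIV ((\<Theta> \<circ>\<^sub>I iunit A) ()) (iunit P ())"
   using \<Theta>_pos by (subst powser_colim_eq[where X = U]) (auto simp: ind_comp_def \<Theta>_def)
  then show ?thesis by (simp add: ind_eq_def)
 qed
 moreover have "ind_eq (ind_tens av (kpow av) A) P (\<Theta> \<circ>\<^sub>I iact A) (iact P \<circ>\<^sub>I ind_tens_map av (kpow av) A (kpow av) P ind_id \<Theta>)"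
 proof (rule tens_powser_eqI[OF _ _ _ kpow_obj_sn A_sn])
  show "obj_bl (ind_tens av (kpow av) A) P (\<Theta> \<circ>\<^sub>I iact A)"
   by (rule obj_bl_comp[OF iact_bl \<Theta>_bl obj_snD[OF kA] obj_snD[OF A_sn]])
  show "obj_bl (ind_tens av (kpow av) A) P (iact P \<circ>\<^sub>I ind_tens_map av (kpow av) A (kpow av) P ind_id \<Theta>)"
   by (rule obj_bl_comp[OF obj_bl_tens[OF kpow_obj_sn A_sn kpow_obj_sn P_sn obj_bl_id \<Theta>_bl] iact_powser_obj_bl obj_snD[OF kA] obj_snD[OF kP]])
  fix c i a z assume r: "c \<in> Obj (Idx (kpow av))" "i \<in> Ob" "a |: (Sp (kpow av) c)" "z |: (Sp A i)"
  have c: "!!n. 0 < c n" using r(1) by simp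
  show "snd ((\<Theta> \<circ>\<^sub>I iact A) (c, i)) (pure_tens av (Sp (kpow av) c) (Sp A i) a z) =
    snd ((iact P \<circ>\<^sub>I ind_tens_map av (kpow av) A (kpow av) P ind_id \<Theta>) (c, i)) (pure_tens av (Sp (kpow av) c) (Sp A i) a z)"
   using ind_tens_map_pure[OF kpow_obj_sn A_sn kpow_obj_sn P_sn obj_bl_id \<Theta>_bl r] ev_act[of c i a z, OF c] r
    gauge_inv_pact[of "ev i z" a] iact_powser_pure[of c "fst (\<Theta> i)" a "snd (\<Theta> i) z", OF c \<Theta>_pos[OF r(2)]]
    obj_blD(3)[OF \<Theta>_bl r(2,4)] by (simp add: ind_comp_def ind_tens_map_fst \<Theta>_def hi_def h_def ind_id_def)
 qed simp_all
 moreover have "snd (\<Theta> i) z 0 = ev i z 0" if "i \<in> Ob" "z |: (Sp A i)" for i z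
  using that by (simp add: \<Theta>_def gauge_inv_0)
 ultimately show ?thesis using \<Theta>_hom G_hom G\<Theta> \<Theta>G unfolding ind_iso_def h_linear_def ind_alg_hom_def by blast
qed

end

theorem theorem3p68:
  fixes av :: "'k::field_char_0 \<Rightarrow> real"
    and I :: "'i set" and \<Psi> :: "'p::ab_group_add set" and \<alpha> :: "'i \<Rightarrow> 'p"
    and form :: "'p \<Rightarrow> 'p \<Rightarrow> rat" and lam :: "'i \<Rightarrow> 'p \<Rightarrow> int"
    and r s :: real
    and U :: "('k, ('k, 'i) uel) nspace"
    and A :: "('o, 'm, 'k, 'v) hindalg"
    and \<theta> :: "('o, 'v, weight, nat \<Rightarrow> ('k, 'i) uel) imor"
    and Q :: "('q, 'n, 'k, 'w) indalg"
    and \<pi> :: "('o, 'v, 'q, 'w) imor"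
    and \<theta>0 :: "('q, 'w, unit, ('k, 'i) uel) imor"
  assumes "na_field av"
    and "root_datum I \<Psi> \<alpha> form lam"
    and "0 < r" and "0 < s" and "1 \<le> r * s"
    and "is_U_an av I (\<lambda>i j. lam i (\<alpha> j)) r s U"
    and "h_algebra av A"
    \<comment> \<open>the linear isomorphism of \<open>A\<close> with \<open>U\<lbrakk>\<hbar>\<rbrakk>\<close>\<close>
    and "ind_iso A (powser_halg av U) \<theta>"
    and "h_linear av A (powser_halg av U) \<theta>"
    and "ind_eq (ind_k av) (powser_halg av U) (\<theta> \<circ>\<^sub>I iunit A) (iunit (powser_halg av U))"
    \<comment> \<open>the algebra \<open>Q = A/\<hbar>A\<close> with its projection \<open>\<pi>\<close>, and the induced isomorphism \<open>\<theta>0\<close>\<close>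
    and "ind_algebra av Q"
    and "ind_cokernel av A A (hbar_mult av A) Q \<pi>"
    and "ind_alg_hom av A Q \<pi>"
    and "ind_eq A (const_alg av U) (\<theta>0 \<circ>\<^sub>I \<pi>) (coeff_map 0 \<circ>\<^sub>I \<theta>)"
    and "ind_iso Q (const_alg av U) \<theta>0"
    and "ind_alg_hom av Q (const_alg av U) \<theta>0"
    and "let g = g_an av I (\<lambda>i j. lam i (\<alpha> j)) r s U;
             H2 = Hb g (commutator U) U (commutator U) 2
         in carrier H2 = {\<one>\<^bsub>H2\<^esub>}"
  shows "\<exists>\<Theta>. ind_iso A (powser_halg av U) \<Theta> \<and>
             h_linear av A (powser_halg av U) \<Theta> \<and>
             ind_alg_hom av A (powser_halg av U) \<Theta> \<and>
             ind_eq A (const_alg av U) (\<theta>0 \<circ>\<^sub>I \<pi>) (coeff_map 0 \<circ>\<^sub>I \<Theta>)"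
proof -
 interpret un: uan av I "%i j. lam i (\<alpha> j)" r s U using assms(1,3,4,6) by unfold_locales auto
 have Ualg: "snalg av U" by (rule un.U_snalg)
 have Ub: "banach_space av U" by (rule un.U_banach)
 note Us = snalg.axioms(1)[OF Ualg]
 interpret pa: powser_algebra av U
  by (intro powser_algebra.intro banach.intro banach_axioms.intro Ualg Ub snalg.axioms(1)[OF Ualg])
 have A_b: "ind_banach av A" using assms(7) by (simp add: h_algebra_def ind_algebra_def)
 have Q_b: "ind_banach av Q" using assms(11) by (simp add: ind_algebra_def)
 note A_sn = obj_sn_banach[OF assms(1) A_b] and Q_sn = obj_sn_banach[OF assms(1) Q_b]
 have C_b: "ind_banach av (const_alg av U)"
  using Ub by (auto simp: ind_banach_def filtered_def is_category_def hom_set_def id_def bl_id)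
 have C_sn: "obj_sn av (const_alg av U)" by (rule obj_sn_banach[OF assms(1) C_b])
 have im: "ind_hom (ind_tens av A A) A (imul A)" using assms(7) by (simp add: h_algebra_def ind_algebra_def)
 have imQ: "ind_hom (ind_tens av Q Q) Q (imul Q)" using assms(11) by (simp add: ind_algebra_def)
 have \<pi>: "ind_hom A Q \<pi>" and \<theta>0: "ind_hom Q (const_alg av U) \<theta>0"
  using assms(13,16) by (simp_all add: ind_alg_hom_def)
 note \<pi>b = ind_hom_obj_bl[OF \<pi>] and \<theta>0b = ind_hom_obj_bl[OF \<theta>0] and imb = ind_hom_obj_bl[OF im] and imQb = ind_hom_obj_bl[OF imQ]
 \<comment> \<open>The reduction of an element of \<open>A\<close> modulo \<hbar>, carried to
   \<open>U\<close> by the given algebra isomorphism; by \<open>coeff\<close> it is the constant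
   coefficient under \<open>\<theta>\<close>.\<close>
 define p where "p i z = snd (\<theta>0 (fst (\<pi> i))) (snd (\<pi> i) z)" for i z
 have coeff: "p i z = snd (\<theta> i) z 0" if "i \<in> Obj (Idx A)" "z |: (Sp A i)" for i z
 proof -
  have "colim_eq (const_alg av U) (carrier (Sp A i)) ((\<theta>0 \<circ>\<^sub>I \<pi>) i) ((coeff_map 0 \<circ>\<^sub>I \<theta>) i)"
   using assms(14) that(1) by (simp add: ind_eq_def)
  then show ?thesis using that(2)
   by (subst (asm) const_colim_eq[where X = U]) (auto simp: p_def ind_comp_def coeff_map_def)
 qed
 \<comment> \<open>Reduction is multiplicative because \<open>\<pi>\<close> and
   \<open>\<theta>0\<close> are algebra morphisms. Together with \<open>coeff\<close> this says that
   constant coefficients multiply as in \<open>U\<close>, which is what the transport of the product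
   asks for.\<close>
 have p_mult: "p (fst (imul A (i, j))) (snd (imul A (i, j)) (pure_tens av (Sp A i) (Sp A j) z w)) = p i z \<otimes>\<^sub>U p j w"
  if i: "i \<in> Obj (Idx A)" "z |: (Sp A i)" and j: "j \<in> Obj (Idx A)" "w |: (Sp A j)" for i j z w
 proof -
  let ?t = "pure_tens av (Sp A i) (Sp A j) z w"
  have t: "?t |: (Sp (ind_tens av A A) (i, j))"
   using pure_tens_cl[OF obj_snD[OF A_sn i(1)] obj_snD[OF A_sn j(1)] i(2) j(2)] by simp
  have o: "(i, j) \<in> Obj (Idx (ind_tens av A A))" using i j by simp
  define z' where "z' = snd (\<pi> i) z"
  define w' where "w' = snd (\<pi> j) w"
  have z': "fst (\<pi> i) \<in> Obj (Idx Q)" "z' |: (Sp Q (fst (\<pi> i)))" and w': "fst (\<pi> j) \<in> Obj (Idx Q)" "w' |: (Sp Q (fst (\<pi> j)))"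
   unfolding z'_def w'_def using obj_blD[OF \<pi>b i(1)] obj_blD[OF \<pi>b j(1)] i(2) j(2) by auto
  let ?t' = "pure_tens av (Sp Q (fst (\<pi> i))) (Sp Q (fst (\<pi> j))) z' w'"
  have t': "?t' |: (Sp (ind_tens av Q Q) (fst (\<pi> i), fst (\<pi> j)))"
   using pure_tens_cl[OF obj_snD[OF Q_sn z'(1)] obj_snD[OF Q_sn w'(1)] z'(2) w'(2)] by simp
  have o': "(fst (\<pi> i), fst (\<pi> j)) \<in> Obj (Idx (ind_tens av Q Q))" using z' w' by simp
  have tm: "snd (ind_tens_map av A A Q Q \<pi> \<pi> (i, j)) ?t = ?t'"
   unfolding z'_def w'_def by (rule ind_tens_map_pure[OF A_sn A_sn Q_sn Q_sn \<pi>b \<pi>b i(1) j(1) i(2) j(2)])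
  \<comment> \<open>Restricted to one elementary tensor, so that the values on both sides can be
    located before \<open>\<theta>0\<close> is applied.\<close>
  have "colim_eq Q {?t} ((\<pi> \<circ>\<^sub>I imul A) (i, j)) ((imul Q \<circ>\<^sub>I ind_tens_map av A A Q Q \<pi> \<pi>) (i, j))"
   using assms(13) o t unfolding ind_alg_hom_def ind_eq_def colim_eq_def by blast
  from colim_eq_nat[OF Q_b C_b \<theta>0 this]
  have "colim_eq (const_alg av U) {?t} (fst (\<theta>0 (fst ((\<pi> \<circ>\<^sub>I imul A) (i, j)))), snd (\<theta>0 (fst ((\<pi> \<circ>\<^sub>I imul A) (i, j)))) \<circ> snd ((\<pi> \<circ>\<^sub>I imul A) (i, j)))
    (fst (\<theta>0 (fst (imul Q (fst (\<pi> i), fst (\<pi> j))))), snd (\<theta>0 (fst (imul Q (fst (\<pi> i), fst (\<pi> j))))) \<circ> snd ((imul Q \<circ>\<^sub>I ind_tens_map av A A Q Q \<pi> \<pi>) (i, j)))"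
   using obj_blD(3)[OF \<pi>b obj_blD(1)[OF imb o] obj_blD(3)[OF imb o t]] obj_blD(3)[OF imQb o' t'] tm
   by (simp add: ind_comp_def ind_tens_map_fst)
  then have 1: "p (fst (imul A (i, j))) (snd (imul A (i, j)) ?t) =
    snd (\<theta>0 (fst (imul Q (fst (\<pi> i), fst (\<pi> j))))) (snd (imul Q (fst (\<pi> i), fst (\<pi> j))) ?t')"
   using tm by (subst (asm) const_colim_eq[where X = U]) (auto simp: p_def ind_comp_def ind_tens_map_fst)
  have "colim_eq (const_alg av U) (carrier (Sp (ind_tens av Q Q) (fst (\<pi> i), fst (\<pi> j)))) ((\<theta>0 \<circ>\<^sub>I imul Q) (fst (\<pi> i), fst (\<pi> j)))
    ((imul (const_alg av U) \<circ>\<^sub>I ind_tens_map av Q Q (const_alg av U) (const_alg av U) \<theta>0 \<theta>0) (fst (\<pi> i), fst (\<pi> j)))"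
   using assms(16) o' unfolding ind_alg_hom_def ind_eq_def by blast
  moreover have "snd (ind_tens_map av Q Q (const_alg av U) (const_alg av U) \<theta>0 \<theta>0 (fst (\<pi> i), fst (\<pi> j))) ?t' =
    pure_tens av U U (p i z) (p j w)"
   using ind_tens_map_pure[OF Q_sn Q_sn C_sn C_sn \<theta>0b \<theta>0b z'(1) w'(1) z'(2) w'(2)] by (simp add: p_def z'_def w'_def)
  moreover have "snd (imul (const_alg av U) x) (pure_tens av U U (p i z) (p j w)) = p i z \<otimes>\<^sub>U p j w" for x
   using tens_lift_pure[OF Us Us Ub snalg.mult_bilin[OF Ualg], of "p i z" "p j w"]
    obj_blD(3)[OF \<theta>0b z'(1) z'(2)] obj_blD(3)[OF \<theta>0b w'(1) w'(2)]
   by (simp add: const_alg_def indalg.defs ind.defs p_def z'_def w'_def)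
  ultimately show ?thesis using t' 1 by (subst (asm) const_colim_eq[where X = U]) (auto simp: ind_comp_def)
 qed
 interpret ht: htransport av U A \<theta>
 proof (intro htransport.intro pa.powser_algebra_axioms htransport_axioms.intro assms(7-10))
  fix i j z w assume r: "i \<in> Obj (Idx A)" "j \<in> Obj (Idx A)" "z |: (Sp A i)" "w |: (Sp A j)"
  have o: "(i, j) \<in> Obj (Idx (ind_tens av A A))" using r by simp
  have t: "pure_tens av (Sp A i) (Sp A j) z w |: (Sp (ind_tens av A A) (i, j))"
   using pure_tens_cl[OF obj_snD[OF A_sn r(1)] obj_snD[OF A_sn r(2)] r(3,4)] by simp
  show "snd (\<theta> (fst (imul A (i, j)))) (snd (imul A (i, j)) (pure_tens av (Sp A i) (Sp A j) z w)) 0 = snd (\<theta> i) z 0 \<otimes>\<^sub>U snd (\<theta> j) w 0"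
   using p_mult[OF r(1,3) r(2,4)] coeff[OF r(1,3)] coeff[OF r(2,4)] coeff[OF obj_blD(1)[OF imb o] obj_blD(3)[OF imb o t]] by simp
 qed
 interpret st: seqmult av U ht.star by (rule ht.star_seqmult)
 interpret de: deform av U ht.star
 proof (intro deform.intro st.seqmult_axioms deform_axioms.intro)
  show "\<exists>D. bl U U D \<and>
    (\<forall>x\<in>carrier U. \<forall>y\<in>carrier U. D (x \<otimes>\<^sub>U y) = (x \<otimes>\<^sub>U D y \<oplus>\<^sub>U D x \<otimes>\<^sub>U y) \<oplus>\<^sub>U m x y)"
   if m: "sqz av U m" for m using un.hochschild_trivial[OF _ m] assms(17) by (simp add: Let_def)
 qed (fact ht.star_sm ht.star_assoc ht.star_unit ht.star_bound)+
 obtain T where T: "!!a. a |: U ==> T 0 a = a" "!!n. bl U U (T n)" "!!n. 0 < n ==> T n \<one>\<^sub>U = \<zero>\<^sub>U"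
  "!!a b. a |: U ==> b |: U ==> (%n. T n (a \<otimes>\<^sub>U b)) = ht.star (%n. T n a) (%n. T n b)"
  by (rule de.gauge_ex) blast
 have "gauge_maps av U T" by (intro gauge_maps.intro Us gauge_maps_axioms.intro T)
 from ht.rectify[OF this T(3,4)] obtain \<Theta> where \<Theta>: "ind_iso A (powser_halg av U) \<Theta>" "h_linear av A (powser_halg av U) \<Theta>"
  "ind_alg_hom av A (powser_halg av U) \<Theta>" "!!i z. i \<in> Obj (Idx A) ==> z |: (Sp A i) ==> snd (\<Theta> i) z 0 = ht.ev i z 0"
  by blast
 \<comment> \<open>The constant coefficient is the same under \<open>\<Theta>\<close> and
   \<open>\<theta>\<close>, and under \<open>\<theta>\<close> it is the given reduction.\<close>
 moreover have "ind_eq A (const_alg av U) (\<theta>0 \<circ>\<^sub>I \<pi>) (coeff_map 0 \<circ>\<^sub>I \<Theta>)" unfolding ind_eq_def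
  using \<Theta>(4) coeff by (subst const_colim_eq[where X = U]) (auto simp: p_def ind_comp_def coeff_map_def ht.ev_def)
 ultimately show ?thesis by blast
qed

end
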